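(* Let $R$ be a finitely generated standard graded algebra over a Noetherian commutative ring $R_0$ and let $M$ be a nonzero finitely generated graded $R$-module. Then $$\operatorname{reg}(M)=\min\{t\in\mathbb Z\mid t\ge d(M)\text{ and } M\text{ is weakly } t\text{-regular}\}.$$
   Context: Standard graded means $R=\bigoplus_{n\ge0}R_n$ is generated over $R_0$ by $R_1$; $R_+=\bigoplus_{n\ge1}R_n$. $H^i_{R_+}(M)$ is the $i$-th (graded) local cohomology module of $M$ with respect to $R_+$, $a_i(M)=\sup\{t\mid H^i_{R_+}(M)_t\ne0\}$ (with $a_i(M)=-\infty$ if $H^i_{R_+}(M)=0$), and $\operatorname{reg}(M)=\max\{a_i(M)+i\mid i\ge0\}$. $M$ is weakly $t$-regular if $H^i_{R_+}(M)_{t-i+1}=0$ for all $i\ge 0$. $d(M)$ is the maximal degree of the homogeneous minimal generators of $M$, i.e. $d(M)=\max\{t\mid (M/R_+M)_t\ne0\}$. *)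

theory Defs
  imports
    "HOL-Algebra.Module"
    "HOL-Algebra.Ideal_Product"
    "HOL-Algebra.Generated_Rings"
    "HOL-Algebra.Ring_Divisibility"
    "HOL-Library.Extended_Real"
begin

section \<open>Graded rings and graded modules\<close>

record 'r graded_ring = "'r ring" +
  rpart :: "nat \<Rightarrow> 'r set"

record ('r, 'm) graded_module = "('r, 'm) module" +
  part :: "int \<Rightarrow> 'm set"

definition internal_direct_sum :: "('b, 'c) ring_scheme \<Rightarrow> ('i \<Rightarrow> 'b set) \<Rightarrow> bool" where
  "internal_direct_sum A D \<longleftrightarrow>
     (\<forall>i. additive_subgroup (D i) A) \<and>
     (\<forall>x\<in>carrier A. \<exists>!f. (\<forall>i. f i \<in> D i) \<and> finite {i. f i \<noteq> \<zero>\<^bsub>A\<^esub>} \<and>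
        x = (\<Oplus>\<^bsub>A\<^esub>i\<in>{i. f i \<noteq> \<zero>\<^bsub>A\<^esub>}. f i))"

locale graded_ring = cring R for R :: "'r graded_ring" (structure) +
  assumes rpart_sum: "internal_direct_sum R (rpart R)"
    and rpart_mult: "\<lbrakk>a \<in> rpart R i; b \<in> rpart R j\<rbrakk> \<Longrightarrow> a \<otimes> b \<in> rpart R (i + j)"

locale standard_graded_ring = graded_ring +
  assumes degree_one_generates: "carrier R = generate_ring R (rpart R 0 \<union> rpart R 1)"

definition finitely_generated_over_degree_zero :: "'r graded_ring \<Rightarrow> bool" where
  "finitely_generated_over_degree_zero R \<longleftrightarrow>
     (\<exists>A. finite A \<and> A \<subseteq> carrier R \<and> carrier R = generate_ring R (rpart R 0 \<union> A))"

definition irrelevant_ideal :: "'r graded_ring \<Rightarrow> 'r set" where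
  "irrelevant_ideal R =
     {\<Oplus>\<^bsub>R\<^esub>n\<in>A. f n | A f. finite A \<and> 0 \<notin> A \<and> (\<forall>n\<in>A. f n \<in> rpart R n)}"

locale graded_module = graded_ring R + module R M
  for R :: "'r graded_ring" (structure) and M :: "('r, 'm) graded_module" (structure) +
  assumes part_sum: "internal_direct_sum M (part M)"
    and part_smult: "\<lbrakk>a \<in> rpart R i; x \<in> part M t\<rbrakk> \<Longrightarrow> a \<odot>\<^bsub>M\<^esub> x \<in> part M (int i + t)"

definition submodule_generated ::
    "'r graded_ring \<Rightarrow> ('r, 'm) graded_module \<Rightarrow> 'm set \<Rightarrow> 'm set" where
  "submodule_generated R M S = \<Inter>{H. submodule H R M \<and> S \<subseteq> H}"

definition finitely_generated_module ::
    "'r graded_ring \<Rightarrow> ('r, 'm) graded_module \<Rightarrow> bool" where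
  "finitely_generated_module R M \<longleftrightarrow>
     (\<exists>A. finite A \<and> A \<subseteq> carrier M \<and> carrier M = submodule_generated R M A)"

text \<open>Graded homomorphisms are homogeneous of degree zero.\<close>

definition graded_hom ::
    "'r graded_ring \<Rightarrow> ('r, 'm) graded_module \<Rightarrow> ('r, 'n) graded_module \<Rightarrow> ('m \<Rightarrow> 'n) set" where
  "graded_hom R M N =
     {f \<in> carrier M \<rightarrow> carrier N.
        (\<forall>x\<in>carrier M. \<forall>y\<in>carrier M. f (x \<oplus>\<^bsub>M\<^esub> y) = f x \<oplus>\<^bsub>N\<^esub> f y) \<and>
        (\<forall>a\<in>carrier R. \<forall>x\<in>carrier M. f (a \<odot>\<^bsub>M\<^esub> x) = a \<odot>\<^bsub>N\<^esub> f x) \<and>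
        (\<forall>t. f ` part M t \<subseteq> part N t)}"

definition graded_sub ::
    "('r, 'm) graded_module \<Rightarrow> 'm set \<Rightarrow> ('r, 'm) graded_module" where
  "graded_sub M H = M\<lparr>carrier := H, part := (\<lambda>t. part M t \<inter> H)\<rparr>"

text \<open>The record of a module inherits the fields \<^const>\<open>monoid.mult\<close> and \<^const>\<open>monoid.one\<close> of rings, which
  have no meaning for modules.\<close>

definition graded_quot ::
    "('r, 'm) graded_module \<Rightarrow> 'm set \<Rightarrow> ('r, 'm set) graded_module" where
  "graded_quot M H =
     \<lparr>carrier = a_rcosets\<^bsub>M\<^esub> H, monoid.mult = undefined, one = undefined,
      zero = H, add = set_add M,
      smult = (\<lambda>a X. \<Union>x\<in>X. H +>\<^bsub>M\<^esub> (a \<odot>\<^bsub>M\<^esub> x)),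
      part = (\<lambda>t. (\<lambda>x. H +>\<^bsub>M\<^esub> x) ` part M t)\<rparr>"


section \<open>Graded local cohomology\<close>

text \<open>
  \<open>H\<^sup>i\<close> with support in \<open>R\<^sub>+\<close> is the \<open>i\<close>-th right derived functor, on the category of graded
  modules and homomorphisms of degree zero, of the \<open>R\<^sub>+\<close>-torsion functor
  \<open>\<Gamma>(M) = {x. \<exists>k. (R\<^sub>+)\<^sup>k x = 0}\<close>.
\<close>

fun ideal_power :: "('r, 'c) ring_scheme \<Rightarrow> 'r set \<Rightarrow> nat \<Rightarrow> 'r set" where
  "ideal_power R I 0 = carrier R"
| "ideal_power R I (Suc k) = ideal_prod R I (ideal_power R I k)"

definition torsion_part :: "'r graded_ring \<Rightarrow> ('r, 'm) graded_module \<Rightarrow> 'm set" where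
  "torsion_part R M =
     {x \<in> carrier M. \<exists>k. \<forall>a\<in>ideal_power R (irrelevant_ideal R) k. a \<odot>\<^bsub>M\<^esub> x = \<zero>\<^bsub>M\<^esub>}"

text \<open>
  Injectivity in the category of graded modules. A HOL definition cannot quantify over the types
  of the test modules \<open>L\<close> and \<open>N\<close>. Test modules whose elements lie in the type of the ring are
  enough: they include all shifts of the ring and their graded submodules, so by the graded form
  of Baer's criterion the extension property then holds for test modules of every type.
\<close>

definition graded_injective :: "'r graded_ring \<Rightarrow> ('r, 'e) graded_module \<Rightarrow> bool" where
  "graded_injective R E \<longleftrightarrow>
     (\<forall>(L :: ('r, 'r) graded_module) (N :: ('r, 'r) graded_module) j f.
        graded_module R L \<and> graded_module R N \<and>
        j \<in> graded_hom R L N \<and> inj_on j (carrier L) \<and> f \<in> graded_hom R L E \<longrightarrow>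
        (\<exists>g\<in>graded_hom R N E. \<forall>x\<in>carrier L. g (j x) = f x))"

text \<open>A resolution \<open>0 \<rightarrow> M \<rightarrow> E 0 \<rightarrow> E 1 \<rightarrow> \<dots>\<close> with augmentation \<open>\<epsilon>\<close> and differentials \<open>d\<close>.\<close>

definition graded_injective_resolution ::
    "'r graded_ring \<Rightarrow> ('r, 'm) graded_module \<Rightarrow>
     ('m \<Rightarrow> 'e) \<times> (nat \<Rightarrow> ('r, 'e) graded_module) \<times> (nat \<Rightarrow> 'e \<Rightarrow> 'e) \<Rightarrow> bool" where
  "graded_injective_resolution R M = (\<lambda>(\<epsilon>, E, d).
     (\<forall>i. graded_module R (E i) \<and> graded_injective R (E i)) \<and>
     \<epsilon> \<in> graded_hom R M (E 0) \<and>
     (\<forall>i. d i \<in> graded_hom R (E i) (E (Suc i))) \<and>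
     inj_on \<epsilon> (carrier M) \<and>
     \<epsilon> ` carrier M = {x \<in> carrier (E 0). d 0 x = \<zero>\<^bsub>E 1\<^esub>} \<and>
     (\<forall>i. d i ` carrier (E i) =
        {x \<in> carrier (E (Suc i)). d (Suc i) x = \<zero>\<^bsub>E (Suc (Suc i))\<^esub>}))"

definition resolution_cocycles ::
    "'r graded_ring \<Rightarrow>
     ('m \<Rightarrow> 'e) \<times> (nat \<Rightarrow> ('r, 'e) graded_module) \<times> (nat \<Rightarrow> 'e \<Rightarrow> 'e) \<Rightarrow> nat \<Rightarrow> 'e set" where
  "resolution_cocycles R = (\<lambda>(\<epsilon>, E, d) i.
     {x \<in> torsion_part R (E i). d i x = \<zero>\<^bsub>E (Suc i)\<^esub>})"

definition resolution_coboundaries ::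
    "'r graded_ring \<Rightarrow>
     ('m \<Rightarrow> 'e) \<times> (nat \<Rightarrow> ('r, 'e) graded_module) \<times> (nat \<Rightarrow> 'e \<Rightarrow> 'e) \<Rightarrow> nat \<Rightarrow> 'e set" where
  "resolution_coboundaries R = (\<lambda>(\<epsilon>, E, d) i.
     case i of 0 \<Rightarrow> {\<zero>\<^bsub>E 0\<^esub>} | Suc j \<Rightarrow> d j ` torsion_part R (E j))"

definition derived_torsion ::
    "'r graded_ring \<Rightarrow>
     ('m \<Rightarrow> 'e) \<times> (nat \<Rightarrow> ('r, 'e) graded_module) \<times> (nat \<Rightarrow> 'e \<Rightarrow> 'e) \<Rightarrow>
     nat \<Rightarrow> ('r, 'e set) graded_module" where
  "derived_torsion R res i =
     graded_quot (graded_sub (fst (snd res) i) (resolution_cocycles R res i))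
       (resolution_coboundaries R res i)"

text \<open>
  The type of the elements of the injective modules has to be fixed. The following type is large
  enough for every graded module over a ring with elements in \<^typ>\<open>'r\<close> and with elements in
  \<^typ>\<open>'m\<close>: its cardinality \<open>\<kappa>\<close> is infinite, bounds that of \<^typ>\<open>'m\<close>, and satisfies
  \<open>\<kappa>\<^sup>\<lambda> = \<kappa>\<close> where \<open>\<lambda>\<close> is the cardinality of \<^typ>\<open>'r list\<close>, so that a graded module with at most
  \<open>\<kappa>\<close> elements embeds in a graded injective module with at most \<open>\<kappa>\<close> elements. Two resolutions
  give isomorphic cohomology, so the choice of one is immaterial.
\<close>

type_synonym ('r, 'm) universe = "'r list \<Rightarrow> nat \<Rightarrow> 'm + nat"

definition chosen_resolution ::
    "'r graded_ring \<Rightarrow> ('r, 'm) graded_module \<Rightarrow>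
     ('m \<Rightarrow> ('r, 'm) universe) \<times> (nat \<Rightarrow> ('r, ('r, 'm) universe) graded_module) \<times>
     (nat \<Rightarrow> ('r, 'm) universe \<Rightarrow> ('r, 'm) universe)" where
  "chosen_resolution R M = (SOME res. graded_injective_resolution R M res)"

definition local_cohomology ::
    "'r graded_ring \<Rightarrow> ('r, 'm) graded_module \<Rightarrow> nat \<Rightarrow>
     ('r, ('r, 'm) universe set) graded_module" where
  "local_cohomology R M i = derived_torsion R (chosen_resolution R M) i"


section \<open>Regularity\<close>

text \<open>Suprema are taken in the extended reals, where the empty supremum is \<open>-\<infinity>\<close>. A supremum of
  integers, or of such suprema, is attained whenever it is finite.\<close>

definition nonzero_degrees :: "('r, 'm) graded_module \<Rightarrow> int set" where
  "nonzero_degrees M = {t. part M t \<noteq> {\<zero>\<^bsub>M\<^esub>}}"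

definition a_invariant :: "'r graded_ring \<Rightarrow> ('r, 'm) graded_module \<Rightarrow> nat \<Rightarrow> ereal" where
  "a_invariant R M i =
     (SUP t\<in>nonzero_degrees (local_cohomology R M i). ereal (real_of_int t))"

definition reg :: "'r graded_ring \<Rightarrow> ('r, 'm) graded_module \<Rightarrow> ereal" where
  "reg R M = (SUP i. a_invariant R M i + ereal (real i))"

definition weakly_regular :: "'r graded_ring \<Rightarrow> ('r, 'm) graded_module \<Rightarrow> int \<Rightarrow> bool" where
  "weakly_regular R M t \<longleftrightarrow>
     (\<forall>i. part (local_cohomology R M i) (t - int i + 1) = {\<zero>\<^bsub>local_cohomology R M i\<^esub>})"

definition irrelevant_smult :: "'r graded_ring \<Rightarrow> ('r, 'm) graded_module \<Rightarrow> 'm set" where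
  "irrelevant_smult R M =
     submodule_generated R M
       {a \<odot>\<^bsub>M\<^esub> x | a x. a \<in> irrelevant_ideal R \<and> x \<in> carrier M}"

definition gen_degree :: "'r graded_ring \<Rightarrow> ('r, 'm) graded_module \<Rightarrow> ereal" where
  "gen_degree R M =
     (SUP t\<in>nonzero_degrees (graded_quot M (irrelevant_smult R M)). ereal (real_of_int t))"

end

theory Submission
  imports Defs "HOL-Library.Poly_Mapping"
begin

text \<open>
  Let \<open>x\<^sub>0, \<dots>, x\<^bsub>n-1\<^esub>\<close> be elements of degree one that generate the ring over \<open>R\<^sub>0\<close>, and let \<open>E\<close> be the
  chosen resolution. The \<open>R\<^sub>+\<close>-torsion \<open>T\<close> of \<open>E\<close> computes local cohomology. Adding one generator at
  a time filters \<open>E\<close> by torsion subcomplexes; since \<open>R\<close> is noetherian and \<open>E\<close> is injective, \<open>x\<^sub>j\<close> acts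
  bijectively on the \<open>j\<close>-th quotient, so the quotient has an acyclic Koszul complex. Hence the Koszul
  complexes of \<open>T\<close> and of \<open>M\<close> have the same cohomology: nothing in positive degree, and \<open>M/R\<^sub>+M\<close> in
  degree zero.

  Adjoining the \<open>x\<^sub>j\<close> one by one, in long exact sequences of mapping cones, gives three facts.
  If \<open>T\<close> is exact at all \<open>(q, u)\<close> with \<open>q + u > r\<close>, then \<open>M/R\<^sub>+M\<close> vanishes above \<open>r\<close>.
  If \<open>T\<close> is exact on the diagonal \<open>q + u = t + 1\<close> and \<open>M\<close> is generated up to degree \<open>t\<close>, then \<open>T\<close> is
  exact on \<open>q + u = t + 2\<close>, and so on all later diagonals. The Koszul complex of a finitely generated
  module has cohomology bounded above, and since \<open>T\<close> is torsion, so has \<open>T\<close>.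
\<close>

section \<open>Internal direct sums\<close>

text \<open>Local cohomology is defined through a \<open>SOME\<close> resolution in a fixed type, so
  nothing can be said about it before a resolution is built inside that type; this accounts for the
  divisible groups, the cofree modules and the codings into \<open>universe\<close>. Two further
  choices shape the development. No quotient complex is ever formed: a pair of families
  \<open>A\<close>, \<open>B\<close> of homogeneous subsets stands for B/A, and each use of a long
  exact sequence is a short diagram chase with elements. And all cones live in one type, by a
  \<open>pairing\<close> of the element type with itself. The numbers work out because the
  generators have degree one: adding a generator to a complex joins (q, u) with (q + 1, u - 1), so
  that q + u is constant, and q + u is the number that occurs both in weak regularity and in a_i +
  i. The noetherian hypothesis enters twice: for M it bounds the Koszul cohomology, for R itself it
  stabilises the annihilators that occur when elements of an injective module are divided by
  generators.\<close>

lemma (in abelian_group) additive_subgroupI':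
  assumes "H \<subseteq> carrier G" "\<zero> \<in> H" "\<And>x y. x \<in> H \<Longrightarrow> y \<in> H \<Longrightarrow> x \<oplus> y \<in> H" "\<And>x. x \<in> H \<Longrightarrow> \<ominus> x \<in> H"
  shows "additive_subgroup H G"
  by (intro additive_subgroup.intro add.subgroupI) (use assms in auto)

lemma (in abelian_group) additive_subgroup_minus:
  assumes "additive_subgroup H G" "x \<in> H" "y \<in> H"
  shows "x \<ominus> y \<in> H"
  using assms additive_subgroup.a_closed additive_subgroup.a_inv_closed a_minus_def
    abelian_group_axioms
  by (metis add.subgroupE(3) additive_subgroup_def)

lemma (in abelian_group) additive_subgroup_neg:
  assumes "additive_subgroup H G" "x \<in> H"
  shows "\<ominus> x \<in> H"
  using assms abelian_group_axioms by (metis add.subgroupE(3) additive_subgroup_def)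

lemma (in abelian_group) a_inv_zero [simp]: "\<ominus> \<zero> = \<zero>"
  by (rule minus_equality) simp_all

lemma (in abelian_group) minus_eq_zero:
  "x \<in> carrier G \<Longrightarrow> y \<in> carrier G \<Longrightarrow> x \<ominus> y = \<zero> \<Longrightarrow> x = y"
  by (metis a_inv_closed a_minus_def minus_equality minus_minus)

lemma (in abelian_group) move_cancel:
  assumes "x \<in> carrier G" "y \<in> carrier G"
  shows "x \<oplus> (y \<oplus> \<ominus> x) = y"
  using assms by (metis a_inv_closed a_comm a_lcomm r_neg r_zero)

lemma (in abelian_group) move_cancel_left:
  assumes "x \<in> carrier G" "y \<in> carrier G" "z \<in> carrier G"
  shows "x \<oplus> (y \<oplus> (\<ominus> x \<oplus> z)) = y \<oplus> z"
  using move_cancel[of x y] assms by (metis a_assoc a_closed a_inv_closed)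

lemma (in abelian_group) move_cancel2:
  assumes "x \<in> carrier G" "a \<in> carrier G" "b \<in> carrier G"
  shows "x \<oplus> (a \<oplus> (b \<oplus> \<ominus> x)) = a \<oplus> b"
  using move_cancel[of x "a \<oplus> b"] assms by (simp add: a_assoc)

lemma (in abelian_group) move_cancel2_left:
  assumes "x \<in> carrier G" "a \<in> carrier G" "b \<in> carrier G" "z \<in> carrier G"
  shows "x \<oplus> (a \<oplus> (b \<oplus> (\<ominus> x \<oplus> z))) = a \<oplus> (b \<oplus> z)"
  using move_cancel_left[of x "a \<oplus> b"] assms by (simp add: a_assoc)

lemma (in abelian_group) move_cancel3:
  assumes "x \<in> carrier G" "a \<in> carrier G" "b \<in> carrier G" "c \<in> carrier G"
  shows "x \<oplus> (a \<oplus> (b \<oplus> (c \<oplus> \<ominus> x))) = a \<oplus> (b \<oplus> c)"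
  using move_cancel[of x "a \<oplus> (b \<oplus> c)"] assms by (simp add: a_assoc)

lemma (in abelian_group) move_cancel3_left:
  assumes "x \<in> carrier G" "a \<in> carrier G" "b \<in> carrier G" "c \<in> carrier G" "z \<in> carrier G"
  shows "x \<oplus> (a \<oplus> (b \<oplus> (c \<oplus> (\<ominus> x \<oplus> z)))) = a \<oplus> (b \<oplus> (c \<oplus> z))"
  using move_cancel_left[of x "a \<oplus> (b \<oplus> c)"] assms by (simp add: a_assoc)

text \<open>Ordered rewriting places an element before its negative, but not next to it.\<close>

lemmas (in abelian_group) group_simps =
  a_minus_def minus_add minus_minus a_ac r_neg r_neg1 r_neg2 l_neg
  move_cancel move_cancel_left move_cancel2 move_cancel2_left move_cancel3 move_cancel3_left

locale direct_sum_group = abelian_group G for G (structure) +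
  fixes D :: "'i \<Rightarrow> 'a set"
  assumes direct_sum: "internal_direct_sum G D"

definition component :: "('b, 'c) ring_scheme \<Rightarrow> ('i \<Rightarrow> 'b set) \<Rightarrow> 'i \<Rightarrow> 'b \<Rightarrow> 'b" where
  "component A D i x =
     (THE f. (\<forall>i. f i \<in> D i) \<and> finite {i. f i \<noteq> \<zero>\<^bsub>A\<^esub>} \<and>
        x = (\<Oplus>\<^bsub>A\<^esub>i\<in>{i. f i \<noteq> \<zero>\<^bsub>A\<^esub>}. f i)) i"

context direct_sum_group
begin

lemma part_subgroup: "additive_subgroup (D i) G"
  using direct_sum by (simp add: internal_direct_sum_def)

lemma part_carrier: "x \<in> D i \<Longrightarrow> x \<in> carrier G"
  using part_subgroup additive_subgroup.a_Hcarr by metis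

lemma part_zero: "\<zero> \<in> D i"
  using part_subgroup additive_subgroup.zero_closed by metis

lemma part_add: "x \<in> D i \<Longrightarrow> y \<in> D i \<Longrightarrow> x \<oplus> y \<in> D i"
  using part_subgroup additive_subgroup.a_closed by metis

lemma component_props:
  assumes "x \<in> carrier G"
  shows "component G D i x \<in> D i" "finite {i. component G D i x \<noteq> \<zero>}"
    "x = (\<Oplus>i\<in>{i. component G D i x \<noteq> \<zero>}. component G D i x)"
proof -
  have "\<exists>!f. (\<forall>i. f i \<in> D i) \<and> finite {i. f i \<noteq> \<zero>} \<and> x = (\<Oplus>i\<in>{i. f i \<noteq> \<zero>}. f i)"
    using direct_sum assms by (simp add: internal_direct_sum_def)
  from theI'[OF this] show "component G D i x \<in> D i" "finite {i. component G D i x \<noteq> \<zero>}"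
    "x = (\<Oplus>i\<in>{i. component G D i x \<noteq> \<zero>}. component G D i x)"
    unfolding component_def by auto
qed

lemmas component_part = component_props(1)
lemmas finite_component = component_props(2)

lemma component_closed: "x \<in> carrier G \<Longrightarrow> component G D i x \<in> carrier G"
  using component_part part_carrier by blast

text \<open>The set \<open>S\<close> may be larger than the support, so that two decompositions can
  be compared over the union of their supports.\<close>

lemma component_unique:
  assumes f: "\<And>i. f i \<in> D i" and S: "finite S" and out: "\<And>i. i \<notin> S \<Longrightarrow> f i = \<zero>"
    and x: "x = (\<Oplus>i\<in>S. f i)"
  shows "component G D i x = f i"
proof -
  have fc: "f i \<in> carrier G" for i using f part_carrier by blast
  have sub: "{i. f i \<noteq> \<zero>} \<subseteq> S" using out by auto
  have "(\<Oplus>i\<in>S. f i) = (\<Oplus>i\<in>{i. f i \<noteq> \<zero>}. f i)"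
    by (rule add.finprod_mono_neutral_cong_left[symmetric]) (use S sub fc in auto)
  then have fx: "(\<forall>i. f i \<in> D i) \<and> finite {i. f i \<noteq> \<zero>} \<and> x = (\<Oplus>i\<in>{i. f i \<noteq> \<zero>}. f i)"
    using f finite_subset[OF sub S] x by auto
  have xc: "x \<in> carrier G" unfolding x using fc by auto
  have "\<exists>!f. (\<forall>i. f i \<in> D i) \<and> finite {i. f i \<noteq> \<zero>} \<and> x = (\<Oplus>i\<in>{i. f i \<noteq> \<zero>}. f i)"
    using direct_sum xc by (simp add: internal_direct_sum_def)
  then have "(THE f. (\<forall>i. f i \<in> D i) \<and> finite {i. f i \<noteq> \<zero>} \<and> x = (\<Oplus>i\<in>{i. f i \<noteq> \<zero>}. f i)) = f"
    by (rule the1_equality) (rule fx)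
  then show ?thesis by (simp add: component_def)
qed

lemma component_add:
  assumes x: "x \<in> carrier G" and y: "y \<in> carrier G"
  shows "component G D i (x \<oplus> y) = component G D i x \<oplus> component G D i y"
proof (rule component_unique)
  let ?S = "{i. component G D i x \<noteq> \<zero>}" and ?T = "{i. component G D i y \<noteq> \<zero>}"
  show "finite (?S \<union> ?T)" using finite_component x y by auto
  then have fin: "finite ?S" "finite ?T" by auto
  have c: "component G D i x \<in> carrier G" "component G D i y \<in> carrier G" for i
    using component_closed x y by auto
  have "(\<Oplus>i\<in>?S. component G D i x) = (\<Oplus>i\<in>?S \<union> ?T. component G D i x)"
    by (rule add.finprod_mono_neutral_cong_left) (use fin c in auto)
  moreover have "(\<Oplus>i\<in>?T. component G D i y) = (\<Oplus>i\<in>?S \<union> ?T. component G D i y)"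
    by (rule add.finprod_mono_neutral_cong_left) (use fin c in auto)
  ultimately show "x \<oplus> y = (\<Oplus>i\<in>?S \<union> ?T. component G D i x \<oplus> component G D i y)"
    using component_props(3)[OF x] component_props(3)[OF y] c
    by (simp add: finsum_addf)
qed (use x y component_part part_add in auto)

lemma component_same: "x \<in> D i \<Longrightarrow> component G D i x = x"
  using component_unique[of "\<lambda>j. if j = i then x else \<zero>" "{i}" x i] part_zero part_carrier
  by (auto simp: finsum_singleton)

lemma component_other: "x \<in> D i \<Longrightarrow> j \<noteq> i \<Longrightarrow> component G D j x = \<zero>"
  using component_unique[of "\<lambda>j. if j = i then x else \<zero>" "{i}" x j] part_zero part_carrier
  by (auto simp: finsum_singleton)

lemma component_zero: "component G D i \<zero> = \<zero>"
  using component_same part_zero by blast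

lemma component_neg:
  assumes "x \<in> carrier G" shows "component G D i (\<ominus> x) = \<ominus> component G D i x"
  using component_add[of "\<ominus> x" x i] assms component_zero component_closed
  by (metis a_inv_closed l_neg minus_equality)

lemma homogeneous_induct [consumes 1, case_names part add]:
  assumes "x \<in> carrier G" and hom: "\<And>i x. x \<in> D i \<Longrightarrow> P x"
    and add: "\<And>x y. x \<in> carrier G \<Longrightarrow> y \<in> carrier G \<Longrightarrow> P x \<Longrightarrow> P y \<Longrightarrow> P (x \<oplus> y)"
  shows "P x"
proof -
  have "P (\<Oplus>i\<in>S. component G D i x)" if "finite S" for S
    using that
  proof induction
    case empty
    show ?case using hom[OF part_zero] by simp
  next
    case (insert i S)
    have c: "component G D i x \<in> carrier G" for i
      using component_closed assms(1) by auto
    then show ?case using insert hom[OF component_part[OF assms(1)]]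
      by (simp add: Pi_def add)
  qed
  from this[OF finite_component] show ?thesis using component_props(3)[OF assms(1)] assms(1) by metis
qed

lemma component_eqI:
  assumes x: "x \<in> carrier G" and y: "y \<in> carrier G"
    and eq: "\<And>i. component G D i x = component G D i y"
  shows "x = y"
  using component_props(3)[OF x] component_props(3)[OF y] eq by simp

end

text \<open>Additive projections \<open>p i\<close> replace the unique-existence clause: applying
  \<open>p j\<close> to a finite sum isolates the j-th summand, which gives uniqueness, and x minus
  the sum of its projections is killed by every \<open>p j\<close>, which gives existence. The
  graded modules constructed later are recognised in this way.\<close>

lemma (in abelian_group) internal_direct_sumI:
  assumes D: "\<And>i. additive_subgroup (D i) G"
    and p_in: "\<And>i x. x \<in> carrier G \<Longrightarrow> p i x \<in> D i"
    and p_add: "\<And>i x y. x \<in> carrier G \<Longrightarrow> y \<in> carrier G \<Longrightarrow> p i (x \<oplus> y) = p i x \<oplus> p i y"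
    and p_same: "\<And>i x. x \<in> D i \<Longrightarrow> p i x = x"
    and p_other: "\<And>i j x. x \<in> D i \<Longrightarrow> j \<noteq> i \<Longrightarrow> p j x = \<zero>"
    and fin: "\<And>x. x \<in> carrier G \<Longrightarrow> finite {i. p i x \<noteq> \<zero>}"
    and zero: "\<And>x. x \<in> carrier G \<Longrightarrow> (\<And>i. p i x = \<zero>) \<Longrightarrow> x = \<zero>"
  shows "internal_direct_sum G D"
  unfolding internal_direct_sum_def
proof (intro conjI allI ballI ex1I)
  show "additive_subgroup (D i) G" for i by fact
  have Dc: "x \<in> D i \<Longrightarrow> x \<in> carrier G" for x i
    using D additive_subgroup.a_Hcarr by metis
  have Dz: "\<zero> \<in> D i" for i using D additive_subgroup.zero_closed by metis
  have psum: "p j (\<Oplus>i\<in>S. f i) = (if j \<in> S then f j else \<zero>)"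
    if "finite S" "\<And>i. f i \<in> D i" for S f j
    using that(1)
  proof induction
    case empty
    show ?case using p_same[OF Dz] by simp
  next
    case (insert i S)
    have fc: "f i \<in> carrier G" for i using that(2) Dc by blast
    have "p j (f i) = (if j = i then f j else \<zero>)"
      using p_same p_other that(2) by metis
    then show ?case using insert fc by (auto simp: Pi_def p_add)
  qed
  fix x assume x: "x \<in> carrier G"
  let ?f = "\<lambda>i. p i x"
  show "p i x \<in> D i" for i using p_in x .
  show f: "finite {i. p i x \<noteq> \<zero>}" using fin x .
  let ?s = "\<Oplus>i\<in>{i. p i x \<noteq> \<zero>}. p i x"
  have pc: "p i y \<in> carrier G" if "y \<in> carrier G" for i y using p_in Dc that by metis
  have sc: "?s \<in> carrier G" using pc x by auto
  have p0: "p i \<zero> = \<zero>" for i using p_same[OF Dz] by auto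
  have pneg: "p i (\<ominus> y) = \<ominus> p i y" if "y \<in> carrier G" for i y
    using p_add[of "\<ominus> y" y i] that p0 pc by (metis a_inv_closed l_neg minus_equality)
  have "p i (x \<ominus> ?s) = \<zero>" for i
  proof -
    have "p i ?s = p i x" using psum[OF f, of "\<lambda>i. p i x" i] p_in[OF x] by auto
    then show ?thesis using x sc pc by (simp add: a_minus_def p_add pneg r_neg)
  qed
  then have "x \<ominus> ?s = \<zero>" using zero x sc by auto
  then show "x = ?s" using x sc minus_eq_zero by blast
  fix g assume g: "(\<forall>i. g i \<in> D i) \<and> finite {i. g i \<noteq> \<zero>} \<and> x = (\<Oplus>i\<in>{i. g i \<noteq> \<zero>}. g i)"
  show "g = ?f"
    using psum[of "{i. g i \<noteq> \<zero>}" g] g by auto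
qed

sublocale graded_ring \<subseteq> RD: direct_sum_group R "rpart R"
  by unfold_locales (rule rpart_sum)

sublocale graded_module \<subseteq> MD: direct_sum_group M "part M"
  by unfold_locales (rule part_sum)

abbreviation ring_component :: "'r graded_ring \<Rightarrow> nat \<Rightarrow> 'r \<Rightarrow> 'r" where
  "ring_component R \<equiv> component R (rpart R)"

abbreviation module_component :: "('r, 'm) graded_module \<Rightarrow> int \<Rightarrow> 'm \<Rightarrow> 'm" where
  "module_component M \<equiv> component M (part M)"

context graded_ring
begin

lemma graded_ring: "graded_ring R" by unfold_locales

lemma ring_component_mult:
  assumes a: "a \<in> rpart R i" and b: "b \<in> carrier R"
  shows "ring_component R k (a \<otimes> b) = (if i \<le> k then a \<otimes> ring_component R (k - i) b else \<zero>)"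
  using b
proof (induction b rule: RD.homogeneous_induct)
  case (part j b)
  have "a \<otimes> b \<in> rpart R (i + j)" using a part rpart_mult by auto
  then have "ring_component R k (a \<otimes> b) = (if k = i + j then a \<otimes> b else \<zero>)"
    using RD.component_same RD.component_other by auto
  moreover have "ring_component R (k - i) b = (if k - i = j then b else \<zero>)"
    using part RD.component_same RD.component_other by auto
  ultimately show ?case using RD.part_carrier[OF a] by auto
next
  case (add x y)
  then show ?case using RD.part_carrier[OF a]
    by (auto simp: r_distr RD.component_add RD.component_closed)
qed

text \<open>That 1 has degree zero is not among the axioms of \<open>graded_ring\<close>. Comparing
  components of degree i in x = x * 1, for x of degree i, shows that the degree-zero component e of
  1 satisfies x * e = x for homogeneous x, hence for all x; then x = 1 gives e = 1.\<close>

lemma one_part: "\<one> \<in> rpart R 0"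
proof -
  let ?e = "ring_component R 0 \<one>"
  have e: "?e \<in> rpart R 0" by (simp add: RD.component_part)
  then have ec: "?e \<in> carrier R" using RD.part_carrier by blast
  have id: "x \<otimes> ?e = x" if "x \<in> carrier R" for x
    using that
  proof (induction x rule: RD.homogeneous_induct)
    case (part i x)
    have "x = ring_component R i (x \<otimes> \<one>)" using part RD.component_same RD.part_carrier by auto
    also have "\<dots> = x \<otimes> ?e" using ring_component_mult[OF part, of \<one> i] by simp
    finally show ?case by simp
  next
    case (add x y)
    then show ?case using ec by (simp add: l_distr)
  qed
  from id[of \<one>] have "?e = \<one>" using ec by simp
  then show ?thesis using e by simp
qed

lemma pow_part: "a \<in> rpart R i \<Longrightarrow> a [^] k \<in> rpart R (k * i)"
proof (induction k)
  case 0
  then show ?case by (simp add: one_part)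
next
  case (Suc k)
  then show ?case using rpart_mult[of "a [^] k" "k * i" a i] by (simp add: add.commute)
qed

end

context graded_module
begin

lemma graded_module: "graded_module R M" by unfold_locales

lemma module: "module R M" by unfold_locales

lemma module_component_smult:
  assumes a: "a \<in> rpart R i" and x: "x \<in> carrier M"
  shows "module_component M t (a \<odot>\<^bsub>M\<^esub> x) = a \<odot>\<^bsub>M\<^esub> module_component M (t - int i) x"
  using x
proof (induction x rule: MD.homogeneous_induct)
  case (part s x)
  have "a \<odot>\<^bsub>M\<^esub> x \<in> part M (int i + s)" using a part part_smult by auto
  then have "module_component M t (a \<odot>\<^bsub>M\<^esub> x) = (if t = int i + s then a \<odot>\<^bsub>M\<^esub> x else \<zero>\<^bsub>M\<^esub>)"
    using MD.component_same MD.component_other by auto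
  moreover have "module_component M (t - int i) x = (if t - int i = s then x else \<zero>\<^bsub>M\<^esub>)"
    using part MD.component_same MD.component_other by auto
  ultimately show ?case using RD.part_carrier[OF a] by auto
next
  case (add x y)
  then show ?case using RD.part_carrier[OF a]
    by (auto simp: smult_r_distr MD.component_add MD.component_closed)
qed

end

context graded_ring
begin

text \<open>Here the module element is homogeneous and the scalar arbitrary, the opposite of
  \<open>module_component_smult\<close>. It serves for maps into cofree modules, where the scalar
  runs through the whole ring, and for showing that certain ideals are homogeneous.\<close>

lemma component_smult_homogeneous:
  assumes N: "graded_module R N" and n: "n \<in> part N s" and r: "r \<in> carrier R"
  shows "module_component N u (r \<odot>\<^bsub>N\<^esub> n) = (if s \<le> u then ring_component R (nat (u - s)) r \<odot>\<^bsub>N\<^esub> n else \<zero>\<^bsub>N\<^esub>)"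
proof -
  interpret N: graded_module R N by (rule N)
  show ?thesis using r
  proof (induction r rule: RD.homogeneous_induct)
    case (part i r)
    have nc: "n \<in> carrier N" using n N.MD.part_carrier by blast
    have "r \<odot>\<^bsub>N\<^esub> n \<in> part N (int i + s)" using N.part_smult[OF part n] .
    then have "module_component N u (r \<odot>\<^bsub>N\<^esub> n) = (if u = int i + s then r \<odot>\<^bsub>N\<^esub> n else \<zero>\<^bsub>N\<^esub>)"
      using N.MD.component_same N.MD.component_other by auto
    moreover have "ring_component R (nat (u - s)) r = (if nat (u - s) = i then r else \<zero>)"
      using part RD.component_same RD.component_other by auto
    ultimately show ?case using nc by auto
  next
    case (add a b)
    have nc: "n \<in> carrier N" using n N.MD.part_carrier by blast
    then show ?case using add by (simp add: N.smult_l_distr N.MD.component_add RD.component_add RD.component_closed)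
  qed
qed

end

section \<open>Complexes and mapping cones\<close>

text \<open>Homogeneity is left out: in cones and homotopies it is expressed by families of
  homogeneous subsets.\<close>

definition linear :: "('r, 'q) ring_scheme \<Rightarrow> ('r, 'a, 'p) module_scheme \<Rightarrow> ('r, 'b, 'n) module_scheme \<Rightarrow> ('a \<Rightarrow> 'b) \<Rightarrow> bool" where
  "linear R P Q f \<longleftrightarrow> f \<in> carrier P \<rightarrow> carrier Q \<and>
     (\<forall>x\<in>carrier P. \<forall>y\<in>carrier P. f (x \<oplus>\<^bsub>P\<^esub> y) = f x \<oplus>\<^bsub>Q\<^esub> f y) \<and>
     (\<forall>a\<in>carrier R. \<forall>x\<in>carrier P. f (a \<odot>\<^bsub>P\<^esub> x) = a \<odot>\<^bsub>Q\<^esub> f x)"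

lemma linear_closed: "linear R P Q f \<Longrightarrow> x \<in> carrier P \<Longrightarrow> f x \<in> carrier Q"
  by (auto simp: linear_def)

lemma linear_add: "linear R P Q f \<Longrightarrow> x \<in> carrier P \<Longrightarrow> y \<in> carrier P \<Longrightarrow> f (x \<oplus>\<^bsub>P\<^esub> y) = f x \<oplus>\<^bsub>Q\<^esub> f y"
  by (auto simp: linear_def)

lemma linear_smult: "linear R P Q f \<Longrightarrow> a \<in> carrier R \<Longrightarrow> x \<in> carrier P \<Longrightarrow> f (a \<odot>\<^bsub>P\<^esub> x) = a \<odot>\<^bsub>Q\<^esub> f x"
  by (auto simp: linear_def)

lemma additive_zero:
  assumes "abelian_group P" "abelian_group Q" "f \<in> carrier P \<rightarrow> carrier Q"
    "\<And>x y. x \<in> carrier P \<Longrightarrow> y \<in> carrier P \<Longrightarrow> f (x \<oplus>\<^bsub>P\<^esub> y) = f x \<oplus>\<^bsub>Q\<^esub> f y"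
  shows "f \<zero>\<^bsub>P\<^esub> = \<zero>\<^bsub>Q\<^esub>"
proof -
  interpret P: abelian_group P by fact
  interpret Q: abelian_group Q by fact
  have "f \<zero>\<^bsub>P\<^esub> = f \<zero>\<^bsub>P\<^esub> \<oplus>\<^bsub>Q\<^esub> f \<zero>\<^bsub>P\<^esub>" using assms(4)[of "\<zero>\<^bsub>P\<^esub>" "\<zero>\<^bsub>P\<^esub>"] by simp
  then show ?thesis using assms(3) by (metis P.zero_closed PiE Q.add.r_cancel_one')
qed

lemma additive_neg:
  assumes "abelian_group P" "abelian_group Q" "f \<in> carrier P \<rightarrow> carrier Q"
    "\<And>x y. x \<in> carrier P \<Longrightarrow> y \<in> carrier P \<Longrightarrow> f (x \<oplus>\<^bsub>P\<^esub> y) = f x \<oplus>\<^bsub>Q\<^esub> f y"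
    and x: "x \<in> carrier P"
  shows "f (\<ominus>\<^bsub>P\<^esub> x) = \<ominus>\<^bsub>Q\<^esub> f x"
proof -
  interpret P: abelian_group P by fact
  interpret Q: abelian_group Q by fact
  have "f (\<ominus>\<^bsub>P\<^esub> x) \<oplus>\<^bsub>Q\<^esub> f x = \<zero>\<^bsub>Q\<^esub>"
    using assms(4)[of "\<ominus>\<^bsub>P\<^esub> x" x] x additive_zero[OF assms(1-4)] by (simp add: P.l_neg)
  then show ?thesis using x assms(3) by (metis P.a_inv_closed PiE Q.minus_equality)
qed

lemma linear_zero: "module R P \<Longrightarrow> module R Q \<Longrightarrow> linear R P Q f \<Longrightarrow> f \<zero>\<^bsub>P\<^esub> = \<zero>\<^bsub>Q\<^esub>"
  by (rule additive_zero) (auto simp: linear_def module_def)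

lemma linear_neg: "module R P \<Longrightarrow> module R Q \<Longrightarrow> linear R P Q f \<Longrightarrow> x \<in> carrier P \<Longrightarrow> f (\<ominus>\<^bsub>P\<^esub> x) = \<ominus>\<^bsub>Q\<^esub> f x"
  by (rule additive_neg) (auto simp: linear_def module_def)

text \<open>A new element type for each cone would leave the recursion of the Koszul complex without
  a type. An injection of pairs into the type itself keeps every iterated cone over
  \<open>'e\<close>. Only the two projection laws are demanded, so the elements of a direct sum are
  the values of \<open>pr\<close>.\<close>

locale pairing =
  fixes pr :: "'e \<Rightarrow> 'e \<Rightarrow> 'e" and p1 p2 :: "'e \<Rightarrow> 'e"
  assumes p1 [simp]: "p1 (pr a b) = a" and p2 [simp]: "p2 (pr a b) = b"
begin

lemma pr_inject [simp]: "pr a b = pr a' b' \<longleftrightarrow> a = a' \<and> b = b'"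
  by (metis p1 p2)

definition pair_module :: "('r, 'e) graded_module \<Rightarrow> ('r, 'e) graded_module \<Rightarrow> ('r, 'e) graded_module" where
  "pair_module P Q = \<lparr>carrier = {pr a b | a b. a \<in> carrier P \<and> b \<in> carrier Q},
     monoid.mult = undefined, one = undefined, zero = pr \<zero>\<^bsub>P\<^esub> \<zero>\<^bsub>Q\<^esub>,
     add = (\<lambda>u v. pr (p1 u \<oplus>\<^bsub>P\<^esub> p1 v) (p2 u \<oplus>\<^bsub>Q\<^esub> p2 v)),
     smult = (\<lambda>r u. pr (r \<odot>\<^bsub>P\<^esub> p1 u) (r \<odot>\<^bsub>Q\<^esub> p2 u)), part = (\<lambda>_. {})\<rparr>"

lemma pair_module_simps [simp]:
  "pr a b \<in> carrier (pair_module P Q) \<longleftrightarrow> a \<in> carrier P \<and> b \<in> carrier Q"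
  "pr a b \<oplus>\<^bsub>pair_module P Q\<^esub> pr a' b' = pr (a \<oplus>\<^bsub>P\<^esub> a') (b \<oplus>\<^bsub>Q\<^esub> b')"
  "r \<odot>\<^bsub>pair_module P Q\<^esub> pr a b = pr (r \<odot>\<^bsub>P\<^esub> a) (r \<odot>\<^bsub>Q\<^esub> b)"
  "\<zero>\<^bsub>pair_module P Q\<^esub> = pr \<zero>\<^bsub>P\<^esub> \<zero>\<^bsub>Q\<^esub>"
  by (auto simp: pair_module_def)

lemma pair_module_cases:
  assumes "u \<in> carrier (pair_module P Q)"
  obtains a b where "u = pr a b" "a \<in> carrier P" "b \<in> carrier Q"
  using assms by (auto simp: pair_module_def)

lemma pair_module:
  assumes "module R P" "module R Q"
  shows "module R (pair_module P Q)"
proof -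
  interpret P: module R P by fact
  interpret Q: module R Q by fact
  show ?thesis
  proof (rule moduleI)
    show "abelian_group (pair_module P Q)"
    proof (rule abelian_groupI)
      fix x assume "x \<in> carrier (pair_module P Q)"
      then obtain a b where "x = pr a b" "a \<in> carrier P" "b \<in> carrier Q" by (rule pair_module_cases)
      then show "\<exists>y\<in>carrier (pair_module P Q). y \<oplus>\<^bsub>pair_module P Q\<^esub> x = \<zero>\<^bsub>pair_module P Q\<^esub>"
        by (intro bexI[of _ "pr (\<ominus>\<^bsub>P\<^esub> a) (\<ominus>\<^bsub>Q\<^esub> b)"]) (auto simp: P.l_neg Q.l_neg)
    qed (auto elim!: pair_module_cases simp: P.a_ac Q.a_ac)
  qed (auto elim!: pair_module_cases simp: P.cring_axioms P.smult_l_distr P.smult_r_distr P.smult_assoc1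
      Q.smult_l_distr Q.smult_r_distr Q.smult_assoc1)
qed

lemma pair_module_neg:
  assumes "module R P" "module R Q" "a \<in> carrier P" "b \<in> carrier Q"
  shows "\<ominus>\<^bsub>pair_module P Q\<^esub> pr a b = pr (\<ominus>\<^bsub>P\<^esub> a) (\<ominus>\<^bsub>Q\<^esub> b)"
proof -
  interpret P: module R P by fact
  interpret Q: module R Q by fact
  interpret M: module R "pair_module P Q" by (rule pair_module) fact+
  show ?thesis using assms by (intro M.minus_equality) (auto simp: P.l_neg Q.l_neg)
qed

lemma pair_module_minus:
  assumes "module R P" "module R Q" "a \<in> carrier P" "b \<in> carrier Q" "a' \<in> carrier P" "b' \<in> carrier Q"
  shows "pr a b \<ominus>\<^bsub>pair_module P Q\<^esub> pr a' b' = pr (a \<ominus>\<^bsub>P\<^esub> a') (b \<ominus>\<^bsub>Q\<^esub> b')"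
  using assms by (simp add: a_minus_def pair_module_neg)

end

text \<open>Indexing by all integers keeps \<open>q - 1\<close> meaningful everywhere, so exactness
  needs no separate clause at the left end.\<close>

definition cochain_complex ::
    "'r graded_ring \<Rightarrow> (int \<Rightarrow> ('r, 'e) graded_module) \<Rightarrow> (int \<Rightarrow> 'e \<Rightarrow> 'e) \<Rightarrow> bool" where
  "cochain_complex R P d \<longleftrightarrow> (\<forall>q. module R (P q)) \<and> (\<forall>q. linear R (P q) (P (q + 1)) (d q)) \<and>
     (\<forall>q. \<forall>x\<in>carrier (P q). d (q + 1) (d q x) = \<zero>\<^bsub>P (q + 2)\<^esub>)"

text \<open>\<open>S q u\<close> is the part of cohomological degree q and internal degree u. The
  grading sits in this family and not in the modules \<open>P q\<close>, so one ambient complex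
  serves for the whole resolution, its torsion and the image of M.\<close>

definition subcomplex ::
    "'r graded_ring \<Rightarrow> (int \<Rightarrow> ('r, 'e) graded_module) \<Rightarrow> (int \<Rightarrow> 'e \<Rightarrow> 'e) \<Rightarrow> (int \<Rightarrow> int \<Rightarrow> 'e set) \<Rightarrow> bool" where
  "subcomplex R P d S \<longleftrightarrow> (\<forall>q u. additive_subgroup (S q u) (P q)) \<and>
     (\<forall>q u i a x. a \<in> rpart R i \<longrightarrow> x \<in> S q u \<longrightarrow> a \<odot>\<^bsub>P q\<^esub> x \<in> S q (u + int i)) \<and>
     (\<forall>q u x. x \<in> S q u \<longrightarrow> d q x \<in> S (q + 1) u)"

text \<open>Exactness of a complex is exactness modulo this family, so that results on quotient
  complexes specialise to absolute ones.\<close>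

definition zero_family :: "(int \<Rightarrow> ('r, 'e) graded_module) \<Rightarrow> int \<Rightarrow> int \<Rightarrow> 'e set" where
  "zero_family P q u = {\<zero>\<^bsub>P q\<^esub>}"

text \<open>Exactness of the quotient complex \<open>B/A\<close> in cohomological degree \<open>q\<close> and internal degree \<open>u\<close>.\<close>

definition relatively_exact ::
    "(int \<Rightarrow> ('r, 'e) graded_module) \<Rightarrow> (int \<Rightarrow> 'e \<Rightarrow> 'e) \<Rightarrow> (int \<Rightarrow> int \<Rightarrow> 'e set) \<Rightarrow> (int \<Rightarrow> int \<Rightarrow> 'e set) \<Rightarrow>
     int \<Rightarrow> int \<Rightarrow> bool" where
  "relatively_exact P d A B q u \<longleftrightarrow>
     (\<forall>b\<in>B q u. d q b \<in> A (q + 1) u \<longrightarrow> (\<exists>c\<in>B (q - 1) u. b \<ominus>\<^bsub>P q\<^esub> d (q - 1) c \<in> A q u))"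

abbreviation exact_at ::
    "(int \<Rightarrow> ('r, 'e) graded_module) \<Rightarrow> (int \<Rightarrow> 'e \<Rightarrow> 'e) \<Rightarrow> (int \<Rightarrow> int \<Rightarrow> 'e set) \<Rightarrow> int \<Rightarrow> int \<Rightarrow> bool" where
  "exact_at P d S \<equiv> relatively_exact P d (zero_family P) S"

context
  fixes R :: "'r graded_ring" and P :: "int \<Rightarrow> ('r, 'e) graded_module" and d :: "int \<Rightarrow> 'e \<Rightarrow> 'e"
  assumes cc: "cochain_complex R P d"
begin

lemma cochain_module: "module R (P q)"
  using cc by (simp add: cochain_complex_def)

lemma cochain_linear: "linear R (P q) (P (q + 1)) (d q)"
  using cc by (simp add: cochain_complex_def)

lemma cochain_dd: "x \<in> carrier (P q) \<Longrightarrow> d (q + 1) (d q x) = \<zero>\<^bsub>P (q + 2)\<^esub>"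
  using cc by (simp add: cochain_complex_def)

lemma cochain_linear': "linear R (P (q - 1)) (P q) (d (q - 1))"
  using cochain_linear[of "q - 1"] by simp

lemma cochain_linear2: "linear R (P (q + 1)) (P (q + 2)) (d (q + 1))"
  using cochain_linear[of "q + 1"] by (simp add: add.commute)

lemma cochain_dd': "x \<in> carrier (P (q - 1)) \<Longrightarrow> d q (d (q - 1) x) = \<zero>\<^bsub>P (q + 1)\<^esub>"
  using cochain_dd[of x "q - 1"] by (simp add: add.commute)

lemmas cochain_simps = linear_add[OF cochain_linear] linear_smult[OF cochain_linear]
  linear_neg[OF cochain_module cochain_module cochain_linear] linear_zero[OF cochain_module cochain_module cochain_linear]
  linear_add[OF cochain_linear'] linear_smult[OF cochain_linear']
  linear_neg[OF cochain_module cochain_module cochain_linear'] linear_zero[OF cochain_module cochain_module cochain_linear']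
  linear_add[OF cochain_linear2] linear_smult[OF cochain_linear2]
  linear_neg[OF cochain_module cochain_module cochain_linear2] linear_zero[OF cochain_module cochain_module cochain_linear2]
  linear_closed[OF cochain_linear2] linear_closed[OF cochain_linear] linear_closed[OF cochain_linear'] cochain_dd cochain_dd'

lemma subcomplex_closed: "subcomplex R P d S \<Longrightarrow> x \<in> S q u \<Longrightarrow> x \<in> carrier (P q)"
  unfolding subcomplex_def by (meson additive_subgroup.a_Hcarr)

lemma subcomplex_zero: "subcomplex R P d S \<Longrightarrow> \<zero>\<^bsub>P q\<^esub> \<in> S q u"
  unfolding subcomplex_def by (meson additive_subgroup.zero_closed)

lemma subcomplex_add: "subcomplex R P d S \<Longrightarrow> x \<in> S q u \<Longrightarrow> y \<in> S q u \<Longrightarrow> x \<oplus>\<^bsub>P q\<^esub> y \<in> S q u"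
  unfolding subcomplex_def by (meson additive_subgroup.a_closed)

lemma subcomplex_neg: "subcomplex R P d S \<Longrightarrow> x \<in> S q u \<Longrightarrow> \<ominus>\<^bsub>P q\<^esub> x \<in> S q u"
  unfolding subcomplex_def
  by (meson abelian_group.additive_subgroup_neg cochain_module module.axioms(2))

lemma subcomplex_minus: "subcomplex R P d S \<Longrightarrow> x \<in> S q u \<Longrightarrow> y \<in> S q u \<Longrightarrow> x \<ominus>\<^bsub>P q\<^esub> y \<in> S q u"
  by (simp add: a_minus_def subcomplex_add subcomplex_neg)

lemma subcomplex_smult:
  "subcomplex R P d S \<Longrightarrow> a \<in> rpart R i \<Longrightarrow> x \<in> S q u \<Longrightarrow> a \<odot>\<^bsub>P q\<^esub> x \<in> S q (u + int i)"
  unfolding subcomplex_def by blast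

lemma subcomplex_d: "subcomplex R P d S \<Longrightarrow> x \<in> S q u \<Longrightarrow> d q x \<in> S (q + 1) u"
  unfolding subcomplex_def by blast

lemma subcomplex_d': "subcomplex R P d S \<Longrightarrow> x \<in> S (q - 1) u \<Longrightarrow> d (q - 1) x \<in> S q u"
  using subcomplex_d[of S x "q - 1" u] by simp

lemma zero_family_subcomplex:
  assumes "graded_ring R" shows "subcomplex R P d (zero_family P)"
proof -
  interpret graded_ring R by fact
  have "additive_subgroup {\<zero>\<^bsub>P q\<^esub>} (P q)" for q
  proof -
    interpret Q: module R "P q" by (rule cochain_module)
    show ?thesis by (rule Q.additive_subgroupI') auto
  qed
  moreover have "a \<odot>\<^bsub>P q\<^esub> \<zero>\<^bsub>P q\<^esub> = \<zero>\<^bsub>P q\<^esub>" if "a \<in> rpart R i" for a q i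
    using module.smult_r_null[OF cochain_module] RD.part_carrier[OF that] by blast
  ultimately show ?thesis
    by (auto simp: subcomplex_def zero_family_def cochain_simps)
qed

lemma zero_family_subset: "subcomplex R P d S \<Longrightarrow> zero_family P q u \<subseteq> S q u"
  using subcomplex_zero by (auto simp: zero_family_def)

lemma exact_at_iff:
  assumes "subcomplex R P d S"
  shows "exact_at P d S q u \<longleftrightarrow> (\<forall>b\<in>S q u. d q b = \<zero>\<^bsub>P (q + 1)\<^esub> \<longrightarrow> (\<exists>c\<in>S (q - 1) u. d (q - 1) c = b))"
proof -
  interpret Q: module R "P q" by (rule cochain_module)
  have "b \<ominus>\<^bsub>P q\<^esub> d (q - 1) c = \<zero>\<^bsub>P q\<^esub> \<longleftrightarrow> d (q - 1) c = b" if "b \<in> S q u" "c \<in> S (q - 1) u" for b c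
    using Q.minus_eq_zero[of b "d (q - 1) c"] subcomplex_closed[OF assms] subcomplex_d'[OF assms] that
    by (metis Q.M.r_neg a_minus_def)
  then show ?thesis by (auto simp: relatively_exact_def zero_family_def)
qed

text \<open>This is the piece H^{q-1}(B/A) -> H^q(A) -> H^q(B) of the long exact sequence: a cycle
  of A bounds some b in B, and b is moved into A by a boundary that exactness of B/A
  provides.\<close>

lemma exact_transfer_down:
  assumes A: "subcomplex R P d A" and B: "subcomplex R P d B"
    and sub: "\<And>q u. A q u \<subseteq> B q u" and rel: "relatively_exact P d A B (q - 1) u"
    and ex: "exact_at P d B q u"
  shows "exact_at P d A q u"
  unfolding exact_at_iff[OF A]
proof (intro ballI impI)
  fix a assume a: "a \<in> A q u" and da: "d q a = \<zero>\<^bsub>P (q + 1)\<^esub>"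
  interpret Q: module R "P q" by (rule cochain_module)
  interpret Q1: module R "P (q - 1)" by (rule cochain_module)
  from a sub ex da obtain b where b: "b \<in> B (q - 1) u" "d (q - 1) b = a"
    unfolding exact_at_iff[OF B] by blast
  with rel a obtain c where c: "c \<in> B (q - 2) u" "b \<ominus>\<^bsub>P (q - 1)\<^esub> d (q - 2) c \<in> A (q - 1) u"
    by (auto simp: relatively_exact_def)
  have cc: "c \<in> carrier (P (q - 2))" "b \<in> carrier (P (q - 1))" "d (q - 2) c \<in> carrier (P (q - 1))"
    using b c subcomplex_closed[OF B] subcomplex_d'[OF B, of c "q - 1"] by auto
  have "d (q - 1) (d (q - 2) c) = \<zero>\<^bsub>P q\<^esub>" using cochain_dd'[of c "q - 1"] cc by simp
  then have "d (q - 1) (b \<ominus>\<^bsub>P (q - 1)\<^esub> d (q - 2) c) = a"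
    using cc b subcomplex_closed[OF A a] by (simp add: a_minus_def cochain_simps)
  then show "\<exists>c\<in>A (q - 1) u. d (q - 1) c = a" using c by blast
qed

text \<open>This is the piece H^q(A) -> H^q(B) -> H^q(B/A): modulo a boundary of B, a cycle of B
  becomes a cycle of A.\<close>

lemma exact_transfer_up:
  assumes A: "subcomplex R P d A" and B: "subcomplex R P d B"
    and sub: "\<And>q u. A q u \<subseteq> B q u" and rel: "relatively_exact P d A B q u"
    and ex: "exact_at P d A q u"
  shows "exact_at P d B q u"
  unfolding exact_at_iff[OF B]
proof (intro ballI impI)
  fix b assume b: "b \<in> B q u" and db: "d q b = \<zero>\<^bsub>P (q + 1)\<^esub>"
  interpret Q: module R "P k" for k by (rule cochain_module)
  obtain c where c: "c \<in> B (q - 1) u" "b \<ominus>\<^bsub>P q\<^esub> d (q - 1) c \<in> A q u"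
  proof -
    have "d q b \<in> A (q + 1) u" using db subcomplex_zero[OF A, of "q + 1" u] by simp
    with rel b show ?thesis unfolding relatively_exact_def using that by blast
  qed
  have cl: "b \<in> carrier (P q)" "c \<in> carrier (P (q - 1))" "d (q - 1) c \<in> carrier (P q)"
    using b c(1) subcomplex_closed[OF B] subcomplex_d'[OF B] by blast+
  have "d q (b \<ominus>\<^bsub>P q\<^esub> d (q - 1) c) = \<zero>\<^bsub>P (q + 1)\<^esub>"
    using cl db by (simp add: a_minus_def cochain_simps)
  with ex c obtain a where a: "a \<in> A (q - 1) u" "d (q - 1) a = b \<ominus>\<^bsub>P q\<^esub> d (q - 1) c"
    unfolding exact_at_iff[OF A] by blast
  have ac: "a \<in> carrier (P (q - 1))" using a subcomplex_closed[OF A] by auto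
  have "d (q - 1) (a \<oplus>\<^bsub>P (q - 1)\<^esub> c) = b"
    using a cl ac by (simp add: cochain_simps Q.M.group_simps)
  moreover have "a \<oplus>\<^bsub>P (q - 1)\<^esub> c \<in> B (q - 1) u" using a c sub subcomplex_add[OF B] by blast
  ultimately show "\<exists>c\<in>B (q - 1) u. d (q - 1) c = b" by blast
qed

end

section \<open>The mapping cone of multiplication by an element of degree one\<close>

context pairing
begin

definition cone_module :: "(int \<Rightarrow> ('r, 'e) graded_module) \<Rightarrow> int \<Rightarrow> ('r, 'e) graded_module" where
  "cone_module P q = pair_module (P q) (P (q + 1))"

text \<open>The differential of the cone of x: P(-1) -> P, sending (a, b) to (da + xb, -db). The
  sign makes the two terms xdb in its square cancel.\<close>

definition cone_diff ::
    "'r \<Rightarrow> (int \<Rightarrow> ('r, 'e) graded_module) \<Rightarrow> (int \<Rightarrow> 'e \<Rightarrow> 'e) \<Rightarrow> int \<Rightarrow> 'e \<Rightarrow> 'e" where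
  "cone_diff x P d q u = pr (d q (p1 u) \<oplus>\<^bsub>P (q + 1)\<^esub> x \<odot>\<^bsub>P (q + 1)\<^esub> p2 u) (\<ominus>\<^bsub>P (q + 2)\<^esub> d (q + 1) (p2 u))"

text \<open>The second entry has internal degree u - 1 because x raises the degree by one; hence
  both entries lie on the same diagonal q + u.\<close>

definition cone_family :: "(int \<Rightarrow> int \<Rightarrow> 'e set) \<Rightarrow> int \<Rightarrow> int \<Rightarrow> 'e set" where
  "cone_family S q u = {pr a b | a b. a \<in> S q u \<and> b \<in> S (q + 1) (u - 1)}"

lemma cone_family_iff [simp]: "pr a b \<in> cone_family S q u \<longleftrightarrow> a \<in> S q u \<and> b \<in> S (q + 1) (u - 1)"
  by (auto simp: cone_family_def)

lemma cone_family_cases: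
  assumes "w \<in> cone_family S q u"
  obtains a b where "w = pr a b" "a \<in> S q u" "b \<in> S (q + 1) (u - 1)"
  using assms by (auto simp: cone_family_def)

lemma cone_diff_pr [simp]: "cone_diff x P d q (pr a b) =
    pr (d q a \<oplus>\<^bsub>P (q + 1)\<^esub> x \<odot>\<^bsub>P (q + 1)\<^esub> b) (\<ominus>\<^bsub>P (q + 2)\<^esub> d (q + 1) b)"
  by (simp add: cone_diff_def)

lemma cone_zero_family: "cone_family (zero_family P) = zero_family (cone_module P)"
  by (intro ext) (auto simp: cone_family_def zero_family_def cone_module_def)

end

locale cone = pairing pr p1 p2 + graded_ring R
  for pr :: "'e \<Rightarrow> 'e \<Rightarrow> 'e" and p1 p2 and R :: "'r graded_ring" (structure) +
  fixes P :: "int \<Rightarrow> ('r, 'e) graded_module" and d :: "int \<Rightarrow> 'e \<Rightarrow> 'e" and x :: 'r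
  assumes cc: "cochain_complex R P d" and x: "x \<in> rpart R 1"
begin

lemma x_carrier: "x \<in> carrier R"
  using x RD.part_carrier by blast

sublocale Q: module R "P k" for k by (rule cochain_module[OF cc])

lemmas cs = cochain_simps[OF cc]

lemma cone_complex: "cochain_complex R (cone_module P) (cone_diff x P d)"
  unfolding cochain_complex_def
proof (intro conjI allI ballI)
  have xc: "x \<in> carrier R" by (rule x_carrier)
  fix q :: int
  have two [simp]: "2 + q = q + 2" by simp
  show "module R (cone_module P q)"
    unfolding cone_module_def by (intro pair_module cochain_module[OF cc])
  show "linear R (cone_module P q) (cone_module P (q + 1)) (cone_diff x P d q)"
    unfolding linear_def cone_module_def
    by (auto elim!: pair_module_cases simp: cs xc Q.smult_r_distr Q.M.a_ac Q.M.minus_add Q.smult_r_minus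
        Q.smult_assoc1[symmetric] m_comm)
  fix v assume "v \<in> carrier (cone_module P q)"
  then obtain a b where v: "v = pr a b" and a: "a \<in> carrier (P q)" and b: "b \<in> carrier (P (q + 1))"
    unfolding cone_module_def by (rule pair_module_cases)
  have *: "q + 2 + 1 = q + 3" "q + 1 + 2 = q + 3" "q + 1 + 1 = q + 2" by simp_all
  have "d (q + 2) (d (q + 1) b) = \<zero>\<^bsub>P (q + 3)\<^esub>"
    using cochain_dd[OF cc b] by (simp add: add.commute)
  moreover have "linear R (P (q + 2)) (P (q + 3)) (d (q + 2))"
    using cochain_linear[OF cc, of "q + 2"] by (simp only: *)
  ultimately have "d (q + 2) (\<ominus>\<^bsub>P (q + 2)\<^esub> d (q + 1) b) = \<zero>\<^bsub>P (q + 3)\<^esub>"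
    using linear_neg[OF Q.module_axioms Q.module_axioms, of "q + 2" "q + 3" "d (q + 2)" "d (q + 1) b"]
      linear_closed[OF cochain_linear2[OF cc]] b by simp
  moreover have "d (q + 1) (d q a \<oplus>\<^bsub>P (q + 1)\<^esub> x \<odot>\<^bsub>P (q + 1)\<^esub> b) \<oplus>\<^bsub>P (q + 2)\<^esub>
      x \<odot>\<^bsub>P (q + 2)\<^esub> (\<ominus>\<^bsub>P (q + 2)\<^esub> d (q + 1) b) = \<zero>\<^bsub>P (q + 2)\<^esub>"
    using a b by (simp add: cs xc Q.smult_r_minus Q.M.r_neg)
  ultimately show "cone_diff x P d (q + 1) (cone_diff x P d q v) = \<zero>\<^bsub>cone_module P (q + 2)\<^esub>"
    unfolding v cone_module_def cone_diff_pr * by simp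
qed

end

context cone
begin

lemma cone_neg: "a \<in> carrier (P q) \<Longrightarrow> b \<in> carrier (P (q + 1)) \<Longrightarrow>
    \<ominus>\<^bsub>cone_module P q\<^esub> pr a b = pr (\<ominus>\<^bsub>P q\<^esub> a) (\<ominus>\<^bsub>P (q + 1)\<^esub> b)"
  by (simp add: cone_module_def pair_module_neg[OF Q.module_axioms Q.module_axioms])

lemma cone_minus: "a \<in> carrier (P q) \<Longrightarrow> b \<in> carrier (P (q + 1)) \<Longrightarrow>
    a' \<in> carrier (P q) \<Longrightarrow> b' \<in> carrier (P (q + 1)) \<Longrightarrow>
    pr a b \<ominus>\<^bsub>cone_module P q\<^esub> pr a' b' = pr (a \<ominus>\<^bsub>P q\<^esub> a') (b \<ominus>\<^bsub>P (q + 1)\<^esub> b')"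
  by (simp add: cone_module_def pair_module_minus[OF Q.module_axioms Q.module_axioms])

lemma cone_diff_pr': "cone_diff x P d (q - 1) (pr a b) =
    pr (d (q - 1) a \<oplus>\<^bsub>P q\<^esub> x \<odot>\<^bsub>P q\<^esub> b) (\<ominus>\<^bsub>P (q + 1)\<^esub> d q b)"
  by (simp add: add.commute)

context
  fixes S assumes S: "subcomplex R P d S"
begin

lemma S_carrier: "a \<in> S q u \<Longrightarrow> a \<in> carrier (P q)"
  by (rule subcomplex_closed[OF cc S])

lemma S_x: "a \<in> S q u \<Longrightarrow> x \<odot>\<^bsub>P q\<^esub> a \<in> S q (u + 1)"
  using subcomplex_smult[OF cc S x] by simp

lemma S_x': "a \<in> S q (u - 1) \<Longrightarrow> x \<odot>\<^bsub>P q\<^esub> a \<in> S q u"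
  using S_x[of a q "u - 1"] by simp

lemma S_d: "a \<in> S q u \<Longrightarrow> d q a \<in> S (q + 1) u"
  by (rule subcomplex_d[OF cc S])

lemma S_d2: "a \<in> S (q + 1) u \<Longrightarrow> d (q + 1) a \<in> S (q + 2) u"
  using S_d[of a "q + 1"] by (simp add: add.commute)

lemma cone_subcomplex: "subcomplex R (cone_module P) (cone_diff x P d) (cone_family S)"
  unfolding subcomplex_def
proof (intro conjI allI impI)
  fix q u
  interpret K: module R "cone_module P q"
    by (rule cochain_module[OF cone_complex])
  show "additive_subgroup (cone_family S q u) (cone_module P q)"
  proof (rule K.additive_subgroupI')
    show "cone_family S q u \<subseteq> carrier (cone_module P q)"
      by (auto simp: cone_family_def cone_module_def S_carrier)
    show "\<zero>\<^bsub>cone_module P q\<^esub> \<in> cone_family S q u"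
      using subcomplex_zero[OF cc S] by (auto simp: cone_module_def)
  qed (auto elim!: cone_family_cases simp: cone_module_def subcomplex_add[OF cc S] subcomplex_neg[OF cc S]
     pair_module_neg[OF Q.module_axioms Q.module_axioms] S_carrier)
next
  fix q u i a w assume a: "a \<in> rpart R i" and "w \<in> cone_family S q u"
  then show "a \<odot>\<^bsub>cone_module P q\<^esub> w \<in> cone_family S q (u + int i)"
    using subcomplex_smult[OF cc S a, of _ q u]  subcomplex_smult[OF cc S a, of _ "q + 1" "u - 1"]
    by (auto elim!: cone_family_cases simp: cone_module_def algebra_simps)
next
  fix q u w assume "w \<in> cone_family S q u"
  then obtain a b where w: "w = pr a b" and a: "a \<in> S q u" and b: "b \<in> S (q + 1) (u - 1)"
    by (rule cone_family_cases)
  have *: "q + 1 + 1 = q + 2" by simp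
  show "cone_diff x P d q w \<in> cone_family S (q + 1) u"
    unfolding w cone_diff_pr cone_family_iff *
    using subcomplex_add[OF cc S S_d[OF a] S_x'[of b "q + 1" u]] subcomplex_neg[OF cc S S_d2[OF b]] b by simp
qed

lemma cone_torsion:
  assumes tors: "\<And>q u a. a \<in> S q u \<Longrightarrow> \<exists>k. y [^] (k::nat) \<odot>\<^bsub>P q\<^esub> a = \<zero>\<^bsub>P q\<^esub>"
    and y: "y \<in> carrier R" and w: "w \<in> cone_family S q u"
  shows "\<exists>k. y [^] (k::nat) \<odot>\<^bsub>cone_module P q\<^esub> w = \<zero>\<^bsub>cone_module P q\<^esub>"
proof -
  from w obtain a b where w: "w = pr a b" and a: "a \<in> S q u" and b: "b \<in> S (q + 1) (u - 1)"
    by (rule cone_family_cases)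
  from tors[OF a] obtain k where k: "y [^] (k::nat) \<odot>\<^bsub>P q\<^esub> a = \<zero>\<^bsub>P q\<^esub>" by blast
  from tors[OF b] obtain l where l: "y [^] (l::nat) \<odot>\<^bsub>P (q + 1)\<^esub> b = \<zero>\<^bsub>P (q + 1)\<^esub>" by blast
  have "y [^] (k + l) \<odot>\<^bsub>P q\<^esub> a = \<zero>\<^bsub>P q\<^esub>"
    using k y S_carrier[OF a] by (simp add: nat_pow_mult[symmetric] m_comm[of "y [^] k"] Q.smult_assoc1)
  moreover have "y [^] (k + l) \<odot>\<^bsub>P (q + 1)\<^esub> b = \<zero>\<^bsub>P (q + 1)\<^esub>"
    using l y S_carrier[OF b] by (simp add: nat_pow_mult[symmetric] Q.smult_assoc1)
  ultimately show ?thesis unfolding w by (intro exI[of _ "k + l"]) (simp add: cone_module_def)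
qed

text \<open>This is the piece H^q(P)_{u-1} -> H^q(P)_u -> H^q(cone)_u, whose first map is
  multiplication by x. It leads from a cone back to the complex at the cost of vanishing one
  internal degree lower.\<close>

lemma exact_at_cone_imp:
  assumes ex: "exact_at P d S q (u - 1)"
    and K: "exact_at (cone_module P) (cone_diff x P d) (cone_family S) q u"
  shows "exact_at P d S q u"
  unfolding exact_at_iff[OF cc S]
proof (intro ballI impI)
  fix a assume a: "a \<in> S q u" and da: "d q a = \<zero>\<^bsub>P (q + 1)\<^esub>"
  have "pr a \<zero>\<^bsub>P (q + 1)\<^esub> \<in> cone_family S q u"
    using a subcomplex_zero[OF cc S] by simp
  moreover have "cone_diff x P d q (pr a \<zero>\<^bsub>P (q + 1)\<^esub>) = \<zero>\<^bsub>cone_module P (q + 1)\<^esub>"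
    using da x_carrier by (simp add: cone_module_def cs add.commute[of q 2])
  ultimately obtain w where w: "w \<in> cone_family S (q - 1) u" "cone_diff x P d (q - 1) w = pr a \<zero>\<^bsub>P (q + 1)\<^esub>"
    using K unfolding exact_at_iff[OF cone_complex cone_subcomplex] by blast
  from w(1) obtain a' b' where w': "w = pr a' b'" and a': "a' \<in> S (q - 1) u" and b': "b' \<in> S q (u - 1)"
    by (auto simp: cone_family_def)
  from w(2) have e: "d (q - 1) a' \<oplus>\<^bsub>P q\<^esub> x \<odot>\<^bsub>P q\<^esub> b' = a" "\<ominus>\<^bsub>P (q + 1)\<^esub> d q b' = \<zero>\<^bsub>P (q + 1)\<^esub>"
    unfolding w' cone_diff_pr' by auto
  then have "d q b' = \<zero>\<^bsub>P (q + 1)\<^esub>"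
    using S_carrier[OF S_d[OF b']] by simp
  with ex b' obtain c where c: "c \<in> S (q - 1) (u - 1)" "d (q - 1) c = b'"
    unfolding exact_at_iff[OF cc S] by blast
  have "d (q - 1) (a' \<oplus>\<^bsub>P (q - 1)\<^esub> x \<odot>\<^bsub>P (q - 1)\<^esub> c) = a"
    using e c S_carrier[OF a'] S_carrier[OF c(1)] x_carrier by (simp add: cs)
  moreover have "a' \<oplus>\<^bsub>P (q - 1)\<^esub> x \<odot>\<^bsub>P (q - 1)\<^esub> c \<in> S (q - 1) u"
    using a' S_x'[OF c(1)] subcomplex_add[OF cc S] by blast
  ultimately show "\<exists>c\<in>S (q - 1) u. d (q - 1) c = a" by blast
qed

text \<open>By the piece H^{q-1}(cone)_{u+1} -> H^q(P)_u -> H^q(P)_{u+1}, vanishing for the cone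
  above D makes x injective on H^q(P) in all degrees u \<ge> D. Every class is killed by a power of
  x, so it vanishes. Injectivity in all higher degrees is needed because powers of x move a class
  upwards.\<close>

lemma exact_at_cone_torsion:
  assumes K: "\<And>u. u > D \<Longrightarrow> exact_at (cone_module P) (cone_diff x P d) (cone_family S) (q - 1) u"
    and tors: "\<And>u a. a \<in> S q u \<Longrightarrow> \<exists>k. x [^] (k::nat) \<odot>\<^bsub>P q\<^esub> a = \<zero>\<^bsub>P q\<^esub>"
    and u: "u \<ge> D"
  shows "exact_at P d S q u"
proof -
  have step: "\<exists>c\<in>S (q - 1) u. d (q - 1) c = z"
    if z: "z \<in> S q u" and dz: "d q z = \<zero>\<^bsub>P (q + 1)\<^esub>" and u: "u \<ge> D"
      and w: "w \<in> S (q - 1) (u + 1)" "d (q - 1) w = x \<odot>\<^bsub>P q\<^esub> z" for z w u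
  proof -
    \<comment> \<open>If xz = dw, the pair (-w, z) is a cocycle of the cone, as d(-w) + xz = 0. Any
      cochain (w', z') that it bounds has -dz' = z.\<close>
    let ?v = "pr (\<ominus>\<^bsub>P (q - 1)\<^esub> w) z"
    have zc: "z \<in> carrier (P q)" using S_carrier z by blast
    have "?v \<in> cone_family S (q - 1) (u + 1)"
      using z w subcomplex_neg[OF cc S] by simp
    moreover have "cone_diff x P d (q - 1) ?v = \<zero>\<^bsub>cone_module P (q - 1 + 1)\<^esub>"
      unfolding cone_diff_pr' using w dz zc S_carrier[OF w(1)] x_carrier
      by (simp add: cs cone_module_def Q.M.l_neg)
    ultimately obtain v' where v': "v' \<in> cone_family S (q - 1 - 1) (u + 1)" "cone_diff x P d (q - 1 - 1) v' = ?v"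
      using K[of "u + 1"] u unfolding exact_at_iff[OF cone_complex cone_subcomplex] by force
    from v'(1) obtain w' z' where e: "v' = pr w' z'" "z' \<in> S (q - 1) u"
      by (auto simp: cone_family_def)
    from v'(2) have "\<ominus>\<^bsub>P q\<^esub> d (q - 1) z' = z"
      unfolding e cone_diff_pr' by simp
    then have "d (q - 1) (\<ominus>\<^bsub>P (q - 1)\<^esub> z') = z" using S_carrier[OF e(2)] by (simp add: cs)
    then show ?thesis using subcomplex_neg[OF cc S e(2)] by blast
  qed
  have "\<exists>c\<in>S (q - 1) u. d (q - 1) c = z"
    if "z \<in> S q u" "d q z = \<zero>\<^bsub>P (q + 1)\<^esub>" "u \<ge> D" "x [^] (k::nat) \<odot>\<^bsub>P q\<^esub> z = \<zero>\<^bsub>P q\<^esub>" for k z u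
    using that
  \<comment> \<open>The degree u is generalised along with z: the induction hypothesis is applied to
    xz, which lives in degree u + 1.\<close>
  proof (induction k arbitrary: z u)
    case 0
    then have "z = \<zero>\<^bsub>P q\<^esub>" using S_carrier by auto
    then show ?case using subcomplex_zero[OF cc S] by (intro bexI[of _ "\<zero>\<^bsub>P (q - 1)\<^esub>"]) (auto simp: cs)
  next
    case (Suc k)
    have zc: "z \<in> carrier (P q)" using S_carrier Suc by blast
    have "x [^] k \<odot>\<^bsub>P q\<^esub> (x \<odot>\<^bsub>P q\<^esub> z) = \<zero>\<^bsub>P q\<^esub>"
      using Suc.prems(4) zc x_carrier by (simp add: Q.smult_assoc1)
    moreover have "d q (x \<odot>\<^bsub>P q\<^esub> z) = \<zero>\<^bsub>P (q + 1)\<^esub>" using Suc.prems zc x_carrier by (simp add: cs)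
    ultimately obtain w where "w \<in> S (q - 1) (u + 1)" "d (q - 1) w = x \<odot>\<^bsub>P q\<^esub> z"
      using Suc.IH[OF S_x[OF Suc.prems(1)]] Suc.prems by auto
    then show ?case using step Suc.prems by blast
  qed
  then show ?thesis unfolding exact_at_iff[OF cc S] using tors u by blast
qed

end

lemma cone_family_mono: "(\<And>q u. A q u \<subseteq> B q u) \<Longrightarrow> cone_family A q u \<subseteq> cone_family B q u"
  by (fastforce simp: cone_family_def)

context
  fixes A B assumes A: "subcomplex R P d A" and B: "subcomplex R P d B"
    and AB: "\<And>q u. A q u \<subseteq> B q u"
begin

text \<open>The cone of x on B/A is an extension of a shifted copy of B/A by B/A, which gives
  H^q(B/A)_u -> H^q(cone)_u -> H^{q+1}(B/A)_{u-1}. The case of zero A is the absolute statement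
  about cones.\<close>

lemma relatively_exact_cone:
  assumes 1: "relatively_exact P d A B q u" and 2: "relatively_exact P d A B (q + 1) (u - 1)"
  shows "relatively_exact (cone_module P) (cone_diff x P d) (cone_family A) (cone_family B) q u"
  unfolding relatively_exact_def
proof (intro ballI impI)
  fix w assume "w \<in> cone_family B q u" and dw: "cone_diff x P d q w \<in> cone_family A (q + 1) u"
  then obtain a b where w: "w = pr a b" and a: "a \<in> B q u" and b: "b \<in> B (q + 1) (u - 1)"
    by (auto elim: cone_family_cases)
  have *: "q + 1 + 1 = q + 2" "q - 1 + 1 = q" by simp_all
  from dw have e: "d q a \<oplus>\<^bsub>P (q + 1)\<^esub> x \<odot>\<^bsub>P (q + 1)\<^esub> b \<in> A (q + 1) u"
      "\<ominus>\<^bsub>P (q + 2)\<^esub> d (q + 1) b \<in> A (q + 2) (u - 1)"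
    unfolding w cone_diff_pr cone_family_iff * by auto
  note cl = S_carrier[OF B a] S_carrier[OF B b] x_carrier
  have "d (q + 1) b \<in> A (q + 1 + 1) (u - 1)"
    using subcomplex_neg[OF cc A e(2)] cl by (simp add: cs *)
  with 2 b obtain c where c: "c \<in> B q (u - 1)" "b \<ominus>\<^bsub>P (q + 1)\<^esub> d q c \<in> A (q + 1) (u - 1)"
    unfolding relatively_exact_def by fastforce
  note cl = cl S_carrier[OF B c(1)]
  have f: "x \<odot>\<^bsub>P (q + 1)\<^esub> (b \<ominus>\<^bsub>P (q + 1)\<^esub> d q c) \<in> A (q + 1) u"
    using S_x'[OF A c(2)] .
  \<comment> \<open>With b equal to dc modulo A, replacing a by a + xc turns the first entry into a
    cocycle modulo A.\<close>
  have "d q (a \<oplus>\<^bsub>P q\<^esub> x \<odot>\<^bsub>P q\<^esub> c) = (d q a \<oplus>\<^bsub>P (q + 1)\<^esub> x \<odot>\<^bsub>P (q + 1)\<^esub> b) \<ominus>\<^bsub>P (q + 1)\<^esub> x \<odot>\<^bsub>P (q + 1)\<^esub> (b \<ominus>\<^bsub>P (q + 1)\<^esub> d q c)"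
    using cl by (simp add: cs Q.smult_r_distr Q.smult_r_minus Q.M.group_simps)
  then have "d q (a \<oplus>\<^bsub>P q\<^esub> x \<odot>\<^bsub>P q\<^esub> c) \<in> A (q + 1) u"
    using subcomplex_minus[OF cc A e(1) f] by simp
  moreover have "a \<oplus>\<^bsub>P q\<^esub> x \<odot>\<^bsub>P q\<^esub> c \<in> B q u"
    using a S_x'[OF B c(1)] subcomplex_add[OF cc B] by blast
  ultimately obtain a' where a': "a' \<in> B (q - 1) u" "(a \<oplus>\<^bsub>P q\<^esub> x \<odot>\<^bsub>P q\<^esub> c) \<ominus>\<^bsub>P q\<^esub> d (q - 1) a' \<in> A q u"
    using 1 unfolding relatively_exact_def by blast
  note cl = cl S_carrier[OF B a'(1)]
  \<comment> \<open>The sign of c compensates the sign in the second entry of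
    \<open>cone_diff\<close>.\<close>
  let ?c = "pr a' (\<ominus>\<^bsub>P q\<^esub> c)"
  have "?c \<in> cone_family B (q - 1) u" using a' c subcomplex_neg[OF cc B] by simp
  moreover have "w \<ominus>\<^bsub>cone_module P q\<^esub> cone_diff x P d (q - 1) ?c =
      pr ((a \<oplus>\<^bsub>P q\<^esub> x \<odot>\<^bsub>P q\<^esub> c) \<ominus>\<^bsub>P q\<^esub> d (q - 1) a') (b \<ominus>\<^bsub>P (q + 1)\<^esub> d q c)"
    unfolding w cone_diff_pr' using cl
    by (subst cone_minus) (simp_all add: cs Q.smult_r_minus Q.M.group_simps)
  ultimately show "\<exists>c\<in>cone_family B (q - 1) u. w \<ominus>\<^bsub>cone_module P q\<^esub> cone_diff x P d (q - 1) c \<in> cone_family A q u"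
    using a' c by (intro bexI[of _ ?c]) (simp_all only: cone_family_iff simp_thms)
qed

text \<open>The cone of an isomorphism is acyclic. For a cocycle (a, b) modulo A, surjectivity
  writes a as xc modulo A; then x kills b + dc modulo A, so b + dc lies in A by injectivity, and (0,
  c) is the bounding cochain.\<close>

lemma relatively_exact_cone_bij:
  assumes inj: "\<And>q u b. b \<in> B q u \<Longrightarrow> x \<odot>\<^bsub>P q\<^esub> b \<in> A q (u + 1) \<Longrightarrow> b \<in> A q u"
    and surj: "\<And>q u b. b \<in> B q u \<Longrightarrow> \<exists>c\<in>B q (u - 1). b \<ominus>\<^bsub>P q\<^esub> x \<odot>\<^bsub>P q\<^esub> c \<in> A q u"
  shows "relatively_exact (cone_module P) (cone_diff x P d) (cone_family A) (cone_family B) q u"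
  unfolding relatively_exact_def
proof (intro ballI impI)
  fix w assume "w \<in> cone_family B q u" and dw: "cone_diff x P d q w \<in> cone_family A (q + 1) u"
  then obtain a b where w: "w = pr a b" and a: "a \<in> B q u" and b: "b \<in> B (q + 1) (u - 1)"
    by (auto elim: cone_family_cases)
  have *: "q + 1 + 1 = q + 2" "q - 1 + 1 = q" by simp_all
  from dw have e: "d q a \<oplus>\<^bsub>P (q + 1)\<^esub> x \<odot>\<^bsub>P (q + 1)\<^esub> b \<in> A (q + 1) u"
    unfolding w cone_diff_pr cone_family_iff * by auto
  from surj[OF a] obtain c where c: "c \<in> B q (u - 1)" "a \<ominus>\<^bsub>P q\<^esub> x \<odot>\<^bsub>P q\<^esub> c \<in> A q u" by blast
  note cl = S_carrier[OF B a] S_carrier[OF B b] x_carrier S_carrier[OF B c(1)]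
  have "x \<odot>\<^bsub>P (q + 1)\<^esub> (b \<oplus>\<^bsub>P (q + 1)\<^esub> d q c) =
      (d q a \<oplus>\<^bsub>P (q + 1)\<^esub> x \<odot>\<^bsub>P (q + 1)\<^esub> b) \<ominus>\<^bsub>P (q + 1)\<^esub> d q (a \<ominus>\<^bsub>P q\<^esub> x \<odot>\<^bsub>P q\<^esub> c)"
    using cl by (simp add: cs Q.smult_r_distr Q.smult_r_minus Q.M.group_simps)
  then have "x \<odot>\<^bsub>P (q + 1)\<^esub> (b \<oplus>\<^bsub>P (q + 1)\<^esub> d q c) \<in> A (q + 1) u"
    using subcomplex_minus[OF cc A e S_d[OF A c(2)]] by simp
  moreover have "b \<oplus>\<^bsub>P (q + 1)\<^esub> d q c \<in> B (q + 1) (u - 1)"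
    using b S_d[OF B c(1)] subcomplex_add[OF cc B] by blast
  ultimately have f: "b \<oplus>\<^bsub>P (q + 1)\<^esub> d q c \<in> A (q + 1) (u - 1)" using inj[of _ "q + 1" "u - 1"] by simp
  let ?c = "pr \<zero>\<^bsub>P (q - 1)\<^esub> c"
  have "?c \<in> cone_family B (q - 1) u" using c subcomplex_zero[OF cc B] by simp
  moreover have "w \<ominus>\<^bsub>cone_module P q\<^esub> cone_diff x P d (q - 1) ?c =
      pr (a \<ominus>\<^bsub>P q\<^esub> x \<odot>\<^bsub>P q\<^esub> c) (b \<oplus>\<^bsub>P (q + 1)\<^esub> d q c)"
    unfolding w cone_diff_pr' using cl
    by (subst cone_minus) (simp_all add: cs Q.smult_r_minus Q.M.group_simps)
  ultimately show "\<exists>c\<in>cone_family B (q - 1) u. w \<ominus>\<^bsub>cone_module P q\<^esub> cone_diff x P d (q - 1) c \<in> cone_family A q u"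
    using f c by (intro bexI[of _ ?c]) (simp_all only: cone_family_iff simp_thms)
qed

text \<open>Together with its companion for surjectivity, this keeps a generator bijective on B/A
  while the cones of other generators are taken before its own turn.\<close>

lemma cone_relatively_inj:
  assumes y: "y \<in> rpart R 1"
    and inj: "\<And>q u b. b \<in> B q u \<Longrightarrow> y \<odot>\<^bsub>P q\<^esub> b \<in> A q (u + 1) \<Longrightarrow> b \<in> A q u"
    and w: "w \<in> cone_family B q u" "y \<odot>\<^bsub>cone_module P q\<^esub> w \<in> cone_family A q (u + 1)"
  shows "w \<in> cone_family A q u"
proof -
  from w obtain a b where w': "w = pr a b" and a: "a \<in> B q u" and b: "b \<in> B (q + 1) (u - 1)"
    by (auto elim: cone_family_cases)
  show ?thesis using inj[OF a] inj[OF b] w(2) unfolding w' by (simp add: cone_module_def)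
qed

lemma cone_relatively_surj:
  assumes y: "y \<in> rpart R 1"
    and surj: "\<And>q u b. b \<in> B q u \<Longrightarrow> \<exists>c\<in>B q (u - 1). b \<ominus>\<^bsub>P q\<^esub> y \<odot>\<^bsub>P q\<^esub> c \<in> A q u"
    and w: "w \<in> cone_family B q u"
  shows "\<exists>c\<in>cone_family B q (u - 1). w \<ominus>\<^bsub>cone_module P q\<^esub> y \<odot>\<^bsub>cone_module P q\<^esub> c \<in> cone_family A q u"
proof -
  from w obtain a b where w': "w = pr a b" and a: "a \<in> B q u" and b: "b \<in> B (q + 1) (u - 1)"
    by (auto elim: cone_family_cases)
  obtain a' where a': "a' \<in> B q (u - 1)" "a \<ominus>\<^bsub>P q\<^esub> y \<odot>\<^bsub>P q\<^esub> a' \<in> A q u"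
    using surj[OF a] by blast
  obtain b' where b': "b' \<in> B (q + 1) (u - 1 - 1)" "b \<ominus>\<^bsub>P (q + 1)\<^esub> y \<odot>\<^bsub>P (q + 1)\<^esub> b' \<in> A (q + 1) (u - 1)"
    using surj[OF b] by blast
  have yc: "y \<in> carrier R" using y RD.part_carrier by blast
  show ?thesis
    by (rule bexI[of _ "pr a' b'"])
      (use a' b' yc S_carrier[OF B a] S_carrier[OF B b] S_carrier[OF B a'(1)] S_carrier[OF B b'(1)] in
        \<open>simp_all add: w' cone_module_def pair_module_minus[OF Q.module_axioms Q.module_axioms]\<close>)
qed

end

end

section \<open>Noetherian families and Koszul complexes\<close>

definition graded_family :: "'r graded_ring \<Rightarrow> ('r, 'e) graded_module \<Rightarrow> (int \<Rightarrow> 'e set) \<Rightarrow> bool" where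
  "graded_family R Q N \<longleftrightarrow> (\<forall>u. additive_subgroup (N u) Q) \<and>
     (\<forall>u i a y. a \<in> rpart R i \<longrightarrow> y \<in> N u \<longrightarrow> a \<odot>\<^bsub>Q\<^esub> y \<in> N (u + int i))"

text \<open>The ascending chain condition is stated for all homogeneous parts at once:
  \<open>k0\<close> is uniform in the degree u, and this uniformity is what later bounds
  cohomology.\<close>

definition noetherian_family :: "'r graded_ring \<Rightarrow> ('r, 'e) graded_module \<Rightarrow> (int \<Rightarrow> 'e set) \<Rightarrow> bool" where
  "noetherian_family R Q T \<longleftrightarrow>
     (\<forall>N. (\<forall>k. graded_family R Q (N k)) \<and> (\<forall>k u. N k u \<subseteq> T u) \<and> (\<forall>k u. N k u \<subseteq> N (Suc k) u) \<longrightarrow>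
        (\<exists>k0::nat. \<forall>k\<ge>k0. \<forall>u. N k u = N k0 u))"

lemma noetherian_familyD:
  assumes "noetherian_family R Q T" "\<And>k. graded_family R Q (N k)" "\<And>k u. N k u \<subseteq> T u" "\<And>k u. N k u \<subseteq> N (Suc k) u"
  obtains k0 :: nat where "\<And>k u. k \<ge> k0 \<Longrightarrow> N k u = N k0 u"
  using assms unfolding noetherian_family_def by metis

text \<open>The homotopy lowers the cohomological degree by one and raises the internal degree by
  one, as fits an element y of degree one. Its existence makes y act as zero on cohomology.\<close>

definition null_homotopic ::
    "'r graded_ring \<Rightarrow> (int \<Rightarrow> ('r, 'e) graded_module) \<Rightarrow> (int \<Rightarrow> 'e \<Rightarrow> 'e) \<Rightarrow> (int \<Rightarrow> int \<Rightarrow> 'e set) \<Rightarrow> 'r \<Rightarrow> bool" where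
  "null_homotopic R P d S y \<longleftrightarrow> (\<exists>h. (\<forall>q. linear R (P q) (P (q - 1)) (h q)) \<and>
     (\<forall>q u. \<forall>z\<in>S q u. h q z \<in> S (q - 1) (u + 1)) \<and>
     (\<forall>q. \<forall>z\<in>carrier (P q). d (q - 1) (h q z) \<oplus>\<^bsub>P q\<^esub> h (q + 1) (d q z) = y \<odot>\<^bsub>P q\<^esub> z))"

context cone
begin

text \<open>A cone is an extension of two copies of the complex, so a chain in it is controlled by
  its traces on the pairs (a, 0) and by its images in the second entry.\<close>

lemma cone_noetherian:
  assumes S: "subcomplex R P d S"
    and n1: "noetherian_family R (P q) (S q)" and n2: "noetherian_family R (P (q + 1)) (S (q + 1))"
  shows "noetherian_family R (cone_module P q) (cone_family S q)"
  unfolding noetherian_family_def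
proof (intro allI impI, elim conjE)
  fix N :: "nat \<Rightarrow> int \<Rightarrow> 'e set"
  assume g: "\<forall>k. graded_family R (cone_module P q) (N k)"
    and sub: "\<forall>k u. N k u \<subseteq> cone_family S q u" and up: "\<forall>k u. N k u \<subseteq> N (Suc k) u"
  interpret K: module R "cone_module P q" by (rule cochain_module[OF cone_complex])
  have add: "additive_subgroup (N k u) (cone_module P q)" for k u
    using g by (simp add: graded_family_def)
  have smult: "r \<odot>\<^bsub>cone_module P q\<^esub> y \<in> N k (u + int i)" if "r \<in> rpart R i" "y \<in> N k u" for r i y k u
    using g that by (simp add: graded_family_def)
  have Nadd: "v \<oplus>\<^bsub>cone_module P q\<^esub> w \<in> N k u" if "v \<in> N k u" "w \<in> N k u" for v w k u
    using add that additive_subgroup.a_closed by metis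
  have Nneg: "\<ominus>\<^bsub>cone_module P q\<^esub> v \<in> N k u" if "v \<in> N k u" for v k u
    using K.additive_subgroup_neg add that by metis
  have Nzero: "pr \<zero>\<^bsub>P q\<^esub> \<zero>\<^bsub>P (q + 1)\<^esub> \<in> N k u" for k u
    using add[of k u] additive_subgroup.zero_closed by (fastforce simp: cone_module_def)
  have Npr: "\<exists>a b. w = pr a b \<and> a \<in> S q u \<and> b \<in> S (q + 1) (u - 1)" if "w \<in> N k u" for w k u
    using sub that by (fastforce simp: cone_family_def)
  have prS: "a \<in> S q u \<and> b \<in> S (q + 1) (u - 1)" if "pr a b \<in> N k u" for a b k u
    using Npr[OF that] by auto
  note cl = S_carrier[OF S]
  define N1 where "N1 k u = {a. pr a \<zero>\<^bsub>P (q + 1)\<^esub> \<in> N k u}" for k u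
  \<comment> \<open>The shift to \<open>u + 1\<close> compensates the shift in
    \<open>cone_family\<close>: second entries of pairs of degree u + 1 have degree u.\<close>
  define N2 where "N2 k u = {b. \<exists>a. pr a b \<in> N k (u + 1)}" for k u
  have N1S: "N1 k u \<subseteq> S q u" for k u using prS by (auto simp: N1_def)
  have N2S: "N2 k u \<subseteq> S (q + 1) u" for k u using prS[of _ _ k "u + 1"] by (auto simp: N2_def)
  have g1: "graded_family R (P q) (N1 k)" for k
    unfolding graded_family_def
  proof (intro conjI allI impI)
    fix u
    show "additive_subgroup (N1 k u) (P q)"
    proof (rule Q.additive_subgroupI')
      show "N1 k u \<subseteq> carrier (P q)" using N1S cl by blast
      show "\<zero>\<^bsub>P q\<^esub> \<in> N1 k u" using Nzero by (simp add: N1_def)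
      show "a \<oplus>\<^bsub>P q\<^esub> b \<in> N1 k u" if "a \<in> N1 k u" "b \<in> N1 k u" for a b
        using Nadd[of "pr a \<zero>\<^bsub>P (q + 1)\<^esub>" k u "pr b \<zero>\<^bsub>P (q + 1)\<^esub>"] that by (simp add: N1_def cone_module_def)
      show "\<ominus>\<^bsub>P q\<^esub> a \<in> N1 k u" if "a \<in> N1 k u" for a
        using Nneg[of "pr a \<zero>\<^bsub>P (q + 1)\<^esub>" k u] that cl[of a q u] prS[of a "\<zero>\<^bsub>P (q + 1)\<^esub>" k u]
        by (auto simp: N1_def cone_neg Q.M.add.inv_one)
    qed
    fix i r y assume "r \<in> rpart R i" "y \<in> N1 k u"
    then show "r \<odot>\<^bsub>P q\<^esub> y \<in> N1 k (u + int i)"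
      using smult[of r i "pr y \<zero>\<^bsub>P (q + 1)\<^esub>" k u] RD.part_carrier[of r i] by (simp add: N1_def cone_module_def)
  qed
  have g2: "graded_family R (P (q + 1)) (N2 k)" for k
    unfolding graded_family_def
  proof (intro conjI allI impI)
    fix u
    show "additive_subgroup (N2 k u) (P (q + 1))"
    proof (rule Q.additive_subgroupI')
      show "N2 k u \<subseteq> carrier (P (q + 1))" using N2S cl by blast
      show "\<zero>\<^bsub>P (q + 1)\<^esub> \<in> N2 k u" using Nzero by (auto simp: N2_def)
      show "b \<oplus>\<^bsub>P (q + 1)\<^esub> b' \<in> N2 k u" if "b \<in> N2 k u" "b' \<in> N2 k u" for b b'
      proof -
        from that obtain a a' where "pr a b \<in> N k (u + 1)" "pr a' b' \<in> N k (u + 1)" by (auto simp: N2_def)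
        from Nadd[OF this] show ?thesis by (auto simp: N2_def cone_module_def)
      qed
      show "\<ominus>\<^bsub>P (q + 1)\<^esub> b \<in> N2 k u" if "b \<in> N2 k u" for b
      proof -
        from that obtain a where a: "pr a b \<in> N k (u + 1)" by (auto simp: N2_def)
        from Nneg[OF this] show ?thesis using prS[OF a] cl by (auto simp: N2_def cone_neg)
      qed
    qed
    fix i r y assume r: "r \<in> rpart R i" and "y \<in> N2 k u"
    then obtain a where "pr a y \<in> N k (u + 1)" by (auto simp: N2_def)
    from smult[OF r this] show "r \<odot>\<^bsub>P (q + 1)\<^esub> y \<in> N2 k (u + int i)"
      by (auto simp: N2_def cone_module_def algebra_simps)
  qed
  from n1 obtain k1 where k1: "\<And>k u. k \<ge> k1 \<Longrightarrow> N1 k u = N1 k1 u"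
  proof (rule noetherian_familyD[of _ _ _ N1])
    show "N1 k u \<subseteq> N1 (Suc k) u" for k u using up by (auto simp: N1_def)
  qed (use g1 N1S in auto)
  from n2 obtain k2 where k2: "\<And>k u. k \<ge> k2 \<Longrightarrow> N2 k u = N2 k2 u"
  proof (rule noetherian_familyD[of _ _ _ N2])
    show "N2 k u \<subseteq> N2 (Suc k) u" for k u using up by (fastforce simp: N2_def)
  qed (use g2 N2S in auto)
  let ?m = "max k1 k2"
  have mono: "N k u \<subseteq> N k' u" if "k \<le> k'" for k k' u
    by (rule lift_Suc_mono_le[of "\<lambda>k. N k u", OF _ that]) (rule up[rule_format])
  have "N k u \<subseteq> N ?m u" if k: "k \<ge> ?m" for k u
  proof
    fix w assume w: "w \<in> N k u"
    then obtain a b where wab: "w = pr a b" and a: "a \<in> S q u" and b: "b \<in> S (q + 1) (u - 1)" using Npr by blast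
    have "b \<in> N2 k (u - 1)" using w wab by (auto simp: N2_def)
    also have "N2 k (u - 1) = N2 ?m (u - 1)" using k2[of k] k2[of ?m] k by simp
    finally obtain a' where a': "pr a' b \<in> N ?m u" by (auto simp: N2_def)
    then have "pr a' b \<in> N k u" using mono[OF k] by blast
    \<comment> \<open>Subtracting a pair with the same second entry leaves (a - a', 0), to which
      stability of \<open>N1\<close> applies.\<close>
    then have "w \<oplus>\<^bsub>cone_module P q\<^esub> \<ominus>\<^bsub>cone_module P q\<^esub> pr a' b \<in> N k u" using w Nadd Nneg by blast
    then have "a \<oplus>\<^bsub>P q\<^esub> \<ominus>\<^bsub>P q\<^esub> a' \<in> N1 k u"
      using a b prS[OF a'] cl cone_minus[of a q b a' b]
      by (auto simp: N1_def wab a_minus_def Q.M.r_neg)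
    also have "N1 k u = N1 ?m u" using k1[of k] k1[of ?m] k by simp
    finally have "pr (a \<oplus>\<^bsub>P q\<^esub> \<ominus>\<^bsub>P q\<^esub> a') \<zero>\<^bsub>P (q + 1)\<^esub> \<in> N ?m u" by (simp add: N1_def)
    from Nadd[OF this a'] have "pr ((a \<oplus>\<^bsub>P q\<^esub> \<ominus>\<^bsub>P q\<^esub> a') \<oplus>\<^bsub>P q\<^esub> a') b \<in> N ?m u"
      using cl[OF b] by (simp add: cone_module_def)
    moreover have "(a \<oplus>\<^bsub>P q\<^esub> \<ominus>\<^bsub>P q\<^esub> a') \<oplus>\<^bsub>P q\<^esub> a' = a"
      using cl[OF a] cl[of a' q u] prS[OF a'] by (simp add: Q.M.a_assoc Q.M.l_neg)
    ultimately show "w \<in> N ?m u" using wab by simp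
  qed
  then show "\<exists>k0. \<forall>k\<ge>k0. \<forall>u. N k u = N k0 u" using mono by blast
qed

text \<open>If h is a homotopy on the complex, (h, -h) is one on the cone: by linearity of h, its
  two terms with x cancel.\<close>

lemma cone_null_homotopic:
  assumes S: "subcomplex R P d S" and y: "y \<in> rpart R 1" and h: "null_homotopic R P d S y"
  shows "null_homotopic R (cone_module P) (cone_diff x P d) (cone_family S) y"
proof -
  from h obtain h where lin: "\<And>q. linear R (P q) (P (q - 1)) (h q)"
    and hS: "\<And>q u z. z \<in> S q u \<Longrightarrow> h q z \<in> S (q - 1) (u + 1)"
    and hd: "\<And>q z. z \<in> carrier (P q) \<Longrightarrow> d (q - 1) (h q z) \<oplus>\<^bsub>P q\<^esub> h (q + 1) (d q z) = y \<odot>\<^bsub>P q\<^esub> z"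
    unfolding null_homotopic_def by metis
  have lin': "linear R (P (q + 1)) (P q) (h (q + 1))" for q using lin[of "q + 1"] by simp
  have lin'': "linear R (P (q + 2)) (P (q + 1)) (h (q + 2))" for q using lin[of "q + 2"] by (simp add: add.commute)
  note hs = linear_add[OF lin] linear_smult[OF lin] linear_neg[OF Q.module_axioms Q.module_axioms lin] linear_closed[OF lin]
    linear_add[OF lin'] linear_smult[OF lin'] linear_neg[OF Q.module_axioms Q.module_axioms lin'] linear_closed[OF lin']
    linear_add[OF lin''] linear_smult[OF lin''] linear_neg[OF Q.module_axioms Q.module_axioms lin''] linear_closed[OF lin'']
  have yc: "y \<in> carrier R" using y RD.part_carrier by blast
  define g where "g q w = pr (h q (p1 w)) (\<ominus>\<^bsub>P q\<^esub> h (q + 1) (p2 w))" for q w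
  have "linear R (cone_module P q) (cone_module P (q - 1)) (g q)" for q
    unfolding linear_def cone_module_def
    by (auto elim!: pair_module_cases simp: g_def hs Q.smult_r_minus Q.M.minus_add)
  moreover have "g q z \<in> cone_family S (q - 1) (u + 1)" if "z \<in> cone_family S q u" for q u z
  proof -
    from that obtain a b where "z = pr a b" "a \<in> S q u" "b \<in> S (q + 1) (u - 1)" by (rule cone_family_cases)
    then show ?thesis using hS[of a q u] hS[of b "q + 1" "u - 1"] subcomplex_neg[OF cc S] by (simp add: g_def)
  qed
  moreover have "cone_diff x P d (q - 1) (g q z) \<oplus>\<^bsub>cone_module P q\<^esub> g (q + 1) (cone_diff x P d q z) = y \<odot>\<^bsub>cone_module P q\<^esub> z"
    if z: "z \<in> carrier (cone_module P q)" for q z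
  proof -
    from z obtain a b where z: "z = pr a b" and a: "a \<in> carrier (P q)" and b: "b \<in> carrier (P (q + 1))"
      unfolding cone_module_def by (rule pair_module_cases)
    have *: "q + 1 + 1 = q + 2" by simp
    note cl = a b yc x_carrier
    have 1: "(d (q - 1) (h q a) \<oplus>\<^bsub>P q\<^esub> x \<odot>\<^bsub>P q\<^esub> \<ominus>\<^bsub>P q\<^esub> h (q + 1) b) \<oplus>\<^bsub>P q\<^esub>
        h (q + 1) (d q a \<oplus>\<^bsub>P (q + 1)\<^esub> x \<odot>\<^bsub>P (q + 1)\<^esub> b) = y \<odot>\<^bsub>P q\<^esub> a"
      unfolding hd[OF a, symmetric] using cl
      by (simp add: cs hs Q.smult_r_minus Q.M.group_simps)
    have "d q (h (q + 1) b) \<oplus>\<^bsub>P (q + 1)\<^esub> h (q + 2) (d (q + 1) b) = y \<odot>\<^bsub>P (q + 1)\<^esub> b"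
      using hd[OF b] unfolding * by simp
    then have 2: "\<ominus>\<^bsub>P (q + 1)\<^esub> d q (\<ominus>\<^bsub>P q\<^esub> h (q + 1) b) \<oplus>\<^bsub>P (q + 1)\<^esub>
        \<ominus>\<^bsub>P (q + 1)\<^esub> h (q + 2) (\<ominus>\<^bsub>P (q + 2)\<^esub> d (q + 1) b) = y \<odot>\<^bsub>P (q + 1)\<^esub> b"
      using cl by (simp add: cs hs add.commute[of 1 q])
    show ?thesis unfolding z g_def p1 p2 cone_diff_pr' cone_diff_pr * using 1 2
      by (simp add: cone_module_def add.commute[of 1 q])
  qed
  ultimately show ?thesis unfolding null_homotopic_def by blast
qed

text \<open>The homotopy is (a, b) -> (0, a), which moves an element into the copy on which the
  differential of the cone is multiplication by x.\<close>

lemma cone_self_null_homotopic: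
  assumes S: "subcomplex R P d S"
  shows "null_homotopic R (cone_module P) (cone_diff x P d) (cone_family S) x"
proof -
  define g where "g q w = pr \<zero>\<^bsub>P (q - 1)\<^esub> (p1 w)" for q w
  have "linear R (cone_module P q) (cone_module P (q - 1)) (g q)" for q
    unfolding linear_def cone_module_def
    by (auto elim!: pair_module_cases simp: g_def)
  moreover have "g q z \<in> cone_family S (q - 1) (u + 1)" if "z \<in> cone_family S q u" for q u z
    using that subcomplex_zero[OF cc S] by (auto elim!: cone_family_cases simp: g_def)
  moreover have "cone_diff x P d (q - 1) (g q z) \<oplus>\<^bsub>cone_module P q\<^esub> g (q + 1) (cone_diff x P d q z) = x \<odot>\<^bsub>cone_module P q\<^esub> z"
    if z: "z \<in> carrier (cone_module P q)" for q z
  proof -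
    from z obtain a b where z: "z = pr a b" and a: "a \<in> carrier (P q)" and b: "b \<in> carrier (P (q + 1))"
      unfolding cone_module_def by (rule pair_module_cases)
    have *: "q + 1 - 1 = q" by simp
    have "\<ominus>\<^bsub>P (q + 1)\<^esub> d q a \<oplus>\<^bsub>P (q + 1)\<^esub> (d q a \<oplus>\<^bsub>P (q + 1)\<^esub> x \<odot>\<^bsub>P (q + 1)\<^esub> b) = x \<odot>\<^bsub>P (q + 1)\<^esub> b"
      using a b x_carrier by (simp add: cs Q.M.r_neg1)
    then show ?thesis unfolding z g_def p1 p2 cone_diff_pr' cone_diff_pr * using a b x_carrier
      by (simp add: cone_module_def cs add.commute[of 1 q])
  qed
  ultimately show ?thesis unfolding null_homotopic_def by blast
qed

end

text \<open>The second clause says that R_{k+1} is the sum of the x_l R_k over l < n, in the form of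
  an induction principle for additive subgroups; this avoids writing elements as sums of products.
  The degree of \<open>x l\<close> is prescribed for all l, so that no index bound has to be carried
  around.\<close>

definition ring_generators :: "'r graded_ring \<Rightarrow> nat \<Rightarrow> (nat \<Rightarrow> 'r) \<Rightarrow> bool" where
  "ring_generators R n x \<longleftrightarrow> (\<forall>l. x l \<in> rpart R 1) \<and>
     (\<forall>k H. additive_subgroup H R \<and> (\<forall>l<n. \<forall>b\<in>rpart R k. x l \<otimes>\<^bsub>R\<^esub> b \<in> H) \<longrightarrow> rpart R (Suc k) \<subseteq> H)"

lemma null_homotopic_boundary:
  assumes "cochain_complex R P d" "subcomplex R P d S" "null_homotopic R P d S y" "z \<in> S q u" "d q z = \<zero>\<^bsub>P (q + 1)\<^esub>"
  shows "\<exists>c\<in>S (q - 1) (u + 1). d (q - 1) c = y \<odot>\<^bsub>P q\<^esub> z"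
proof -
  from assms(3) obtain h where lin: "\<And>q. linear R (P q) (P (q - 1)) (h q)"
    and hS: "\<And>q u z. z \<in> S q u \<Longrightarrow> h q z \<in> S (q - 1) (u + 1)"
    and hd: "\<And>q z. z \<in> carrier (P q) \<Longrightarrow> d (q - 1) (h q z) \<oplus>\<^bsub>P q\<^esub> h (q + 1) (d q z) = y \<odot>\<^bsub>P q\<^esub> z"
    unfolding null_homotopic_def by metis
  interpret Q: module R "P k" for k by (rule cochain_module[OF assms(1)])
  have "linear R (P (q + 1)) (P q) (h (q + 1))" using lin[of "q + 1"] by simp
  from linear_zero[OF Q.module_axioms Q.module_axioms this]
  have "h (q + 1) (d q z) = \<zero>\<^bsub>P q\<^esub>" using assms(5) by simp
  moreover have "h q z \<in> S (q - 1) (u + 1)" using hS assms(4) by blast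
  moreover from this have "d (q - 1) (h q z) \<in> carrier (P q)"
    using subcomplex_closed[OF assms(1,2)] subcomplex_d'[OF assms(1,2)] by blast
  ultimately show ?thesis using hd[of z q] subcomplex_closed[OF assms(1,2,4)] by (intro bexI[of _ "h q z"]) auto
qed

text \<open>The generators act as zero on the cohomology Z/Y, so R_+ carries Z into Y. Therefore the
  family equal to Z up to degree k and to Y above it is again stable under R. These families ascend
  with k, and in the degrees beyond the point where they stop growing Z and Y agree.\<close>

lemma noetherian_exact_at_large:
  fixes R (structure)
  assumes "graded_ring R" and cc: "cochain_complex R P d" and S: "subcomplex R P d S"
    and gen: "ring_generators R n x" and hom: "\<And>l. l < n \<Longrightarrow> null_homotopic R P d S (x l)"
    and noeth: "noetherian_family R (P q) (S q)"
  shows "\<exists>D. \<forall>u>D. exact_at P d S q u"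
proof -
  interpret graded_ring R by fact
  interpret Q: module R "P k" for k by (rule cochain_module[OF cc])
  note cs = cochain_simps[OF cc]
  note cl = subcomplex_closed[OF cc S]
  define Z where "Z u = {z \<in> S q u. d q z = \<zero>\<^bsub>P (q + 1)\<^esub>}" for u
  define Y where "Y u = d (q - 1) ` S (q - 1) u" for u
  have YZ: "Y u \<subseteq> Z u" for u using subcomplex_d'[OF cc S] cl by (auto simp: Y_def Z_def cs)
  have Zsub: "additive_subgroup (Z u) (P q)" for u
    by (rule Q.additive_subgroupI')
      (auto simp: Z_def cl subcomplex_zero[OF cc S] subcomplex_add[OF cc S] subcomplex_neg[OF cc S] cs)
  have Ysub: "additive_subgroup (Y u) (P q)" for u
  proof (rule Q.additive_subgroupI')
    show "Y u \<subseteq> carrier (P q)" using YZ[of u] cl[of _ q u] by (auto simp: Z_def)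
    have "d (q - 1) \<zero>\<^bsub>P (q - 1)\<^esub> \<in> Y u" unfolding Y_def using subcomplex_zero[OF cc S] by blast
    then show "\<zero>\<^bsub>P q\<^esub> \<in> Y u" by (simp add: cs)
  next
    fix v w assume "v \<in> Y u" "w \<in> Y u"
    then obtain a b where "a \<in> S (q - 1) u" "b \<in> S (q - 1) u" "v = d (q - 1) a" "w = d (q - 1) b" by (auto simp: Y_def)
    then show "v \<oplus>\<^bsub>P q\<^esub> w \<in> Y u" unfolding Y_def
      by (intro image_eqI[of _ _ "a \<oplus>\<^bsub>P (q - 1)\<^esub> b"]) (auto simp: cs cl subcomplex_add[OF cc S])
  next
    fix v assume "v \<in> Y u"
    then obtain a where "a \<in> S (q - 1) u" "v = d (q - 1) a" by (auto simp: Y_def)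
    then show "\<ominus>\<^bsub>P q\<^esub> v \<in> Y u" unfolding Y_def
      by (intro image_eqI[of _ _ "\<ominus>\<^bsub>P (q - 1)\<^esub> a"]) (auto simp: cs cl subcomplex_neg[OF cc S])
  qed
  have Zsm: "a \<odot>\<^bsub>P q\<^esub> z \<in> Z (u + int i)" if "a \<in> rpart R i" "z \<in> Z u" for a z i u
    using that RD.part_carrier[of a i] cl by (auto simp: Z_def cs subcomplex_smult[OF cc S])
  have Ysm: "a \<odot>\<^bsub>P q\<^esub> z \<in> Y (u + int i)" if a: "a \<in> rpart R i" and "z \<in> Y u" for a z i u
  proof -
    from that(2) obtain b where b: "b \<in> S (q - 1) u" "z = d (q - 1) b" by (auto simp: Y_def)
    then show ?thesis unfolding Y_def
      by (intro image_eqI[of _ _ "a \<odot>\<^bsub>P (q - 1)\<^esub> b"])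
        (auto simp: cs cl[OF b(1)] RD.part_carrier[OF a] subcomplex_smult[OF cc S a])
  qed
  have xZ: "x l \<odot>\<^bsub>P q\<^esub> z \<in> Y (u + 1)" if l: "l < n" and z: "z \<in> Z u" for l z u
  proof -
    obtain c where "c \<in> S (q - 1) (u + 1)" "d (q - 1) c = x l \<odot>\<^bsub>P q\<^esub> z"
      using null_homotopic_boundary[OF cc S hom[OF l], of z q u] z by (auto simp: Z_def)
    then show ?thesis unfolding Y_def by (intro image_eqI[of _ _ c]) simp_all
  qed
  have xc: "x l \<in> carrier R" for l using gen RD.part_carrier unfolding ring_generators_def by blast
  \<comment> \<open>R_{k+1} is generated by products x_l b, and x_l z already is a boundary.\<close>
  have pos: "a \<odot>\<^bsub>P q\<^esub> z \<in> Y (u + int (Suc k))" if a: "a \<in> rpart R (Suc k)" and z: "z \<in> Z u" for a z k u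
  proof -
    have zc: "z \<in> carrier (P q)" using z cl by (auto simp: Z_def)
    let ?H = "{a \<in> carrier R. a \<odot>\<^bsub>P q\<^esub> z \<in> Y (u + int (Suc k))}"
    have "additive_subgroup ?H R"
      by (rule additive_subgroupI')
        (use zc Ysub[of "u + int (Suc k)"] Q.additive_subgroup_neg in
          \<open>auto simp: Q.smult_l_distr Q.smult_l_minus additive_subgroup.zero_closed additive_subgroup.a_closed\<close>)
    moreover have "x l \<otimes> b \<in> ?H" if l: "l < n" and b: "b \<in> rpart R k" for l b
    proof -
      have "b \<odot>\<^bsub>P q\<^esub> (x l \<odot>\<^bsub>P q\<^esub> z) \<in> Y (u + 1 + int k)" using Ysm[OF b xZ[OF l z]] .
      then show ?thesis using xc[of l] RD.part_carrier[OF b] zc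
        by (simp add: Q.smult_assoc1[symmetric] m_comm algebra_simps)
    qed
    ultimately have "rpart R (Suc k) \<subseteq> ?H" using gen unfolding ring_generators_def by blast
    then show ?thesis using a by blast
  qed
  define N where "N k u = (if u \<le> int k then Z u else Y u)" for k u
  from noeth obtain k0 where k0: "\<And>k u. k \<ge> k0 \<Longrightarrow> N k u = N k0 u"
  proof (rule noetherian_familyD[of _ _ _ N])
    fix k
    show "graded_family R (P q) (N k)"
      unfolding graded_family_def
    proof (intro conjI allI impI)
      show "additive_subgroup (N k u) (P q)" for u using Zsub Ysub by (simp add: N_def)
      fix u i a y assume a: "a \<in> rpart R i" and y: "y \<in> N k u"
      show "a \<odot>\<^bsub>P q\<^esub> y \<in> N k (u + int i)"
      proof (cases i)
        case 0
        then show ?thesis using Zsm[OF a, of y u] Ysm[OF a, of y u] y by (simp add: N_def split: if_splits)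
      next
        case (Suc j)
        have "y \<in> Z u" using y YZ by (auto simp: N_def split: if_splits)
        with pos[of a j y u] a Suc have "a \<odot>\<^bsub>P q\<^esub> y \<in> Y (u + int i)" by simp
        then show ?thesis using YZ by (auto simp: N_def)
      qed
    qed
    show "N k u \<subseteq> S q u" for u using YZ by (fastforce simp: N_def Z_def split: if_splits)
    show "N k u \<subseteq> N (Suc k) u" for u using YZ by (auto simp: N_def)
  qed auto
  have "exact_at P d S q u" if "u > int k0" for u
  proof -
    \<comment> \<open>At an index at least u the family is Z in degree u, while at the index
      \<open>k0\<close>, which is below u, it is Y.\<close>
    have "N (max k0 (nat u)) u = N k0 u" by (rule k0) simp
    then have "Z u = Y u" using that by (auto simp: N_def split: if_splits)
    moreover have "b \<in> Z u" if "b \<in> S q u" "d q b = \<zero>\<^bsub>P (q + 1)\<^esub>" for b using that by (simp add: Z_def)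
    ultimately have *: "b \<in> Y u" if "b \<in> S q u" "d q b = \<zero>\<^bsub>P (q + 1)\<^esub>" for b using that by simp
    show ?thesis unfolding exact_at_iff[OF cc S]
    proof (intro ballI impI)
      fix b assume "b \<in> S q u" "d q b = \<zero>\<^bsub>P (q + 1)\<^esub>"
      from *[OF this] obtain c where "c \<in> S (q - 1) u" "b = d (q - 1) c" unfolding Y_def by (rule imageE)
      then show "\<exists>c\<in>S (q - 1) u. d (q - 1) c = b" by (intro bexI[of _ c]) simp_all
    qed
  qed
  then show ?thesis by blast
qed

section \<open>Iterated cones: Koszul complexes\<close>

context pairing
begin

primrec koszul ::
    "(nat \<Rightarrow> 'r) \<Rightarrow> (int \<Rightarrow> ('r, 'e) graded_module) \<Rightarrow> (int \<Rightarrow> 'e \<Rightarrow> 'e) \<Rightarrow> nat \<Rightarrow>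
     (int \<Rightarrow> ('r, 'e) graded_module) \<times> (int \<Rightarrow> 'e \<Rightarrow> 'e)" where
  "koszul x P d 0 = (P, d)"
| "koszul x P d (Suc j) = (cone_module (fst (koszul x P d j)),
     cone_diff (x j) (fst (koszul x P d j)) (snd (koszul x P d j)))"

end

locale koszul_complex = pairing pr p1 p2 + graded_ring R
  for pr :: "'e \<Rightarrow> 'e \<Rightarrow> 'e" and p1 p2 and R :: "'r graded_ring" (structure) +
  fixes P :: "int \<Rightarrow> ('r, 'e) graded_module" and d :: "int \<Rightarrow> 'e \<Rightarrow> 'e" and x :: "nat \<Rightarrow> 'r"
  assumes complex: "cochain_complex R P d" and x_part: "x l \<in> rpart R 1"
begin

abbreviation "KP j \<equiv> fst (koszul x P d j)"
abbreviation "KD j \<equiv> snd (koszul x P d j)"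
abbreviation "KF S j \<equiv> (cone_family ^^ j) S"

lemma koszul_cochain_complex: "cochain_complex R (KP j) (KD j)"
proof (induction j)
  case (Suc j)
  interpret cone pr p1 p2 R "KP j" "KD j" "x j"
    by unfold_locales (use Suc x_part in auto)
  show ?case using cone_complex by simp
qed (simp add: complex)

sublocale K: cone pr p1 p2 R "KP j" "KD j" "x j" for j
  by unfold_locales (use koszul_cochain_complex x_part in auto)

lemma koszul_subcomplex: "subcomplex R P d S \<Longrightarrow> subcomplex R (KP j) (KD j) (KF S j)"
  by (induction j) (auto simp: K.cone_subcomplex)

lemma koszul_mono: "(\<And>q u. A q u \<subseteq> B q u) \<Longrightarrow> KF A j q u \<subseteq> KF B j q u"
proof (induction j arbitrary: q u)
  case (Suc j)
  then show ?case using K.cone_family_mono[of "KF A j" "KF B j" q u] by auto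
qed auto

lemma koszul_zero_family: "KF (zero_family P) j = zero_family (KP j)"
  by (induction j) (auto simp: cone_zero_family)

lemma koszul_relatively_exact_step:
  assumes "subcomplex R P d A" "subcomplex R P d B" "\<And>q u. A q u \<subseteq> B q u"
    and "relatively_exact (KP j) (KD j) (KF A j) (KF B j) q u"
    and "relatively_exact (KP j) (KD j) (KF A j) (KF B j) (q + 1) (u - 1)"
  shows "relatively_exact (KP (Suc j)) (KD (Suc j)) (KF A (Suc j)) (KF B (Suc j)) q u"
  using K.relatively_exact_cone[OF koszul_subcomplex koszul_subcomplex koszul_mono, of A B j q u] assms by auto

lemma koszul_exact_step:
  assumes "subcomplex R P d S"
    and "exact_at (KP j) (KD j) (KF S j) q u" and "exact_at (KP j) (KD j) (KF S j) (q + 1) (u - 1)"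
  shows "exact_at (KP (Suc j)) (KD (Suc j)) (KF S (Suc j)) q u"
  using koszul_relatively_exact_step[OF zero_family_subcomplex[OF complex graded_ring] assms(1) zero_family_subset[OF complex assms(1)], of j q u]
    assms(2,3) unfolding koszul_zero_family by blast

lemma koszul_relatively_exact:
  assumes "subcomplex R P d A" "subcomplex R P d B" "\<And>q u. A q u \<subseteq> B q u"
    and "\<And>q u. relatively_exact (KP i) (KD i) (KF A i) (KF B i) q u" and "i \<le> j"
  shows "relatively_exact (KP j) (KD j) (KF A j) (KF B j) q u"
  using assms(5)
proof (induction j arbitrary: q u rule: dec_induct)
  case (step j)
  then show ?case using koszul_relatively_exact_step[OF assms(1-3)] by blast
qed (use assms in auto)

text \<open>Bijectivity of x_i on B/A survives the cones of x_0, ..., x_{i-1}; the cone of x_i then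
  makes the quotient complex acyclic, and the later cones keep it acyclic.\<close>

lemma koszul_relatively_exact_bij:
  assumes A: "subcomplex R P d A" and B: "subcomplex R P d B" and AB: "\<And>q u. A q u \<subseteq> B q u"
    and inj: "\<And>q u b. b \<in> B q u \<Longrightarrow> x i \<odot>\<^bsub>P q\<^esub> b \<in> A q (u + 1) \<Longrightarrow> b \<in> A q u"
    and surj: "\<And>q u b. b \<in> B q u \<Longrightarrow> \<exists>c\<in>B q (u - 1). b \<ominus>\<^bsub>P q\<^esub> x i \<odot>\<^bsub>P q\<^esub> c \<in> A q u"
    and "i < n"
  shows "relatively_exact (KP n) (KD n) (KF A n) (KF B n) q u"
proof -
  have "(\<forall>q u. \<forall>b\<in>KF B j q u. x i \<odot>\<^bsub>KP j q\<^esub> b \<in> KF A j q (u + 1) \<longrightarrow> b \<in> KF A j q u) \<and>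
    (\<forall>q u. \<forall>b\<in>KF B j q u. \<exists>c\<in>KF B j q (u - 1). b \<ominus>\<^bsub>KP j q\<^esub> x i \<odot>\<^bsub>KP j q\<^esub> c \<in> KF A j q u)" for j
  proof (induction j)
    case 0
    then show ?case using inj surj by simp
  next
    case (Suc j)
    note c = koszul_subcomplex[OF A, of j] koszul_subcomplex[OF B, of j] koszul_mono[OF AB, of j] x_part[of i]
    show ?case
      using K.cone_relatively_inj[OF c] K.cone_relatively_surj[OF c] Suc by simp
  qed
  then have "relatively_exact (cone_module (KP i)) (cone_diff (x i) (KP i) (KD i)) (cone_family (KF A i)) (cone_family (KF B i)) q u" for q u
    by (intro K.relatively_exact_cone_bij koszul_subcomplex[OF A] koszul_subcomplex[OF B] koszul_mono[OF AB]) blast+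
  then have "relatively_exact (KP (Suc i)) (KD (Suc i)) (KF A (Suc i)) (KF B (Suc i)) q u" for q u by simp
  then show ?thesis using koszul_relatively_exact[OF A B AB] \<open>i < n\<close> by (meson Suc_leI)
qed

lemma koszul_torsion:
  assumes S: "subcomplex R P d S" and y: "y \<in> carrier R"
    and tors: "\<And>q u a. a \<in> S q u \<Longrightarrow> \<exists>k. y [^] (k::nat) \<odot>\<^bsub>P q\<^esub> a = \<zero>\<^bsub>P q\<^esub>"
  shows "a \<in> KF S j q u \<Longrightarrow> \<exists>k. y [^] (k::nat) \<odot>\<^bsub>KP j q\<^esub> a = \<zero>\<^bsub>KP j q\<^esub>"
proof (induction j arbitrary: q u a)
  case 0
  then show ?case using tors by auto
next
  case (Suc j)
  show ?case using K.cone_torsion[OF koszul_subcomplex[OF S, of j] _ y, of a q u] Suc by simp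
qed

lemma koszul_noetherian:
  assumes S: "subcomplex R P d S" and "\<And>q. noetherian_family R (P q) (S q)"
  shows "noetherian_family R (KP j q) (KF S j q)"
proof (induction j arbitrary: q)
  case 0
  then show ?case using assms by simp
next
  case (Suc j)
  show ?case using K.cone_noetherian[OF koszul_subcomplex[OF S] Suc Suc] by simp
qed

lemma koszul_null_homotopic:
  assumes S: "subcomplex R P d S" and "l < j"
  shows "null_homotopic R (KP j) (KD j) (KF S j) (x l)"
  using \<open>l < j\<close>
proof (induction j)
  case (Suc j)
  show ?case
  proof (cases "l = j")
    case True
    then show ?thesis using K.cone_self_null_homotopic[OF koszul_subcomplex[OF S]] by simp
  next
    case False
    then show ?thesis using K.cone_null_homotopic[OF koszul_subcomplex[OF S] x_part] Suc by simp
  qed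
qed simp

lemma koszul_trivial_above:
  assumes "\<And>q u. q > 0 \<Longrightarrow> S q u = {\<zero>\<^bsub>P q\<^esub>}" and "q > 0"
  shows "KF S j q u = {\<zero>\<^bsub>KP j q\<^esub>}"
  using assms(2)
proof (induction j arbitrary: q u)
  case (Suc j)
  then show ?case by (auto simp: cone_family_def cone_module_def)
qed (use assms in auto)

text \<open>Each cone reaches one cohomological degree further down, which accounts for the summand
  j.\<close>

lemma koszul_trivial_below:
  assumes "\<And>q u. q < 0 \<Longrightarrow> S q u = {\<zero>\<^bsub>P q\<^esub>}" and "q + int j < 0"
  shows "KF S j q u = {\<zero>\<^bsub>KP j q\<^esub>}"
  using assms(2)
proof (induction j arbitrary: q u)
  case (Suc j)
  then show ?case by (auto simp: cone_family_def cone_module_def)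
qed (use assms in auto)

lemma exact_at_trivial:
  assumes "subcomplex R P d S" and "KF S j q u = {\<zero>\<^bsub>KP j q\<^esub>}"
  shows "exact_at (KP j) (KD j) (KF S j) q u"
  unfolding exact_at_iff[OF koszul_cochain_complex koszul_subcomplex[OF assms(1)]] assms(2)
  using subcomplex_zero[OF koszul_cochain_complex koszul_subcomplex[OF assms(1)], of j "q - 1" u]
  by (intro ballI impI bexI[of _ "\<zero>\<^bsub>KP j (q - 1)\<^esub>"]) (auto simp: K.cs)

lemma koszul_exact_above:
  assumes S: "subcomplex R P d S" and ex: "\<And>q u. u \<ge> t - q \<Longrightarrow> exact_at P d S q u"
  shows "u \<ge> t - q \<Longrightarrow> exact_at (KP j) (KD j) (KF S j) q u"
proof (induction j arbitrary: q u)
  case (Suc j)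
  then show ?case using koszul_exact_step[OF S, of j q u] by simp
qed (use ex in auto)

text \<open>A cone at (q, u) involves only the places (q, u) and (q + 1, u - 1), so a single
  diagonal can be treated by itself.\<close>

lemma koszul_exact_diagonal:
  assumes S: "subcomplex R P d S" and ex: "\<And>q. exact_at P d S q (t - q + 1)"
  shows "exact_at (KP j) (KD j) (KF S j) q (t - q + 1)"
proof (induction j arbitrary: q)
  case (Suc j)
  then show ?case using koszul_exact_step[OF S Suc[of q]] Suc[of "q + 1"] by (simp add: algebra_simps)
qed (use ex in auto)

text \<open>The cones are removed one after the other, from n down to j. Removing one at (q, t - q +
  2) costs exactness one internal degree lower, which lies on the preceding diagonal and is known
  there for every intermediate Koszul complex.\<close>

lemma exact_diagonal_from_koszul:
  assumes S: "subcomplex R P d S" and ex: "\<And>q. exact_at P d S q (t - q + 1)"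
    and top: "exact_at (KP n) (KD n) (KF S n) q (t - q + 2)" and "j \<le> n"
  shows "exact_at (KP j) (KD j) (KF S j) q (t - q + 2)"
  using \<open>j \<le> n\<close>
proof (induction j rule: inc_induct)
  case base
  then show ?case using top by simp
next
  case (step j)
  show ?case
    using K.exact_at_cone_imp[OF koszul_subcomplex[OF S], of j q "t - q + 2"]
      koszul_exact_diagonal[OF S ex, of j q] step.IH by (simp add: algebra_simps)
qed

text \<open>Removing a cone by torsion raises the cohomological degree by one, so the full Koszul
  complex has to be controlled in degree q - n in order to reach degree q of the complex
  itself.\<close>

lemma exact_from_koszul_torsion:
  assumes S: "subcomplex R P d S"
    and tors: "\<And>q u a l. a \<in> S q u \<Longrightarrow> l < n \<Longrightarrow> \<exists>k. x l [^] (k::nat) \<odot>\<^bsub>P q\<^esub> a = \<zero>\<^bsub>P q\<^esub>"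
    and top: "\<And>u. u > D \<Longrightarrow> exact_at (KP n) (KD n) (KF S n) (q - int n) u" and "j \<le> n"
  shows "u > D \<Longrightarrow> exact_at (KP j) (KD j) (KF S j) (q - int j) u"
  using \<open>j \<le> n\<close>
proof (induction j arbitrary: u rule: inc_induct)
  case base
  then show ?case using top by simp
next
  case (step j)
  have xc: "x l \<in> carrier R" for l using x_part RD.part_carrier by blast
  show ?case
  proof (rule K.exact_at_cone_torsion[OF koszul_subcomplex[OF S]])
    show "exact_at (cone_module (KP j)) (cone_diff (x j) (KP j) (KD j)) (cone_family (KF S j)) (q - int j - 1) u" if "u > D" for u
      using step.IH[OF that] by (simp add: algebra_simps)
    show "\<exists>k. x j [^] (k::nat) \<odot>\<^bsub>KP j (q - int j)\<^esub> a = \<zero>\<^bsub>KP j (q - int j)\<^esub>" if "a \<in> KF S j (q - int j) u" for u a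
      by (rule koszul_torsion[OF S xc tors that]) (use step in auto)
    show "D \<le> u" using step by simp
  qed
qed

text \<open>The sum of the x_l N_{u-1} over l < j; for a complex concentrated in degree zero it is
  the image of the last Koszul differential.\<close>

primrec xspan :: "(int \<Rightarrow> 'e set) \<Rightarrow> nat \<Rightarrow> int \<Rightarrow> 'e set" where
  "xspan N 0 u = {\<zero>\<^bsub>P 0\<^esub>}"
| "xspan N (Suc j) u = {w \<oplus>\<^bsub>P 0\<^esub> x j \<odot>\<^bsub>P 0\<^esub> b | w b. w \<in> xspan N j u \<and> b \<in> N (u - 1)}"

text \<open>The inclusion of \<open>P 0\<close> into the Koszul complex, a -> (...((a, 0), 0)...,
  0).\<close>

primrec embed :: "nat \<Rightarrow> 'e \<Rightarrow> 'e" where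
  "embed 0 a = a"
| "embed (Suc j) a = pr (embed j a) \<zero>\<^bsub>KP j 1\<^esub>"

lemma embed_linear: "linear R (P 0) (KP j 0) (embed j)"
proof (induction j)
  case (Suc j)
  then show ?case by (auto simp: linear_def cone_module_def)
qed (simp add: linear_def)

lemma embed_inject: "embed j a = embed j b \<Longrightarrow> a = b"
  by (induction j) auto

context
  fixes S assumes S: "subcomplex R P d S" and conc: "\<And>q u. q \<noteq> 0 \<Longrightarrow> S q u = {\<zero>\<^bsub>P q\<^esub>}"
begin

lemma above: "q > 0 \<Longrightarrow> KF S j q u = {\<zero>\<^bsub>KP j q\<^esub>}"
  using koszul_trivial_above[of S] conc by auto

text \<open>The second entries in degree zero come from degree one, where the complex is
  zero.\<close>

lemma koszul_degree_zero: "KF S j 0 u = embed j ` S 0 u"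
proof (induction j)
  case (Suc j)
  have "w \<in> KF S (Suc j) 0 u \<longleftrightarrow> w \<in> embed (Suc j) ` S 0 u" for w
    using Suc above[of 1 j "u - 1"] by (auto elim!: cone_family_cases)
  then show ?case by blast
qed simp

lemma xspan_carrier: "w \<in> xspan (S 0) j u \<Longrightarrow> w \<in> carrier (P 0)"
proof (induction j arbitrary: w)
  case 0
  then show ?case using subcomplex_closed[OF complex S] subcomplex_zero[OF complex S] by auto
next
  case (Suc j)
  interpret P0: module R "P 0" by (rule cochain_module[OF complex])
  have "x j \<in> carrier R" using x_part RD.part_carrier by blast
  then show ?case using Suc subcomplex_closed[OF complex S] by auto
qed

text \<open>A cochain of degree -1 of the next cone is a pair (a, b) with b in degree zero. Its
  differential has first entry da + x_j b, and the second entry vanishes because there is nothing in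
  degree one.\<close>

lemma koszul_boundaries: "KD j (-1) ` KF S j (-1) u = embed j ` xspan (S 0) j u"
proof (induction j)
  case 0
  have "d (-1) \<zero>\<^bsub>P (-1)\<^esub> = \<zero>\<^bsub>P 0\<^esub>"
    using cochain_simps(8)[OF complex, of 0]
      linear_zero[OF cochain_module[OF complex] cochain_module[OF complex] cochain_linear[OF complex], of "-1"] by simp
  then show ?case using conc by simp
next
  case (Suc j)
  interpret M: module R "KP j k" for k by (rule cochain_module[OF koszul_cochain_complex])
  have xc: "x j \<in> carrier R" using x_part RD.part_carrier by blast
  have D: "KD (Suc j) (-1) (pr a (embed j b)) = embed (Suc j) (w \<oplus>\<^bsub>P 0\<^esub> x j \<odot>\<^bsub>P 0\<^esub> b)"
    if a: "KD j (-1) a = embed j w" and w: "w \<in> xspan (S 0) j u" and b: "b \<in> S 0 (u - 1)" for a b w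
  proof -
    have bc: "b \<in> carrier (P 0)" "w \<in> carrier (P 0)"
      using subcomplex_closed[OF complex S] b xspan_carrier w by auto
    interpret P0: module R "P 0" by (rule cochain_module[OF complex])
    have "embed j b \<in> KF S j 0 (u - 1)" using koszul_degree_zero b by auto
    then have "KD j 0 (embed j b) \<in> KF S j (0 + 1) (u - 1)"
      using subcomplex_d[OF koszul_cochain_complex koszul_subcomplex[OF S]] by blast
    then have "KD j 0 (embed j b) = \<zero>\<^bsub>KP j 1\<^esub>" using above[of 1 j] by simp
    then show ?thesis using K.cone_diff_pr'[of j 0 a "embed j b"] a bc xc
      by (simp add: linear_add[OF embed_linear] linear_smult[OF embed_linear])
  qed
  show ?case
  proof (intro equalityI subsetI)
    fix v assume "v \<in> KD (Suc j) (-1) ` KF S (Suc j) (-1) u"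
    then obtain a b where v: "v = KD (Suc j) (-1) (pr a (embed j b))" and a: "a \<in> KF S j (-1) u" and b: "b \<in> S 0 (u - 1)"
      using koszul_degree_zero by (auto simp: cone_family_def)
    from a Suc obtain w where "w \<in> xspan (S 0) j u" "KD j (-1) a = embed j w" by blast
    then show "v \<in> embed (Suc j) ` xspan (S 0) (Suc j) u" using D b v by auto
  next
    fix v assume "v \<in> embed (Suc j) ` xspan (S 0) (Suc j) u"
    then obtain w b where v: "v = embed (Suc j) (w \<oplus>\<^bsub>P 0\<^esub> x j \<odot>\<^bsub>P 0\<^esub> b)" and w: "w \<in> xspan (S 0) j u" and b: "b \<in> S 0 (u - 1)"
      by auto
    have "embed j w \<in> KD j (-1) ` KF S j (-1) u" unfolding Suc using w by (rule imageI)
    then obtain a where a: "a \<in> KF S j (-1) u" "embed j w = KD j (-1) a" by (rule imageE)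
    have "pr a (embed j b) \<in> KF S (Suc j) (-1) u" using a b koszul_degree_zero by auto
    from imageI[OF this, of "KD (Suc j) (-1)"]
    show "v \<in> KD (Suc j) (-1) ` KF S (Suc j) (-1) u" unfolding D[OF a(2)[symmetric] w b] v .
  qed
qed

text \<open>Everything in degree zero is a cocycle, so exactness asks that every element be a
  boundary.\<close>

lemma koszul_exact_at_zero: "exact_at (KP j) (KD j) (KF S j) 0 u \<longleftrightarrow> S 0 u \<subseteq> xspan (S 0) j u"
proof -
  have cyc: "KD j 0 z = \<zero>\<^bsub>KP j (0 + 1)\<^esub>" if "z \<in> KF S j 0 u" for z
    using subcomplex_d[OF koszul_cochain_complex koszul_subcomplex[OF S] that] above[of 1 j] by simp
  have "exact_at (KP j) (KD j) (KF S j) 0 u \<longleftrightarrow> (\<forall>z\<in>KF S j 0 u. z \<in> KD j (-1) ` KF S j (-1) u)"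
    unfolding exact_at_iff[OF koszul_cochain_complex koszul_subcomplex[OF S]]
    using cyc by (simp add: image_iff) (metis (no_types))
  also have "\<dots> \<longleftrightarrow> S 0 u \<subseteq> xspan (S 0) j u"
    unfolding koszul_boundaries koszul_degree_zero using embed_inject by blast
  finally show ?thesis .
qed

lemma koszul_exact_at_pos: "q > 0 \<Longrightarrow> exact_at (KP j) (KD j) (KF S j) q u"
  using exact_at_trivial[OF S above] .

end

end

section \<open>Chains of submodules\<close>

text \<open>The set \<open>\<Omega>\<close> of operators is a parameter, which starts as R_0 and
  grows by one ring generator at a time. This replaces the passage to polynomial rings and modules
  over them.\<close>

definition stable_subgroup :: "('r, 'm, 'q) module_scheme \<Rightarrow> 'r set \<Rightarrow> 'm set \<Rightarrow> bool" where
  "stable_subgroup M \<Omega> H \<longleftrightarrow> additive_subgroup H M \<and> (\<forall>r\<in>\<Omega>. \<forall>y\<in>H. r \<odot>\<^bsub>M\<^esub> y \<in> H)"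

definition acc_below :: "('r, 'm, 'q) module_scheme \<Rightarrow> 'r set \<Rightarrow> 'm set \<Rightarrow> bool" where
  "acc_below M \<Omega> H \<longleftrightarrow>
     (\<forall>L. (\<forall>s. stable_subgroup M \<Omega> (L s)) \<and> (\<forall>s. L s \<subseteq> H) \<and> (\<forall>s. L s \<subseteq> L (Suc s)) \<longrightarrow>
        (\<exists>s0::nat. \<forall>s\<ge>s0. L s = L s0))"

lemma acc_belowD:
  assumes "acc_below M \<Omega> H" "\<And>s. stable_subgroup M \<Omega> (L s)" "\<And>s. L s \<subseteq> H" "\<And>s. L s \<subseteq> L (Suc s)"
  obtains s0 :: nat where "\<And>s. s \<ge> s0 \<Longrightarrow> L s = L s0"
  using assms unfolding acc_below_def by metis

lemma chain_mono:
  assumes "\<And>s. (L :: nat \<Rightarrow> 'x set) s \<subseteq> L (Suc s)" "i \<le> j"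
  shows "L i \<subseteq> L j"
  by (rule lift_Suc_mono_le[of L, OF assms(1) assms(2)])

context module
begin

lemma stable_closed:
  assumes "stable_subgroup M \<Omega> H"
  shows "y \<in> H \<Longrightarrow> y \<in> carrier M" "\<zero>\<^bsub>M\<^esub> \<in> H" "y \<in> H \<Longrightarrow> z \<in> H \<Longrightarrow> y \<oplus>\<^bsub>M\<^esub> z \<in> H"
    "y \<in> H \<Longrightarrow> \<ominus>\<^bsub>M\<^esub> y \<in> H" "y \<in> H \<Longrightarrow> z \<in> H \<Longrightarrow> y \<ominus>\<^bsub>M\<^esub> z \<in> H" "r \<in> \<Omega> \<Longrightarrow> y \<in> H \<Longrightarrow> r \<odot>\<^bsub>M\<^esub> y \<in> H"
proof -
  have a: "additive_subgroup H M" and b: "\<forall>r\<in>\<Omega>. \<forall>y\<in>H. r \<odot>\<^bsub>M\<^esub> y \<in> H"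
    using assms by (auto simp: stable_subgroup_def)
  show "y \<in> H \<Longrightarrow> y \<in> carrier M" "\<zero>\<^bsub>M\<^esub> \<in> H" "y \<in> H \<Longrightarrow> z \<in> H \<Longrightarrow> y \<oplus>\<^bsub>M\<^esub> z \<in> H"
    using a additive_subgroup.a_Hcarr additive_subgroup.zero_closed additive_subgroup.a_closed by metis+
  show "y \<in> H \<Longrightarrow> \<ominus>\<^bsub>M\<^esub> y \<in> H" "y \<in> H \<Longrightarrow> z \<in> H \<Longrightarrow> y \<ominus>\<^bsub>M\<^esub> z \<in> H"
    using a M.additive_subgroup_neg M.additive_subgroup_minus by auto
  show "r \<in> \<Omega> \<Longrightarrow> y \<in> H \<Longrightarrow> r \<odot>\<^bsub>M\<^esub> y \<in> H" using b by auto
qed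

lemma stable_subgroupI:
  assumes "H \<subseteq> carrier M" "\<zero>\<^bsub>M\<^esub> \<in> H" "\<And>x y. x \<in> H \<Longrightarrow> y \<in> H \<Longrightarrow> x \<oplus>\<^bsub>M\<^esub> y \<in> H" "\<And>x. x \<in> H \<Longrightarrow> \<ominus>\<^bsub>M\<^esub> x \<in> H"
    "\<And>r y. r \<in> \<Omega> \<Longrightarrow> y \<in> H \<Longrightarrow> r \<odot>\<^bsub>M\<^esub> y \<in> H"
  shows "stable_subgroup M \<Omega> H"
  unfolding stable_subgroup_def using assms M.additive_subgroupI'[of H] by auto

text \<open>Hilbert's basis theorem in operator form: the submodules of \<open>\<Sum>x\<^sup>m H\<close> are controlled by the
  subgroups of leading coefficients in \<open>H\<close>.\<close>

lemma acc_adjoin: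
  assumes \<Omega>: "\<Omega> \<subseteq> carrier R" and x: "x \<in> carrier R"
    and H: "stable_subgroup M \<Omega> H" and acc: "acc_below M \<Omega> H"
  shows "\<exists>H'. stable_subgroup M (insert x \<Omega>) H' \<and> acc_below M (insert x \<Omega>) H' \<and> H \<subseteq> H'"
proof -
  \<comment> \<open>\<open>T m\<close> consists of the expressions in x of degree less than m with
    coefficients in \<open>H\<close>.\<close>
  define T where "T = rec_nat {\<zero>\<^bsub>M\<^esub>} (\<lambda>m A. {x [^] m \<odot>\<^bsub>M\<^esub> a \<oplus>\<^bsub>M\<^esub> b | a b. a \<in> H \<and> b \<in> A})"
  have T0: "T 0 = {\<zero>\<^bsub>M\<^esub>}" by (simp add: T_def)
  have TS: "T (Suc m) = {x [^] m \<odot>\<^bsub>M\<^esub> a \<oplus>\<^bsub>M\<^esub> b | a b. a \<in> H \<and> b \<in> T m}" for m by (simp add: T_def)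
  note Hc = stable_closed[OF H]
  have xm: "x [^] (m::nat) \<in> carrier R" for m using x by simp
  have T: "stable_subgroup M \<Omega> (T m)" for m
  proof (induction m)
    case 0
    show ?case unfolding T0 by (rule stable_subgroupI) (use \<Omega> in auto)
  next
    case (Suc m)
    note Tc = stable_closed[OF Suc]
    show ?case
    proof (rule stable_subgroupI)
      show "T (Suc m) \<subseteq> carrier M" using Hc(1) Tc(1) xm by (auto simp: TS)
      show "\<zero>\<^bsub>M\<^esub> \<in> T (Suc m)" unfolding TS using Hc(2) Tc(2) xm
        by (intro CollectI exI[of _ "\<zero>\<^bsub>M\<^esub>"]) simp
    next
      fix v w assume "v \<in> T (Suc m)" "w \<in> T (Suc m)"
      then obtain a b a' b' where e: "v = x [^] m \<odot>\<^bsub>M\<^esub> a \<oplus>\<^bsub>M\<^esub> b" "w = x [^] m \<odot>\<^bsub>M\<^esub> a' \<oplus>\<^bsub>M\<^esub> b'"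
          "a \<in> H" "b \<in> T m" "a' \<in> H" "b' \<in> T m" by (auto simp: TS)
      have "v \<oplus>\<^bsub>M\<^esub> w = x [^] m \<odot>\<^bsub>M\<^esub> (a \<oplus>\<^bsub>M\<^esub> a') \<oplus>\<^bsub>M\<^esub> (b \<oplus>\<^bsub>M\<^esub> b')"
        using e Hc(1) Tc(1) xm by (simp add: smult_r_distr M.a_ac)
      then show "v \<oplus>\<^bsub>M\<^esub> w \<in> T (Suc m)" unfolding TS using e Hc(3) Tc(3) by blast
    next
      fix v assume "v \<in> T (Suc m)"
      then obtain a b where e: "v = x [^] m \<odot>\<^bsub>M\<^esub> a \<oplus>\<^bsub>M\<^esub> b" "a \<in> H" "b \<in> T m" by (auto simp: TS)
      have "\<ominus>\<^bsub>M\<^esub> v = x [^] m \<odot>\<^bsub>M\<^esub> (\<ominus>\<^bsub>M\<^esub> a) \<oplus>\<^bsub>M\<^esub> (\<ominus>\<^bsub>M\<^esub> b)"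
        using e Hc(1) Tc(1) xm by (simp add: smult_r_minus M.minus_add)
      then show "\<ominus>\<^bsub>M\<^esub> v \<in> T (Suc m)" unfolding TS using e Hc(4) Tc(4) by blast
    next
      fix r v assume r: "r \<in> \<Omega>" and "v \<in> T (Suc m)"
      then obtain a b where e: "v = x [^] m \<odot>\<^bsub>M\<^esub> a \<oplus>\<^bsub>M\<^esub> b" "a \<in> H" "b \<in> T m" by (auto simp: TS)
      have "r \<odot>\<^bsub>M\<^esub> v = x [^] m \<odot>\<^bsub>M\<^esub> (r \<odot>\<^bsub>M\<^esub> a) \<oplus>\<^bsub>M\<^esub> (r \<odot>\<^bsub>M\<^esub> b)"
        using e Hc(1) Tc(1) xm \<Omega> r by (simp add: smult_r_distr smult_assoc1[symmetric] m_comm subset_iff)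
      then show "r \<odot>\<^bsub>M\<^esub> v \<in> T (Suc m)" unfolding TS using e Hc(6) Tc(6) r by blast
    qed
  qed
  note Tc = stable_closed[OF T]
  have Tup: "T m \<subseteq> T (Suc m)" for m
  proof
    fix v assume v: "v \<in> T m"
    have "v = x [^] m \<odot>\<^bsub>M\<^esub> \<zero>\<^bsub>M\<^esub> \<oplus>\<^bsub>M\<^esub> v" using Tc(1)[OF v] xm by simp
    then show "v \<in> T (Suc m)" unfolding TS using v Hc(2) by blast
  qed
  note Tmono = chain_mono[of T, OF Tup]
  have Tx: "x \<odot>\<^bsub>M\<^esub> v \<in> T (Suc m)" if "v \<in> T m" for v m
    using that
  proof (induction m arbitrary: v)
    case 0
    then show ?case using Tc(2) x by (auto simp: T0)
  next
    case (Suc m)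
    then obtain a b where e: "v = x [^] m \<odot>\<^bsub>M\<^esub> a \<oplus>\<^bsub>M\<^esub> b" "a \<in> H" "b \<in> T m" by (auto simp: TS)
    have "x \<odot>\<^bsub>M\<^esub> v = x [^] (Suc m) \<odot>\<^bsub>M\<^esub> a \<oplus>\<^bsub>M\<^esub> x \<odot>\<^bsub>M\<^esub> b"
      using e Hc(1) Tc(1) xm x by (simp add: smult_r_distr smult_assoc1[symmetric] m_comm)
    then show ?case unfolding TS[of "Suc m"] using e Suc.IH by blast
  qed
  define U where "U = (\<Union>m. T m)"
  have HU: "H \<subseteq> U"
  proof
    fix a assume a: "a \<in> H"
    have "a = x [^] (0::nat) \<odot>\<^bsub>M\<^esub> a \<oplus>\<^bsub>M\<^esub> \<zero>\<^bsub>M\<^esub>" using Hc(1)[OF a] by simp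
    then have "a \<in> T (Suc 0)" unfolding TS using a T0 by blast
    then show "a \<in> U" unfolding U_def by blast
  qed
  have U: "stable_subgroup M (insert x \<Omega>) U"
  proof (rule stable_subgroupI)
    fix v w assume "v \<in> U" "w \<in> U"
    then obtain m k where "v \<in> T m" "w \<in> T k" by (auto simp: U_def)
    then have "v \<in> T (max m k)" "w \<in> T (max m k)" using Tmono[of m "max m k"] Tmono[of k "max m k"] by auto
    then show "v \<oplus>\<^bsub>M\<^esub> w \<in> U" unfolding U_def using Tc(3) by blast
  next
    fix r v assume "r \<in> insert x \<Omega>" "v \<in> U"
    then show "r \<odot>\<^bsub>M\<^esub> v \<in> U" unfolding U_def using Tc(6) Tx by blast
  qed (use Tc(1,2,4) in \<open>fastforce simp: U_def\<close>)+
  have "acc_below M (insert x \<Omega>) U"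
    unfolding acc_below_def
  proof (intro allI impI, elim conjE)
    fix L :: "nat \<Rightarrow> 'c set"
    assume stab: "\<forall>s. stable_subgroup M (insert x \<Omega>) (L s)" and LU: "\<forall>s. L s \<subseteq> U" and up: "\<forall>s. L s \<subseteq> L (Suc s)"
    note Lc = stable_closed[OF stab[rule_format]]
    note Lmono = chain_mono[of L, OF up[rule_format]]
    \<comment> \<open>The leading coefficients, at x^m, of those elements of \<open>L s\<close> that
      lie in \<open>T (Suc m)\<close>. They ascend in s, and also in m, through multiplication by
      x.\<close>
    define A where "A s m = {a \<in> H. \<exists>b\<in>T m. x [^] m \<odot>\<^bsub>M\<^esub> a \<oplus>\<^bsub>M\<^esub> b \<in> L s}" for s m
    have Ast: "stable_subgroup M \<Omega> (A s m)" for s m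
    proof (rule stable_subgroupI)
      show "A s m \<subseteq> carrier M" using Hc(1) by (auto simp: A_def)
      have "x [^] m \<odot>\<^bsub>M\<^esub> \<zero>\<^bsub>M\<^esub> \<oplus>\<^bsub>M\<^esub> \<zero>\<^bsub>M\<^esub> \<in> L s" using Lc(2) xm by simp
      then show "\<zero>\<^bsub>M\<^esub> \<in> A s m" using Hc(2) Tc(2) unfolding A_def by blast
    next
      fix a a' assume "a \<in> A s m" "a' \<in> A s m"
      then obtain b b' where e: "a \<in> H" "a' \<in> H" "b \<in> T m" "b' \<in> T m" "x [^] m \<odot>\<^bsub>M\<^esub> a \<oplus>\<^bsub>M\<^esub> b \<in> L s" "x [^] m \<odot>\<^bsub>M\<^esub> a' \<oplus>\<^bsub>M\<^esub> b' \<in> L s"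
        by (auto simp: A_def)
      have "x [^] m \<odot>\<^bsub>M\<^esub> (a \<oplus>\<^bsub>M\<^esub> a') \<oplus>\<^bsub>M\<^esub> (b \<oplus>\<^bsub>M\<^esub> b') = (x [^] m \<odot>\<^bsub>M\<^esub> a \<oplus>\<^bsub>M\<^esub> b) \<oplus>\<^bsub>M\<^esub> (x [^] m \<odot>\<^bsub>M\<^esub> a' \<oplus>\<^bsub>M\<^esub> b')"
        using e Hc(1) Tc(1) xm by (simp add: smult_r_distr M.a_ac)
      then have "x [^] m \<odot>\<^bsub>M\<^esub> (a \<oplus>\<^bsub>M\<^esub> a') \<oplus>\<^bsub>M\<^esub> (b \<oplus>\<^bsub>M\<^esub> b') \<in> L s" using Lc(3)[OF e(5,6)] by simp
      then show "a \<oplus>\<^bsub>M\<^esub> a' \<in> A s m" unfolding A_def using e Hc(3) Tc(3) by blast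
    next
      fix a assume "a \<in> A s m"
      then obtain b where e: "a \<in> H" "b \<in> T m" "x [^] m \<odot>\<^bsub>M\<^esub> a \<oplus>\<^bsub>M\<^esub> b \<in> L s" by (auto simp: A_def)
      have "x [^] m \<odot>\<^bsub>M\<^esub> (\<ominus>\<^bsub>M\<^esub> a) \<oplus>\<^bsub>M\<^esub> (\<ominus>\<^bsub>M\<^esub> b) = \<ominus>\<^bsub>M\<^esub> (x [^] m \<odot>\<^bsub>M\<^esub> a \<oplus>\<^bsub>M\<^esub> b)"
        using e Hc(1) Tc(1) xm by (simp add: smult_r_minus M.minus_add)
      then have "x [^] m \<odot>\<^bsub>M\<^esub> (\<ominus>\<^bsub>M\<^esub> a) \<oplus>\<^bsub>M\<^esub> (\<ominus>\<^bsub>M\<^esub> b) \<in> L s" using Lc(4)[OF e(3)] by simp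
      then show "\<ominus>\<^bsub>M\<^esub> a \<in> A s m" unfolding A_def using e Hc(4) Tc(4) by blast
    next
      fix r a assume r: "r \<in> \<Omega>" and "a \<in> A s m"
      then obtain b where e: "a \<in> H" "b \<in> T m" "x [^] m \<odot>\<^bsub>M\<^esub> a \<oplus>\<^bsub>M\<^esub> b \<in> L s" by (auto simp: A_def)
      have "x [^] m \<odot>\<^bsub>M\<^esub> (r \<odot>\<^bsub>M\<^esub> a) \<oplus>\<^bsub>M\<^esub> (r \<odot>\<^bsub>M\<^esub> b) = r \<odot>\<^bsub>M\<^esub> (x [^] m \<odot>\<^bsub>M\<^esub> a \<oplus>\<^bsub>M\<^esub> b)"
        using e Hc(1) Tc(1) xm \<Omega> r by (simp add: smult_r_distr smult_assoc1[symmetric] m_comm subset_iff)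
      then have "x [^] m \<odot>\<^bsub>M\<^esub> (r \<odot>\<^bsub>M\<^esub> a) \<oplus>\<^bsub>M\<^esub> (r \<odot>\<^bsub>M\<^esub> b) \<in> L s" using Lc(6)[OF _ e(3)] r by simp
      then show "r \<odot>\<^bsub>M\<^esub> a \<in> A s m" unfolding A_def using e r Hc(6) Tc(6) by blast
    qed
    have AH: "A s m \<subseteq> H" for s m by (auto simp: A_def)
    have Aup1: "A s m \<subseteq> A (Suc s) m" for s m using up by (fastforce simp: A_def)
    have Aup2: "A s m \<subseteq> A s (Suc m)" for s m
    proof
      fix a assume "a \<in> A s m"
      then obtain b where e: "a \<in> H" "b \<in> T m" "x [^] m \<odot>\<^bsub>M\<^esub> a \<oplus>\<^bsub>M\<^esub> b \<in> L s" by (auto simp: A_def)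
      have "x [^] Suc m \<odot>\<^bsub>M\<^esub> a \<oplus>\<^bsub>M\<^esub> x \<odot>\<^bsub>M\<^esub> b = x \<odot>\<^bsub>M\<^esub> (x [^] m \<odot>\<^bsub>M\<^esub> a \<oplus>\<^bsub>M\<^esub> b)"
        using e Hc(1) Tc(1) xm x by (simp add: smult_r_distr smult_assoc1[symmetric] m_comm)
      then have "x [^] Suc m \<odot>\<^bsub>M\<^esub> a \<oplus>\<^bsub>M\<^esub> x \<odot>\<^bsub>M\<^esub> b \<in> L s" using Lc(6)[OF _ e(3)] by simp
      then show "a \<in> A s (Suc m)" unfolding A_def using e Tx by blast
    qed
    note Amono1 = chain_mono[of "\<lambda>s. A s m" for m, OF Aup1]
    note Amono2 = chain_mono[of "\<lambda>m. A s m" for s, OF Aup2]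
    \<comment> \<open>The diagonal chain settles \<open>A s m\<close> for all large s and m at once.
      Only the finitely many m below \<open>s0\<close> remain, and each of these is settled by its
      own chain.\<close>
    have diag: "A s s \<subseteq> A (Suc s) (Suc s)" for s using Aup1 Aup2 by blast
    obtain s0 where s0: "\<And>s. s \<ge> s0 \<Longrightarrow> A s s = A s0 s0"
      using acc_belowD[OF acc, of "\<lambda>s. A s s"] Ast AH diag by metis
    have big: "A s m = A s0 s0" if "s \<ge> s0" "m \<ge> s0" for s m
    proof
      have "A s m \<subseteq> A (max s m) (max s m)" using Amono1[of s "max s m" m] Amono2[of m "max s m" "max s m"] by auto
      then show "A s m \<subseteq> A s0 s0" using s0[of "max s m"] that by auto
      show "A s0 s0 \<subseteq> A s m" using Amono1[of s0 s s0] Amono2[of s0 m s] that by auto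
    qed
    have "\<exists>t. \<forall>s\<ge>t. A s m = A t m" for m
      using acc_belowD[OF acc, of "\<lambda>s. A s m"] Ast AH Aup1 by metis
    then obtain t where t: "\<And>m s. s \<ge> t m \<Longrightarrow> A s m = A (t m) m" by metis
    define s1 where "s1 = Max (insert s0 (t ` {..<s0}))"
    have s1: "s1 \<ge> s0" "m < s0 \<Longrightarrow> s1 \<ge> t m" for m unfolding s1_def by (auto intro: Max_ge)
    have stabA: "A s m = A s1 m" if "s \<ge> s1" for s m
    proof (cases "m < s0")
      case True
      then show ?thesis using t[of m s] t[of m s1] s1(2)[OF True] that by simp
    next
      case False
      then show ?thesis using big[of s m] big[of s1 m] s1 that by simp
    qed
    \<comment> \<open>Induction on the degree: an element of \<open>L s\<close> shares its leading
      coefficient with one of \<open>L s1\<close>, and the difference has smaller degree.\<close>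
    have "L s \<inter> T m \<subseteq> L s1" if s: "s \<ge> s1" for s m
    proof (induction m)
      case 0
      then show ?case using Lc(2) by (auto simp: T0)
    next
      case (Suc m)
      show ?case
      proof
        fix v assume v: "v \<in> L s \<inter> T (Suc m)"
        then obtain a b where e: "v = x [^] m \<odot>\<^bsub>M\<^esub> a \<oplus>\<^bsub>M\<^esub> b" "a \<in> H" "b \<in> T m" by (auto simp: TS)
        then have "a \<in> A s m" using v by (auto simp: A_def)
        then have "a \<in> A s1 m" using stabA[OF s] by simp
        then obtain b' where b': "b' \<in> T m" "x [^] m \<odot>\<^bsub>M\<^esub> a \<oplus>\<^bsub>M\<^esub> b' \<in> L s1"
          by (auto simp: A_def)
        have "b \<ominus>\<^bsub>M\<^esub> b' = v \<ominus>\<^bsub>M\<^esub> (x [^] m \<odot>\<^bsub>M\<^esub> a \<oplus>\<^bsub>M\<^esub> b')"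
          using e b' Hc(1) Tc(1) xm by (simp add: M.group_simps)
        moreover have "v \<ominus>\<^bsub>M\<^esub> (x [^] m \<odot>\<^bsub>M\<^esub> a \<oplus>\<^bsub>M\<^esub> b') \<in> L s"
          using Lc(5) v b'(2) Lmono[OF s] by blast
        ultimately have "b \<ominus>\<^bsub>M\<^esub> b' \<in> L s1" using Suc Tc(5)[OF e(3) b'(1)] by auto
        from Lc(3)[OF b'(2) this] have "(x [^] m \<odot>\<^bsub>M\<^esub> a \<oplus>\<^bsub>M\<^esub> b') \<oplus>\<^bsub>M\<^esub> (b \<ominus>\<^bsub>M\<^esub> b') \<in> L s1" .
        moreover have "(x [^] m \<odot>\<^bsub>M\<^esub> a \<oplus>\<^bsub>M\<^esub> b') \<oplus>\<^bsub>M\<^esub> (b \<ominus>\<^bsub>M\<^esub> b') = v"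
          using e b' Hc(1) Tc(1) xm by (simp add: M.group_simps)
        ultimately show "v \<in> L s1" by simp
      qed
    qed
    then have "L s = L s1" if "s \<ge> s1" for s
      using LU Lmono[OF that] that unfolding U_def by blast
    then show "\<exists>s0. \<forall>s\<ge>s0. L s = L s0" by blast
  qed
  then show ?thesis using U HU by blast
qed

text \<open>A chain in Kg + H is controlled by its ideals of coefficients of g, which stabilise
  because K is noetherian, and by its traces on H, which stabilise by hypothesis.\<close>

lemma acc_add_generator:
  assumes noeth: "noetherian_ring (R\<lparr>carrier := K\<rparr>)" and K: "K \<subseteq> carrier R"
    and H: "stable_subgroup M K H" and acc: "acc_below M K H" and g: "g \<in> carrier M"
  shows "\<exists>H'. stable_subgroup M K H' \<and> acc_below M K H' \<and> H \<subseteq> H' \<and> g \<in> H'"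
proof -
  interpret N: noetherian_ring "R\<lparr>carrier := K\<rparr>" by (rule noeth)
  have Kz: "\<zero> \<in> K" "\<one> \<in> K" using N.zero_closed N.one_closed by auto
  have Kadd: "r \<oplus> s \<in> K" "r \<otimes> s \<in> K" if "r \<in> K" "s \<in> K" for r s
    using N.a_closed[of r s] N.m_closed[of r s] that by auto
  have Kneg: "\<ominus> r \<in> K" if r: "r \<in> K" for r
  proof -
    obtain s where s: "s \<in> K" "s \<oplus> r = \<zero>" using N.l_neg[of r] N.a_inv_closed[of r] r by auto
    then have "\<ominus> r = s" using K r by (intro R.minus_equality) auto
    then show ?thesis using s by simp
  qed
  have Kc: "r \<in> carrier R" if "r \<in> K" for r using K that by blast
  note Hc = stable_closed[OF H]
  define U where "U = {r \<odot>\<^bsub>M\<^esub> g \<oplus>\<^bsub>M\<^esub> b | r b. r \<in> K \<and> b \<in> H}"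
  have U: "stable_subgroup M K U"
  proof (rule stable_subgroupI)
    show "U \<subseteq> carrier M" using Hc(1) g Kc by (auto simp: U_def)
    show "\<zero>\<^bsub>M\<^esub> \<in> U" unfolding U_def using Kz Hc(2) g by (intro CollectI exI[of _ \<zero>] exI[of _ "\<zero>\<^bsub>M\<^esub>"]) simp
  next
    fix v w assume "v \<in> U" "w \<in> U"
    then obtain a b a' b' where e: "v = a \<odot>\<^bsub>M\<^esub> g \<oplus>\<^bsub>M\<^esub> b" "w = a' \<odot>\<^bsub>M\<^esub> g \<oplus>\<^bsub>M\<^esub> b'"
        "a \<in> K" "b \<in> H" "a' \<in> K" "b' \<in> H" by (auto simp: U_def)
    have "v \<oplus>\<^bsub>M\<^esub> w = (a \<oplus> a') \<odot>\<^bsub>M\<^esub> g \<oplus>\<^bsub>M\<^esub> (b \<oplus>\<^bsub>M\<^esub> b')"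
      using e Hc(1) Kc g by (simp add: smult_l_distr M.a_ac)
    then show "v \<oplus>\<^bsub>M\<^esub> w \<in> U" unfolding U_def using e Hc(3) Kadd by blast
  next
    fix v assume "v \<in> U"
    then obtain a b where e: "v = a \<odot>\<^bsub>M\<^esub> g \<oplus>\<^bsub>M\<^esub> b" "a \<in> K" "b \<in> H" by (auto simp: U_def)
    have "\<ominus>\<^bsub>M\<^esub> v = (\<ominus> a) \<odot>\<^bsub>M\<^esub> g \<oplus>\<^bsub>M\<^esub> (\<ominus>\<^bsub>M\<^esub> b)"
      using e Hc(1) Kc g by (simp add: smult_l_minus M.minus_add)
    then show "\<ominus>\<^bsub>M\<^esub> v \<in> U" unfolding U_def using e Hc(4) Kneg by blast
  next
    fix r v assume r: "r \<in> K" and "v \<in> U"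
    then obtain a b where e: "v = a \<odot>\<^bsub>M\<^esub> g \<oplus>\<^bsub>M\<^esub> b" "a \<in> K" "b \<in> H" by (auto simp: U_def)
    have "r \<odot>\<^bsub>M\<^esub> v = (r \<otimes> a) \<odot>\<^bsub>M\<^esub> g \<oplus>\<^bsub>M\<^esub> (r \<odot>\<^bsub>M\<^esub> b)"
      using e Hc(1) Kc g r by (simp add: smult_r_distr smult_assoc1)
    then show "r \<odot>\<^bsub>M\<^esub> v \<in> U" unfolding U_def using e Hc(6) Kadd r by blast
  qed
  have HU: "H \<subseteq> U"
  proof
    fix b assume b: "b \<in> H"
    have "b = \<zero> \<odot>\<^bsub>M\<^esub> g \<oplus>\<^bsub>M\<^esub> b" using Hc(1)[OF b] g by simp
    then show "b \<in> U" unfolding U_def using b Kz by blast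
  qed
  have "g = \<one> \<odot>\<^bsub>M\<^esub> g \<oplus>\<^bsub>M\<^esub> \<zero>\<^bsub>M\<^esub>" using g by simp
  then have gU: "g \<in> U" unfolding U_def using Hc(2) Kz by blast
  have "acc_below M K U"
    unfolding acc_below_def
  proof (intro allI impI, elim conjE)
    fix L :: "nat \<Rightarrow> 'c set"
    assume stab: "\<forall>s. stable_subgroup M K (L s)" and LU: "\<forall>s. L s \<subseteq> U" and up: "\<forall>s. L s \<subseteq> L (Suc s)"
    note Lc = stable_closed[OF stab[rule_format]]
    note Lmono = chain_mono[of L, OF up[rule_format]]
    define I where "I s = {r \<in> K. \<exists>b\<in>H. r \<odot>\<^bsub>M\<^esub> g \<oplus>\<^bsub>M\<^esub> b \<in> L s}" for s
    have Iadd: "r \<oplus> r' \<in> I s" if "r \<in> I s" "r' \<in> I s" for r r' s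
    proof -
      from that obtain b b' where e: "r \<in> K" "r' \<in> K" "b \<in> H" "b' \<in> H" "r \<odot>\<^bsub>M\<^esub> g \<oplus>\<^bsub>M\<^esub> b \<in> L s" "r' \<odot>\<^bsub>M\<^esub> g \<oplus>\<^bsub>M\<^esub> b' \<in> L s"
        by (auto simp: I_def)
      have "(r \<oplus> r') \<odot>\<^bsub>M\<^esub> g \<oplus>\<^bsub>M\<^esub> (b \<oplus>\<^bsub>M\<^esub> b') = (r \<odot>\<^bsub>M\<^esub> g \<oplus>\<^bsub>M\<^esub> b) \<oplus>\<^bsub>M\<^esub> (r' \<odot>\<^bsub>M\<^esub> g \<oplus>\<^bsub>M\<^esub> b')"
        using e Hc(1) Kc g by (simp add: smult_l_distr M.a_ac)
      then have "(r \<oplus> r') \<odot>\<^bsub>M\<^esub> g \<oplus>\<^bsub>M\<^esub> (b \<oplus>\<^bsub>M\<^esub> b') \<in> L s" using Lc(3)[OF e(5,6)] by simp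
      then show ?thesis unfolding I_def using e Hc(3) Kadd by blast
    qed
    have Imult: "k \<otimes> r \<in> I s" if "r \<in> I s" "k \<in> K" for k r s
    proof -
      from that obtain b where e: "r \<in> K" "b \<in> H" "r \<odot>\<^bsub>M\<^esub> g \<oplus>\<^bsub>M\<^esub> b \<in> L s"
        by (auto simp: I_def)
      have "(k \<otimes> r) \<odot>\<^bsub>M\<^esub> g \<oplus>\<^bsub>M\<^esub> (k \<odot>\<^bsub>M\<^esub> b) = k \<odot>\<^bsub>M\<^esub> (r \<odot>\<^bsub>M\<^esub> g \<oplus>\<^bsub>M\<^esub> b)"
        using e Hc(1) Kc g that by (simp add: smult_r_distr smult_assoc1)
      then have "(k \<otimes> r) \<odot>\<^bsub>M\<^esub> g \<oplus>\<^bsub>M\<^esub> (k \<odot>\<^bsub>M\<^esub> b) \<in> L s" using Lc(6)[OF that(2) e(3)] by simp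
      then show ?thesis unfolding I_def using e Hc(6) Kadd that by blast
    qed
    have Izero: "\<zero> \<in> I s" for s
    proof -
      have "\<zero> \<odot>\<^bsub>M\<^esub> g \<oplus>\<^bsub>M\<^esub> \<zero>\<^bsub>M\<^esub> \<in> L s" using Lc(2) g by simp
      then show ?thesis unfolding I_def using Hc(2) Kz by blast
    qed
    have IK: "I s \<subseteq> K" for s by (auto simp: I_def)
    have ideal: "ideal (I s) (R\<lparr>carrier := K\<rparr>)" for s
    proof (rule idealI)
      show "ring (R\<lparr>carrier := K\<rparr>)" by (rule N.ring_axioms)
      show "subgroup (I s) (add_monoid (R\<lparr>carrier := K\<rparr>))"
      proof (rule N.add.subgroupI)
        show "I s \<subseteq> carrier (R\<lparr>carrier := K\<rparr>)" using IK by simp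
        show "I s \<noteq> {}" using Izero by blast
        show "a \<oplus>\<^bsub>R\<lparr>carrier := K\<rparr>\<^esub> b \<in> I s" if "a \<in> I s" "b \<in> I s" for a b using Iadd that by simp
        fix a assume a: "a \<in> I s"
        then have aK: "a \<in> K" using IK by blast
        have "(\<ominus> \<one>) \<otimes> a \<in> I s" using Imult[OF a] Kneg Kz by blast
        then have "\<ominus> a \<in> I s" using Kc[OF aK] by (simp add: R.l_minus)
        moreover have "\<ominus>\<^bsub>R\<lparr>carrier := K\<rparr>\<^esub> a = \<ominus> a"
          by (rule N.minus_equality) (use aK Kc Kneg in \<open>auto simp: R.l_neg\<close>)
        ultimately show "\<ominus>\<^bsub>R\<lparr>carrier := K\<rparr>\<^esub> a \<in> I s" by simp
      qed
      fix a k assume a: "a \<in> I s" and k: "k \<in> carrier (R\<lparr>carrier := K\<rparr>)"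
      show "k \<otimes>\<^bsub>R\<lparr>carrier := K\<rparr>\<^esub> a \<in> I s" using Imult a k by simp
      have "a \<otimes> k = k \<otimes> a" using a k IK Kc by (intro R.m_comm) auto
      then show "a \<otimes>\<^bsub>R\<lparr>carrier := K\<rparr>\<^esub> k \<in> I s" using Imult a k by simp
    qed
    have Iup: "I s \<subseteq> I (Suc s)" for s using up by (fastforce simp: I_def)
    note Imono = chain_mono[of I, OF Iup]
    have "subset.chain {I. ideal I (R\<lparr>carrier := K\<rparr>)} (range I)"
      unfolding subset_chain_def
    proof (intro conjI ballI)
      fix A B assume "A \<in> range I" "B \<in> range I"
      then obtain i j where "A = I i" "B = I j" by blast
      then show "A \<subseteq> B \<or> B \<subseteq> A"
        using Imono[of i j] Imono[of j i] by (cases "i \<le> j") auto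
    qed (use ideal in auto)
    then have "\<Union> (range I) \<in> range I" by (intro N.ideal_chain_is_trivial) auto
    then obtain t where t: "\<Union> (range I) = I t" by blast
    have Lt: "stable_subgroup M K (L s \<inter> H)" for s
      by (rule stable_subgroupI) (use Lc Hc in auto)
    obtain t' where t': "\<And>s. s \<ge> t' \<Longrightarrow> L s \<inter> H = L t' \<inter> H"
      using acc_belowD[OF acc, of "\<lambda>s. L s \<inter> H"] Lt up by (metis Int_lower2 Int_mono order_refl)
    define s1 where "s1 = max t t'"
    have "L s \<subseteq> L s1" if s: "s \<ge> s1" for s
    proof
      fix v assume v: "v \<in> L s"
      then obtain r b where e: "v = r \<odot>\<^bsub>M\<^esub> g \<oplus>\<^bsub>M\<^esub> b" "r \<in> K" "b \<in> H" using LU by (fastforce simp: U_def)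
      then have "r \<in> I s" using v by (auto simp: I_def)
      then have "r \<in> I s1" using t Imono[of t s1] by (auto simp: s1_def)
      then obtain b' where b': "b' \<in> H" "r \<odot>\<^bsub>M\<^esub> g \<oplus>\<^bsub>M\<^esub> b' \<in> L s1" by (auto simp: I_def)
      have "b \<ominus>\<^bsub>M\<^esub> b' = v \<ominus>\<^bsub>M\<^esub> (r \<odot>\<^bsub>M\<^esub> g \<oplus>\<^bsub>M\<^esub> b')"
        using e b' Hc(1) Kc g by (simp add: M.group_simps)
      moreover have "v \<ominus>\<^bsub>M\<^esub> (r \<odot>\<^bsub>M\<^esub> g \<oplus>\<^bsub>M\<^esub> b') \<in> L s"
        using Lc(5) v b'(2) Lmono[OF s] by blast
      ultimately have "b \<ominus>\<^bsub>M\<^esub> b' \<in> L s \<inter> H" using Hc(5)[OF e(3) b'(1)] by (metis IntI)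
      then have "b \<ominus>\<^bsub>M\<^esub> b' \<in> L s1" using t'[of s] t'[of s1] s by (auto simp: s1_def)
      from Lc(3)[OF b'(2) this] have "(r \<odot>\<^bsub>M\<^esub> g \<oplus>\<^bsub>M\<^esub> b') \<oplus>\<^bsub>M\<^esub> (b \<ominus>\<^bsub>M\<^esub> b') \<in> L s1" .
      moreover have "(r \<odot>\<^bsub>M\<^esub> g \<oplus>\<^bsub>M\<^esub> b') \<oplus>\<^bsub>M\<^esub> (b \<ominus>\<^bsub>M\<^esub> b') = v"
        using e b' Hc(1) Kc g by (simp add: M.group_simps)
      ultimately show "v \<in> L s1" by simp
    qed
    then show "\<exists>s0. \<forall>s\<ge>s0. L s = L s0" using Lmono by blast
  qed
  then show ?thesis using U HU gU by blast
qed

text \<open>The generators of the module are added over the noetherian ring K, and those of the ring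
  afterwards as operators. The resulting subgroup is stable under all of R and contains G, so it is
  the whole module.\<close>

theorem finitely_generated_acc:
  assumes noeth: "noetherian_ring (R\<lparr>carrier := K\<rparr>)" and K: "K \<subseteq> carrier R"
    and A: "finite A" "A \<subseteq> carrier R" and gen: "carrier R = generate_ring R (K \<union> A)"
    and G: "finite G" "G \<subseteq> carrier M" and top: "\<And>H. submodule H R M \<Longrightarrow> G \<subseteq> H \<Longrightarrow> H = carrier M"
  shows "acc_below M (carrier R) (carrier M)"
proof -
  have z: "stable_subgroup M K {\<zero>\<^bsub>M\<^esub>}" by (rule stable_subgroupI) (use K in auto)
  have "acc_below M K {\<zero>\<^bsub>M\<^esub>}"
    unfolding acc_below_def
  proof (intro allI impI, elim conjE)
    fix L :: "nat \<Rightarrow> 'c set" assume "\<forall>s. stable_subgroup M K (L s)" "\<forall>s. L s \<subseteq> {\<zero>\<^bsub>M\<^esub>}"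
    then have "L s = {\<zero>\<^bsub>M\<^esub>}" for s using stable_closed(2) by blast
    then show "\<exists>s0. \<forall>s\<ge>s0. L s = L s0" by simp
  qed
  with G have "\<exists>H. stable_subgroup M K H \<and> acc_below M K H \<and> G \<subseteq> H"
  proof (induction G rule: finite_induct)
    case empty
    then show ?case using z by blast
  next
    case (insert g G)
    then obtain H where "stable_subgroup M K H" "acc_below M K H" "G \<subseteq> H" by auto
    with acc_add_generator[OF noeth K this(1,2), of g] insert show ?case by blast
  qed
  then obtain H0 where H0: "stable_subgroup M K H0" "acc_below M K H0" "G \<subseteq> H0" by blast
  from A have "\<exists>H. stable_subgroup M (K \<union> A) H \<and> acc_below M (K \<union> A) H \<and> G \<subseteq> H"
  proof (induction A rule: finite_induct)
    case empty
    then show ?case using H0 by auto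
  next
    case (insert a A)
    then obtain H where H: "stable_subgroup M (K \<union> A) H" "acc_below M (K \<union> A) H" "G \<subseteq> H" by auto
    have "K \<union> A \<subseteq> carrier R" "a \<in> carrier R" using insert K by auto
    from acc_adjoin[OF this H(1,2)] H(3) show ?case by (metis Un_insert_right order_trans)
  qed
  then obtain H where H: "stable_subgroup M (K \<union> A) H" "acc_below M (K \<union> A) H" "G \<subseteq> H" by blast
  note Hc = stable_closed[OF H(1)]
  have "\<forall>y\<in>H. r \<odot>\<^bsub>M\<^esub> y \<in> H" if "r \<in> generate_ring R (K \<union> A)" for r
    using that
  proof (induction r rule: generate_ring.induct)
    case one
    then show ?case using Hc(1) by auto
  next
    case (incl h)
    then show ?case using Hc(6) by auto
  next
    case (a_inv h)
    then have "h \<in> carrier R" using gen by simp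
    then show ?case using a_inv Hc(1,4) by (auto simp: smult_l_minus)
  next
    case (eng_add h1 h2)
    then have "h1 \<in> carrier R" "h2 \<in> carrier R" using gen by auto
    then show ?case using eng_add Hc(1,3) by (auto simp: smult_l_distr)
  next
    case (eng_mult h1 h2)
    then have "h1 \<in> carrier R" "h2 \<in> carrier R" using gen by auto
    then show ?case using eng_mult Hc(1) by (auto simp: smult_assoc1)
  qed
  then have "submodule H R M" using Hc gen by (intro submoduleI) auto
  from top[OF this H(3)] have HM: "H = carrier M" .
  show ?thesis
    unfolding acc_below_def
  proof (intro allI impI, elim conjE)
    fix L :: "nat \<Rightarrow> 'c set"
    assume L: "\<forall>s. stable_subgroup M (carrier R) (L s)" "\<forall>s. L s \<subseteq> carrier M" "\<forall>s. L s \<subseteq> L (Suc s)"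
    have "stable_subgroup M (K \<union> A) (L s)" for s using L(1) K A by (fastforce simp: stable_subgroup_def)
    then show "\<exists>s0. \<forall>s\<ge>s0. L s = L s0" using H(2) L(2,3) unfolding HM acc_below_def by blast
  qed
qed

end

section \<open>Quotients of rational vector spaces\<close>

text \<open>Injective modules have to be found in a prescribed type. Every abelian group embeds in a
  quotient of the space \<open>V\<close> of finitely supported rational functions on it, and \<open>V\<close> is not larger than
  the group as long as the latter is infinite.\<close>

definition scale :: "rat \<Rightarrow> ('n \<Rightarrow>\<^sub>0 rat) \<Rightarrow> ('n \<Rightarrow>\<^sub>0 rat)" where
  "scale q = Poly_Mapping.mapp (\<lambda>_. (*) q)"

lemma lookup_scale [simp]: "Poly_Mapping.lookup (scale q v) x = q * Poly_Mapping.lookup v x"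
  by (simp add: scale_def lookup_mapp when_def in_keys_iff)

lemma scale_simps: "scale (p + q) v = scale p v + scale q v" "scale q (v + w) = scale q v + scale q w"
  "scale p (scale q v) = scale (p * q) v" "scale 1 v = v" "scale 0 v = 0" "scale (- q) v = - scale q v"
  by (auto intro!: poly_mapping_eqI simp: lookup_add algebra_simps)

definition subgroup_closed :: "'v::ab_group_add set \<Rightarrow> bool" where
  "subgroup_closed K \<longleftrightarrow> 0 \<in> K \<and> (\<forall>v\<in>K. \<forall>w\<in>K. v + w \<in> K) \<and> (\<forall>v\<in>K. - v \<in> K)"

lemma subgroup_closed_diff: "subgroup_closed K \<Longrightarrow> v \<in> K \<Longrightarrow> w \<in> K \<Longrightarrow> v - w \<in> K"
  unfolding subgroup_closed_def by (metis diff_conv_add_uminus)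

text \<open>A partial homomorphism to \<open>V/K\<close> is encoded as an additive relation to \<open>V\<close> that relates
  \<open>0\<close> only to elements of \<open>K\<close>.\<close>

definition relation_subgroup :: "('n, 'q) ring_scheme \<Rightarrow> 'v::ab_group_add set \<Rightarrow> ('n \<times> 'v) set \<Rightarrow> bool" where
  "relation_subgroup N K G \<longleftrightarrow> G \<subseteq> carrier N \<times> UNIV \<and> (\<zero>\<^bsub>N\<^esub>, 0) \<in> G \<and>
     (\<forall>a v b w. (a, v) \<in> G \<longrightarrow> (b, w) \<in> G \<longrightarrow> (a \<oplus>\<^bsub>N\<^esub> b, v + w) \<in> G) \<and>
     (\<forall>a v. (a, v) \<in> G \<longrightarrow> (\<ominus>\<^bsub>N\<^esub> a, - v) \<in> G) \<and> (\<forall>v. (\<zero>\<^bsub>N\<^esub>, v) \<in> G \<longrightarrow> v \<in> K)"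

lemma relation_subgroupD:
  assumes "relation_subgroup N K G"
  shows "(a, v) \<in> G \<Longrightarrow> a \<in> carrier N" "(\<zero>\<^bsub>N\<^esub>, 0) \<in> G"
    "(a, v) \<in> G \<Longrightarrow> (b, w) \<in> G \<Longrightarrow> (a \<oplus>\<^bsub>N\<^esub> b, v + w) \<in> G"
    "(a, v) \<in> G \<Longrightarrow> (\<ominus>\<^bsub>N\<^esub> a, - v) \<in> G" "(\<zero>\<^bsub>N\<^esub>, v) \<in> G \<Longrightarrow> v \<in> K"
  using assms unfolding relation_subgroup_def by blast+

section \<open>Extension of additive relations with values in rational vector spaces\<close>

context abelian_group
begin

lemma int_multiple_add: "a \<in> carrier G \<Longrightarrow> add_pow G (i + j::int) a = add_pow G (i) a \<oplus> add_pow G (j) a"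
  using add.int_pow_mult by simp

lemma int_multiple_closed: "a \<in> carrier G \<Longrightarrow> add_pow G (i::int) a \<in> carrier G"
  using add.int_pow_closed by simp

lemma int_multiple_neg: "a \<in> carrier G \<Longrightarrow> add_pow G (- i::int) a = \<ominus> (add_pow G (i) a)"
  using add.int_pow_neg by simp

lemma int_multiple_zero: "add_pow G (0::int) a = \<zero>"
  by (simp add: add_pow_def)

lemma int_multiple_one: "a \<in> carrier G \<Longrightarrow> add_pow G (1::int) a = a"
  using add.int_pow_1 by simp

lemma int_multiple_mult: "a \<in> carrier G \<Longrightarrow> add_pow G (i * j::int) a = add_pow G (i) (add_pow G (j) a)"
  using add.int_pow_pow[of a i j] by (simp add: mult.commute)

lemma relation_subgroup_multiple:
  assumes S: "relation_subgroup G K S" and av: "(a, v :: 'n \<Rightarrow>\<^sub>0 rat) \<in> S"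
  shows "(add_pow G (m::int) a, scale (of_int m) v) \<in> S"
proof -
  note Sc = relation_subgroupD[OF S]
  have a: "a \<in> carrier G" using Sc(1) av by blast
  have nat: "(add_pow G (int k) a, scale (of_nat k) v) \<in> S" for k
  proof (induction k)
    case 0
    then show ?case using Sc(2) by (simp add: int_multiple_zero scale_simps)
  next
    case (Suc k)
    from Sc(3)[OF Suc av] show ?case
      using int_multiple_add[OF a, of "int k" 1] by (simp add: int_multiple_one a scale_simps add.commute)
  qed
  show ?thesis
  proof (cases "m \<ge> 0")
    case True
    then show ?thesis using nat[of "nat m"] by simp
  next
    case False
    from Sc(4)[OF nat[of "nat (- m)"]] show ?thesis
      using False int_multiple_neg[OF a, of "- m"] by (simp add: scale_simps(6)[symmetric])
  qed
qed

text \<open>Baer's argument over the integers: the value w at n must agree modulo K with S on those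
  multiples of n that lie in its domain. These are the multiples of pn for a least positive p, and a
  value at pn can be divided by p in a rational vector space.\<close>

lemma relation_subgroup_extend:
  fixes S :: "('a \<times> ('n \<Rightarrow>\<^sub>0 rat)) set"
  assumes S: "relation_subgroup G K S" and K: "subgroup_closed K" and n: "n \<in> carrier G"
  shows "\<exists>S'. relation_subgroup G K S' \<and> S \<subseteq> S' \<and> n \<in> Domain S'"
proof -
  note Sc = relation_subgroupD[OF S]
  have "\<exists>w. \<forall>m v. (add_pow G (m::int) n, v) \<in> S \<longrightarrow> v - scale (of_int m) w \<in> K"
  proof (cases "\<exists>m>0. add_pow G (m::int) n \<in> Domain S")
    \<comment> \<open>No nonzero multiple of n lies in the domain, so w = 0 will do.\<close>
    case False
    have "m = 0" if "(add_pow G (m::int) n, v) \<in> S" for m v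
    proof (rule ccontr)
      assume "m \<noteq> 0"
      then consider "m > 0" | "- m > 0" by linarith
      then show False
        using False that Sc(4)[OF that] int_multiple_neg[OF n, of m] by cases (force, metis Domain.DomainI)
    qed
    then have "v - scale (of_int m) 0 \<in> K" if "(add_pow G (m::int) n, v) \<in> S" for m v
      using that Sc(5)[of v] by (metis diff_zero int_multiple_zero of_int_0 scale_simps(5))
    then show ?thesis by blast
  next
    case True
    define p where "p = (LEAST k. k > 0 \<and> add_pow G (int k) n \<in> Domain S)"
    have ex: "\<exists>k. k > 0 \<and> add_pow G (int k) n \<in> Domain S"
    proof -
      from True obtain m where "m > 0" "add_pow G (m::int) n \<in> Domain S" by blast
      then show ?thesis by (intro exI[of _ "nat m"]) simp
    qed
    have p: "p > 0" "add_pow G (int p) n \<in> Domain S" using LeastI_ex[OF ex] by (auto simp: p_def)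
    have pmin: "k > 0 \<Longrightarrow> add_pow G (int k) n \<in> Domain S \<Longrightarrow> p \<le> k" for k
      unfolding p_def by (rule Least_le) simp
    from p(2) obtain v0 where v0: "(add_pow G (int p) n, v0) \<in> S" by blast
    define w where "w = scale (1 / of_nat p) v0"
    have "v - scale (of_int m) w \<in> K" if mv: "(add_pow G (m::int) n, v) \<in> S" for m v
    proof -
      let ?k = "m div int p"
      have k: "(add_pow G (?k * int p) n, scale (of_int ?k) v0) \<in> S"
        using relation_subgroup_multiple[OF S v0, of ?k] int_multiple_mult[OF n] by simp
      have "(add_pow G (m) n \<oplus> \<ominus> (add_pow G (?k * int p) n), v + - scale (of_int ?k) v0) \<in> S"
        by (rule Sc(3)[OF mv Sc(4)[OF k]])
      moreover have "add_pow G (m) n \<oplus> \<ominus> (add_pow G (?k * int p) n) = add_pow G (m mod int p) n"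
        using int_multiple_add[OF n, of m "- (?k * int p)"] int_multiple_neg[OF n]
        by (simp add: minus_div_mult_eq_mod[symmetric])
      ultimately have r: "(add_pow G (m mod int p) n, v - scale (of_int ?k) v0) \<in> S" by simp
      \<comment> \<open>The remainder is again the index of a multiple of n in the domain, so
        minimality of p forces it to vanish.\<close>
      have "m mod int p = 0"
      proof (rule ccontr)
        assume "m mod int p \<noteq> 0"
        moreover have "0 \<le> m mod int p" using p(1) by simp
        ultimately have "nat (m mod int p) > 0" by linarith
        moreover have "add_pow G (int (nat (m mod int p))) n \<in> Domain S" using r p(1) by auto
        ultimately have "p \<le> nat (m mod int p)" by (rule pmin)
        moreover have "m mod int p < int p" "0 \<le> m mod int p" using p(1) by simp_all
        ultimately show False by linarith
      qed
      then have mk: "?k * int p = m" by (metis minus_div_mult_eq_mod eq_iff_diff_eq_0)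
      have "rat_of_int (k * int p) * (1 / of_nat p) = of_int k" for k using p(1) by simp
      from this[of ?k] have "rat_of_int m * (1 / of_nat p) = of_int ?k" unfolding mk .
      then have "scale (of_int m) w = scale (of_int ?k) v0"
        unfolding w_def scale_simps(3) by (rule arg_cong)
      moreover have "v - scale (of_int ?k) v0 \<in> K" using r \<open>m mod int p = 0\<close> Sc(5) by (simp add: int_multiple_zero)
      ultimately show ?thesis by simp
    qed
    then show ?thesis by blast
  qed
  then obtain w where w: "\<And>m v. (add_pow G (m::int) n, v) \<in> S \<Longrightarrow> v - scale (of_int m) w \<in> K" by blast
  define S' where "S' = {(a \<oplus> add_pow G (m::int) n, v + scale (of_int m) w) | a v m. (a, v) \<in> S}"
  note nc = int_multiple_closed[OF n]
  have "relation_subgroup G K S'"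
    unfolding relation_subgroup_def
  proof (intro conjI allI impI)
    show "S' \<subseteq> carrier G \<times> UNIV" using Sc(1) nc by (auto simp: S'_def)
    have "(\<zero>, 0) = (\<zero> \<oplus> add_pow G (0::int) n, 0 + scale (of_int 0) w)" by (simp add: int_multiple_zero scale_simps)
    then show "(\<zero>, 0) \<in> S'" unfolding S'_def using Sc(2) by blast
  next
    fix a v b u assume "(a, v) \<in> S'" "(b, u) \<in> S'"
    then obtain a' v' m b' u' k where e: "a = a' \<oplus> add_pow G (m::int) n" "v = v' + scale (of_int m) w" "(a', v') \<in> S"
        "b = b' \<oplus> add_pow G (k::int) n" "u = u' + scale (of_int k) w" "(b', u') \<in> S" by (auto simp: S'_def)
    have "a \<oplus> b = (a' \<oplus> b') \<oplus> add_pow G (m + k) n" using e Sc(1) nc by (simp add: int_multiple_add n a_ac)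
    moreover have "v + u = (v' + u') + scale (of_int (m + k)) w" using e by (simp add: scale_simps)
    ultimately show "(a \<oplus> b, v + u) \<in> S'" unfolding S'_def using Sc(3)[OF e(3,6)] by blast
  next
    fix a v assume "(a, v) \<in> S'"
    then obtain a' v' m where e: "a = a' \<oplus> add_pow G (m::int) n" "v = v' + scale (of_int m) w" "(a', v') \<in> S"
      by (auto simp: S'_def)
    have "\<ominus> a = (\<ominus> a') \<oplus> add_pow G (- m) n" using e Sc(1) nc by (simp add: int_multiple_neg n minus_add)
    moreover have "- v = - v' + scale (of_int (- m)) w" using e by (simp add: scale_simps)
    ultimately show "(\<ominus> a, - v) \<in> S'" unfolding S'_def using Sc(4)[OF e(3)] by blast
  next
    fix v assume "(\<zero>, v) \<in> S'"
    then obtain a' v' m where e: "\<zero> = a' \<oplus> add_pow G (m::int) n" "v = v' + scale (of_int m) w" "(a', v') \<in> S"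
      by (auto simp: S'_def)
    have "add_pow G (m) n = \<ominus> a'" using e Sc(1) nc by (metis a_comm minus_equality minus_minus a_inv_closed)
    then have "(add_pow G (m) n, - v') \<in> S" using Sc(4)[OF e(3)] by simp
    from w[OF this] have "- v' - scale (of_int m) w \<in> K" .
    then have "- (- v' - scale (of_int m) w) \<in> K" using K unfolding subgroup_closed_def by blast
    then show "v \<in> K" using e by (simp add: add.commute)
  qed
  moreover have "S \<subseteq> S'"
  proof
    fix s assume "s \<in> S"
    then obtain a v where s: "s = (a, v)" "(a, v) \<in> S" by (cases s) auto
    then have "s = (a \<oplus> add_pow G (0::int) n, v + scale (of_int 0) w)"
      using Sc(1) by (simp add: int_multiple_zero scale_simps)
    then show "s \<in> S'" unfolding S'_def using s by blast
  qed
  moreover have "n \<in> Domain S'"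
  proof -
    have "(\<zero> \<oplus> add_pow G (1::int) n, 0 + scale (of_int 1) w) \<in> S'" unfolding S'_def using Sc(2) by blast
    then show ?thesis using n by (auto simp: int_multiple_one)
  qed
  ultimately show ?thesis by blast
qed

text \<open>Zorn's lemma gives a maximal relation, which is total by the one-element
  extension.\<close>

lemma relation_subgroup_total:
  fixes S :: "('a \<times> ('n \<Rightarrow>\<^sub>0 rat)) set"
  assumes S: "relation_subgroup G K S" and K: "subgroup_closed K"
  shows "\<exists>S'. relation_subgroup G K S' \<and> S \<subseteq> S' \<and> Domain S' = carrier G"
proof -
  let ?F = "{T. relation_subgroup G K T \<and> S \<subseteq> T}"
  have "\<exists>T\<in>?F. \<forall>X\<in>?F. T \<subseteq> X \<longrightarrow> X = T"
  proof (rule subset_Zorn_nonempty)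
    show "?F \<noteq> {}" using S by blast
    fix C assume C: "C \<noteq> {}" "subset.chain ?F C"
    have Cr: "relation_subgroup G K T" "S \<subseteq> T" if "T \<in> C" for T
      using C(2) that unfolding subset_chain_def by auto
    note Cc = relation_subgroupD[OF Cr(1)]
    have two: "\<exists>T\<in>C. p \<in> T \<and> q \<in> T" if "p \<in> \<Union>C" "q \<in> \<Union>C" for p q
      using that C(2) unfolding subset_chain_def by blast
    have "relation_subgroup G K (\<Union>C)"
      unfolding relation_subgroup_def
    proof (intro conjI allI impI)
      show "\<Union>C \<subseteq> carrier G \<times> UNIV" using Cc(1) by fast
      show "(\<zero>, 0) \<in> \<Union>C" using Cc(2) C(1) by blast
      show "(a \<oplus> b, v + w) \<in> \<Union>C" if "(a, v) \<in> \<Union>C" "(b, w) \<in> \<Union>C" for a v b w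
        using two[OF that] Cc(3) by blast
      show "(\<ominus> a, - v) \<in> \<Union>C" if "(a, v) \<in> \<Union>C" for a v
        using that Cc(4) by blast
      show "v \<in> K" if "(\<zero>, v) \<in> \<Union>C" for v using that Cc(5) by blast
    qed
    then show "\<Union>C \<in> ?F" using C(1) Cr(2) by blast
  qed
  then obtain T where TF: "T \<in> ?F" and max: "\<forall>X\<in>?F. T \<subseteq> X \<longrightarrow> X = T" by (rule bexE)
  then have T: "relation_subgroup G K T" "S \<subseteq> T" by auto
  have "n \<in> Domain T" if n: "n \<in> carrier G" for n
  proof -
    obtain X where "relation_subgroup G K X" "T \<subseteq> X" "n \<in> Domain X"
      using relation_subgroup_extend[OF T(1) K n] by blast
    then show ?thesis using bspec[OF max, of X] T(2) by auto
  qed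
  then show ?thesis using T relation_subgroupD(1)[OF T(1)] by blast
qed

end

text \<open>Cosets are encoded by chosen representatives, so that the carrier stays in the type of \<open>V\<close>.\<close>

definition canonical :: "'v::ab_group_add set \<Rightarrow> 'v \<Rightarrow> 'v" where
  "canonical K v = (SOME w. w - v \<in> K)"

definition quotient_group :: "'v::ab_group_add set \<Rightarrow> 'v ring" where
  "quotient_group K = \<lparr>carrier = range (canonical K), monoid.mult = undefined, one = undefined,
     zero = canonical K 0, add = (\<lambda>v w. canonical K (v + w))\<rparr>"

lemma quotient_group_simps [simp]:
  "carrier (quotient_group K) = range (canonical K)" "\<zero>\<^bsub>quotient_group K\<^esub> = canonical K 0"
  "v \<oplus>\<^bsub>quotient_group K\<^esub> w = canonical K (v + w)"
  by (simp_all add: quotient_group_def)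

context
  fixes K :: "'v::ab_group_add set" assumes K: "subgroup_closed K"
begin

lemma canonical_diff: "canonical K v - v \<in> K"
  unfolding canonical_def by (rule someI[of _ v]) (use K in \<open>simp add: subgroup_closed_def\<close>)

lemma canonical_eq: "canonical K v = canonical K w \<longleftrightarrow> v - w \<in> K"
proof
  assume e: "canonical K v = canonical K w"
  have "(canonical K w - w) - (canonical K v - v) \<in> K"
    by (rule subgroup_closed_diff[OF K canonical_diff canonical_diff])
  then show "v - w \<in> K" using e by simp
next
  assume vw: "v - w \<in> K"
  have "u - v \<in> K \<longleftrightarrow> u - w \<in> K" for u
  proof
    assume "u - v \<in> K"
    then have "(u - v) + (v - w) \<in> K" using vw K unfolding subgroup_closed_def by blast
    then show "u - w \<in> K" by simp
  next
    assume "u - w \<in> K"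
    from subgroup_closed_diff[OF K this vw] show "u - v \<in> K" by simp
  qed
  then show "canonical K v = canonical K w" by (simp add: canonical_def)
qed

lemma canonical_canonical [simp]: "canonical K (canonical K v) = canonical K v"
  using canonical_diff by (simp add: canonical_eq)

lemma canonical_add [simp]: "canonical K (canonical K v + w) = canonical K (v + w)"
    "canonical K (v + canonical K w) = canonical K (v + w)"
  using canonical_diff by (simp_all add: canonical_eq)

lemma quotient_group: "abelian_group (quotient_group K)"
proof (rule abelian_groupI)
  fix x assume "x \<in> carrier (quotient_group K)"
  then obtain v where "x = canonical K v" by auto
  then show "\<exists>y\<in>carrier (quotient_group K). y \<oplus>\<^bsub>quotient_group K\<^esub> x = \<zero>\<^bsub>quotient_group K\<^esub>"
    by (intro bexI[of _ "canonical K (- v)"]) auto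
next
  fix x y z :: 'v
  assume "x \<in> carrier (quotient_group K)" "y \<in> carrier (quotient_group K)" "z \<in> carrier (quotient_group K)"
  then show "x \<oplus>\<^bsub>quotient_group K\<^esub> y \<oplus>\<^bsub>quotient_group K\<^esub> z = x \<oplus>\<^bsub>quotient_group K\<^esub> (y \<oplus>\<^bsub>quotient_group K\<^esub> z)"
    by (simp add: add.assoc)
qed (auto simp: add.commute)

end

text \<open>Reading f as the relation of pairs (j x, v), with v a representative of f x, reduces the
  claim to the existence of total relations. Two values of such a relation at one element differ by
  an element of K, so it defines a map into V/K.\<close>

lemma quotient_group_extension:
  fixes K :: "('n \<Rightarrow>\<^sub>0 rat) set"
  assumes K: "subgroup_closed K" and L: "abelian_group L" and N: "abelian_group N"
    and j: "j \<in> carrier L \<rightarrow> carrier N" "\<And>x y. x \<in> carrier L \<Longrightarrow> y \<in> carrier L \<Longrightarrow> j (x \<oplus>\<^bsub>L\<^esub> y) = j x \<oplus>\<^bsub>N\<^esub> j y"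
    and inj: "inj_on j (carrier L)"
    and f: "f \<in> carrier L \<rightarrow> carrier (quotient_group K)"
      "\<And>x y. x \<in> carrier L \<Longrightarrow> y \<in> carrier L \<Longrightarrow> f (x \<oplus>\<^bsub>L\<^esub> y) = f x \<oplus>\<^bsub>quotient_group K\<^esub> f y"
  shows "\<exists>g \<in> carrier N \<rightarrow> carrier (quotient_group K).
    (\<forall>x\<in>carrier N. \<forall>y\<in>carrier N. g (x \<oplus>\<^bsub>N\<^esub> y) = g x \<oplus>\<^bsub>quotient_group K\<^esub> g y) \<and> (\<forall>x\<in>carrier L. g (j x) = f x)"
proof -
  interpret L: abelian_group L by fact
  interpret N: abelian_group N by fact
  note KK = K[unfolded subgroup_closed_def]
  define S where "S = {(j x, v) | x v. x \<in> carrier L \<and> canonical K v = f x}"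
  note Q = quotient_group[OF K]
  have f0: "f \<zero>\<^bsub>L\<^esub> = canonical K 0" using additive_zero[OF L Q f] by simp
  have "relation_subgroup N K S"
    unfolding relation_subgroup_def
  proof (intro conjI allI impI)
    show "S \<subseteq> carrier N \<times> UNIV" using j(1) by (auto simp: S_def)
    show "(\<zero>\<^bsub>N\<^esub>, 0) \<in> S" unfolding S_def using additive_zero[OF L N j] f0 by force
  next
    fix a v b w assume "(a, v) \<in> S" "(b, w) \<in> S"
    then obtain x y where e: "x \<in> carrier L" "y \<in> carrier L" "a = j x" "b = j y" "canonical K v = f x" "canonical K w = f y"
      by (auto simp: S_def)
    have "f (x \<oplus>\<^bsub>L\<^esub> y) = canonical K (v + w)" using f(2)[OF e(1,2)] by (simp add: e(5,6)[symmetric] K)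
    then show "(a \<oplus>\<^bsub>N\<^esub> b, v + w) \<in> S" unfolding S_def e(3,4) j(2)[OF e(1,2), symmetric] using e(1,2)
      by (intro CollectI exI[of _ "x \<oplus>\<^bsub>L\<^esub> y"] exI[of _ "v + w"]) simp
  next
    fix a v assume "(a, v) \<in> S"
    then obtain x where e: "x \<in> carrier L" "a = j x" "canonical K v = f x" by (auto simp: S_def)
    obtain u where u: "f (\<ominus>\<^bsub>L\<^esub> x) = canonical K u" using f(1) e(1) by force
    have "canonical K (u + v) = canonical K 0"
      using f(2)[of "\<ominus>\<^bsub>L\<^esub> x" x] e(1) e(3)[symmetric] u f0 by (simp add: L.l_neg K)
    then have "u + v \<in> K" by (simp add: canonical_eq[OF K])
    then have neg: "- (u + v) \<in> K" using KK by blast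
    have eq: "- (u + v) = - v - u" by (metis add.commute minus_add_distrib diff_conv_add_uminus)
    from neg have "- v - u \<in> K" unfolding eq .
    then have "canonical K (- v) = f (\<ominus>\<^bsub>L\<^esub> x)" using u by (simp add: canonical_eq[OF K])
    then show "(\<ominus>\<^bsub>N\<^esub> a, - v) \<in> S" unfolding S_def using e(1,2) additive_neg[OF L N j e(1)]
      by (intro CollectI exI[of _ "\<ominus>\<^bsub>L\<^esub> x"] exI[of _ "- v"]) simp
  next
    fix v assume "(\<zero>\<^bsub>N\<^esub>, v) \<in> S"
    then obtain x where e: "x \<in> carrier L" "j x = \<zero>\<^bsub>N\<^esub>" "canonical K v = f x" by (auto simp: S_def)
    then have "x = \<zero>\<^bsub>L\<^esub>" using inj additive_zero[OF L N j] by (metis L.zero_closed inj_onD)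
    then have "canonical K v = canonical K 0" using e f0 by simp
    then show "v \<in> K" by (simp add: canonical_eq[OF K])
  qed
  from N.relation_subgroup_total[OF this K] obtain T
    where T: "relation_subgroup N K T" "S \<subseteq> T" "Domain T = carrier N" by blast
  note Tc = relation_subgroupD[OF T(1)]
  define g where "g n = canonical K (SOME v. (n, v) \<in> T)" for n
  have g: "g n = canonical K v" if nv: "(n, v) \<in> T" for n v
  proof -
    let ?w = "SOME v. (n, v) \<in> T"
    have "(n, ?w) \<in> T" using nv by (rule someI)
    from Tc(3)[OF this Tc(4)[OF nv]] have "(\<zero>\<^bsub>N\<^esub>, ?w - v) \<in> T" using Tc(1)[OF nv] by (simp add: N.r_neg)
    then show ?thesis unfolding g_def using Tc(5) by (simp add: canonical_eq[OF K])
  qed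
  have total: "\<exists>v. (n, v) \<in> T" if "n \<in> carrier N" for n using T(3) that by blast
  show ?thesis
  proof (intro bexI[of _ g] conjI ballI)
    fix x y assume "x \<in> carrier N" "y \<in> carrier N"
    then obtain v w where vw: "(x, v) \<in> T" "(y, w) \<in> T" using total by metis
    show "g (x \<oplus>\<^bsub>N\<^esub> y) = g x \<oplus>\<^bsub>quotient_group K\<^esub> g y"
      using g[OF vw(1)] g[OF vw(2)] g[OF Tc(3)[OF vw]] by (simp add: K)
  next
    fix x assume x: "x \<in> carrier L"
    then obtain v where v: "f x = canonical K v" using f(1) by force
    then have "(j x, v) \<in> T" using T(2) x by (force simp: S_def)
    then show "g (j x) = f x" using g v by simp
  qed (auto simp: g_def)
qed

section \<open>Graded injective modules\<close>

text \<open>Additive maps from R into copies of D, one for each internal degree u: the module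
  coinduced from a graded abelian group with all parts equal to D. The value zero outside the
  carrier makes each map unique as a HOL function.\<close>

definition cofree_space :: "'r graded_ring \<Rightarrow> 'd ring \<Rightarrow> (int \<Rightarrow> 'r \<Rightarrow> 'd) set" where
  "cofree_space R D = {\<Phi>. \<forall>u. \<Phi> u \<in> carrier R \<rightarrow> carrier D \<and>
     (\<forall>r\<in>carrier R. \<forall>s\<in>carrier R. \<Phi> u (r \<oplus>\<^bsub>R\<^esub> s) = \<Phi> u r \<oplus>\<^bsub>D\<^esub> \<Phi> u s) \<and>
     (\<forall>r. r \<notin> carrier R \<longrightarrow> \<Phi> u r = \<zero>\<^bsub>D\<^esub>)}"

text \<open>An element of degree \<open>t\<close> is a family of homomorphisms from the part of degree \<open>u - t\<close> of the
  ring to a copy of \<open>D\<close> in degree \<open>u\<close>.\<close>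

definition cofree_proj :: "'r graded_ring \<Rightarrow> 'd ring \<Rightarrow> int \<Rightarrow> (int \<Rightarrow> 'r \<Rightarrow> 'd) \<Rightarrow> int \<Rightarrow> 'r \<Rightarrow> 'd" where
  "cofree_proj R D t \<Phi> = (\<lambda>u r. if r \<in> carrier R \<and> t \<le> u then \<Phi> u (ring_component R (nat (u - t)) r) else \<zero>\<^bsub>D\<^esub>)"

definition cofree_full :: "'r graded_ring \<Rightarrow> 'd ring \<Rightarrow> ('r, int \<Rightarrow> 'r \<Rightarrow> 'd) graded_module" where
  "cofree_full R D = \<lparr>carrier = cofree_space R D, monoid.mult = undefined, one = undefined,
     zero = (\<lambda>u r. \<zero>\<^bsub>D\<^esub>), add = (\<lambda>\<Phi> \<Psi> u r. \<Phi> u r \<oplus>\<^bsub>D\<^esub> \<Psi> u r),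
     smult = (\<lambda>a \<Phi> u r. if r \<in> carrier R then \<Phi> u (a \<otimes>\<^bsub>R\<^esub> r) else \<zero>\<^bsub>D\<^esub>),
     part = (\<lambda>t. {\<Phi> \<in> cofree_space R D. cofree_proj R D t \<Phi> = \<Phi>})\<rparr>"

definition cofree :: "'r graded_ring \<Rightarrow> 'd ring \<Rightarrow> ('r, int \<Rightarrow> 'r \<Rightarrow> 'd) graded_module" where
  "cofree R D = (cofree_full R D)\<lparr>carrier :=
     {\<Phi> \<in> cofree_space R D. finite {t. cofree_proj R D t \<Phi> \<noteq> (\<lambda>u r. \<zero>\<^bsub>D\<^esub>)}}\<rparr>"

text \<open>The adjunction between forgetting scalars and coinduction: additive maps
  \<open>h u\<close> on the parts of degree u give a graded homomorphism into the cofree module, and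
  evaluation at 1 recovers \<open>h u\<close> on the part of degree u.\<close>

definition cofree_map ::
    "'r graded_ring \<Rightarrow> 'd ring \<Rightarrow> ('r, 'n) graded_module \<Rightarrow> (int \<Rightarrow> 'n \<Rightarrow> 'd) \<Rightarrow> 'n \<Rightarrow> int \<Rightarrow> 'r \<Rightarrow> 'd" where
  "cofree_map R D N h n = (\<lambda>u r. if r \<in> carrier R then h u (module_component N u (r \<odot>\<^bsub>N\<^esub> n)) else \<zero>\<^bsub>D\<^esub>)"

locale cofree_setup = graded_ring R + D: abelian_group D
  for R :: "'r graded_ring" (structure) and D :: "'d ring"
begin

abbreviation "S \<equiv> cofree_space R D"
abbreviation "prj \<equiv> cofree_proj R D"
abbreviation "F \<equiv> cofree_full R D"
abbreviation "E \<equiv> cofree R D"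
abbreviation "Z \<equiv> \<zero>\<^bsub>F\<^esub>"

lemma spaceD:
  assumes "\<Phi> \<in> S"
  shows "r \<in> carrier R \<Longrightarrow> \<Phi> u r \<in> carrier D"
    "r \<in> carrier R \<Longrightarrow> s \<in> carrier R \<Longrightarrow> \<Phi> u (r \<oplus> s) = \<Phi> u r \<oplus>\<^bsub>D\<^esub> \<Phi> u s"
    "r \<notin> carrier R \<Longrightarrow> \<Phi> u r = \<zero>\<^bsub>D\<^esub>" "\<Phi> u r \<in> carrier D"
proof -
  show 1: "r \<in> carrier R \<Longrightarrow> \<Phi> u r \<in> carrier D"
    "r \<in> carrier R \<Longrightarrow> s \<in> carrier R \<Longrightarrow> \<Phi> u (r \<oplus> s) = \<Phi> u r \<oplus>\<^bsub>D\<^esub> \<Phi> u s"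
    and 2: "r \<notin> carrier R \<Longrightarrow> \<Phi> u r = \<zero>\<^bsub>D\<^esub>"
    using assms by (auto simp: cofree_space_def)
  show "\<Phi> u r \<in> carrier D" using 1(1) 2 by (cases "r \<in> carrier R") auto
qed

lemma space_zero: "\<Phi> \<in> S \<Longrightarrow> \<Phi> u \<zero> = \<zero>\<^bsub>D\<^esub>"
  by (rule additive_zero[OF abelian_group_axioms D.abelian_group_axioms]) (auto dest: spaceD)

lemma spaceI:
  assumes "\<And>u r. r \<in> carrier R \<Longrightarrow> \<Phi> u r \<in> carrier D"
    "\<And>u r s. r \<in> carrier R \<Longrightarrow> s \<in> carrier R \<Longrightarrow> \<Phi> u (r \<oplus> s) = \<Phi> u r \<oplus>\<^bsub>D\<^esub> \<Phi> u s"
    "\<And>u r. r \<notin> carrier R \<Longrightarrow> \<Phi> u r = \<zero>\<^bsub>D\<^esub>"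
  shows "\<Phi> \<in> S"
  using assms by (auto simp: cofree_space_def)

lemma full_simps [simp]:
  "carrier F = S" "part F t = {\<Phi> \<in> S. prj t \<Phi> = \<Phi>}"
  by (simp_all add: cofree_full_def)

lemma full_apply: "Z u r = \<zero>\<^bsub>D\<^esub>" "(\<Phi> \<oplus>\<^bsub>F\<^esub> \<Psi>) u r = \<Phi> u r \<oplus>\<^bsub>D\<^esub> \<Psi> u r"
  "(a \<odot>\<^bsub>F\<^esub> \<Phi>) u r = (if r \<in> carrier R then \<Phi> u (a \<otimes> r) else \<zero>\<^bsub>D\<^esub>)"
  by (simp_all add: cofree_full_def)

lemma full_module: "module R F"
proof (rule moduleI)
  show "abelian_group F"
  proof (rule abelian_groupI)
    fix \<Phi> assume P: "\<Phi> \<in> carrier F"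
    have "(\<lambda>u r. \<ominus>\<^bsub>D\<^esub> \<Phi> u r) \<in> carrier F"
      using spaceD[OF P[unfolded full_simps]] by (simp add: cofree_space_def D.minus_add)
    moreover have "(\<lambda>u r. \<ominus>\<^bsub>D\<^esub> \<Phi> u r) \<oplus>\<^bsub>F\<^esub> \<Phi> = \<zero>\<^bsub>F\<^esub>"
      using spaceD(4)[OF P[unfolded full_simps]] by (auto simp: fun_eq_iff full_apply D.l_neg)
    ultimately show "\<exists>\<Psi>\<in>carrier F. \<Psi> \<oplus>\<^bsub>F\<^esub> \<Phi> = \<zero>\<^bsub>F\<^esub>" by blast
  next
    show "\<Phi> \<oplus>\<^bsub>F\<^esub> \<Psi> \<in> carrier F" if "\<Phi> \<in> carrier F" "\<Psi> \<in> carrier F" for \<Phi> \<Psi>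
      using that spaceD[of \<Phi>] spaceD[of \<Psi>] unfolding full_simps by (intro spaceI) (auto simp: full_apply D.a_ac)
    show "\<zero>\<^bsub>F\<^esub> \<in> carrier F" by (simp add: cofree_space_def full_apply)
  qed (use spaceD(4) in \<open>auto simp: fun_eq_iff full_apply D.a_ac\<close>)
  show "cring R" by (rule cring_axioms)
  show "a \<odot>\<^bsub>F\<^esub> \<Phi> \<in> carrier F" if "a \<in> carrier R" "\<Phi> \<in> carrier F" for a \<Phi>
    using that spaceD[of \<Phi>] unfolding full_simps by (intro spaceI) (auto simp: full_apply r_distr)
  show "\<one> \<odot>\<^bsub>F\<^esub> \<Phi> = \<Phi>" if "\<Phi> \<in> carrier F" for \<Phi>
    using that spaceD(3)[of \<Phi>] by (auto simp: fun_eq_iff full_apply)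
qed (use spaceD in \<open>auto simp: fun_eq_iff full_apply l_distr r_distr m_ac\<close>)

sublocale F: module R F by (rule full_module)

lemma prj_space: "\<Phi> \<in> S \<Longrightarrow> prj t \<Phi> \<in> S"
  by (rule spaceI) (auto simp: cofree_proj_def RD.component_closed RD.component_add spaceD)

lemma prj_add: "\<Phi> \<in> S \<Longrightarrow> \<Psi> \<in> S \<Longrightarrow> prj t (\<Phi> \<oplus>\<^bsub>F\<^esub> \<Psi>) = prj t \<Phi> \<oplus>\<^bsub>F\<^esub> prj t \<Psi>"
  by (auto simp: fun_eq_iff full_apply cofree_proj_def)

lemma prj_prj: "\<Phi> \<in> S \<Longrightarrow> prj s (prj t \<Phi>) = (if s = t then prj t \<Phi> else Z)"
proof (intro ext)
  fix u r assume P: "\<Phi> \<in> S"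
  show "prj s (prj t \<Phi>) u r = (if s = t then prj t \<Phi> else Z) u r"
  proof (cases "r \<in> carrier R \<and> s \<le> u \<and> t \<le> u")
    case True
    have "ring_component R (nat (u - s)) r \<in> rpart R (nat (u - s))" using True by (simp add: RD.component_part)
    then have "ring_component R (nat (u - t)) (ring_component R (nat (u - s)) r) =
        (if nat (u - t) = nat (u - s) then ring_component R (nat (u - s)) r else \<zero>)"
      using RD.component_same RD.component_other by auto
    then show ?thesis using True space_zero[OF P] by (auto simp: cofree_proj_def RD.component_closed full_apply)
  qed (auto simp: cofree_proj_def full_apply)
qed

lemma prj_smult:
  assumes a: "a \<in> rpart R i" and P: "\<Phi> \<in> S"
  shows "prj t (a \<odot>\<^bsub>F\<^esub> \<Phi>) = a \<odot>\<^bsub>F\<^esub> prj (t - int i) \<Phi>"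
proof (intro ext)
  fix u r
  have ac: "a \<in> carrier R" using a RD.part_carrier by blast
  show "prj t (a \<odot>\<^bsub>F\<^esub> \<Phi>) u r = (a \<odot>\<^bsub>F\<^esub> prj (t - int i) \<Phi>) u r"
  proof (cases "r \<in> carrier R")
    case True
    have eq: "nat (u - (t - int i)) = nat (u - t) + i" if "t \<le> u" using that by simp
    have lt: "nat (u - (t - int i)) < i" if "\<not> t \<le> u" "t - int i \<le> u" using that by linarith
    show ?thesis using True ac space_zero[OF P] ring_component_mult[OF a True] lt
      by (auto simp: full_apply cofree_proj_def RD.component_closed eq)
  qed (simp add: full_apply cofree_proj_def)
qed

text \<open>The value of \<open>\<Phi> u\<close> on an element of degree i comes from the projection
  of degree u - i alone.\<close>

lemma prj_all_zero:
  assumes P: "\<Phi> \<in> S" and z: "\<And>t. prj t \<Phi> = Z"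
  shows "\<Phi> = Z"
proof (intro ext)
  fix u r
  show "\<Phi> u r = Z u r"
  proof (cases "r \<in> carrier R")
    case True
    then show ?thesis
    proof (induction r rule: RD.homogeneous_induct)
      case (part i r)
      have "prj (u - int i) \<Phi> u r = \<Phi> u r"
        using part RD.component_same RD.part_carrier by (simp add: cofree_proj_def)
      then show ?case using z by (simp add: full_apply)
    qed (use spaceD[OF P] in \<open>auto simp: full_apply\<close>)
  qed (use spaceD[OF P] in \<open>auto simp: full_apply\<close>)
qed

lemma prj_zero: "prj t Z = Z"
  by (auto simp: fun_eq_iff cofree_proj_def full_apply)

lemma cofree_carrier: "carrier E = {\<Phi> \<in> S. finite {t. prj t \<Phi> \<noteq> Z}}"
  by (simp add: cofree_def cofree_full_def)

lemma cofree_simps: "\<zero>\<^bsub>E\<^esub> = \<zero>\<^bsub>F\<^esub>" "\<Phi> \<oplus>\<^bsub>E\<^esub> \<Psi> = \<Phi> \<oplus>\<^bsub>F\<^esub> \<Psi>" "a \<odot>\<^bsub>E\<^esub> \<Phi> = a \<odot>\<^bsub>F\<^esub> \<Phi>" "part E = part F"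
  by (simp_all add: cofree_def)

lemma prj_neg:
  assumes "\<Phi> \<in> S" shows "prj t (\<ominus>\<^bsub>F\<^esub> \<Phi>) = \<ominus>\<^bsub>F\<^esub> prj t \<Phi>"
  by (rule additive_neg[OF F.abelian_group_axioms F.abelian_group_axioms]) (auto simp: assms prj_space prj_add)

lemma finite_support_add:
  assumes "\<Phi> \<in> carrier E" "\<Psi> \<in> carrier E" shows "\<Phi> \<oplus>\<^bsub>F\<^esub> \<Psi> \<in> carrier E"
proof -
  have "prj t (\<Phi> \<oplus>\<^bsub>F\<^esub> \<Psi>) = Z" if "prj t \<Phi> = Z" "prj t \<Psi> = Z" for t
    using assms that F.M.l_zero[OF F.M.zero_closed] by (simp add: cofree_carrier prj_add)
  then have "{t. prj t (\<Phi> \<oplus>\<^bsub>F\<^esub> \<Psi>) \<noteq> Z} \<subseteq> {t. prj t \<Phi> \<noteq> Z} \<union> {t. prj t \<Psi> \<noteq> Z}" by blast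
  then show ?thesis using assms F.M.a_closed[of \<Phi> \<Psi>] finite_subset by (fastforce simp: cofree_carrier)
qed

lemma cofree_submodule: "submodule (carrier E) R F"
proof (rule F.submoduleI)
  show "carrier E \<subseteq> carrier F" by (auto simp: cofree_carrier)
  show "\<zero>\<^bsub>F\<^esub> \<in> carrier E" using F.M.zero_closed by (simp add: cofree_carrier prj_zero)
  show "\<ominus>\<^bsub>F\<^esub> \<Phi> \<in> carrier E" if P: "\<Phi> \<in> carrier E" for \<Phi>
  proof -
    have PS: "\<Phi> \<in> S" using P by (simp add: cofree_carrier)
    have "prj t (\<ominus>\<^bsub>F\<^esub> \<Phi>) = Z" if "prj t \<Phi> = Z" for t
      using prj_neg[OF PS] that by simp
    then have "{t. prj t (\<ominus>\<^bsub>F\<^esub> \<Phi>) \<noteq> Z} \<subseteq> {t. prj t \<Phi> \<noteq> Z}" by blast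
    then show ?thesis using P PS F.M.a_inv_closed[of \<Phi>] finite_subset by (fastforce simp: cofree_carrier)
  qed
  show "\<Phi> \<oplus>\<^bsub>F\<^esub> \<Psi> \<in> carrier E" if "\<Phi> \<in> carrier E" "\<Psi> \<in> carrier E" for \<Phi> \<Psi>
    using finite_support_add that .
  fix a \<Phi> assume a: "a \<in> carrier R" and P: "\<Phi> \<in> carrier E"
  have PS: "\<Phi> \<in> S" using P by (simp add: cofree_carrier)
  from a show "a \<odot>\<^bsub>F\<^esub> \<Phi> \<in> carrier E"
  proof (induction a rule: RD.homogeneous_induct)
    case (part i a)
    have ac: "a \<in> carrier R" using part RD.part_carrier by blast
    have "prj t (a \<odot>\<^bsub>F\<^esub> \<Phi>) = Z" if "prj (t - int i) \<Phi> = Z" for t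
      using prj_smult[OF part PS, of t] that ac by simp
    then have "{t. prj t (a \<odot>\<^bsub>F\<^esub> \<Phi>) \<noteq> Z} \<subseteq> (\<lambda>t. t + int i) ` {t. prj t \<Phi> \<noteq> Z}"
      by (intro subsetI image_eqI[of _ _ "_ - int i"]) auto
    then show ?case using P PS F.smult_closed[OF ac, of \<Phi>] finite_subset by (fastforce simp: cofree_carrier)
  next
    case (add a b)
    then show ?case using finite_support_add PS by (simp add: F.smult_l_distr)
  qed
qed

lemma cofree_module: "module R E"
  using submodule.submodule_is_module[OF cofree_submodule full_module] by (simp add: cofree_def)

lemma part_E: "\<Phi> \<in> part E t \<longleftrightarrow> \<Phi> \<in> S \<and> prj t \<Phi> = \<Phi>"
  by (simp add: cofree_simps)

lemma part_prj: "\<Phi> \<in> part E t \<Longrightarrow> s \<noteq> t \<Longrightarrow> prj s \<Phi> = Z"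
  using prj_prj[of \<Phi> s t] unfolding part_E by metis

lemma part_E_carrier: "\<Phi> \<in> part E t \<Longrightarrow> \<Phi> \<in> carrier E"
proof -
  assume P: "\<Phi> \<in> part E t"
  then have "{s. prj s \<Phi> \<noteq> Z} \<subseteq> {t}" using part_prj by blast
  then show ?thesis using P finite_subset by (fastforce simp: cofree_carrier part_E)
qed

lemma cofree_graded_module: "graded_module R E"
proof -
  interpret E: module R E by (rule cofree_module)
  have ES: "\<Phi> \<in> S" if "\<Phi> \<in> carrier E" for \<Phi> using that by (simp add: cofree_carrier)
  have "internal_direct_sum E (part E)"
  proof (rule E.internal_direct_sumI[where p = prj])
    show "additive_subgroup (part E t) E" for t
    proof (rule E.additive_subgroupI')
      show "part E t \<subseteq> carrier E" using part_E_carrier by blast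
      show "\<zero>\<^bsub>E\<^esub> \<in> part E t" using F.M.zero_closed by (simp add: part_E prj_zero cofree_simps)
      show "\<Phi> \<oplus>\<^bsub>E\<^esub> \<Psi> \<in> part E t" if "\<Phi> \<in> part E t" "\<Psi> \<in> part E t" for \<Phi> \<Psi>
        using that F.M.a_closed[of \<Phi> \<Psi>] unfolding part_E by (simp add: cofree_simps prj_add)
      show "\<ominus>\<^bsub>E\<^esub> \<Phi> \<in> part E t" if P: "\<Phi> \<in> part E t" for \<Phi>
      proof -
        have PS: "\<Phi> \<in> S" using P part_E by blast
        have "\<ominus>\<^bsub>E\<^esub> \<Phi> = \<ominus>\<^bsub>F\<^esub> \<Phi>"
        proof (rule E.minus_equality)
          show "\<ominus>\<^bsub>F\<^esub> \<Phi> \<in> carrier E" using F.submoduleE(3)[OF cofree_submodule] part_E_carrier[OF P] by blast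
          show "\<ominus>\<^bsub>F\<^esub> \<Phi> \<oplus>\<^bsub>E\<^esub> \<Phi> = \<zero>\<^bsub>E\<^esub>" using PS F.M.l_neg[of \<Phi>] by (simp add: cofree_simps)
        qed (use part_E_carrier[OF P] in auto)
        then show ?thesis using P PS F.M.a_inv_closed[of \<Phi>] prj_neg[OF PS] unfolding part_E by simp
      qed
    qed
    show "prj t \<Phi> \<in> part E t" if "\<Phi> \<in> carrier E" for t \<Phi>
      using ES[OF that] prj_space prj_prj unfolding part_E by simp
    show "prj t (\<Phi> \<oplus>\<^bsub>E\<^esub> \<Psi>) = prj t \<Phi> \<oplus>\<^bsub>E\<^esub> prj t \<Psi>" if "\<Phi> \<in> carrier E" "\<Psi> \<in> carrier E" for t \<Phi> \<Psi>
      using ES that by (simp add: cofree_simps prj_add)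
    show "prj t \<Phi> = \<Phi>" if "\<Phi> \<in> part E t" for t \<Phi> using that part_E by blast
    show "prj s \<Phi> = \<zero>\<^bsub>E\<^esub>" if "\<Phi> \<in> part E t" "s \<noteq> t" for s t \<Phi>
      using part_prj[OF that] by (simp add: cofree_simps)
    show "finite {t. prj t \<Phi> \<noteq> \<zero>\<^bsub>E\<^esub>}" if "\<Phi> \<in> carrier E" for \<Phi>
      using that by (simp add: cofree_carrier cofree_simps)
    show "\<Phi> = \<zero>\<^bsub>E\<^esub>" if "\<Phi> \<in> carrier E" "\<And>t. prj t \<Phi> = \<zero>\<^bsub>E\<^esub>" for \<Phi>
      using prj_all_zero[OF ES[OF that(1)]] that(2) by (simp add: cofree_simps)
  qed
  moreover have "a \<odot>\<^bsub>E\<^esub> \<Phi> \<in> part E (int i + t)" if "a \<in> rpart R i" "\<Phi> \<in> part E t" for a i \<Phi> t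
    using that F.smult_closed[OF RD.part_carrier[OF that(1)], of \<Phi>] prj_smult[OF that(1), of \<Phi> "int i + t"]
    unfolding part_E by (simp add: cofree_simps)
  ultimately show ?thesis
    by (intro graded_module.intro graded_ring_axioms cofree_module graded_module_axioms.intro)
qed

context
  fixes N :: "('r, 'n) graded_module" and h :: "int \<Rightarrow> 'n \<Rightarrow> 'd"
  assumes N: "graded_module R N" and h: "\<And>u n. n \<in> carrier N \<Longrightarrow> h u n \<in> carrier D"
    and h_add: "\<And>u m n. m \<in> carrier N \<Longrightarrow> n \<in> carrier N \<Longrightarrow> h u (m \<oplus>\<^bsub>N\<^esub> n) = h u m \<oplus>\<^bsub>D\<^esub> h u n"
begin

interpretation N: graded_module R N by (rule N)

lemma h_zero: "h u \<zero>\<^bsub>N\<^esub> = \<zero>\<^bsub>D\<^esub>"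
  by (rule additive_zero[OF N.abelian_group_axioms D.abelian_group_axioms]) (auto simp: h h_add)

lemma cofree_map_space: "n \<in> carrier N \<Longrightarrow> cofree_map R D N h n \<in> S"
  by (rule spaceI) (auto simp: cofree_map_def h h_add N.MD.component_closed N.smult_l_distr N.MD.component_add)

lemma cofree_map_add:
  "m \<in> carrier N \<Longrightarrow> n \<in> carrier N \<Longrightarrow> cofree_map R D N h (m \<oplus>\<^bsub>N\<^esub> n) = cofree_map R D N h m \<oplus>\<^bsub>F\<^esub> cofree_map R D N h n"
  by (auto simp: fun_eq_iff full_apply cofree_map_def h_add N.MD.component_closed N.smult_r_distr N.MD.component_add)

lemma cofree_map_part: "n \<in> part N s \<Longrightarrow> cofree_map R D N h n \<in> part E s"
  unfolding part_E using cofree_map_space[of n] N.MD.part_carrier[of n s]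
  by (auto simp: fun_eq_iff cofree_map_def cofree_proj_def component_smult_homogeneous[OF N] RD.component_closed h_zero
      RD.component_same[OF RD.component_part])

lemma cofree_map_carrier: "n \<in> carrier N \<Longrightarrow> cofree_map R D N h n \<in> carrier E"
proof (induction n rule: N.MD.homogeneous_induct)
  case (part i x)
  then show ?case using part_E_carrier cofree_map_part by blast
next
  case (add x y)
  then show ?case using finite_support_add by (simp add: cofree_map_add)
qed

lemma cofree_map_hom: "cofree_map R D N h \<in> graded_hom R N E"
  unfolding graded_hom_def
proof (intro CollectI conjI ballI allI)
  show "cofree_map R D N h (a \<odot>\<^bsub>N\<^esub> x) = a \<odot>\<^bsub>E\<^esub> cofree_map R D N h x" if "a \<in> carrier R" "x \<in> carrier N" for a x
    using that by (auto simp: fun_eq_iff full_apply cofree_simps cofree_map_def N.smult_assoc1[symmetric] m_comm)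
qed (use cofree_map_carrier cofree_map_add cofree_map_part in \<open>auto simp: cofree_simps\<close>)

lemma cofree_map_eq_zero_iff:
  assumes n: "n \<in> carrier N"
  shows "cofree_map R D N h n = \<zero>\<^bsub>E\<^esub> \<longleftrightarrow> (\<forall>u. \<forall>r\<in>carrier R. h u (module_component N u (r \<odot>\<^bsub>N\<^esub> n)) = \<zero>\<^bsub>D\<^esub>)"
  by (auto simp: fun_eq_iff cofree_map_def cofree_simps full_apply)

end

end

lemma graded_hom_component:
  assumes "graded_module R L" "graded_module R E" "f \<in> graded_hom R L E" "l \<in> carrier L"
  shows "f (module_component L t l) = module_component E t (f l)"
proof -
  interpret L: graded_module R L by fact
  interpret E: graded_module R E by fact
  have f: "\<And>x y. x \<in> carrier L \<Longrightarrow> y \<in> carrier L \<Longrightarrow> f (x \<oplus>\<^bsub>L\<^esub> y) = f x \<oplus>\<^bsub>E\<^esub> f y"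
    "\<And>x. x \<in> carrier L \<Longrightarrow> f x \<in> carrier E" "\<And>x t. x \<in> part L t \<Longrightarrow> f x \<in> part E t"
    using assms(3) unfolding graded_hom_def by blast+
  have f0: "f \<zero>\<^bsub>L\<^esub> = \<zero>\<^bsub>E\<^esub>"
    by (rule additive_zero[OF L.abelian_group_axioms E.abelian_group_axioms]) (auto simp: f)
  show ?thesis
    using assms(4)
  proof (induction l rule: L.MD.homogeneous_induct)
    case (part i x)
    show ?case
      using L.MD.component_same[OF part] L.MD.component_other[OF part, of t]
        E.MD.component_same[OF f(3)[OF part]] E.MD.component_other[OF f(3)[OF part], of t] f0
      by (cases "t = i") auto
  next
    case (add x y)
    then show ?case by (simp add: L.MD.component_add E.MD.component_add f L.MD.component_closed)
  qed
qed

lemma (in cofree_setup) component_cofree: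
  assumes "\<Phi> \<in> carrier E" shows "component E (part E) t \<Phi> = prj t \<Phi>"
proof -
  interpret E: graded_module R E by (rule cofree_graded_module)
  show ?thesis using assms
  proof (induction \<Phi> rule: E.MD.homogeneous_induct)
    case (part i x)
    then show ?case
      using E.MD.component_same[OF part] E.MD.component_other[OF part, of t] part_prj[OF part, of t] part
      unfolding part_E by (cases "t = i") (simp_all add: cofree_simps(1))
  next
    case (add x y)
    then show ?case by (simp only: E.MD.component_add) (simp add: cofree_simps(2) cofree_carrier prj_add)
  qed
qed

text \<open>By adjunction, a graded homomorphism into a cofree module is determined by the additive
  maps obtained by evaluation at 1, and these extend because D is a quotient V/K of a rational
  space. The extension takes place among abelian groups, for test modules with elements of any
  type.\<close>

lemma cofree_extension:
  fixes R (structure) and K :: "('k \<Rightarrow>\<^sub>0 rat) set"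
  defines "D \<equiv> quotient_group K"
  assumes gr: "graded_ring R" and K: "subgroup_closed K" and L: "graded_module R L" and N: "graded_module R N"
    and j: "j \<in> graded_hom R L N" "inj_on j (carrier L)" and f: "f \<in> graded_hom R L (cofree R D)"
  shows "\<exists>g\<in>graded_hom R N (cofree R D). \<forall>x\<in>carrier L. g (j x) = f x"
proof -
  interpret cofree_setup R D
    unfolding D_def by (intro cofree_setup.intro gr quotient_group K)
  interpret L: graded_module R L by (rule L)
  interpret N: graded_module R N by (rule N)
  have jj: "j \<in> carrier L \<rightarrow> carrier N" "\<And>x y. x \<in> carrier L \<Longrightarrow> y \<in> carrier L \<Longrightarrow> j (x \<oplus>\<^bsub>L\<^esub> y) = j x \<oplus>\<^bsub>N\<^esub> j y"
    "\<And>a x. a \<in> carrier R \<Longrightarrow> x \<in> carrier L \<Longrightarrow> j (a \<odot>\<^bsub>L\<^esub> x) = a \<odot>\<^bsub>N\<^esub> j x"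
    using j(1) unfolding graded_hom_def by blast+
  have ff: "\<And>x. x \<in> carrier L \<Longrightarrow> f x \<in> carrier E" "\<And>x y. x \<in> carrier L \<Longrightarrow> y \<in> carrier L \<Longrightarrow> f (x \<oplus>\<^bsub>L\<^esub> y) = f x \<oplus>\<^bsub>E\<^esub> f y"
    "\<And>a x. a \<in> carrier R \<Longrightarrow> x \<in> carrier L \<Longrightarrow> f (a \<odot>\<^bsub>L\<^esub> x) = a \<odot>\<^bsub>E\<^esub> f x"
    using f unfolding graded_hom_def by blast+
  have fS: "f x \<in> S" if "x \<in> carrier L" for x using ff(1)[OF that] by (simp add: cofree_carrier)
  have "\<exists>g \<in> carrier N \<rightarrow> carrier D. (\<forall>x\<in>carrier N. \<forall>y\<in>carrier N. g (x \<oplus>\<^bsub>N\<^esub> y) = g x \<oplus>\<^bsub>D\<^esub> g y) \<and>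
      (\<forall>x\<in>carrier L. g (j x) = f x u \<one>)" for u
    unfolding D_def
  proof (rule quotient_group_extension[OF K L.abelian_group_axioms N.abelian_group_axioms jj(1,2) j(2)])
    show "(\<lambda>x. f x u \<one>) \<in> carrier L \<rightarrow> carrier (quotient_group K)"
      using spaceD(4)[OF fS] unfolding D_def by blast
    show "f (x \<oplus>\<^bsub>L\<^esub> y) u \<one> = f x u \<one> \<oplus>\<^bsub>quotient_group K\<^esub> f y u \<one>" if "x \<in> carrier L" "y \<in> carrier L" for x y
      unfolding D_def[symmetric] ff(2)[OF that] cofree_simps full_apply ..
  qed
  then obtain h where h: "\<And>u. h u \<in> carrier N \<rightarrow> carrier D"
    "\<And>u x y. x \<in> carrier N \<Longrightarrow> y \<in> carrier N \<Longrightarrow> h u (x \<oplus>\<^bsub>N\<^esub> y) = h u x \<oplus>\<^bsub>D\<^esub> h u y"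
    "\<And>u x. x \<in> carrier L \<Longrightarrow> h u (j x) = f x u \<one>" by metis
  have hc: "h u n \<in> carrier D" if "n \<in> carrier N" for u n using h(1) that by blast
  show ?thesis
  proof (intro bexI[of _ "cofree_map R D N h"] ballI)
    show "cofree_map R D N h \<in> graded_hom R N E"
      by (rule cofree_map_hom[OF N hc h(2)])
    fix l assume l: "l \<in> carrier L"
    show "cofree_map R D N h (j l) = f l"
    proof (intro ext)
      fix u r
      show "cofree_map R D N h (j l) u r = f l u r"
      proof (cases "r \<in> carrier R")
        case True
        have rl: "r \<odot>\<^bsub>L\<^esub> l \<in> carrier L" using True l by simp
        \<comment> \<open>Linearity moves the argument r to the module side: f l u r is the value of
          f (r l) at 1, and at 1 only the component of degree u counts.\<close>
        have "cofree_map R D N h (j l) u r = h u (j (module_component L u (r \<odot>\<^bsub>L\<^esub> l)))"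
          using True l by (simp add: cofree_map_def jj(3)[symmetric] graded_hom_component[OF L N j(1) rl])
        also have "\<dots> = f (module_component L u (r \<odot>\<^bsub>L\<^esub> l)) u \<one>"
          using h(3) L.MD.component_closed[OF rl] by simp
        also have "\<dots> = prj u (f (r \<odot>\<^bsub>L\<^esub> l)) u \<one>"
          using graded_hom_component[OF L cofree_graded_module f rl] component_cofree[OF ff(1)[OF rl]] by simp
        also have "\<dots> = f (r \<odot>\<^bsub>L\<^esub> l) u \<one>"
          by (simp add: cofree_proj_def RD.component_same[OF one_part])
        also have "\<dots> = f l u r"
          using True l by (simp add: ff(3) cofree_simps full_apply)
        finally show ?thesis .
      next
        case False
        then show ?thesis using spaceD(3)[OF fS[OF l]] by (simp add: cofree_map_def)
      qed
    qed
  qed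
qed

text \<open>The group N/B is the group I of integral functions on N modulo those whose evaluation
  lies in B, and I sits in the rational space V. The subgroup B enters as a kernel so that cokernels
  need not be formed, which would change the type at each step of a resolution.\<close>

lemma divisible_embedding:
  fixes N :: "('n, 'q) ring_scheme"
  assumes N: "abelian_group N" and B: "additive_subgroup B N"
  shows "\<exists>(K :: ('n \<Rightarrow>\<^sub>0 rat) set) h. subgroup_closed K \<and> (\<forall>n\<in>carrier N. h n \<in> carrier (quotient_group K)) \<and>
    (\<forall>m\<in>carrier N. \<forall>n\<in>carrier N. h (m \<oplus>\<^bsub>N\<^esub> n) = h m \<oplus>\<^bsub>quotient_group K\<^esub> h n) \<and>
    (\<forall>n\<in>carrier N. h n = \<zero>\<^bsub>quotient_group K\<^esub> \<longleftrightarrow> n \<in> B)"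
proof -
  interpret N: abelian_group N by fact
  have Bc: "\<zero>\<^bsub>N\<^esub> \<in> B" "x \<in> B \<Longrightarrow> y \<in> B \<Longrightarrow> x \<oplus>\<^bsub>N\<^esub> y \<in> B" "x \<in> B \<Longrightarrow> \<ominus>\<^bsub>N\<^esub> x \<in> B" for x y
    using B additive_subgroup.zero_closed additive_subgroup.a_closed N.additive_subgroup_neg by metis+
  define I where "I = {k :: 'n \<Rightarrow>\<^sub>0 rat. Poly_Mapping.keys k \<subseteq> carrier N \<and> (\<forall>x. Poly_Mapping.lookup k x \<in> \<int>)}"
  \<comment> \<open>An integral function k stands for the formal sum of the k(x) x; the floor only
    converts its integral values to integers.\<close>
  define ev where "ev k = (\<Oplus>\<^bsub>N\<^esub>x\<in>Poly_Mapping.keys k. add_pow N \<lfloor>Poly_Mapping.lookup k x\<rfloor> x)" for k :: "'n \<Rightarrow>\<^sub>0 rat"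
  have pc: "add_pow N (i::int) x \<in> carrier N" if "x \<in> carrier N" for i x using N.int_multiple_closed that .
  have ev_eq: "ev k = (\<Oplus>\<^bsub>N\<^esub>x\<in>A. add_pow N \<lfloor>Poly_Mapping.lookup k x\<rfloor> x)"
    if "finite A" "Poly_Mapping.keys k \<subseteq> A" "A \<subseteq> carrier N" for k A
    unfolding ev_def
    by (rule N.add.finprod_mono_neutral_cong_left)
      (use that pc in \<open>auto simp: in_keys_iff N.int_multiple_zero Pi_def\<close>)
  have ev_closed: "ev k \<in> carrier N" if "k \<in> I" for k
    unfolding ev_def using that pc by (intro N.finsum_closed) (auto simp: I_def)
  have I_add: "k + l \<in> I" if "k \<in> I" "l \<in> I" for k l
    using that Poly_Mapping.keys_add[of k l] by (auto simp: I_def lookup_add)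
  have ev_add: "ev (k + l) = ev k \<oplus>\<^bsub>N\<^esub> ev l" if "k \<in> I" "l \<in> I" for k l
  proof -
    let ?A = "Poly_Mapping.keys k \<union> Poly_Mapping.keys l"
    have A: "finite ?A" "?A \<subseteq> carrier N" using that by (auto simp: I_def)
    have fl: "\<lfloor>Poly_Mapping.lookup (k + l) x\<rfloor> = \<lfloor>Poly_Mapping.lookup k x\<rfloor> + \<lfloor>Poly_Mapping.lookup l x\<rfloor>" for x
      using that by (auto simp: I_def lookup_add elim!: Ints_cases)
    have "ev (k + l) = (\<Oplus>\<^bsub>N\<^esub>x\<in>?A. add_pow N \<lfloor>Poly_Mapping.lookup (k + l) x\<rfloor> x)"
      by (rule ev_eq) (use A Poly_Mapping.keys_add[of k l] in auto)
    also have "\<dots> = (\<Oplus>\<^bsub>N\<^esub>x\<in>?A. add_pow N \<lfloor>Poly_Mapping.lookup k x\<rfloor> x \<oplus>\<^bsub>N\<^esub> add_pow N \<lfloor>Poly_Mapping.lookup l x\<rfloor> x)"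
      by (rule N.finsum_cong') (use A pc in \<open>auto simp: fl N.int_multiple_add\<close>)
    also have "\<dots> = ev k \<oplus>\<^bsub>N\<^esub> ev l"
      using A pc by (subst N.finsum_addf) (auto simp: Pi_def ev_eq[of ?A])
    finally show ?thesis .
  qed
  have I0: "0 \<in> I" by (simp add: I_def)
  have ev0: "ev 0 = \<zero>\<^bsub>N\<^esub>" by (simp add: ev_def)
  have I_neg: "- k \<in> I" if "k \<in> I" for k using that by (auto simp: I_def)
  have ev_neg: "ev (- k) = \<ominus>\<^bsub>N\<^esub> ev k" if "k \<in> I" for k
    using ev_add[OF I_neg[OF that] that] ev0 ev_closed that I_neg
    by (intro N.minus_equality[symmetric]) auto
  define e where "e n = (Poly_Mapping.single n 1 :: 'n \<Rightarrow>\<^sub>0 rat)" for n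
  have eI: "e n \<in> I" if "n \<in> carrier N" for n using that by (auto simp: I_def e_def lookup_single when_def)
  have ev_e: "ev (e n) = n" if "n \<in> carrier N" for n
    using that by (simp add: ev_def e_def lookup_single N.finsum_singleton[of n "{n}" "\<lambda>x. x", simplified] N.int_multiple_one)
  define K where "K = {k \<in> I. ev k \<in> B}"
  have K: "subgroup_closed K"
    unfolding subgroup_closed_def K_def using I0 ev0 I_add ev_add I_neg ev_neg Bc by auto
  have KI: "k - l \<in> K \<longleftrightarrow> ev k \<ominus>\<^bsub>N\<^esub> ev l \<in> B" if "k \<in> I" "l \<in> I" for k l
    using ev_add[OF that(1) I_neg[OF that(2)]] ev_neg[OF that(2)] I_add[OF that(1) I_neg[OF that(2)]]
    by (simp add: K_def a_minus_def)
  show ?thesis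
  proof (intro exI[of _ K] exI[of _ "\<lambda>n. canonical K (e n)"] conjI ballI K)
    fix m n assume mn: "m \<in> carrier N" "n \<in> carrier N"
    have "e (m \<oplus>\<^bsub>N\<^esub> n) - (e m + e n) \<in> K"
      using mn Bc(1) by (subst KI) (auto simp: eI I_add ev_add ev_e a_minus_def N.r_neg)
    then show "canonical K (e (m \<oplus>\<^bsub>N\<^esub> n)) = canonical K (e m) \<oplus>\<^bsub>quotient_group K\<^esub> canonical K (e n)"
      by (simp add: K canonical_eq[OF K])
  next
    fix n assume n: "n \<in> carrier N"
    show "canonical K (e n) = \<zero>\<^bsub>quotient_group K\<^esub> \<longleftrightarrow> n \<in> B"
    proof -
      have "canonical K (e n) = canonical K 0 \<longleftrightarrow> e n \<in> K" using canonical_eq[OF K, of "e n" 0] by simp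
      also have "\<dots> \<longleftrightarrow> n \<in> B" using n by (simp add: K_def eI ev_e)
      finally show ?thesis by simp
    qed
  qed simp
qed

section \<open>Moving modules into the prescribed type\<close>

definition transport :: "('a \<Rightarrow> 'b) \<Rightarrow> ('r, 'a) graded_module \<Rightarrow> ('r, 'b) graded_module" where
  "transport e E = (let i = the_inv_into (carrier E) e in
     \<lparr>carrier = e ` carrier E, monoid.mult = undefined, one = undefined, zero = e \<zero>\<^bsub>E\<^esub>,
      add = (\<lambda>x y. e (i x \<oplus>\<^bsub>E\<^esub> i y)), smult = (\<lambda>a x. e (a \<odot>\<^bsub>E\<^esub> i x)), part = (\<lambda>t. e ` part E t)\<rparr>)"

lemma transport:
  assumes "graded_module R E" and inj: "inj_on e (carrier E)"
  shows "graded_module R (transport e E)" "e \<in> graded_hom R E (transport e E)"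
    "the_inv_into (carrier E) e \<in> graded_hom R (transport e E) E"
proof -
  interpret E: graded_module R E by fact
  define i where "i = the_inv_into (carrier E) e"
  have i: "i (e x) = x" if "x \<in> carrier E" for x using the_inv_into_f_f[OF inj that] by (simp add: i_def)
  let ?T = "transport e E"
  have T [simp]: "carrier ?T = e ` carrier E" "\<zero>\<^bsub>?T\<^esub> = e \<zero>\<^bsub>E\<^esub>" "x \<oplus>\<^bsub>?T\<^esub> y = e (i x \<oplus>\<^bsub>E\<^esub> i y)"
    "a \<odot>\<^bsub>?T\<^esub> x = e (a \<odot>\<^bsub>E\<^esub> i x)" "part ?T t = e ` part E t" for x y a t
    by (simp_all add: transport_def i_def Let_def)
  have ag: "abelian_group ?T"
  proof (rule abelian_groupI)
    fix x assume "x \<in> carrier ?T"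
    then obtain y where y: "y \<in> carrier E" "x = e y" by auto
    then show "\<exists>z\<in>carrier ?T. z \<oplus>\<^bsub>?T\<^esub> x = \<zero>\<^bsub>?T\<^esub>"
      by (intro bexI[of _ "e (\<ominus>\<^bsub>E\<^esub> y)"]) (auto simp: i E.M.l_neg)
  qed (auto simp: i E.M.a_ac)
  interpret T: abelian_group ?T by (rule ag)
  have mod: "module R ?T"
    by (rule moduleI[OF E.cring_axioms ag])
      (auto simp: i E.smult_l_distr E.smult_r_distr E.smult_assoc1)
  have Tneg: "\<ominus>\<^bsub>?T\<^esub> e x = e (\<ominus>\<^bsub>E\<^esub> x)" if "x \<in> carrier E" for x
    by (rule T.minus_equality) (use that in \<open>auto simp: i E.M.l_neg\<close>)
  have eeq: "e x = e y \<longleftrightarrow> x = y" if "x \<in> carrier E" "y \<in> carrier E" for x y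
    using inj that by (meson inj_on_def)
  have ids: "internal_direct_sum ?T (part ?T)"
  proof (rule T.internal_direct_sumI[where p = "\<lambda>t x. e (module_component E t (i x))"])
    show "additive_subgroup (part ?T t) ?T" for t
    proof (rule T.additive_subgroupI')
      show "part ?T t \<subseteq> carrier ?T" using E.MD.part_carrier by auto
      show "\<zero>\<^bsub>?T\<^esub> \<in> part ?T t" using E.MD.part_zero by auto
      show "x \<oplus>\<^bsub>?T\<^esub> y \<in> part ?T t" if "x \<in> part ?T t" "y \<in> part ?T t" for x y
        using that E.MD.part_add by (auto simp: i E.MD.part_carrier)
      show "\<ominus>\<^bsub>?T\<^esub> x \<in> part ?T t" if "x \<in> part ?T t" for x
        using that E.M.additive_subgroup_neg[OF E.MD.part_subgroup] by (auto simp: Tneg E.MD.part_carrier)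
    qed
    fix x assume "x \<in> carrier ?T"
    then obtain y where y: "y \<in> carrier E" "x = e y" by auto
    show "e (module_component E t (i x)) \<in> part ?T t" for t
      using y i E.MD.component_part by simp
    have "e (module_component E t (i x)) = \<zero>\<^bsub>?T\<^esub> \<longleftrightarrow> module_component E t y = \<zero>\<^bsub>E\<^esub>" for t
      using y i eeq E.MD.component_closed by simp
    note z = this
    show "finite {t. e (module_component E t (i x)) \<noteq> \<zero>\<^bsub>?T\<^esub>}"
      unfolding z using E.MD.finite_component y by simp
    show "x = \<zero>\<^bsub>?T\<^esub>" if "\<And>t. e (module_component E t (i x)) = \<zero>\<^bsub>?T\<^esub>"
      using E.MD.component_eqI[of y "\<zero>\<^bsub>E\<^esub>"] that y E.MD.component_zero unfolding z by simp
    fix x' t assume "x' \<in> carrier ?T"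
    then obtain y' where y': "y' \<in> carrier E" "x' = e y'" by auto
    show "e (module_component E t (i (x \<oplus>\<^bsub>?T\<^esub> x'))) = e (module_component E t (i x)) \<oplus>\<^bsub>?T\<^esub> e (module_component E t (i x'))"
      using y y' by (simp add: i E.MD.component_add E.MD.component_closed)
  next
    fix t x assume "x \<in> part ?T t"
    then obtain y where y: "y \<in> part E t" "x = e y" by auto
    then have iy: "i x = y" using i E.MD.part_carrier by simp
    show "e (module_component E t (i x)) = x" using y iy E.MD.component_same by simp
    show "e (module_component E s (i x)) = \<zero>\<^bsub>?T\<^esub>" if "s \<noteq> t" for s
      using y iy E.MD.component_other that by simp
  qed
  show "graded_module R ?T"
  proof (intro graded_module.intro E.graded_ring_axioms mod graded_module_axioms.intro ids)
    show "a \<odot>\<^bsub>?T\<^esub> x \<in> part ?T (int k + t)" if "a \<in> rpart R k" "x \<in> part ?T t" for a k x t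
    proof -
      from that(2) obtain y where y: "y \<in> part E t" "x = e y" by auto
      then have "a \<odot>\<^bsub>?T\<^esub> x = e (a \<odot>\<^bsub>E\<^esub> y)" using i[OF E.MD.part_carrier[OF y(1)]] by simp
      then show ?thesis using E.part_smult[OF that(1) y(1)] by simp
    qed
  qed
  show "e \<in> graded_hom R E ?T" unfolding graded_hom_def by (simp add: i Pi_def)
  show "the_inv_into (carrier E) e \<in> graded_hom R ?T E"
    unfolding i_def[symmetric] graded_hom_def
  proof (intro CollectI conjI allI ballI)
    show "i ` part ?T t \<subseteq> part E t" for t using i[OF E.MD.part_carrier] by fastforce
    show "i (x \<oplus>\<^bsub>?T\<^esub> y) = i x \<oplus>\<^bsub>E\<^esub> i y" if "x \<in> carrier ?T" "y \<in> carrier ?T" for x y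
      using that by (auto simp: i)
    show "i (a \<odot>\<^bsub>?T\<^esub> x) = a \<odot>\<^bsub>E\<^esub> i x" if "a \<in> carrier R" "x \<in> carrier ?T" for a x
      using that by (auto simp: i)
  qed (auto simp: i)
qed

text \<open>A finitely supported function is coded by a list of the elements of its support with
  their values, and such a list by one element of \<open>universe\<close>, whose numerical argument
  is split so as to hold all entries side by side.\<close>

lemma inj_finsupp_universe:
  assumes c: "inj (c :: 'n \<Rightarrow> ('r, 'm) universe)"
  shows "\<exists>e :: ('n \<Rightarrow>\<^sub>0 rat) \<Rightarrow> ('r, 'm) universe. inj e"
proof -
  define ls where "ls v = (SOME xs. set xs = {(x, Poly_Mapping.lookup v x) |x. x \<in> Poly_Mapping.keys v})" for v :: "'n \<Rightarrow>\<^sub>0 rat"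
  have ls: "set (ls v) = {(x, Poly_Mapping.lookup v x) |x. x \<in> Poly_Mapping.keys v}" for v :: "'n \<Rightarrow>\<^sub>0 rat"
  proof -
    have "finite {(x, Poly_Mapping.lookup v x) |x. x \<in> Poly_Mapping.keys v}" by simp
    from finite_list[OF this] show ?thesis unfolding ls_def by (rule someI_ex)
  qed
  have inj_ls: "inj ls"
  proof (rule injI, rule poly_mapping_eqI)
    fix v w x assume "ls v = ls w"
    then have e: "(x, q) \<in> {(x, Poly_Mapping.lookup v x) |x. x \<in> Poly_Mapping.keys v} \<longleftrightarrow>
        (x, q) \<in> {(x, Poly_Mapping.lookup w x) |x. x \<in> Poly_Mapping.keys w}" for q using ls by metis
    show "Poly_Mapping.lookup v x = Poly_Mapping.lookup w x"
      using e[of "Poly_Mapping.lookup v x"] e[of "Poly_Mapping.lookup w x"] by (auto simp: in_keys_iff)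
  qed
  \<comment> \<open>With k decoded as (i, b), row 0 holds the length and row i > 0 holds entry i -
    1: its rational at b = 0, and the values of its code under c from b = 1 on.\<close>
  define code :: "('n \<times> rat) list \<Rightarrow> ('r, 'm) universe" where
    "code xs = (\<lambda>l k. case prod_decode k of (i, b) \<Rightarrow>
       if i = 0 then Inr (length xs)
       else if b = 0 then Inr (to_nat (snd (xs ! (i - 1)))) else c (fst (xs ! (i - 1))) l (b - 1))" for xs
  have "inj code"
  proof (rule injI)
    fix xs ys assume e: "code xs = code ys"
    have len: "length xs = length ys"
      using fun_cong[OF fun_cong[OF e], of "[]" "prod_encode (0, 0)"] by (simp add: code_def)
    show "xs = ys"
    proof (rule nth_equalityI[OF len])
      fix i assume "i < length xs"
      have "snd (xs ! i) = snd (ys ! i)"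
        using fun_cong[OF fun_cong[OF e], of "[]" "prod_encode (Suc i, 0)"] by (simp add: code_def)
      moreover have "c (fst (xs ! i)) l b = c (fst (ys ! i)) l b" for l b
        using fun_cong[OF fun_cong[OF e], of l "prod_encode (Suc i, Suc b)"] by (simp add: code_def)
      then have "fst (xs ! i) = fst (ys ! i)" using c by (meson ext injD)
      ultimately show "xs ! i = ys ! i" by (simp add: prod_eq_iff)
    qed
  qed
  then have "inj (code \<circ> ls)" using inj_ls by (rule inj_compose)
  then show ?thesis by blast
qed

text \<open>A list over \<open>'r\<close> absorbs one more argument from \<open>'r\<close> as its
  head, and the number absorbs the degree; the tail and the remaining number are passed on to the
  code of the value.\<close>

lemma inj_functions_universe:
  assumes c: "inj (c :: 'v \<Rightarrow> ('r, 'm) universe)"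
  shows "\<exists>e :: (int \<Rightarrow> 'r \<Rightarrow> 'v) \<Rightarrow> ('r, 'm) universe. inj e"
proof -
  define e :: "(int \<Rightarrow> 'r \<Rightarrow> 'v) \<Rightarrow> ('r, 'm) universe" where
    "e \<Phi> = (\<lambda>l k. case l of [] \<Rightarrow> Inr 0 | r # l' \<Rightarrow> (case prod_decode k of (a, b) \<Rightarrow> c (\<Phi> (int_decode a) r) l' b))" for \<Phi>
  have "inj e"
  proof (rule injI, intro ext)
    fix \<Phi> \<Psi> u r assume eq: "e \<Phi> = e \<Psi>"
    have "c (\<Phi> u r) l b = c (\<Psi> u r) l b" for l b
    proof -
      have "e \<Phi> (r # l) (prod_encode (int_encode u, b)) = e \<Psi> (r # l) (prod_encode (int_encode u, b))"
        unfolding eq ..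
      then show ?thesis by (simp add: e_def)
    qed
    then show "\<Phi> u r = \<Psi> u r" using c by (meson ext injD)
  qed
  then show ?thesis by blast
qed

lemma graded_hom_comp:
  assumes f: "f \<in> graded_hom R X Y" and g: "g \<in> graded_hom R Y Z"
  shows "g \<circ> f \<in> graded_hom R X Z"
  unfolding graded_hom_def
proof (intro CollectI conjI ballI allI)
  have ff: "\<And>x. x \<in> carrier X \<Longrightarrow> f x \<in> carrier Y" "\<And>t. f ` part X t \<subseteq> part Y t"
    "\<And>x y. x \<in> carrier X \<Longrightarrow> y \<in> carrier X \<Longrightarrow> f (x \<oplus>\<^bsub>X\<^esub> y) = f x \<oplus>\<^bsub>Y\<^esub> f y"
    "\<And>a x. a \<in> carrier R \<Longrightarrow> x \<in> carrier X \<Longrightarrow> f (a \<odot>\<^bsub>X\<^esub> x) = a \<odot>\<^bsub>Y\<^esub> f x"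
    using f unfolding graded_hom_def by blast+
  have gg: "\<And>x. x \<in> carrier Y \<Longrightarrow> g x \<in> carrier Z" "\<And>t. g ` part Y t \<subseteq> part Z t"
    "\<And>x y. x \<in> carrier Y \<Longrightarrow> y \<in> carrier Y \<Longrightarrow> g (x \<oplus>\<^bsub>Y\<^esub> y) = g x \<oplus>\<^bsub>Z\<^esub> g y"
    "\<And>a x. a \<in> carrier R \<Longrightarrow> x \<in> carrier Y \<Longrightarrow> g (a \<odot>\<^bsub>Y\<^esub> x) = a \<odot>\<^bsub>Z\<^esub> g x"
    using g unfolding graded_hom_def by blast+
  show "g \<circ> f \<in> carrier X \<rightarrow> carrier Z" using ff(1) gg(1) by auto
  show "(g \<circ> f) ` part X t \<subseteq> part Z t" for t using ff(2)[of t] gg(2)[of t] by auto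
qed (use f g in \<open>auto simp: graded_hom_def Pi_iff\<close>)

text \<open>Divisible embedding, coinduction and coding compose to a map with kernel exactly B, that
  is, an embedding of N/B. An element maps to zero when all components of all its multiples lie in
  B; since B is a graded submodule, this means that the element itself lies in B.\<close>

lemma injective_embedding:
  fixes R :: "'r graded_ring" and N :: "('r, 'n) graded_module" and c :: "'n \<Rightarrow> ('r, 'm) universe"
  assumes N: "graded_module R N" and c: "inj c" and B: "submodule B R N"
    and B_comp: "\<And>x t. x \<in> B \<Longrightarrow> module_component N t x \<in> B"
  shows "\<exists>(E :: ('r, ('r, 'm) universe) graded_module) d. graded_module R E \<and> graded_injective R E \<and>
     d \<in> graded_hom R N E \<and> {x \<in> carrier N. d x = \<zero>\<^bsub>E\<^esub>} = B"
proof -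
  interpret N: graded_module R N by (rule N)
  note Bc = N.submoduleE[OF B]
  have "additive_subgroup B N" using B by (simp add: additive_subgroup_def submodule_def)
  from divisible_embedding[OF N.abelian_group_axioms this] obtain K :: "('n \<Rightarrow>\<^sub>0 rat) set" and h
    where K: "subgroup_closed K" and h: "\<And>n. n \<in> carrier N \<Longrightarrow> h n \<in> carrier (quotient_group K)"
      "\<And>m n. m \<in> carrier N \<Longrightarrow> n \<in> carrier N \<Longrightarrow> h (m \<oplus>\<^bsub>N\<^esub> n) = h m \<oplus>\<^bsub>quotient_group K\<^esub> h n"
      "\<And>n. n \<in> carrier N \<Longrightarrow> h n = \<zero>\<^bsub>quotient_group K\<^esub> \<longleftrightarrow> n \<in> B" by blast
  interpret C: cofree_setup R "quotient_group K"
    by (intro cofree_setup.intro N.graded_ring quotient_group K)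
  let ?F = "cofree R (quotient_group K)"
  define d where "d = cofree_map R (quotient_group K) N (\<lambda>u. h)"
  have d: "d \<in> graded_hom R N ?F" unfolding d_def by (rule C.cofree_map_hom[OF N h(1,2)])
  obtain c1 :: "('n \<Rightarrow>\<^sub>0 rat) \<Rightarrow> ('r, 'm) universe" where "inj c1" using inj_finsupp_universe[OF c] by blast
  then obtain e :: "(int \<Rightarrow> 'r \<Rightarrow> ('n \<Rightarrow>\<^sub>0 rat)) \<Rightarrow> ('r, 'm) universe" where "inj e"
    using inj_functions_universe by blast
  then have e: "inj_on e (carrier ?F)" using inj_on_subset by blast
  note T = transport[OF C.cofree_graded_module e]
  interpret T: graded_module R "transport e ?F" by (rule T(1))
  let ?i = "the_inv_into (carrier ?F) e"
  have eF: "e x \<in> carrier (transport e ?F)" if "x \<in> carrier ?F" for x using T(2) that by (auto simp: graded_hom_def)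
  have "graded_injective R (transport e ?F)"
    unfolding graded_injective_def
  proof (intro allI impI, elim conjE)
    fix L N' :: "('r, 'r) graded_module" and j f
    assume L: "graded_module R L" and N': "graded_module R N'" and j: "j \<in> graded_hom R L N'" "inj_on j (carrier L)"
      and f: "f \<in> graded_hom R L (transport e ?F)"
    have "(?i \<circ> f) \<in> graded_hom R L ?F" by (rule graded_hom_comp[OF f T(3)])
    from cofree_extension[OF N.graded_ring K L N' j this] obtain g
      where g: "g \<in> graded_hom R N' ?F" "\<And>x. x \<in> carrier L \<Longrightarrow> g (j x) = (?i \<circ> f) x" by blast
    have "(e \<circ> g) (j x) = f x" if x: "x \<in> carrier L" for x
    proof -
      have "f x \<in> carrier (transport e ?F)" using f x by (auto simp: graded_hom_def)
      then have "f x \<in> e ` carrier ?F" by (simp add: transport_def Let_def)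
      then show ?thesis using g(2)[OF x] f_the_inv_into_f[OF e] by simp
    qed
    then show "\<exists>g\<in>graded_hom R N' (transport e ?F). \<forall>x\<in>carrier L. g (j x) = f x"
      using graded_hom_comp[OF g(1) T(2)] by blast
  qed
  moreover have "e \<circ> d \<in> graded_hom R N (transport e ?F)" by (rule graded_hom_comp[OF d T(2)])
  moreover have "{x \<in> carrier N. (e \<circ> d) x = \<zero>\<^bsub>transport e ?F\<^esub>} = B"
  proof -
    have "(e \<circ> d) x = \<zero>\<^bsub>transport e ?F\<^esub> \<longleftrightarrow> x \<in> B" if x: "x \<in> carrier N" for x
    proof -
      have "d x \<in> carrier ?F" using d x by (auto simp: graded_hom_def)
      moreover have "\<zero>\<^bsub>?F\<^esub> \<in> carrier ?F" using C.cofree_submodule C.F.submoduleE(2) C.cofree_module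
        by (meson abelian_group_def abelian_monoid.zero_closed module.axioms(2))
      ultimately have "(e \<circ> d) x = \<zero>\<^bsub>transport e ?F\<^esub> \<longleftrightarrow> d x = \<zero>\<^bsub>?F\<^esub>"
        using e by (simp add: transport_def Let_def inj_on_eq_iff)
      also have "\<dots> \<longleftrightarrow> (\<forall>u. \<forall>r\<in>carrier R. module_component N u (r \<odot>\<^bsub>N\<^esub> x) \<in> B)"
        unfolding d_def using C.cofree_map_eq_zero_iff[where h = "\<lambda>u. h", OF N h(1) h(2) x] h(3) x
        by (simp add: N.MD.component_closed)
      also have "\<dots> \<longleftrightarrow> x \<in> B"
      proof
        assume "x \<in> B"
        then show "\<forall>u. \<forall>r\<in>carrier R. module_component N u (r \<odot>\<^bsub>N\<^esub> x) \<in> B" using Bc(4) B_comp by blast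
      next
        assume "\<forall>u. \<forall>r\<in>carrier R. module_component N u (r \<odot>\<^bsub>N\<^esub> x) \<in> B"
        then have mB: "module_component N u x \<in> B" for u using x N.smult_one N.one_closed by metis
        have zB: "\<zero>\<^bsub>N\<^esub> \<in> B" using Bc(2,3,5) Bc(1) N.M.l_neg by (metis ex_in_conv subsetD)
        have "(\<Oplus>\<^bsub>N\<^esub>u\<in>A. module_component N u x) \<in> B" if fin: "finite A" for A
          using fin
        proof (induction A rule: finite_induct)
          case (insert a A)
          then show ?case using Bc(5)[OF mB] x N.MD.component_closed by (simp add: Pi_def)
        qed (simp add: zB)
        then show "x \<in> B" using N.MD.component_props(2,3)[OF x] by metis
      qed
      finally show ?thesis .
    qed
    then show ?thesis using Bc(1) by blast
  qed
  ultimately show ?thesis using T(1) by blast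
qed

lemma graded_hom_image:
  assumes N: "graded_module R N" and E: "graded_module R E" and f: "f \<in> graded_hom R N E"
  shows "submodule (f ` carrier N) R E" "\<And>x t. x \<in> f ` carrier N \<Longrightarrow> module_component E t x \<in> f ` carrier N"
proof -
  interpret N: graded_module R N by (rule N)
  interpret E: graded_module R E by (rule E)
  have ff: "f \<in> carrier N \<rightarrow> carrier E" "\<And>x y. x \<in> carrier N \<Longrightarrow> y \<in> carrier N \<Longrightarrow> f (x \<oplus>\<^bsub>N\<^esub> y) = f x \<oplus>\<^bsub>E\<^esub> f y"
    "\<And>a x. a \<in> carrier R \<Longrightarrow> x \<in> carrier N \<Longrightarrow> f (a \<odot>\<^bsub>N\<^esub> x) = a \<odot>\<^bsub>E\<^esub> f x"
    using f unfolding graded_hom_def by blast+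
  show "submodule (f ` carrier N) R E"
  proof (rule E.submoduleI)
    show "f ` carrier N \<subseteq> carrier E" using ff(1) by blast
    show "\<zero>\<^bsub>E\<^esub> \<in> f ` carrier N"
      using additive_zero[OF N.abelian_group_axioms E.abelian_group_axioms ff(1,2)] by (metis N.M.zero_closed imageI)
  next
    fix a assume "a \<in> f ` carrier N"
    then obtain x where "x \<in> carrier N" "a = f x" by blast
    then show "\<ominus>\<^bsub>E\<^esub> a \<in> f ` carrier N"
      using additive_neg[OF N.abelian_group_axioms E.abelian_group_axioms ff(1,2), of x] by (metis N.M.a_inv_closed imageI)
  next
    fix a b assume "a \<in> f ` carrier N" "b \<in> f ` carrier N"
    then obtain x y where "x \<in> carrier N" "y \<in> carrier N" "a = f x" "b = f y" by blast
    then show "a \<oplus>\<^bsub>E\<^esub> b \<in> f ` carrier N" using ff(2)[of x y] by (metis N.M.a_closed imageI)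
  next
    fix r a assume "r \<in> carrier R" "a \<in> f ` carrier N"
    then obtain x where "r \<in> carrier R" "x \<in> carrier N" "a = f x" by blast
    then show "r \<odot>\<^bsub>E\<^esub> a \<in> f ` carrier N" using ff(3)[of r x] by (metis N.smult_closed imageI)
  qed
  fix x t assume "x \<in> f ` carrier N"
  then obtain n where n: "n \<in> carrier N" "x = f n" by blast
  then show "module_component E t x \<in> f ` carrier N"
    using graded_hom_component[OF N E f n(1), of t, symmetric] N.MD.component_closed[OF n(1)] by simp
qed

text \<open>The recursion runs over pairs of an injective module and the graded submodule that the
  next differential has to kill. As the embedding step returns to the type \<open>universe\<close>,
  it can be iterated.\<close>

theorem graded_injective_resolution_exists:
  fixes R :: "'r graded_ring" and M :: "('r, 'm) graded_module"
  assumes M: "graded_module R M"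
  shows "graded_injective_resolution R M (chosen_resolution R M)"
proof -
  interpret M: graded_module R M by (rule M)
  let ?U = "TYPE(('r, 'm) universe)"
  define c where "c m = (\<lambda>(l :: 'r list) (k :: nat). Inl m :: 'm + nat)" for m
  have "inj c" unfolding c_def by (rule injI) (metis sum.inject(1))
  have z: "submodule {\<zero>\<^bsub>M\<^esub>} R M" by (rule M.submoduleI) auto
  have "\<exists>(E :: ('r, ('r, 'm) universe) graded_module) d. graded_module R E \<and> graded_injective R E \<and>
     d \<in> graded_hom R M E \<and> {x \<in> carrier M. d x = \<zero>\<^bsub>E\<^esub>} = {\<zero>\<^bsub>M\<^esub>}"
    by (rule injective_embedding[OF M \<open>inj c\<close> z]) (simp add: M.MD.component_zero)
  then obtain E0 :: "('r, ('r, 'm) universe) graded_module" and \<epsilon>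
    where E0: "graded_module R E0" "graded_injective R E0" "\<epsilon> \<in> graded_hom R M E0"
      "{x \<in> carrier M. \<epsilon> x = \<zero>\<^bsub>E0\<^esub>} = {\<zero>\<^bsub>M\<^esub>}" by blast
  define P :: "('r, ('r, 'm) universe) graded_module \<times> ('r, 'm) universe set \<Rightarrow> bool" where
    "P s \<longleftrightarrow> graded_module R (fst s) \<and> graded_injective R (fst s) \<and> submodule (snd s) R (fst s) \<and>
       (\<forall>x\<in>snd s. \<forall>t. module_component (fst s) t x \<in> snd s)" for s
  define Q :: "('r, ('r, 'm) universe) graded_module \<times> ('r, 'm) universe set \<Rightarrow>
      ('r, ('r, 'm) universe) graded_module \<times> ('r, 'm) universe set \<Rightarrow> bool" where
    "Q s s' \<longleftrightarrow> (\<exists>d\<in>graded_hom R (fst s) (fst s'). {x \<in> carrier (fst s). d x = \<zero>\<^bsub>fst s'\<^esub>} = snd s \<and>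
       d ` carrier (fst s) = snd s')" for s s'
  have "\<exists>s'. P s' \<and> Q s s'" if s: "P s" for s
  proof -
    have E: "graded_module R (fst s)" "submodule (snd s) R (fst s)"
      "\<And>x t. x \<in> snd s \<Longrightarrow> module_component (fst s) t x \<in> snd s" using s unfolding P_def by blast+
    from injective_embedding[OF E(1) inj_on_id E(2,3)]
    obtain E' :: "('r, ('r, 'm) universe) graded_module" and d
      where E': "graded_module R E'" "graded_injective R E'" "d \<in> graded_hom R (fst s) E'"
        "{x \<in> carrier (fst s). d x = \<zero>\<^bsub>E'\<^esub>} = snd s" by blast
    have "P (E', d ` carrier (fst s))"
      unfolding P_def fst_conv snd_conv using E' graded_hom_image[OF E(1) E'(1,3)] by blast
    moreover have "Q s (E', d ` carrier (fst s))"
      unfolding Q_def fst_conv snd_conv using E'(3,4) by blast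
    ultimately show ?thesis by blast
  qed
  then obtain nx where nx: "\<And>s. P s \<Longrightarrow> P (nx s)" "\<And>s. P s \<Longrightarrow> Q s (nx s)" by metis
  define f where "f = rec_nat (E0, \<epsilon> ` carrier M) (\<lambda>_. nx)"
  have f0: "f 0 = (E0, \<epsilon> ` carrier M)" and fS: "f (Suc n) = nx (f n)" for n by (simp_all add: f_def)
  have P0: "P (f 0)"
    unfolding f0 P_def fst_conv snd_conv using E0(1,2) graded_hom_image[OF M E0(1,3)] by blast
  have fP: "P (f n)" for n by (induction n) (simp_all add: P0 fS nx)
  have fQ: "Q (f n) (f (Suc n))" for n using nx(2)[OF fP] fS by simp
  define E where "E n = fst (f n)" for n
  define B where "B n = snd (f n)" for n
  have EB: "graded_module R (E n)" "graded_injective R (E n)" for n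
    using fP[of n] unfolding P_def E_def by blast+
  have "\<forall>n. \<exists>d. d \<in> graded_hom R (E n) (E (Suc n)) \<and> {x \<in> carrier (E n). d x = \<zero>\<^bsub>E (Suc n)\<^esub>} = B n \<and>
      d ` carrier (E n) = B (Suc n)"
    using fQ unfolding Q_def E_def B_def Bex_def by blast
  from choice[OF this] obtain d where dd: "\<forall>n. d n \<in> graded_hom R (E n) (E (Suc n)) \<and>
      {x \<in> carrier (E n). d n x = \<zero>\<^bsub>E (Suc n)\<^esub>} = B n \<and> d n ` carrier (E n) = B (Suc n)" by (rule exE)
  then have d: "\<And>n. d n \<in> graded_hom R (E n) (E (Suc n))"
    "\<And>n. {x \<in> carrier (E n). d n x = \<zero>\<^bsub>E (Suc n)\<^esub>} = B n" "\<And>n. d n ` carrier (E n) = B (Suc n)" by auto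
  have e0: "E 0 = E0" "B 0 = \<epsilon> ` carrier M" using f0 by (simp_all add: E_def B_def)
  interpret E0: graded_module R E0 by (rule E0(1))
  have inj: "inj_on \<epsilon> (carrier M)"
  proof (rule inj_onI)
    fix x y assume xy: "x \<in> carrier M" "y \<in> carrier M" "\<epsilon> x = \<epsilon> y"
    have ee: "\<epsilon> \<in> carrier M \<rightarrow> carrier E0" "\<And>x y. x \<in> carrier M \<Longrightarrow> y \<in> carrier M \<Longrightarrow> \<epsilon> (x \<oplus>\<^bsub>M\<^esub> y) = \<epsilon> x \<oplus>\<^bsub>E0\<^esub> \<epsilon> y"
      using E0(3) unfolding graded_hom_def by blast+
    have "\<epsilon> (x \<ominus>\<^bsub>M\<^esub> y) = \<zero>\<^bsub>E0\<^esub>"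
      using xy ee additive_neg[OF M.abelian_group_axioms E0.abelian_group_axioms ee xy(2)]
      by (simp add: a_minus_def E0.M.r_neg Pi_iff)
    then have "x \<ominus>\<^bsub>M\<^esub> y \<in> {\<zero>\<^bsub>M\<^esub>}" unfolding E0(4)[symmetric] using xy by simp
    then show "x = y" using M.minus_eq_zero xy by simp
  qed
  have "graded_injective_resolution R M (\<epsilon>, E, d)"
    unfolding graded_injective_resolution_def using EB d E0(3) inj e0 d(2)[of 0] by simp
  then show ?thesis unfolding chosen_resolution_def by (rule someI)
qed

section \<open>Torsion in standard graded rings\<close>

lemma (in abelian_group) finsum_in_subgroup:
  assumes H: "additive_subgroup H G" and f: "\<And>i. i \<in> A \<Longrightarrow> f i \<in> H"
  shows "(\<Oplus>i\<in>A. f i) \<in> H"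
proof (cases "finite A")
  case True
  then show ?thesis using f
  proof (induction A rule: finite_induct)
    case empty
    then show ?case using additive_subgroup.zero_closed[OF H] by simp
  next
    case (insert a A)
    then have "f a \<in> H" "(\<Oplus>i\<in>A. f i) \<in> H" by auto
    moreover have "f \<in> A \<rightarrow> carrier G" "f a \<in> carrier G"
      using insert additive_subgroup.a_Hcarr[OF H] by auto
    ultimately show ?case using insert additive_subgroup.a_closed[OF H] by simp
  qed
next
  case False
  then show ?thesis using additive_subgroup.zero_closed[OF H] by (simp add: finsum_infinite)
qed

lemma (in graded_ring) ring_component_product:
  assumes "r \<in> carrier R" and s: "s \<in> carrier R"
  shows "ring_component R k (r \<otimes> s) = (\<Oplus>i\<in>{..k}. ring_component R i r \<otimes> ring_component R (k - i) s)"
  using assms(1)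
proof (induction r rule: RD.homogeneous_induct)
  case (part j r)
  have rc: "r \<in> carrier R" using part RD.part_carrier by blast
  have "(\<Oplus>i\<in>{..k}. ring_component R i r \<otimes> ring_component R (k - i) s) =
      (\<Oplus>i\<in>{..k}. if j = i then r \<otimes> ring_component R (k - i) s else \<zero>)"
    by (rule finsum_cong') (use part s rc RD.component_same RD.component_other RD.component_closed in auto)
  also have "\<dots> = (if j \<le> k then r \<otimes> ring_component R (k - j) s else \<zero>)"
  proof (cases "j \<le> k")
    case True
    then show ?thesis
      using add.finprod_singleton[of j "{..k}" "\<lambda>i. r \<otimes> ring_component R (k - i) s"] rc s RD.component_closed by auto
  next
    case False
    then have "(\<Oplus>i\<in>{..k}. if j = i then r \<otimes> ring_component R (k - i) s else \<zero>) = (\<Oplus>i\<in>{..k}. \<zero>)"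
      by (intro finsum_cong') auto
    then show ?thesis using False by simp
  qed
  finally show ?case using ring_component_mult[OF part s] by simp
next
  case (add r r')
  have "(\<Oplus>i\<in>{..k}. ring_component R i (r \<oplus> r') \<otimes> ring_component R (k - i) s) =
      (\<Oplus>i\<in>{..k}. ring_component R i r \<otimes> ring_component R (k - i) s \<oplus> ring_component R i r' \<otimes> ring_component R (k - i) s)"
    by (rule finsum_cong') (use add s RD.component_closed in \<open>auto simp: RD.component_add l_distr\<close>)
  also have "\<dots> = ring_component R k (r \<otimes> s) \<oplus> ring_component R k (r' \<otimes> s)"
    using add s RD.component_closed by (subst finsum_addf) auto
  finally show ?case using add s by (simp add: l_distr RD.component_add)
qed

text \<open>The generators are the components of degree one of a finite generating set, whose
  elements may be inhomogeneous. That set shows that they span R_1 over R_0, and generation of the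
  ring in degree one extends this to R_{k+1} as the sum of the x_l R_k.\<close>

lemma standard_ring_generators:
  fixes R (structure)
  assumes "standard_graded_ring R" "finitely_generated_over_degree_zero R"
  shows "\<exists>n x. ring_generators R n x"
proof -
  interpret standard_graded_ring R by fact
  from assms(2) obtain A where A: "finite A" "A \<subseteq> carrier R" "carrier R = generate_ring R (rpart R 0 \<union> A)"
    unfolding finitely_generated_over_degree_zero_def by blast
  from finite_list[OF finite_imageI[OF A(1), of "ring_component R 1"]]
  obtain xs where xs: "set xs = ring_component R 1 ` A" by (rule exE)
  define n where "n = length xs"
  define x where "x l = (if l < n then xs ! l else \<zero>)" for l
  have xp: "x l \<in> rpart R 1" for l
  proof (cases "l < n")
    case True
    then have "xs ! l \<in> ring_component R 1 ` A" using xs nth_mem by (auto simp: n_def)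
    then show ?thesis using True A(2) RD.component_part by (auto simp: x_def)
  qed (simp add: x_def RD.part_zero)
  have xA: "\<exists>l<n. x l = ring_component R 1 a" if "a \<in> A" for a
    using that xs by (metis image_eqI in_set_conv_nth n_def x_def)
  have xc: "x l \<in> carrier R" for l using xp RD.part_carrier by blast
  define FF where "FF k = {H. additive_subgroup H R \<and> (\<forall>l<n. \<forall>b\<in>rpart R k. x l \<otimes> b \<in> H)}" for k
  \<comment> \<open>\<open>G k\<close> is the least additive subgroup that contains all x_l b with b
    of degree k.\<close>
  define G where "G k = \<Inter>(FF k)" for k
  have carrier_FF: "carrier R \<in> FF k" for k
    using additive_subgroupI'[of "carrier R"] xc RD.part_carrier by (auto simp: FF_def)
  have GF: "g \<in> carrier R" if "g \<in> G k" for g k using that carrier_FF by (auto simp: G_def)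
  have Gsub: "additive_subgroup (G k) R" for k
  proof (rule additive_subgroupI')
    show "G k \<subseteq> carrier R" using GF by blast
    have FFs: "additive_subgroup H R" if "H \<in> FF k" for H using that by (simp add: FF_def)
    show "\<zero> \<in> G k" using additive_subgroup.zero_closed[OF FFs] by (auto simp: G_def)
    show "a \<oplus> b \<in> G k" if "a \<in> G k" "b \<in> G k" for a b
      using that additive_subgroup.a_closed[OF FFs] by (auto simp: G_def)
    show "\<ominus> a \<in> G k" if "a \<in> G k" for a
      using that additive_subgroup_neg[OF FFs] by (auto simp: G_def)
  qed
  have Gx: "x l \<otimes> b \<in> G k" if "l < n" "b \<in> rpart R k" for l b k using that by (auto simp: G_def FF_def)
  \<comment> \<open>For each H that defines \<open>G (k + j)\<close>, the set of r with rs in H is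
    one of the subgroups that define \<open>G k\<close>, so it contains g.\<close>
  have Gmult: "g \<otimes> s \<in> G (k + j)" if g: "g \<in> G k" and s: "s \<in> rpart R j" for g s k j
  proof -
    have sc: "s \<in> carrier R" using s RD.part_carrier by blast
    have "g \<otimes> s \<in> H" if H: "H \<in> FF (k + j)" for H
    proof -
      have Hs: "additive_subgroup H R" using H by (simp add: FF_def)
      have "{r \<in> carrier R. r \<otimes> s \<in> H} \<in> FF k"
        unfolding FF_def
      proof (intro CollectI conjI allI impI ballI)
        show "additive_subgroup {r \<in> carrier R. r \<otimes> s \<in> H} R"
          by (rule additive_subgroupI')
            (use sc additive_subgroup.zero_closed[OF Hs] additive_subgroup.a_closed[OF Hs] additive_subgroup_neg[OF Hs] in
              \<open>auto simp: l_distr l_minus\<close>)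
        fix l b assume l: "l < n" and b: "b \<in> rpart R k"
        have "x l \<otimes> (b \<otimes> s) \<in> H" using H l rpart_mult[OF b s] by (simp add: FF_def)
        then show "x l \<otimes> b \<in> carrier R" "x l \<otimes> b \<otimes> s \<in> H"
          using xc RD.part_carrier[OF b] sc by (auto simp: m_assoc)
      qed
      then show ?thesis using g by (auto simp: G_def)
    qed
    then show ?thesis by (simp add: G_def)
  qed
  have prodG: "ring_component R (Suc k) (r \<otimes> s) \<in> G k"
    if r: "r \<in> carrier R" and s: "s \<in> carrier R"
      and rG: "\<And>i. i \<le> k \<Longrightarrow> ring_component R (Suc i) r \<in> G i" and sG: "\<And>i. i \<le> k \<Longrightarrow> ring_component R (Suc i) s \<in> G i" for r s k
    unfolding ring_component_product[OF r s]
  proof (rule finsum_in_subgroup[OF Gsub])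
    fix i assume i: "i \<in> {..Suc k}"
    have c: "ring_component R m r \<in> rpart R m" "ring_component R m s \<in> rpart R m" for m
      using r s RD.component_part by auto
    show "ring_component R i r \<otimes> ring_component R (Suc k - i) s \<in> G k"
    proof (cases i)
      case 0
      have "ring_component R (Suc k) s \<otimes> ring_component R 0 r \<in> G (k + 0)" using Gmult[OF sG[of k] c(1)[of 0]] by simp
      then show ?thesis using 0 RD.component_closed r s by (simp add: m_comm)
    next
      case (Suc m)
      then have "ring_component R (Suc m) r \<otimes> ring_component R (k - m) s \<in> G (m + (k - m))"
        using Gmult[OF rG[of m] c(2)[of "k - m"]] i by simp
      then show ?thesis using Suc i by simp
    qed
  qed
  \<comment> \<open>Only degree one is treated here, since the components of the elements of A in
    other degrees are not under control.\<close>
  have 1: "ring_component R 1 r \<in> G 0" if "r \<in> generate_ring R (rpart R 0 \<union> A)" for r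
    using that
  proof (induction r rule: generate_ring.induct)
    case one
    show ?case using RD.component_other[OF one_part, of 1] additive_subgroup.zero_closed[OF Gsub] by simp
  next
    case (incl h)
    then show ?case
    proof
      assume "h \<in> rpart R 0"
      then show ?thesis using RD.component_other[of h 0 1] additive_subgroup.zero_closed[OF Gsub] by simp
    next
      assume "h \<in> A"
      then obtain l where "l < n" "x l = ring_component R 1 h" using xA by blast
      then show ?thesis using Gx[OF _ one_part, of l] xc[of l] by simp
    qed
  next
    case (a_inv h)
    then show ?case using A(3) RD.component_neg additive_subgroup_neg[OF Gsub] by simp
  next
    case (eng_add h1 h2)
    then show ?case using A(3) RD.component_add additive_subgroup.a_closed[OF Gsub] by simp
  next
    case (eng_mult h1 h2)
    then show ?case using prodG[of h1 h2 0] A(3) by simp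
  qed
  \<comment> \<open>Now the ring is generated by R_0 and R_1, whose elements are homogeneous, and
    the preceding fact covers R_1.\<close>
  have 2: "\<forall>k. ring_component R (Suc k) r \<in> G k" if "r \<in> generate_ring R (rpart R 0 \<union> rpart R 1)" for r
    using that
  proof (induction r rule: generate_ring.induct)
    case one
    show ?case using RD.component_other[OF one_part] additive_subgroup.zero_closed[OF Gsub] by simp
  next
    case (incl h)
    then show ?case
    proof
      assume "h \<in> rpart R 0"
      then show ?thesis using RD.component_other[of h 0] additive_subgroup.zero_closed[OF Gsub] by simp
    next
      assume h: "h \<in> rpart R 1"
      then have "h \<in> generate_ring R (rpart R 0 \<union> A)" using A(3) RD.part_carrier by blast
      from 1[OF this] have "ring_component R (Suc 0) h \<in> G 0" by simp
      moreover have "ring_component R (Suc k) h \<in> G k" if "k \<noteq> 0" for k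
        using RD.component_other[OF h, of "Suc k"] that additive_subgroup.zero_closed[OF Gsub] by simp
      ultimately show ?thesis by metis
    qed
  next
    case (a_inv h)
    then show ?case using degree_one_generates RD.component_neg additive_subgroup_neg[OF Gsub] by simp
  next
    case (eng_add h1 h2)
    then show ?case using degree_one_generates RD.component_add additive_subgroup.a_closed[OF Gsub] by simp
  next
    case (eng_mult h1 h2)
    then show ?case using prodG[of h1 h2] degree_one_generates by simp
  qed
  have "rpart R (Suc k) \<subseteq> H" if "additive_subgroup H R" "\<forall>l<n. \<forall>b\<in>rpart R k. x l \<otimes> b \<in> H" for k H
  proof
    fix r assume r: "r \<in> rpart R (Suc k)"
    then have "r \<in> generate_ring R (rpart R 0 \<union> rpart R 1)" using RD.part_carrier degree_one_generates by blast
    from 2[OF this] have "r \<in> G k" using RD.component_same[OF r] by metis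
    then show "r \<in> H" using that by (auto simp: G_def FF_def)
  qed
  then show ?thesis unfolding ring_generators_def using xp by blast
qed

text \<open>This is R(-v), free on the generator 1 in degree v, so its graded homomorphisms to E
  correspond to the elements of \<open>part E v\<close>. Its elements have the type of the ring, as
  \<open>graded_injective\<close> asks of test modules.\<close>

definition shifted_ring :: "'r graded_ring \<Rightarrow> int \<Rightarrow> ('r, 'r) graded_module" where
  "shifted_ring R v = \<lparr>carrier = carrier R, monoid.mult = undefined, one = undefined,
     zero = \<zero>\<^bsub>R\<^esub>, add = add R, smult = monoid.mult R,
     part = (\<lambda>t. if v \<le> t then rpart R (nat (t - v)) else {\<zero>\<^bsub>R\<^esub>})\<rparr>"

section \<open>The ring as a graded module over itself\<close>

context graded_ring
begin

lemma shifted_ring_simps [simp]: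
  "carrier (shifted_ring R v) = carrier R" "\<zero>\<^bsub>shifted_ring R v\<^esub> = \<zero>" "r \<oplus>\<^bsub>shifted_ring R v\<^esub> s = r \<oplus> s"
  "r \<odot>\<^bsub>shifted_ring R v\<^esub> s = r \<otimes> s"
  by (simp_all add: shifted_ring_def)

lemma shifted_ring_part: "part (shifted_ring R v) t = (if v \<le> t then rpart R (nat (t - v)) else {\<zero>})"
  by (simp add: shifted_ring_def)

lemma shifted_ring_module: "module R (shifted_ring R v)"
proof (rule moduleI[OF cring_axioms])
  show "abelian_group (shifted_ring R v)"
    by (rule abelian_groupI) (auto simp: a_ac intro: bexI[of _ "\<ominus> _"] simp: l_neg)
qed (auto simp: l_distr r_distr m_assoc)

lemma shifted_ring: "graded_module R (shifted_ring R v)"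
proof -
  interpret S: module R "shifted_ring R v" by (rule shifted_ring_module)
  have neg: "\<ominus>\<^bsub>shifted_ring R v\<^esub> r = \<ominus> r" if "r \<in> carrier R" for r
    by (rule S.M.minus_equality) (use that in \<open>auto simp: l_neg\<close>)
  have "internal_direct_sum (shifted_ring R v) (part (shifted_ring R v))"
  proof (rule S.M.internal_direct_sumI[where p = "\<lambda>t r. if v \<le> t then ring_component R (nat (t - v)) r else \<zero>"])
    show "additive_subgroup (part (shifted_ring R v) t) (shifted_ring R v)" for t
      by (rule S.M.additive_subgroupI')
        (use RD.part_carrier RD.part_zero RD.part_add additive_subgroup_neg[OF RD.part_subgroup] in \<open>auto simp: neg shifted_ring_part split: if_splits\<close>)
    fix r assume r: "r \<in> carrier (shifted_ring R v)"
    have "{t. (if v \<le> t then ring_component R (nat (t - v)) r else \<zero>) \<noteq> \<zero>\<^bsub>shifted_ring R v\<^esub>} \<subseteq>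
        (\<lambda>k. int k + v) ` {k. ring_component R k r \<noteq> \<zero>}"
    proof
      fix t assume "t \<in> {t. (if v \<le> t then ring_component R (nat (t - v)) r else \<zero>) \<noteq> \<zero>\<^bsub>shifted_ring R v\<^esub>}"
      then have "v \<le> t" "ring_component R (nat (t - v)) r \<noteq> \<zero>" by (auto split: if_splits)
      then show "t \<in> (\<lambda>k. int k + v) ` {k. ring_component R k r \<noteq> \<zero>}" by (intro image_eqI[of _ _ "nat (t - v)"]) auto
    qed
    then show "finite {t. (if v \<le> t then ring_component R (nat (t - v)) r else \<zero>) \<noteq> \<zero>\<^bsub>shifted_ring R v\<^esub>}"
      by (rule finite_subset) (use RD.finite_component r in simp)
    assume z: "\<And>t. (if v \<le> t then ring_component R (nat (t - v)) r else \<zero>) = \<zero>\<^bsub>shifted_ring R v\<^esub>"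
    have "ring_component R k r = \<zero>" for k using z[of "int k + v"] by simp
    then show "r = \<zero>\<^bsub>shifted_ring R v\<^esub>" using RD.component_eqI[of r \<zero>] r RD.component_zero by simp
  qed (use RD.component_part RD.component_add RD.component_same RD.component_other in \<open>auto simp: shifted_ring_part RD.component_zero split: if_splits\<close>)
  moreover have "a \<odot>\<^bsub>shifted_ring R v\<^esub> r \<in> part (shifted_ring R v) (int i + t)"
    if a: "a \<in> rpart R i" and r: "r \<in> part (shifted_ring R v) t" for a i r t
  proof (cases "v \<le> t")
    case True
    then have "r \<in> rpart R (nat (t - v))" using r by (simp add: shifted_ring_part)
    from rpart_mult[OF a this] have "a \<otimes> r \<in> rpart R (i + nat (t - v))" .
    moreover have "i + nat (t - v) = nat (int i + t - v)" using True by simp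
    ultimately show ?thesis using True by (simp add: shifted_ring_part)
  next
    case False
    then have "r = \<zero>" using r by (simp add: shifted_ring_part)
    then show ?thesis using RD.part_carrier[OF a] RD.part_zero by (simp add: shifted_ring_part)
  qed
  ultimately show ?thesis
    by (intro graded_module.intro graded_module_axioms.intro graded_ring_axioms shifted_ring_module)
qed

lemma shifted_ring_component:
  assumes r: "r \<in> carrier R"
  shows "module_component (shifted_ring R v) t r = (if v \<le> t then ring_component R (nat (t - v)) r else \<zero>)"
proof -
  interpret S: graded_module R "shifted_ring R v" by (rule shifted_ring)
  show ?thesis using r
  proof (induction r rule: RD.homogeneous_induct)
    case (part i r)
    then have "r \<in> part (shifted_ring R v) (int i + v)" by (simp add: shifted_ring_part)
    from S.MD.component_same[OF this] S.MD.component_other[OF this, of t]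
    show ?case using RD.component_same[OF part] RD.component_other[OF part, of "nat (t - v)"]
      by (cases "t = int i + v") auto
  next
    case (add x y)
    then show ?case using S.MD.component_add[of x y t] RD.component_add[of x y] by auto
  qed
qed

end

lemma graded_sub_graded_module:
  assumes N: "graded_module R N" and H: "submodule H R N" and comp: "\<And>x t. x \<in> H \<Longrightarrow> module_component N t x \<in> H"
  shows "graded_module R (graded_sub N H)"
proof -
  interpret N: graded_module R N by (rule N)
  have g [simp]: "carrier (graded_sub N H) = H" "\<zero>\<^bsub>graded_sub N H\<^esub> = \<zero>\<^bsub>N\<^esub>" "x \<oplus>\<^bsub>graded_sub N H\<^esub> y = x \<oplus>\<^bsub>N\<^esub> y"
    "a \<odot>\<^bsub>graded_sub N H\<^esub> x = a \<odot>\<^bsub>N\<^esub> x" "part (graded_sub N H) t = part N t \<inter> H" for x y a t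
    by (simp_all add: graded_sub_def)
  note Hc = N.submoduleE[OF H]
  have Hz: "\<zero>\<^bsub>N\<^esub> \<in> H" using Hc(2,3,5) Hc(1) N.M.l_neg by (metis ex_in_conv subsetD)
  have ag: "abelian_group (graded_sub N H)"
  proof (rule abelian_groupI)
    show "\<exists>y\<in>carrier (graded_sub N H). y \<oplus>\<^bsub>graded_sub N H\<^esub> x = \<zero>\<^bsub>graded_sub N H\<^esub>" if "x \<in> carrier (graded_sub N H)" for x
      using that Hc(3) N.M.l_neg[of x] Hc(1) by (intro bexI[of _ "\<ominus>\<^bsub>N\<^esub> x"]) auto
  qed (use Hc Hz in \<open>auto simp: N.M.a_ac subset_iff\<close>)
  have mod: "module R (graded_sub N H)"
    by (rule moduleI[OF N.cring_axioms ag])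
      (use Hc in \<open>auto simp: N.smult_l_distr N.smult_r_distr N.smult_assoc1 subset_iff\<close>)
  interpret G: module R "graded_sub N H" by (rule mod)
  have neg: "\<ominus>\<^bsub>graded_sub N H\<^esub> x = \<ominus>\<^bsub>N\<^esub> x" if "x \<in> H" for x
    by (rule G.M.minus_equality) (use that Hc(1,3) in \<open>auto simp: N.M.l_neg subset_iff\<close>)
  have "internal_direct_sum (graded_sub N H) (part (graded_sub N H))"
  proof (rule G.M.internal_direct_sumI[where p = "module_component N"])
    show "additive_subgroup (part (graded_sub N H) t) (graded_sub N H)" for t
      by (rule G.M.additive_subgroupI')
        (use Hz Hc N.MD.part_zero N.MD.part_add N.M.additive_subgroup_neg[OF N.MD.part_subgroup] in \<open>auto simp: neg\<close>)
    show "finite {t. module_component N t x \<noteq> \<zero>\<^bsub>graded_sub N H\<^esub>}" if "x \<in> carrier (graded_sub N H)" for x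
      using that Hc(1) N.MD.finite_component by auto
    show "x = \<zero>\<^bsub>graded_sub N H\<^esub>" if "x \<in> carrier (graded_sub N H)" "\<And>t. module_component N t x = \<zero>\<^bsub>graded_sub N H\<^esub>" for x
      using that Hc(1) N.MD.component_eqI[of x "\<zero>\<^bsub>N\<^esub>"] by (auto simp: N.MD.component_zero)
  qed (use Hc(1) comp N.MD.component_part N.MD.component_add N.MD.component_same N.MD.component_other in \<open>auto simp: subset_iff\<close>)
  then show ?thesis
    by (intro graded_module.intro graded_module_axioms.intro N.graded_ring_axioms mod)
      (use N.part_smult Hc(4) N.RD.part_carrier in auto)
qed

section \<open>Division in graded injective modules\<close>

context graded_ring
begin

text \<open>The annihilators of the x^p z ascend with p and are ideals of a noetherian ring.\<close>

lemma annihilators_stabilise: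
  assumes acc: "acc_below (shifted_ring R 0) (carrier R) (carrier R)" and E: "module R E"
    and x: "x \<in> carrier R" and z: "z \<in> carrier E"
  shows "\<exists>p::nat. \<forall>m. \<forall>r\<in>carrier R. r \<odot>\<^bsub>E\<^esub> (x [^] (p + m) \<odot>\<^bsub>E\<^esub> z) = \<zero>\<^bsub>E\<^esub> \<longrightarrow> r \<odot>\<^bsub>E\<^esub> (x [^] p \<odot>\<^bsub>E\<^esub> z) = \<zero>\<^bsub>E\<^esub>"
proof -
  interpret E: module R E by (rule E)
  interpret S: module R "shifted_ring R 0" by (rule shifted_ring_module)
  have neg: "\<ominus>\<^bsub>shifted_ring R 0\<^esub> r = \<ominus> r" if "r \<in> carrier R" for r
    by (rule S.M.minus_equality) (use that in \<open>auto simp: l_neg\<close>)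
  define L where "L p = {r \<in> carrier R. r \<odot>\<^bsub>E\<^esub> (x [^] (p::nat) \<odot>\<^bsub>E\<^esub> z) = \<zero>\<^bsub>E\<^esub>}" for p
  have zp: "x [^] (p::nat) \<odot>\<^bsub>E\<^esub> z \<in> carrier E" for p using x z by simp
  have st: "stable_subgroup (shifted_ring R 0) (carrier R) (L p)" for p
    by (rule S.stable_subgroupI)
      (use zp[of p] in \<open>auto simp: L_def neg E.smult_l_distr E.smult_l_minus E.smult_assoc1\<close>)
  have up: "L p \<subseteq> L (Suc p)" for p
  proof
    fix r assume "r \<in> L p"
    then have r: "r \<in> carrier R" "r \<odot>\<^bsub>E\<^esub> (x [^] p \<odot>\<^bsub>E\<^esub> z) = \<zero>\<^bsub>E\<^esub>" by (auto simp: L_def)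
    have "r \<odot>\<^bsub>E\<^esub> (x [^] Suc p \<odot>\<^bsub>E\<^esub> z) = x \<odot>\<^bsub>E\<^esub> (r \<odot>\<^bsub>E\<^esub> (x [^] p \<odot>\<^bsub>E\<^esub> z))"
      using r(1) x z by (simp add: E.smult_assoc1[symmetric] m_ac)
    then show "r \<in> L (Suc p)" using r x by (simp add: L_def)
  qed
  have sub: "L p \<subseteq> carrier R" for p by (auto simp: L_def)
  obtain p0 where p0: "\<And>p. p \<ge> p0 \<Longrightarrow> L p = L p0"
    using acc_belowD[where L = L, OF acc st sub up] by (metis order_refl)
  have "r \<odot>\<^bsub>E\<^esub> (x [^] p0 \<odot>\<^bsub>E\<^esub> z) = \<zero>\<^bsub>E\<^esub>" if "r \<in> carrier R" "r \<odot>\<^bsub>E\<^esub> (x [^] (p0 + m) \<odot>\<^bsub>E\<^esub> z) = \<zero>\<^bsub>E\<^esub>" for r m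
  proof -
    have "r \<in> L (p0 + m)" using that by (simp add: L_def)
    then have "r \<in> L p0" using p0[of "p0 + m"] by simp
    then show ?thesis by (simp add: L_def)
  qed
  then show ?thesis by blast
qed

text \<open>In the manner of Baer's criterion, xr + s -> rw is a map on the ideal xR + I, well
  defined by \<open>cond\<close>, and an extension to R(-v) sends 1 to the required e. That I
  annihilates e is demanded so that solutions can be corrected without disturbing other
  equations.\<close>

lemma graded_injective_divide:
  fixes E :: "('r, 'e) graded_module"
  assumes E: "graded_module R E" and inj: "graded_injective R E"
    and x: "x \<in> rpart R a" and w: "w \<in> part E (v + int a)"
    and I: "additive_subgroup I R" and I_mult: "\<And>r s. r \<in> carrier R \<Longrightarrow> s \<in> I \<Longrightarrow> r \<otimes> s \<in> I"
    and I_comp: "\<And>s k. s \<in> I \<Longrightarrow> ring_component R k s \<in> I"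
    and cond: "\<And>r. r \<in> carrier R \<Longrightarrow> x \<otimes> r \<in> I \<Longrightarrow> r \<odot>\<^bsub>E\<^esub> w = \<zero>\<^bsub>E\<^esub>"
  shows "\<exists>e\<in>part E v. x \<odot>\<^bsub>E\<^esub> e = w \<and> (\<forall>s\<in>I. s \<odot>\<^bsub>E\<^esub> e = \<zero>\<^bsub>E\<^esub>)"
proof -
  interpret E: graded_module R E by (rule E)
  let ?N = "shifted_ring R v"
  interpret N: graded_module R ?N by (rule shifted_ring)
  have xc: "x \<in> carrier R" using x RD.part_carrier by blast
  have wc: "w \<in> carrier E" using w E.MD.part_carrier by blast
  have Ic: "s \<in> carrier R" if "s \<in> I" for s using additive_subgroup.a_Hcarr[OF I that] .
  have Iadd: "s \<oplus> t \<in> I" if "s \<in> I" "t \<in> I" for s t using additive_subgroup.a_closed[OF I that] .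
  have Izero: "\<zero> \<in> I" using additive_subgroup.zero_closed[OF I] .
  have Ineg: "\<ominus> s \<in> I" if "s \<in> I" for s using additive_subgroup_neg[OF I that] .
  have neg: "\<ominus>\<^bsub>?N\<^esub> r = \<ominus> r" if "r \<in> carrier R" for r
    by (rule N.M.minus_equality) (use that in \<open>auto simp: l_neg\<close>)
  define H where "H = {x \<otimes> r \<oplus> s | r s. r \<in> carrier R \<and> s \<in> I}"
  have HI: "x \<otimes> r \<oplus> s \<in> H" if "r \<in> carrier R" "s \<in> I" for r s using that by (auto simp: H_def)
  have HE: "\<exists>r s. z = x \<otimes> r \<oplus> s \<and> r \<in> carrier R \<and> s \<in> I" if "z \<in> H" for z using that by (auto simp: H_def)
  have sub: "submodule H R ?N"
  proof (rule N.submoduleI)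
    show "H \<subseteq> carrier ?N" using xc Ic by (auto simp: H_def)
    show "\<zero>\<^bsub>?N\<^esub> \<in> H" using HI[OF zero_closed Izero] xc by simp
  next
    fix z assume "z \<in> H"
    then obtain r s where e: "z = x \<otimes> r \<oplus> s" "r \<in> carrier R" "s \<in> I" using HE by blast
    have "\<ominus>\<^bsub>?N\<^esub> z = x \<otimes> (\<ominus> r) \<oplus> (\<ominus> s)" using e xc Ic by (simp add: neg minus_add r_minus)
    then show "\<ominus>\<^bsub>?N\<^esub> z \<in> H" using HI[of "\<ominus> r" "\<ominus> s"] e Ineg by simp
  next
    fix z z' assume "z \<in> H" "z' \<in> H"
    then obtain r s r' s' where e: "z = x \<otimes> r \<oplus> s" "r \<in> carrier R" "s \<in> I" "z' = x \<otimes> r' \<oplus> s'" "r' \<in> carrier R" "s' \<in> I"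
      using HE by metis
    have "z \<oplus>\<^bsub>?N\<^esub> z' = x \<otimes> (r \<oplus> r') \<oplus> (s \<oplus> s')" using e xc Ic by (simp add: r_distr a_ac)
    then show "z \<oplus>\<^bsub>?N\<^esub> z' \<in> H" using HI[of "r \<oplus> r'" "s \<oplus> s'"] e Iadd by simp
  next
    fix b z assume b: "b \<in> carrier R" and "z \<in> H"
    then obtain r s where e: "z = x \<otimes> r \<oplus> s" "r \<in> carrier R" "s \<in> I" using HE by blast
    have "b \<odot>\<^bsub>?N\<^esub> z = x \<otimes> (b \<otimes> r) \<oplus> (b \<otimes> s)" using e xc Ic b by (simp add: r_distr m_ac)
    then show "b \<odot>\<^bsub>?N\<^esub> z \<in> H" using HI[of "b \<otimes> r" "b \<otimes> s"] e I_mult b by simp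
  qed
  have Hc: "z \<in> carrier R" if "z \<in> H" for z using HE[OF that] xc Ic by auto
  have comp_form: "ring_component R k (x \<otimes> r \<oplus> s) =
      x \<otimes> (if a \<le> k then ring_component R (k - a) r else \<zero>) \<oplus> ring_component R k s"
    if "r \<in> carrier R" "s \<in> I" for r s k
    using that xc Ic ring_component_mult[OF x] by (simp add: RD.component_add)
  have comp: "module_component ?N t z \<in> H" if zH: "z \<in> H" for z t
  proof (cases "v \<le> t")
    case True
    obtain r s where e: "z = x \<otimes> r \<oplus> s" "r \<in> carrier R" "s \<in> I" using HE[OF zH] by metis
    show ?thesis
      using True HI[of "if a \<le> nat (t - v) then ring_component R (nat (t - v) - a) r else \<zero>" "ring_component R (nat (t - v)) s"]
        e I_comp RD.component_closed
      by (simp add: shifted_ring_component[OF Hc[OF zH]] comp_form e(1)[symmetric] del: if_split) (simp add: e(1) comp_form)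
  next
    case False
    then show ?thesis using HI[OF zero_closed Izero] xc by (simp add: shifted_ring_component[OF Hc[OF zH]])
  qed
  let ?L = "graded_sub ?N H"
  have L: "graded_module R ?L" by (rule graded_sub_graded_module[OF shifted_ring sub comp])
  have graded_sub_carrier: "carrier ?L = H" by (simp add: graded_sub_def)
  \<comment> \<open>The coefficient r of an element xr + s is not unique; the next fact shows that
    the choice does not matter.\<close>
  define f where "f z = (SOME r. r \<in> carrier R \<and> (\<exists>s\<in>I. z = x \<otimes> r \<oplus> s)) \<odot>\<^bsub>E\<^esub> w" for z
  have f: "f (x \<otimes> r \<oplus> s) = r \<odot>\<^bsub>E\<^esub> w" if r: "r \<in> carrier R" and s: "s \<in> I" for r s
  proof -
    let ?q = "SOME q. q \<in> carrier R \<and> (\<exists>t\<in>I. x \<otimes> r \<oplus> s = x \<otimes> q \<oplus> t)"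
    have "?q \<in> carrier R \<and> (\<exists>t\<in>I. x \<otimes> r \<oplus> s = x \<otimes> ?q \<oplus> t)"
      by (rule someI[of _ r]) (use r s in blast)
    then obtain t where q: "?q \<in> carrier R" and t: "t \<in> I" "x \<otimes> r \<oplus> s = x \<otimes> ?q \<oplus> t" by blast
    have "x \<otimes> (?q \<ominus> r) = (x \<otimes> ?q \<oplus> t) \<ominus> (x \<otimes> r \<oplus> t)"
      using xc q r Ic[OF t(1)] by (simp add: group_simps r_distr r_minus)
    also have "\<dots> = s \<ominus> t" unfolding t(2)[symmetric] using xc q r Ic[OF t(1)] Ic[OF s] by (simp add: group_simps)
    finally have "x \<otimes> (?q \<ominus> r) \<in> I" using Iadd[OF s Ineg[OF t(1)]] by (simp add: a_minus_def)
    then have "(?q \<ominus> r) \<odot>\<^bsub>E\<^esub> w = \<zero>\<^bsub>E\<^esub>" using cond q r by simp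
    then have "?q \<odot>\<^bsub>E\<^esub> w = r \<odot>\<^bsub>E\<^esub> w"
      using q r wc E.minus_eq_zero[of "?q \<odot>\<^bsub>E\<^esub> w" "r \<odot>\<^bsub>E\<^esub> w"]
      by (simp add: a_minus_def E.smult_l_distr E.smult_l_minus)
    then show ?thesis by (simp add: f_def)
  qed
  have fhom: "f \<in> graded_hom R ?L E"
    unfolding graded_hom_def
  proof (intro CollectI conjI ballI allI)
    show "f \<in> carrier ?L \<rightarrow> carrier E"
    proof
      fix z assume "z \<in> carrier ?L"
      then obtain r s where "z = x \<otimes> r \<oplus> s" "r \<in> carrier R" "s \<in> I" using HE[of z] graded_sub_carrier by metis
      then show "f z \<in> carrier E" using f wc by simp
    qed
  next
    fix z z' assume "z \<in> carrier ?L" "z' \<in> carrier ?L"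
    then obtain r s r' s' where e: "z = x \<otimes> r \<oplus> s" "r \<in> carrier R" "s \<in> I" "z' = x \<otimes> r' \<oplus> s'" "r' \<in> carrier R" "s' \<in> I"
      using HE[of z] HE[of z'] graded_sub_carrier by metis
    have "z \<oplus>\<^bsub>?L\<^esub> z' = x \<otimes> (r \<oplus> r') \<oplus> (s \<oplus> s')" using e xc Ic by (simp add: graded_sub_def r_distr a_ac)
    then show "f (z \<oplus>\<^bsub>?L\<^esub> z') = f z \<oplus>\<^bsub>E\<^esub> f z'" using e f Iadd wc by (simp add: E.smult_l_distr)
  next
    fix b z assume b: "b \<in> carrier R" and "z \<in> carrier ?L"
    then obtain r s where e: "z = x \<otimes> r \<oplus> s" "r \<in> carrier R" "s \<in> I" using HE[of z] graded_sub_carrier by metis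
    have "b \<odot>\<^bsub>?L\<^esub> z = x \<otimes> (b \<otimes> r) \<oplus> (b \<otimes> s)" using e xc Ic b by (simp add: graded_sub_def r_distr m_ac)
    then show "f (b \<odot>\<^bsub>?L\<^esub> z) = b \<odot>\<^bsub>E\<^esub> f z" using e f I_mult wc b by (simp add: E.smult_assoc1)
  next
    fix t
    show "f ` part ?L t \<subseteq> part E t"
    proof
      fix y assume "y \<in> f ` part ?L t"
      then obtain z where z: "z \<in> part ?N t" "z \<in> H" "y = f z" by (auto simp: graded_sub_def)
      obtain r s where e: "z = x \<otimes> r \<oplus> s" "r \<in> carrier R" "s \<in> I" using HE[OF z(2)] by metis
      have f0: "f (x \<otimes> \<zero> \<oplus> s') = \<zero>\<^bsub>E\<^esub>" if "s' \<in> I" for s' using f[OF zero_closed that] wc by simp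
      show "y \<in> part E t"
      proof (cases "v \<le> t")
        case True
        define k where "k = nat (t - v)"
        have "z = ring_component R k z" using z(1) True RD.component_same by (simp add: shifted_ring_part k_def)
        also have "\<dots> = x \<otimes> (if a \<le> k then ring_component R (k - a) r else \<zero>) \<oplus> ring_component R k s"
          unfolding e(1) by (rule comp_form[OF e(2,3)])
        finally have zk: "z = x \<otimes> (if a \<le> k then ring_component R (k - a) r else \<zero>) \<oplus> ring_component R k s" .
        show ?thesis
        proof (cases "a \<le> k")
          case True
          have "f z = ring_component R (k - a) r \<odot>\<^bsub>E\<^esub> w"
            using zk True f[OF RD.component_closed[OF e(2)] I_comp[OF e(3)]] by simp
          moreover have "ring_component R (k - a) r \<odot>\<^bsub>E\<^esub> w \<in> part E (int (k - a) + (v + int a))"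
            by (rule E.part_smult[OF RD.component_part[OF e(2)] w])
          moreover have "int (k - a) + (v + int a) = t" using True \<open>v \<le> t\<close> by (simp add: k_def)
          ultimately show ?thesis using z(3) by simp
        next
          case False
          then have "f z = \<zero>\<^bsub>E\<^esub>" using zk f0[OF I_comp[OF e(3)]] by simp
          then show ?thesis using z(3) E.MD.part_zero by simp
        qed
      next
        case False
        then have "z = x \<otimes> \<zero> \<oplus> \<zero>" using z(1) xc by (simp add: shifted_ring_part)
        then have "f z = \<zero>\<^bsub>E\<^esub>" using f0[OF Izero] by simp
        then show ?thesis using z(3) E.MD.part_zero by simp
      qed
    qed
  qed
  have jhom: "(\<lambda>z. z) \<in> graded_hom R ?L ?N"
    using Hc by (auto simp: graded_hom_def graded_sub_def)
  have "\<exists>g\<in>graded_hom R ?N E. \<forall>z\<in>carrier ?L. g ((\<lambda>z. z) z) = f z"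
    using L shifted_ring[of v] jhom fhom inj_on_id2[of "carrier ?L"] inj[unfolded graded_injective_def, rule_format, of ?L ?N "\<lambda>z. z" f] by blast
  then obtain g where g: "g \<in> graded_hom R ?N E" "\<And>z. z \<in> H \<Longrightarrow> g z = f z"
    by (auto simp: graded_sub_def)
  have gs: "g (b \<otimes> z) = b \<odot>\<^bsub>E\<^esub> g z" if "b \<in> carrier R" "z \<in> carrier R" for b z
    using g(1) that by (auto simp: graded_hom_def)
  have g1: "b \<odot>\<^bsub>E\<^esub> g \<one> = f b" if "b \<in> H" for b using gs[OF Hc[OF that] one_closed] g(2)[OF that] Hc[OF that] by simp
  show ?thesis
  proof (intro bexI conjI ballI)
    have "\<one> \<in> part ?N v" using one_part by (simp add: shifted_ring_part)
    then show "g \<one> \<in> part E v" using g(1) unfolding graded_hom_def by blast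
    have "x \<otimes> \<one> \<oplus> \<zero> = x" using xc by simp
    then show "x \<odot>\<^bsub>E\<^esub> g \<one> = w" using HI[OF one_closed Izero] g1[of x] f[OF one_closed Izero] wc by simp
    fix s assume s: "s \<in> I"
    have "x \<otimes> \<zero> \<oplus> s = s" using xc Ic[OF s] by simp
    then show "s \<odot>\<^bsub>E\<^esub> g \<one> = \<zero>\<^bsub>E\<^esub>" using HI[OF zero_closed s] g1[of s] f[OF zero_closed s] wc by simp
  qed
qed

text \<open>Surjectivity of \<open>y\<close> modulo \<open>y\<close>-torsion on the part of an injective module that is torsion
  with respect to the \<open>x l\<close>.\<close>

lemma graded_injective_torsion_divide:
  fixes E :: "('r, 'e) graded_module" and x :: "nat \<Rightarrow> 'r"
  assumes acc: "acc_below (shifted_ring R 0) (carrier R) (carrier R)"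
    and E: "graded_module R E" and inj: "graded_injective R E"
    and y: "y \<in> rpart R 1" and x: "\<And>l. x l \<in> rpart R 1"
    and e: "e \<in> part E u" and tors: "\<And>l. l < j \<Longrightarrow> \<exists>m. x l [^] (m::nat) \<odot>\<^bsub>E\<^esub> e = \<zero>\<^bsub>E\<^esub>"
  shows "\<exists>k::nat. \<exists>e'\<in>part E (u - 1). y [^] Suc k \<odot>\<^bsub>E\<^esub> e' = y [^] k \<odot>\<^bsub>E\<^esub> e \<and>
    (\<forall>l<j. \<exists>p. x l [^] (p::nat) \<odot>\<^bsub>E\<^esub> e' = \<zero>\<^bsub>E\<^esub>)"
proof -
  interpret E: graded_module R E by (rule E)
  have yc: "y \<in> carrier R" and xc: "\<And>l. x l \<in> carrier R" using y x RD.part_carrier by blast+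
  have ec: "e \<in> carrier E" using e E.MD.part_carrier by blast
  \<comment> \<open>From the exponent k on, the annihilators of the powers of y are constant. This
    makes the equation y^{k+1} e0 = y^k e solvable, although y e0 = e need not be.\<close>
  obtain k :: nat where k: "\<And>m r. r \<in> carrier R \<Longrightarrow> r \<otimes> y [^] (k + m) = \<zero> \<Longrightarrow> r \<otimes> y [^] k = \<zero>"
  proof -
    obtain k :: nat where k: "\<And>m r. r \<in> carrier R \<Longrightarrow> r \<otimes> (y [^] (k + m) \<otimes> \<one>) = \<zero> \<Longrightarrow> r \<otimes> (y [^] k \<otimes> \<one>) = \<zero>"
      using annihilators_stabilise[OF acc shifted_ring_module[of 0] yc, unfolded shifted_ring_simps, OF one_closed] by blast
    have "r \<otimes> y [^] k = \<zero>" if "r \<in> carrier R" "r \<otimes> y [^] (k + m) = \<zero>" for r m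
      using k[of r m] that yc by simp
    then show thesis by (rule that)
  qed
  let ?w = "y [^] k \<odot>\<^bsub>E\<^esub> e"
  have wp: "?w \<in> part E (int k + u)" using E.part_smult[OF pow_part[OF y, of k] e] by simp
  have wc: "?w \<in> carrier E" using wp E.MD.part_carrier by blast
  have ykp: "y [^] Suc k \<in> rpart R (Suc k)" using pow_part[OF y, of "Suc k"] by simp
  have zero_ideal: "additive_subgroup {\<zero>} R" by (rule additive_subgroupI') auto
  have "\<exists>e'\<in>part E (u - 1). y [^] Suc k \<odot>\<^bsub>E\<^esub> e' = ?w \<and> (\<forall>s\<in>{\<zero>}. s \<odot>\<^bsub>E\<^esub> e' = \<zero>\<^bsub>E\<^esub>)"
  proof (rule graded_injective_divide[OF E inj ykp])
    show "?w \<in> part E (u - 1 + int (Suc k))" using wp by (simp add: algebra_simps)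
    show "r \<odot>\<^bsub>E\<^esub> ?w = \<zero>\<^bsub>E\<^esub>" if r: "r \<in> carrier R" "y [^] Suc k \<otimes> r \<in> {\<zero>}" for r
    proof -
      have "r \<otimes> y [^] (k + 1) = \<zero>" using r yc by (simp add: m_comm)
      then have "r \<otimes> y [^] k = \<zero>" using k[OF r(1)] by blast
      then show ?thesis using r yc ec by (simp add: E.smult_assoc1[symmetric])
    qed
  qed (use zero_ideal RD.component_zero in auto)
  then obtain e0 where e0: "e0 \<in> part E (u - 1)" "y [^] Suc k \<odot>\<^bsub>E\<^esub> e0 = ?w" by blast
  \<comment> \<open>The solution need not be torsion; it is corrected for one x_i at a time, keeping
    the equation with y and the torsion already achieved.\<close>
  have "\<exists>e'\<in>part E (u - 1). y [^] Suc k \<odot>\<^bsub>E\<^esub> e' = ?w \<and> (\<forall>l<i. \<exists>p. x l [^] (p::nat) \<odot>\<^bsub>E\<^esub> e' = \<zero>\<^bsub>E\<^esub>)" if "i \<le> j" for i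
    using that
  proof (induction i)
    case 0
    then show ?case using e0 by auto
  next
    case (Suc i)
    then obtain e' where e': "e' \<in> part E (u - 1)" "y [^] Suc k \<odot>\<^bsub>E\<^esub> e' = ?w"
      "\<And>l. l < i \<Longrightarrow> \<exists>p. x l [^] (p::nat) \<odot>\<^bsub>E\<^esub> e' = \<zero>\<^bsub>E\<^esub>" by auto
    have e'c: "e' \<in> carrier E" using e' E.MD.part_carrier by blast
    obtain p :: nat where p: "\<And>m r. r \<in> carrier R \<Longrightarrow> r \<odot>\<^bsub>E\<^esub> (x i [^] (p + m) \<odot>\<^bsub>E\<^esub> e') = \<zero>\<^bsub>E\<^esub> \<Longrightarrow> r \<odot>\<^bsub>E\<^esub> (x i [^] p \<odot>\<^bsub>E\<^esub> e') = \<zero>\<^bsub>E\<^esub>"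
      using annihilators_stabilise[OF acc E.module xc e'c, of i] by blast
    obtain m where m: "x i [^] (m::nat) \<odot>\<^bsub>E\<^esub> e = \<zero>\<^bsub>E\<^esub>" using tors[of i] Suc.prems by auto
    \<comment> \<open>The ideal of all s with se' in Rw, where w = y^k e. It contains y^{k+1} and
      the powers of the earlier x_l that kill e', so subtracting an element d annihilated by this
      ideal preserves all these relations.\<close>
    define I where "I = {s \<in> carrier R. \<exists>r\<in>carrier R. s \<odot>\<^bsub>E\<^esub> e' = r \<odot>\<^bsub>E\<^esub> ?w}"
    let ?z = "x i [^] p \<odot>\<^bsub>E\<^esub> e'"
    have zp: "?z \<in> part E (int p + (u - 1))" using E.part_smult[OF pow_part[OF x, of i p] e'(1)] by simp
    have "\<exists>d\<in>part E (u - 1). x i [^] p \<odot>\<^bsub>E\<^esub> d = ?z \<and> (\<forall>s\<in>I. s \<odot>\<^bsub>E\<^esub> d = \<zero>\<^bsub>E\<^esub>)"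
    proof (rule graded_injective_divide[OF E inj])
      show "x i [^] p \<in> rpart R p" using pow_part[OF x, of i p] by simp
      show "?z \<in> part E (u - 1 + int p)" using zp by (simp add: algebra_simps)
      show "additive_subgroup I R"
      proof (rule additive_subgroupI')
        show "I \<subseteq> carrier R" by (auto simp: I_def)
        show "\<zero> \<in> I" unfolding I_def using e'c wc by (intro CollectI conjI bexI[of _ \<zero>]) auto
      next
        fix s t assume "s \<in> I" "t \<in> I"
        then obtain r q where h: "s \<in> carrier R" "t \<in> carrier R" "r \<in> carrier R" "q \<in> carrier R"
          "s \<odot>\<^bsub>E\<^esub> e' = r \<odot>\<^bsub>E\<^esub> ?w" "t \<odot>\<^bsub>E\<^esub> e' = q \<odot>\<^bsub>E\<^esub> ?w" by (auto simp: I_def)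
        then have "(s \<oplus> t) \<odot>\<^bsub>E\<^esub> e' = (r \<oplus> q) \<odot>\<^bsub>E\<^esub> ?w" using e'c wc E.smult_l_distr by simp
        then show "s \<oplus> t \<in> I" unfolding I_def using h by blast
      next
        fix s assume "s \<in> I"
        then obtain r where h: "s \<in> carrier R" "r \<in> carrier R" "s \<odot>\<^bsub>E\<^esub> e' = r \<odot>\<^bsub>E\<^esub> ?w" by (auto simp: I_def)
        then have "(\<ominus> s) \<odot>\<^bsub>E\<^esub> e' = (\<ominus> r) \<odot>\<^bsub>E\<^esub> ?w" using e'c wc E.smult_l_minus by simp
        then show "\<ominus> s \<in> I" unfolding I_def using h by blast
      qed
      show "b \<otimes> s \<in> I" if b: "b \<in> carrier R" and "s \<in> I" for b s
      proof -
        from that obtain r where h: "s \<in> carrier R" "r \<in> carrier R" "s \<odot>\<^bsub>E\<^esub> e' = r \<odot>\<^bsub>E\<^esub> ?w" by (auto simp: I_def)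
        then have "(b \<otimes> s) \<odot>\<^bsub>E\<^esub> e' = (b \<otimes> r) \<odot>\<^bsub>E\<^esub> ?w" using e'c wc b E.smult_assoc1 by simp
        then show ?thesis unfolding I_def using h b by blast
      qed
      show "ring_component R t s \<in> I" if "s \<in> I" for s t
      proof -
        from that obtain r where h: "s \<in> carrier R" "r \<in> carrier R" "s \<odot>\<^bsub>E\<^esub> e' = r \<odot>\<^bsub>E\<^esub> ?w" by (auto simp: I_def)
        let ?v = "int t + (u - 1)"
        have "ring_component R t s \<odot>\<^bsub>E\<^esub> e' = module_component E ?v (r \<odot>\<^bsub>E\<^esub> ?w)"
          using component_smult_homogeneous[OF E e'(1) h(1), of ?v] h(3) by simp
        also have "\<dots> = (if int k + u \<le> ?v then ring_component R (nat (?v - (int k + u))) r else \<zero>) \<odot>\<^bsub>E\<^esub> ?w"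
          using component_smult_homogeneous[OF E wp h(2), of ?v] wc by simp
        finally show ?thesis unfolding I_def using h RD.component_closed by (auto split: if_splits)
      qed
      \<comment> \<open>Elements of Rw are killed by x_i^m. Hence r x_i^{p+m} e' = 0, and p was
        chosen such that r x_i^p e' = 0 follows.\<close>
      show "r \<odot>\<^bsub>E\<^esub> ?z = \<zero>\<^bsub>E\<^esub>" if r: "r \<in> carrier R" and "x i [^] p \<otimes> r \<in> I" for r
      proof -
        from that(2) obtain q where q: "q \<in> carrier R" "(x i [^] p \<otimes> r) \<odot>\<^bsub>E\<^esub> e' = q \<odot>\<^bsub>E\<^esub> ?w" by (auto simp: I_def)
        have "r \<odot>\<^bsub>E\<^esub> (x i [^] (p + m) \<odot>\<^bsub>E\<^esub> e') = x i [^] m \<odot>\<^bsub>E\<^esub> ((x i [^] p \<otimes> r) \<odot>\<^bsub>E\<^esub> e')"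
          using r xc e'c by (simp add: E.smult_assoc1[symmetric] nat_pow_mult[symmetric] m_ac)
        also have "\<dots> = (q \<otimes> y [^] k) \<odot>\<^bsub>E\<^esub> (x i [^] m \<odot>\<^bsub>E\<^esub> e)"
          unfolding q(2) using q(1) xc yc ec by (simp add: E.smult_assoc1[symmetric] m_ac)
        also have "\<dots> = \<zero>\<^bsub>E\<^esub>" unfolding m using q(1) yc by simp
        finally show ?thesis by (rule p[OF r])
      qed
    qed
    then obtain d where d: "d \<in> part E (u - 1)" "x i [^] p \<odot>\<^bsub>E\<^esub> d = ?z" "\<And>s. s \<in> I \<Longrightarrow> s \<odot>\<^bsub>E\<^esub> d = \<zero>\<^bsub>E\<^esub>" by blast
    have dc: "d \<in> carrier E" using d E.MD.part_carrier by blast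
    have sub: "b \<odot>\<^bsub>E\<^esub> (e' \<ominus>\<^bsub>E\<^esub> d) = b \<odot>\<^bsub>E\<^esub> e' \<ominus>\<^bsub>E\<^esub> b \<odot>\<^bsub>E\<^esub> d" if "b \<in> carrier R" for b
      using that dc e'c by (simp add: a_minus_def E.smult_r_distr E.smult_r_minus)
    show ?case
    proof (intro bexI conjI allI impI)
      show "e' \<ominus>\<^bsub>E\<^esub> d \<in> part E (u - 1)"
        using E.M.additive_subgroup_minus[OF E.MD.part_subgroup e'(1) d(1)] .
      have "y [^] Suc k \<odot>\<^bsub>E\<^esub> e' = \<one> \<odot>\<^bsub>E\<^esub> ?w" using e'(2) wc by simp
      then have "y [^] Suc k \<in> I" unfolding I_def using yc by blast
      then show "y [^] Suc k \<odot>\<^bsub>E\<^esub> (e' \<ominus>\<^bsub>E\<^esub> d) = ?w"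
        using sub[of "y [^] Suc k"] d(3) e'(2) wc yc by (simp add: a_minus_def)
      fix l assume l: "l < Suc i"
      show "\<exists>q. x l [^] (q::nat) \<odot>\<^bsub>E\<^esub> (e' \<ominus>\<^bsub>E\<^esub> d) = \<zero>\<^bsub>E\<^esub>"
      proof (cases "l = i")
        case True
        then show ?thesis using sub[of "x i [^] p"] d(2) xc e'c by (intro exI[of _ p]) (simp add: a_minus_def E.M.r_neg)
      next
        case False
        then obtain q where q: "x l [^] (q::nat) \<odot>\<^bsub>E\<^esub> e' = \<zero>\<^bsub>E\<^esub>" using e'(3)[of l] l by auto
        then have "x l [^] q \<odot>\<^bsub>E\<^esub> e' = \<zero> \<odot>\<^bsub>E\<^esub> ?w" using wc by simp
        then have "x l [^] q \<in> I" unfolding I_def using xc by blast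
        then show ?thesis using sub[of "x l [^] q"] d(3) q xc by (intro exI[of _ q]) (simp add: a_minus_def)
      qed
    qed
  qed
  then show ?thesis by blast
qed

end

section \<open>Torsion with respect to generators of degree one\<close>

context graded_ring
begin

lemma irrelevant_ideal_component:
  assumes "a \<in> irrelevant_ideal R"
  shows "a \<in> carrier R" "ring_component R 0 a = \<zero>"
proof -
  from assms obtain A f where f: "a = (\<Oplus>n\<in>A. f n)" "finite A" "0 \<notin> A" "\<And>n. n \<in> A \<Longrightarrow> f n \<in> rpart R n"
    unfolding irrelevant_ideal_def by blast
  let ?H = "{r \<in> carrier R. ring_component R 0 r = \<zero>}"
  have H: "additive_subgroup ?H R"
    by (rule additive_subgroupI') (auto simp: RD.component_add RD.component_neg RD.component_zero)
  have "f n \<in> ?H" if "n \<in> A" for n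
    using f(3) f(4)[OF that] that RD.component_other[of "f n" n 0] RD.part_carrier by (cases "n = 0") auto
  from finsum_in_subgroup[OF H, of A f] this show "a \<in> carrier R" "ring_component R 0 a = \<zero>" using f(1) by auto
qed

lemma part_irrelevant_ideal:
  assumes a: "a \<in> rpart R i" and "i > 0" shows "a \<in> irrelevant_ideal R"
proof -
  have "a = (\<Oplus>n\<in>{i}. a)" using RD.part_carrier[OF a] by (simp add: finsum_singleton)
  then show ?thesis unfolding irrelevant_ideal_def using assms
    by (intro CollectI exI[of _ "{i}"] exI[of _ "\<lambda>_. a"]) auto
qed

lemma ideal_power_component:
  assumes "a \<in> ideal_power R (irrelevant_ideal R) k"
  shows "a \<in> carrier R \<and> (\<forall>i<k. ring_component R i a = \<zero>)"
  using assms
proof (induction k arbitrary: a)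
  case (Suc k)
  from Suc.prems have "a \<in> ideal_prod R (irrelevant_ideal R) (ideal_power R (irrelevant_ideal R) k)" by simp
  then show ?case
  proof (induction a rule: ideal_prod.induct)
    case (prod r s)
    have r: "r \<in> carrier R" "ring_component R 0 r = \<zero>" using irrelevant_ideal_component[OF prod(1)] by auto
    have s: "s \<in> carrier R" "\<And>i. i < k \<Longrightarrow> ring_component R i s = \<zero>" using Suc.IH[OF prod(2)] by auto
    have "ring_component R i (r \<otimes> s) = \<zero>" if "i < Suc k" for i
    proof -
      have "ring_component R j r \<otimes> ring_component R (i - j) s \<in> {\<zero>}" if "j \<in> {..i}" for j
        using r s RD.component_closed \<open>i < Suc k\<close> that by (cases "j = 0") auto
      moreover have "additive_subgroup {\<zero>} R" by (rule additive_subgroupI') auto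
      ultimately have "(\<Oplus>j\<in>{..i}. ring_component R j r \<otimes> ring_component R (i - j) s) \<in> {\<zero>}"
        using finsum_in_subgroup[of "{\<zero>}" "{..i}" "\<lambda>j. ring_component R j r \<otimes> ring_component R (i - j) s"] by blast
      then show ?thesis using ring_component_product[OF r(1) s(1)] by simp
    qed
    then show ?case using r s by simp
  next
    case (sum r s)
    then show ?case by (simp add: RD.component_add)
  qed
qed simp

lemma pow_ideal_power:
  assumes a: "a \<in> rpart R 1" shows "a [^] k \<in> ideal_power R (irrelevant_ideal R) k"
proof (induction k)
  case (Suc k)
  have "a \<otimes> a [^] k \<in> ideal_power R (irrelevant_ideal R) (Suc k)"
    using ideal_prod.prod[OF part_irrelevant_ideal[OF a] Suc] by simp
  then show ?case using RD.part_carrier[OF a] by (simp add: m_comm)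
qed simp

lemma smult_preimage_subgroup:
  assumes E: "module R E" and e: "e \<in> carrier E" and H: "additive_subgroup H E"
  shows "additive_subgroup {r \<in> carrier R. r \<odot>\<^bsub>E\<^esub> e \<in> H} R"
proof -
  interpret E: module R E by (rule E)
  show ?thesis
    by (rule additive_subgroupI')
      (use e additive_subgroup.zero_closed[OF H] additive_subgroup.a_closed[OF H] E.additive_subgroup_neg[OF H]
        in \<open>auto simp: E.smult_l_distr E.smult_l_minus\<close>)
qed

lemma smult_by_components:
  assumes E: "module R E" and e: "e \<in> carrier E" and H: "additive_subgroup H E"
    and a: "a \<in> carrier R" and "\<And>i. ring_component R i a \<odot>\<^bsub>E\<^esub> e \<in> H"
  shows "a \<odot>\<^bsub>E\<^esub> e \<in> H"
proof -
  have "ring_component R i a \<in> {r \<in> carrier R. r \<odot>\<^bsub>E\<^esub> e \<in> H}" for i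
    using assms(5) RD.component_closed[OF a] by simp
  then have "(\<Oplus>i\<in>{i. ring_component R i a \<noteq> \<zero>}. ring_component R i a) \<in> {r \<in> carrier R. r \<odot>\<^bsub>E\<^esub> e \<in> H}"
    by (intro finsum_in_subgroup[OF smult_preimage_subgroup[OF E e H]])
  then show ?thesis using RD.component_props(3)[OF a] by simp
qed

text \<open>A pigeonhole principle: a monomial of high degree in the x_l contains some x_l at least
  \<open>k l\<close> times. Formally, one factor x_l is split off and moved to e, which lowers the
  exponent required for x_l by one.\<close>

lemma high_degree_annihilates:
  assumes gen: "ring_generators R n x" and E: "module R E" and e: "e \<in> carrier E"
    and "\<And>l. l < n \<Longrightarrow> x l [^] (k l :: nat) \<odot>\<^bsub>E\<^esub> e = \<zero>\<^bsub>E\<^esub>" and "(\<Sum>l<n. k l) < m" and "r \<in> rpart R m"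
  shows "r \<odot>\<^bsub>E\<^esub> e = \<zero>\<^bsub>E\<^esub>"
  using e assms(4-6)
proof (induction "\<Sum>l<n. k l" arbitrary: k e m r rule: less_induct)
  case less
  interpret E: module R E by (rule E)
  have xp: "x l \<in> rpart R 1" and xc: "x l \<in> carrier R" for l
    using gen RD.part_carrier by (auto simp: ring_generators_def)
  obtain m' where m: "m = Suc m'" using less.prems(3) by (cases m) auto
  let ?H = "{r \<in> carrier R. r \<odot>\<^bsub>E\<^esub> e = \<zero>\<^bsub>E\<^esub>}"
  have H: "additive_subgroup ?H R"
    by (rule additive_subgroupI') (use less.prems(1) in \<open>auto simp: E.smult_l_distr E.smult_l_minus\<close>)
  have "x l \<otimes> b \<in> ?H" if l: "l < n" and b: "b \<in> rpart R m'" for l b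
  proof -
    have bc: "b \<in> carrier R" using b RD.part_carrier by blast
    show ?thesis
    proof (cases "k l")
      case 0
      then have "e = \<zero>\<^bsub>E\<^esub>" using less.prems(1,2) l by fastforce
      then show ?thesis using bc xc by simp
    next
      case (Suc p)
      let ?k = "k(l := p)"
      have s: "(\<Sum>i<n. k i) = Suc (\<Sum>i<n. ?k i)"
        using l Suc sum.remove[of "{..<n}" l k] sum.remove[of "{..<n}" l ?k] by simp
      have "b \<odot>\<^bsub>E\<^esub> (x l \<odot>\<^bsub>E\<^esub> e) = \<zero>\<^bsub>E\<^esub>"
      proof (rule less.hyps[of ?k])
        fix i assume i: "i < n"
        show "x i [^] ?k i \<odot>\<^bsub>E\<^esub> (x l \<odot>\<^bsub>E\<^esub> e) = \<zero>\<^bsub>E\<^esub>"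
        proof (cases "i = l")
          case True
          then show ?thesis using less.prems(1) less.prems(2)[OF l] Suc xc by (simp add: E.smult_assoc1)
        next
          case False
          have "x i [^] k i \<odot>\<^bsub>E\<^esub> (x l \<odot>\<^bsub>E\<^esub> e) = x l \<odot>\<^bsub>E\<^esub> (x i [^] k i \<odot>\<^bsub>E\<^esub> e)"
            using less.prems(1) xc by (simp add: E.smult_assoc1[symmetric] m_comm)
          then show ?thesis using False less.prems(2)[OF i] xc by simp
        qed
      qed (use s less.prems m b xc in auto)
      then show ?thesis using bc xc less.prems(1) by (simp add: E.smult_assoc1[symmetric] m_comm)
    qed
  qed
  then have "rpart R (Suc m') \<subseteq> ?H" using gen H unfolding ring_generators_def by blast
  then show ?case using less.prems(4) m by blast
qed

text \<open>Torsion with respect to powers of an ideal becomes a condition on each generator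
  separately, so that it can be imposed one generator at a time.\<close>

lemma torsion_part_eq:
  assumes gen: "ring_generators R n x" and E: "module R E"
  shows "torsion_part R E = {e \<in> carrier E. \<forall>l<n. \<exists>k. x l [^] (k::nat) \<odot>\<^bsub>E\<^esub> e = \<zero>\<^bsub>E\<^esub>}"
proof (intro equalityI subsetI)
  fix e assume "e \<in> torsion_part R E"
  then show "e \<in> {e \<in> carrier E. \<forall>l<n. \<exists>k. x l [^] (k::nat) \<odot>\<^bsub>E\<^esub> e = \<zero>\<^bsub>E\<^esub>}"
    using gen pow_ideal_power by (fastforce simp: torsion_part_def ring_generators_def)
next
  interpret E: module R E by (rule E)
  fix e assume "e \<in> {e \<in> carrier E. \<forall>l<n. \<exists>k. x l [^] (k::nat) \<odot>\<^bsub>E\<^esub> e = \<zero>\<^bsub>E\<^esub>}"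
  then obtain k :: "nat \<Rightarrow> nat" where e: "e \<in> carrier E" and k: "\<And>l. l < n \<Longrightarrow> x l [^] k l \<odot>\<^bsub>E\<^esub> e = \<zero>\<^bsub>E\<^esub>" by auto metis
  have z: "additive_subgroup {\<zero>\<^bsub>E\<^esub>} E" by (rule E.additive_subgroupI') auto
  have "a \<odot>\<^bsub>E\<^esub> e = \<zero>\<^bsub>E\<^esub>" if "a \<in> ideal_power R (irrelevant_ideal R) (Suc (\<Sum>l<n. k l))" for a
  proof -
    have a: "a \<in> carrier R" "\<And>i. i < Suc (\<Sum>l<n. k l) \<Longrightarrow> ring_component R i a = \<zero>"
      using ideal_power_component[OF that] by auto
    have "ring_component R i a \<odot>\<^bsub>E\<^esub> e \<in> {\<zero>\<^bsub>E\<^esub>}" for i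
    proof (cases "i < Suc (\<Sum>l<n. k l)")
      case True
      then show ?thesis using a(2) e by simp
    next
      case False
      then show ?thesis
        using high_degree_annihilates[OF gen E e k _ RD.component_part[OF a(1)], of i] RD.component_closed[OF a(1)] by simp
    qed
    from smult_by_components[OF E e z a(1) this] show ?thesis by simp
  qed
  then show "e \<in> torsion_part R E" using e unfolding torsion_part_def by blast
qed

lemma power_annihilates_mono:
  assumes "module R E" "e \<in> carrier E" "y \<in> carrier R" "y [^] (k::nat) \<odot>\<^bsub>E\<^esub> e = \<zero>\<^bsub>E\<^esub>"
  shows "y [^] (m + k) \<odot>\<^bsub>E\<^esub> e = \<zero>\<^bsub>E\<^esub>"
proof -
  interpret E: module R E by fact
  show ?thesis using assms by (simp add: nat_pow_mult[symmetric] E.smult_assoc1)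
qed

lemma power_torsion_subgroup:
  assumes E: "module R E" and H: "additive_subgroup H E" and y: "\<And>l. l \<in> I \<Longrightarrow> y l \<in> carrier R"
  shows "additive_subgroup {e \<in> H. \<forall>l\<in>I. \<exists>k. y l [^] (k::nat) \<odot>\<^bsub>E\<^esub> e = \<zero>\<^bsub>E\<^esub>} E"
proof -
  interpret E: module R E by (rule E)
  note Hc = additive_subgroup.a_Hcarr[OF H] and Ha = additive_subgroup.a_closed[OF H]
    and Hz = additive_subgroup.zero_closed[OF H] and Hn = E.additive_subgroup_neg[OF H]
  show ?thesis
  proof (rule E.additive_subgroupI')
    show "\<zero>\<^bsub>E\<^esub> \<in> {e \<in> H. \<forall>l\<in>I. \<exists>k. y l [^] (k::nat) \<odot>\<^bsub>E\<^esub> e = \<zero>\<^bsub>E\<^esub>}" using Hz y by auto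
  next
    fix e f assume e: "e \<in> {e \<in> H. \<forall>l\<in>I. \<exists>k. y l [^] (k::nat) \<odot>\<^bsub>E\<^esub> e = \<zero>\<^bsub>E\<^esub>}"
      and f: "f \<in> {e \<in> H. \<forall>l\<in>I. \<exists>k. y l [^] (k::nat) \<odot>\<^bsub>E\<^esub> e = \<zero>\<^bsub>E\<^esub>}"
    have "\<exists>k. y l [^] (k::nat) \<odot>\<^bsub>E\<^esub> (e \<oplus>\<^bsub>E\<^esub> f) = \<zero>\<^bsub>E\<^esub>" if l: "l \<in> I" for l
    proof -
      obtain j k :: nat where "y l [^] j \<odot>\<^bsub>E\<^esub> e = \<zero>\<^bsub>E\<^esub>" "y l [^] k \<odot>\<^bsub>E\<^esub> f = \<zero>\<^bsub>E\<^esub>" using e f l by blast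
      then have "y l [^] (k + j) \<odot>\<^bsub>E\<^esub> e = \<zero>\<^bsub>E\<^esub>" "y l [^] (k + j) \<odot>\<^bsub>E\<^esub> f = \<zero>\<^bsub>E\<^esub>"
        using power_annihilates_mono[OF E _ y[OF l], of e j k] power_annihilates_mono[OF E _ y[OF l], of f k j]
          e f Hc by (simp_all add: add.commute[of j k])
      then show ?thesis using e f Hc y[OF l] by (intro exI[of _ "k + j"]) (simp add: E.smult_r_distr)
    qed
    then show "e \<oplus>\<^bsub>E\<^esub> f \<in> {e \<in> H. \<forall>l\<in>I. \<exists>k. y l [^] (k::nat) \<odot>\<^bsub>E\<^esub> e = \<zero>\<^bsub>E\<^esub>}" using e f Ha by auto
  next
    fix e assume e: "e \<in> {e \<in> H. \<forall>l\<in>I. \<exists>k. y l [^] (k::nat) \<odot>\<^bsub>E\<^esub> e = \<zero>\<^bsub>E\<^esub>}"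
    have "\<exists>k. y l [^] (k::nat) \<odot>\<^bsub>E\<^esub> (\<ominus>\<^bsub>E\<^esub> e) = \<zero>\<^bsub>E\<^esub>" if l: "l \<in> I" for l
    proof -
      obtain k :: nat where "y l [^] k \<odot>\<^bsub>E\<^esub> e = \<zero>\<^bsub>E\<^esub>" using e l by blast
      then show ?thesis using e Hc y[OF l] by (intro exI[of _ k]) (simp add: E.smult_r_minus)
    qed
    then show "\<ominus>\<^bsub>E\<^esub> e \<in> {e \<in> H. \<forall>l\<in>I. \<exists>k. y l [^] (k::nat) \<odot>\<^bsub>E\<^esub> e = \<zero>\<^bsub>E\<^esub>}" using e Hn by auto
  qed (use Hc in auto)
qed

end

text \<open>\<open>N\<close> only has to share the addition of \<open>M\<close>. Hence the statement
  applies to the cocycles inside a module of the resolution without making them a module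
  beforehand.\<close>

lemma graded_quot_part_trivial:
  assumes M: "abelian_group M" and add: "add N = add M" and H: "additive_subgroup H M"
    and sub: "part N t \<subseteq> carrier M" and ne: "part N t \<noteq> {}"
  shows "part (graded_quot N H) t = {\<zero>\<^bsub>graded_quot N H\<^esub>} \<longleftrightarrow> part N t \<subseteq> H"
proof -
  interpret M: abelian_group M by (rule M)
  note Ha = additive_subgroup.a_closed[OF H] and Hz = additive_subgroup.zero_closed[OF H]
    and Hm = M.additive_subgroup_minus[OF H] and Hc = additive_subgroup.a_Hcarr[OF H]
  have coset: "H +>\<^bsub>N\<^esub> y = {h \<oplus>\<^bsub>M\<^esub> y | h. h \<in> H}" for y
    by (auto simp: a_r_coset_def r_coset_def add)
  have "H +>\<^bsub>N\<^esub> y = H \<longleftrightarrow> y \<in> H" if y: "y \<in> part N t" for y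
  proof
    assume "H +>\<^bsub>N\<^esub> y = H"
    then have "\<zero>\<^bsub>M\<^esub> \<oplus>\<^bsub>M\<^esub> y \<in> H" using Hz unfolding coset by blast
    then show "y \<in> H" using y sub by auto
  next
    assume yH: "y \<in> H"
    have "h = (h \<ominus>\<^bsub>M\<^esub> y) \<oplus>\<^bsub>M\<^esub> y" if "h \<in> H" for h using Hc[OF that] Hc[OF yH] by (simp add: M.group_simps)
    then show "H +>\<^bsub>N\<^esub> y = H" unfolding coset using Hm[OF _ yH] Ha[OF _ yH] by blast
  qed
  then show ?thesis using ne by (auto simp: graded_quot_def)
qed

section \<open>R_+M and chain conditions, one degree at a time\<close>

context graded_module
begin

text \<open>The sum of the x_l M_{u-1} over l < j; for j = n it is the part of R_+M in degree
  u.\<close>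

primrec generated_part :: "(nat \<Rightarrow> 'r) \<Rightarrow> nat \<Rightarrow> int \<Rightarrow> 'm set" where
  "generated_part x 0 u = {\<zero>\<^bsub>M\<^esub>}"
| "generated_part x (Suc j) u = {w \<oplus>\<^bsub>M\<^esub> x j \<odot>\<^bsub>M\<^esub> b | w b. w \<in> generated_part x j u \<and> b \<in> part M (u - 1)}"

context
  fixes x :: "nat \<Rightarrow> 'r" and n :: nat
  assumes gen: "ring_generators R n x"
begin

lemma gen_part: "x l \<in> rpart R 1" and gen_carrier: "x l \<in> carrier R"
  using gen RD.part_carrier by (auto simp: ring_generators_def)

lemma generated_part_sub: "generated_part x j u \<subseteq> part M u"
proof (induction j)
  case (Suc j)
  have "x j \<odot>\<^bsub>M\<^esub> b \<in> part M u" if "b \<in> part M (u - 1)" for b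
    using part_smult[OF gen_part that, of j] by simp
  then show ?case using Suc MD.part_add by auto
qed (simp add: MD.part_zero)

lemma generated_part_closed: "w \<in> generated_part x j u \<Longrightarrow> w \<in> carrier M"
  using generated_part_sub MD.part_carrier by blast

lemma generated_part_subgroup: "additive_subgroup (generated_part x j u) M"
proof (induction j)
  case 0
  show ?case by (rule M.additive_subgroupI') auto
next
  case (Suc j)
  note Ha = additive_subgroup.a_closed[OF Suc] and Hz = additive_subgroup.zero_closed[OF Suc]
    and Hn = M.additive_subgroup_neg[OF Suc]
  note Pn = M.additive_subgroup_neg[OF MD.part_subgroup]
  have I: "w \<oplus>\<^bsub>M\<^esub> x j \<odot>\<^bsub>M\<^esub> b \<in> generated_part x (Suc j) u" if "w \<in> generated_part x j u" "b \<in> part M (u - 1)" for w b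
    using that by auto
  show ?case
  proof (rule M.additive_subgroupI')
    show "generated_part x (Suc j) u \<subseteq> carrier M" using generated_part_closed by blast
    show "\<zero>\<^bsub>M\<^esub> \<in> generated_part x (Suc j) u" using I[OF Hz MD.part_zero] gen_carrier by simp
  next
    fix v v' assume "v \<in> generated_part x (Suc j) u" "v' \<in> generated_part x (Suc j) u"
    then obtain w b w' b' where h: "w \<in> generated_part x j u" "b \<in> part M (u - 1)" "v = w \<oplus>\<^bsub>M\<^esub> x j \<odot>\<^bsub>M\<^esub> b"
      "w' \<in> generated_part x j u" "b' \<in> part M (u - 1)" "v' = w' \<oplus>\<^bsub>M\<^esub> x j \<odot>\<^bsub>M\<^esub> b'" by auto
    have "v \<oplus>\<^bsub>M\<^esub> v' = (w \<oplus>\<^bsub>M\<^esub> w') \<oplus>\<^bsub>M\<^esub> x j \<odot>\<^bsub>M\<^esub> (b \<oplus>\<^bsub>M\<^esub> b')"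
      using h gen_carrier generated_part_closed MD.part_carrier by (simp add: smult_r_distr M.a_ac)
    then show "v \<oplus>\<^bsub>M\<^esub> v' \<in> generated_part x (Suc j) u" using I[OF Ha[OF h(1,4)] MD.part_add[OF h(2,5)]] by simp
  next
    fix v assume "v \<in> generated_part x (Suc j) u"
    then obtain w b where h: "w \<in> generated_part x j u" "b \<in> part M (u - 1)" "v = w \<oplus>\<^bsub>M\<^esub> x j \<odot>\<^bsub>M\<^esub> b" by auto
    have "\<ominus>\<^bsub>M\<^esub> v = \<ominus>\<^bsub>M\<^esub> w \<oplus>\<^bsub>M\<^esub> x j \<odot>\<^bsub>M\<^esub> (\<ominus>\<^bsub>M\<^esub> b)"
      using h gen_carrier generated_part_closed MD.part_carrier by (simp add: smult_r_minus M.minus_add)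
    then show "\<ominus>\<^bsub>M\<^esub> v \<in> generated_part x (Suc j) u" using I[OF Hn[OF h(1)] Pn[OF h(2)]] by simp
  qed
qed

lemma generator_smult_part:
  assumes b: "b \<in> part M (u - 1)" shows "l < j \<Longrightarrow> x l \<odot>\<^bsub>M\<^esub> b \<in> generated_part x j u"
proof (induction j)
  case (Suc j)
  have xb: "x l \<odot>\<^bsub>M\<^esub> b \<in> carrier M" for l using gen_carrier b MD.part_carrier by auto
  show ?case
  proof (cases "l = j")
    case True
    then have "x l \<odot>\<^bsub>M\<^esub> b = \<zero>\<^bsub>M\<^esub> \<oplus>\<^bsub>M\<^esub> x j \<odot>\<^bsub>M\<^esub> b" using xb by simp
    then show ?thesis using b additive_subgroup.zero_closed[OF generated_part_subgroup] by auto
  next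
    case False
    have "x l \<odot>\<^bsub>M\<^esub> b = x l \<odot>\<^bsub>M\<^esub> b \<oplus>\<^bsub>M\<^esub> x j \<odot>\<^bsub>M\<^esub> \<zero>\<^bsub>M\<^esub>" using xb[of l] gen_carrier by simp
    then show ?thesis using False Suc MD.part_zero[of "u - 1"] by (simp) (use False Suc in blast)
  qed
qed simp

lemma generated_part_smult:
  assumes r: "r \<in> rpart R i" shows "w \<in> generated_part x j u \<Longrightarrow> r \<odot>\<^bsub>M\<^esub> w \<in> generated_part x j (u + int i)"
proof (induction j arbitrary: w)
  case 0
  then show ?case using RD.part_carrier[OF r] by simp
next
  case (Suc j)
  have rc: "r \<in> carrier R" using r RD.part_carrier by blast
  from Suc.prems obtain v b where h: "v \<in> generated_part x j u" "b \<in> part M (u - 1)" "w = v \<oplus>\<^bsub>M\<^esub> x j \<odot>\<^bsub>M\<^esub> b" by auto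
  have bc: "b \<in> carrier M" and vc: "v \<in> carrier M" using h MD.part_carrier generated_part_closed by blast+
  have "r \<odot>\<^bsub>M\<^esub> (x j \<odot>\<^bsub>M\<^esub> b) = x j \<odot>\<^bsub>M\<^esub> (r \<odot>\<^bsub>M\<^esub> b)"
    using rc bc gen_carrier by (simp add: smult_assoc1[symmetric] m_comm)
  then have "r \<odot>\<^bsub>M\<^esub> w = r \<odot>\<^bsub>M\<^esub> v \<oplus>\<^bsub>M\<^esub> x j \<odot>\<^bsub>M\<^esub> (r \<odot>\<^bsub>M\<^esub> b)"
    using h rc bc vc gen_carrier by (simp add: smult_r_distr)
  moreover have "r \<odot>\<^bsub>M\<^esub> b \<in> part M (u + int i - 1)" using part_smult[OF r h(2)] by (simp add: algebra_simps)
  ultimately show ?case using Suc.IH[OF h(1)] by auto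
qed

lemma positive_degree_smult:
  assumes r: "r \<in> rpart R (Suc i)" and m: "m \<in> part M t"
  shows "r \<odot>\<^bsub>M\<^esub> m \<in> generated_part x n (t + int (Suc i))"
proof -
  let ?u = "t + int (Suc i)"
  have mc: "m \<in> carrier M" using m MD.part_carrier by blast
  note S = generated_part_subgroup[of n ?u]
  let ?H = "{r \<in> carrier R. r \<odot>\<^bsub>M\<^esub> m \<in> generated_part x n ?u}"
  have "additive_subgroup ?H R" by (rule smult_preimage_subgroup[OF module mc S])
  moreover have "x l \<otimes> b \<in> ?H" if l: "l < n" and b: "b \<in> rpart R i" for l b
  proof -
    have bc: "b \<in> carrier R" using b RD.part_carrier by blast
    have "b \<odot>\<^bsub>M\<^esub> m \<in> part M (?u - 1)" using part_smult[OF b m] by (simp add: algebra_simps)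
    from generator_smult_part[OF this l] show ?thesis using bc mc gen_carrier by (simp add: smult_assoc1)
  qed
  ultimately have "rpart R (Suc i) \<subseteq> ?H" using gen unfolding ring_generators_def by blast
  then show ?thesis using r by blast
qed

text \<open>For the harder inclusion, the elements all of whose components are generated form a
  submodule. It contains every product am with a in R_+, since the components of a have positive
  degree and lie in the ideal of the x_l.\<close>

lemma irrelevant_smult_part: "irrelevant_smult R M \<inter> part M u = generated_part x n u"
proof (intro equalityI subsetI)
  fix w assume "w \<in> generated_part x n u"
  moreover have "generated_part x j u \<subseteq> irrelevant_smult R M" for j
    unfolding irrelevant_smult_def submodule_generated_def
  proof (rule Inter_greatest)
    fix H assume "H \<in> {H. submodule H R M \<and> {a \<odot>\<^bsub>M\<^esub> y |a y. a \<in> irrelevant_ideal R \<and> y \<in> carrier M} \<subseteq> H}"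
    then have H: "submodule H R M" and sub: "\<And>a y. a \<in> irrelevant_ideal R \<Longrightarrow> y \<in> carrier M \<Longrightarrow> a \<odot>\<^bsub>M\<^esub> y \<in> H" by auto
    note Hc = submoduleE[OF H]
    show "generated_part x j u \<subseteq> H"
    proof (induction j)
      case 0
      obtain h where "h \<in> H" using Hc(2) by blast
      then have "\<zero> \<odot>\<^bsub>M\<^esub> h \<in> H" using Hc(4) by simp
      then show ?case using \<open>h \<in> H\<close> Hc(1) by auto
    next
      case (Suc j)
      have "x j \<odot>\<^bsub>M\<^esub> b \<in> H" if "b \<in> part M (u - 1)" for b
        using sub[OF part_irrelevant_ideal[OF gen_part]] MD.part_carrier[OF that] by simp
      then show ?case using Suc Hc(5) by auto
    qed
  qed
  ultimately show "w \<in> irrelevant_smult R M \<inter> part M u" using generated_part_sub by blast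
next
  fix w assume w: "w \<in> irrelevant_smult R M \<inter> part M u"
  let ?H = "{m \<in> carrier M. \<forall>t. module_component M t m \<in> generated_part x n t}"
  note S = generated_part_subgroup
  have Hadd: "v \<oplus>\<^bsub>M\<^esub> w \<in> ?H" if "v \<in> ?H" "w \<in> ?H" for v w
    using that additive_subgroup.a_closed[OF S] by (simp add: MD.component_add)
  have Hz: "\<zero>\<^bsub>M\<^esub> \<in> ?H" using additive_subgroup.zero_closed[OF S] by (simp add: MD.component_zero)
  have Hsub: "additive_subgroup ?H M"
    by (rule M.additive_subgroupI') (use Hadd Hz M.additive_subgroup_neg[OF S] in \<open>auto simp: MD.component_neg\<close>)
  have smult: "r \<odot>\<^bsub>M\<^esub> m \<in> ?H" if r: "r \<in> carrier R" and m: "m \<in> ?H" for r m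
    using r
  proof (induction r rule: RD.homogeneous_induct)
    case (part i r)
    have "r \<odot>\<^bsub>M\<^esub> module_component M (t - int i) m \<in> generated_part x n t" for t
      using generated_part_smult[OF part, of _ n "t - int i"] m by simp
    then show ?case using m RD.part_carrier[OF part] by (simp add: module_component_smult[OF part])
  next
    case (add r s)
    then show ?case using Hadd m by (simp add: smult_l_distr)
  qed
  have "submodule ?H R M"
    by (rule submoduleI) (use Hz Hadd smult M.additive_subgroup_neg[OF Hsub] in auto)
  moreover have "a \<odot>\<^bsub>M\<^esub> m \<in> ?H" if a: "a \<in> irrelevant_ideal R" and m: "m \<in> carrier M" for a m
  proof -
    have "ring_component R i a \<odot>\<^bsub>M\<^esub> m \<in> ?H" for i
    proof (cases i)
      case 0
      then show ?thesis using irrelevant_ideal_component[OF a] m Hz by simp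
    next
      case (Suc i')
      have ap: "ring_component R i a \<in> rpart R i" and ac: "ring_component R i a \<in> carrier R"
        using irrelevant_ideal_component[OF a] RD.component_part RD.component_closed by auto
      have "module_component M t (ring_component R i a \<odot>\<^bsub>M\<^esub> m) \<in> generated_part x n t" for t
        using positive_degree_smult[OF ap[unfolded Suc] MD.component_part[OF m, of "t - int i"]]
          module_component_smult[OF ap m, of t] Suc by simp
      then show ?thesis using ac m by simp
    qed
    from smult_by_components[OF module m Hsub irrelevant_ideal_component(1)[OF a] this] show ?thesis .
  qed
  ultimately have "irrelevant_smult R M \<subseteq> ?H"
    unfolding irrelevant_smult_def submodule_generated_def by (intro Inter_lower) blast
  then have "module_component M u w \<in> generated_part x n u" using w by blast
  then show "w \<in> generated_part x n u" using w MD.component_same[of w u] by simp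
qed

end

text \<open>A graded family is recovered from the submodule of all elements whose components lie in
  it, so chains of families become chains of submodules.\<close>

lemma acc_noetherian_family:
  assumes acc: "acc_below M (carrier R) (carrier M)"
  shows "noetherian_family R M (part M)"
  unfolding noetherian_family_def
proof (intro allI impI, elim conjE)
  fix N :: "nat \<Rightarrow> int \<Rightarrow> 'm set"
  assume g: "\<forall>k. graded_family R M (N k)" and sub: "\<forall>k u. N k u \<subseteq> part M u" and up: "\<forall>k u. N k u \<subseteq> N (Suc k) u"
  have S: "additive_subgroup (N k u) M" for k u using g by (simp add: graded_family_def)
  have smult: "r \<odot>\<^bsub>M\<^esub> y \<in> N k (u + int i)" if "r \<in> rpart R i" "y \<in> N k u" for r i y k u
    using g that by (simp add: graded_family_def)
  define L where "L k = {m \<in> carrier M. \<forall>t. module_component M t m \<in> N k t}" for k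
  have Ladd: "v \<oplus>\<^bsub>M\<^esub> w \<in> L k" if "v \<in> L k" "w \<in> L k" for v w k
    using that additive_subgroup.a_closed[OF S] by (simp add: L_def MD.component_add)
  have Lz: "\<zero>\<^bsub>M\<^esub> \<in> L k" for k using additive_subgroup.zero_closed[OF S] by (simp add: L_def MD.component_zero)
  have Lsmult: "r \<odot>\<^bsub>M\<^esub> m \<in> L k" if r: "r \<in> carrier R" and m: "m \<in> L k" for r m k
    using r
  proof (induction r rule: RD.homogeneous_induct)
    case (part i r)
    have mc: "m \<in> carrier M" using m by (simp add: L_def)
    have "r \<odot>\<^bsub>M\<^esub> module_component M (t - int i) m \<in> N k t" for t
      using smult[OF part, of _ k "t - int i"] m by (simp add: L_def)
    then show ?case using mc RD.part_carrier[OF part] by (simp add: L_def module_component_smult[OF part])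
  next
    case (add r s)
    then show ?case using Ladd m by (simp add: smult_l_distr L_def)
  qed
  have st: "stable_subgroup M (carrier R) (L k)" for k
    by (rule stable_subgroupI)
      (use Ladd Lz Lsmult M.additive_subgroup_neg[OF S] in \<open>auto simp: L_def MD.component_neg\<close>)
  have "L k \<subseteq> carrier M" "L k \<subseteq> L (Suc k)" for k using up by (auto simp: L_def)
  then obtain k0 where k0: "\<And>k. k \<ge> k0 \<Longrightarrow> L k = L k0"
    using acc_belowD[where L = L, OF acc st] by metis
  have mem: "y \<in> N k u \<longleftrightarrow> y \<in> L k \<and> y \<in> part M u" for y k u
  proof
    assume y: "y \<in> N k u"
    then have yp: "y \<in> part M u" using sub by blast
    have "module_component M t y \<in> N k t" for t
      using y MD.component_same[OF yp] MD.component_other[OF yp] additive_subgroup.zero_closed[OF S] by (cases "t = u") auto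
    then show "y \<in> L k \<and> y \<in> part M u" using yp MD.part_carrier by (simp add: L_def)
  next
    assume "y \<in> L k \<and> y \<in> part M u"
    then have "module_component M u y \<in> N k u" unfolding L_def by blast
    moreover have "module_component M u y = y" using MD.component_same[of y u] \<open>y \<in> L k \<and> y \<in> part M u\<close> by blast
    ultimately show "y \<in> N k u" by simp
  qed
  show "\<exists>k0. \<forall>k\<ge>k0. \<forall>u. N k u = N k0 u" using k0 mem by blast
qed

text \<open>R has no negative degrees, so the parts of M in degrees at least -k form a graded
  submodule; these submodules ascend with k and must become constant.\<close>

lemma part_bounded_below:
  assumes "noetherian_family R M (part M)"
  shows "\<exists>u0. \<forall>u<u0. part M u = {\<zero>\<^bsub>M\<^esub>}"
proof -
  define N where "N k u = (if u < - int k then {\<zero>\<^bsub>M\<^esub>} else part M u)" for k u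
  have z: "additive_subgroup {\<zero>\<^bsub>M\<^esub>} M" by (rule M.additive_subgroupI') auto
  have "r \<odot>\<^bsub>M\<^esub> y \<in> N k (u + int i)" if "r \<in> rpart R i" "y \<in> N k u" for r i y k u
    using part_smult[OF that(1), of y u] that MD.part_zero RD.part_carrier[OF that(1)] smult_r_null
    by (auto simp: N_def add.commute split: if_splits)
  then have "graded_family R M (N k)" for k
    unfolding graded_family_def using MD.part_subgroup z by (auto simp: N_def)
  moreover have "N k u \<subseteq> part M u" "N k u \<subseteq> N (Suc k) u" for k u using MD.part_zero by (auto simp: N_def)
  ultimately obtain k0 where k0: "\<And>k u. k \<ge> k0 \<Longrightarrow> N k u = N k0 u"
    using noetherian_familyD[OF assms, of N] by metis
  have "part M u = {\<zero>\<^bsub>M\<^esub>}" if "u < - int k0" for u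
    using k0[of "nat (- u)" u] that by (simp add: N_def)
  then show ?thesis by blast
qed

end

section \<open>Koszul complexes and local cohomology\<close>

locale resolved_module = pairing pr p1 p2 + graded_module R M
  for pr :: "'e \<Rightarrow> 'e \<Rightarrow> 'e" and p1 p2 and R :: "'r graded_ring" (structure) and M :: "('r, 'm) graded_module" +
  fixes n :: nat and x :: "nat \<Rightarrow> 'r" and \<epsilon> :: "'m \<Rightarrow> 'e" and E :: "nat \<Rightarrow> ('r, 'e) graded_module"
    and d :: "nat \<Rightarrow> 'e \<Rightarrow> 'e"
  assumes gen: "ring_generators R n x" and res: "graded_injective_resolution R M (\<epsilon>, E, d)"
    and ring_acc: "acc_below (shifted_ring R 0) (carrier R) (carrier R)"
    and acc: "acc_below M (carrier R) (carrier M)"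
begin

text \<open>Since \<open>nat\<close> truncates, \<open>P q\<close> is \<open>E 0\<close> for
  negative q, and \<open>D q\<close> is zero there. The families below are zero in negative degrees,
  so they behave as if the resolution were extended by zero.\<close>

definition P :: "int \<Rightarrow> ('r, 'e) graded_module" where "P q = E (nat q)"
definition D :: "int \<Rightarrow> 'e \<Rightarrow> 'e" where "D q = (if q < 0 then (\<lambda>_. \<zero>\<^bsub>E 0\<^esub>) else d (nat q))"

text \<open>For j = 0 this is the whole resolution, for j = n its R_+-torsion; j counts the
  generators for which torsion has been imposed.\<close>

definition torsion_family :: "nat \<Rightarrow> int \<Rightarrow> int \<Rightarrow> 'e set" where
  "torsion_family j q u = (if q < 0 then {\<zero>\<^bsub>P q\<^esub>}
     else {e \<in> part (P q) u. \<forall>l\<in>{..<j}. \<exists>k. x l [^] (k::nat) \<odot>\<^bsub>P q\<^esub> e = \<zero>\<^bsub>P q\<^esub>})"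

text \<open>M as a complex concentrated in degree zero, by way of its image under
  \<open>\<epsilon>\<close>.\<close>

definition cocycle_family :: "int \<Rightarrow> int \<Rightarrow> 'e set" where
  "cocycle_family q u = (if q = 0 then {e \<in> part (P q) u. D q e = \<zero>\<^bsub>P 1\<^esub>} else {\<zero>\<^bsub>P q\<^esub>})"

lemma E_graded: "graded_module R (E i)" and E_injective: "graded_injective R (E i)"
  and d_hom: "d i \<in> graded_hom R (E i) (E (Suc i))" and \<epsilon>_hom: "\<epsilon> \<in> graded_hom R M (E 0)"
  and \<epsilon>_inj: "inj_on \<epsilon> (carrier M)" and \<epsilon>_image: "\<epsilon> ` carrier M = {e \<in> carrier (E 0). d 0 e = \<zero>\<^bsub>E 1\<^esub>}"
  and d_image: "d i ` carrier (E i) = {e \<in> carrier (E (Suc i)). d (Suc i) e = \<zero>\<^bsub>E (Suc (Suc i))\<^esub>}"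
  using res unfolding graded_injective_resolution_def prod.case by blast+

lemma d_part: "e \<in> part (E i) u \<Longrightarrow> d i e \<in> part (E (Suc i)) u"
  using d_hom[of i] unfolding graded_hom_def by blast

lemma \<epsilon>_part: "m \<in> part M u \<Longrightarrow> \<epsilon> m \<in> part (E 0) u"
  using \<epsilon>_hom unfolding graded_hom_def by blast

lemma P_graded: "graded_module R (P q)" by (simp add: P_def E_graded)

interpretation P: graded_module R "P q" for q by (rule P_graded)

lemma D_part: "e \<in> part (P q) u \<Longrightarrow> D q e \<in> part (P (q + 1)) u"
proof (cases "q < 0")
  case True
  then have "nat (q + 1) = 0" by simp
  then show ?thesis using True P.MD.part_zero[of "q + 1"] by (simp add: D_def P_def)
next
  case False
  then have "nat (q + 1) = Suc (nat q)" by simp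
  moreover assume "e \<in> part (P q) u"
  ultimately show ?thesis using d_part[of e "nat q" u] False by (simp add: D_def P_def)
qed

lemma D_linear: "linear R (P q) (P (q + 1)) (D q)"
proof (cases "q < 0")
  case True
  interpret E0: graded_module R "E 0" by (rule E_graded)
  have "P (q + 1) = E 0" using True by (simp add: P_def)
  then show ?thesis using True by (simp add: linear_def D_def)
next
  case False
  then have "nat (q + 1) = Suc (nat q)" by simp
  then show ?thesis using d_hom[of "nat q"] False by (auto simp: graded_hom_def D_def P_def linear_def)
qed

lemma complex: "cochain_complex R P D"
  unfolding cochain_complex_def
proof (intro conjI allI ballI)
  fix q
  show "module R (P q)" by (rule P.module)
  show "linear R (P q) (P (q + 1)) (D q)" by (rule D_linear)
  fix e assume e: "e \<in> carrier (P q)"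
  show "D (q + 1) (D q e) = \<zero>\<^bsub>P (q + 2)\<^esub>"
  proof (cases "q < 0")
    case True
    then have "D q e = \<zero>\<^bsub>P (q + 1)\<^esub>" by (simp add: D_def P_def)
    then show ?thesis using linear_zero[OF P.module P.module D_linear, of "q + 1"]
      by (simp add: add.commute[of 2 q])
  next
    case False
    then have *: "nat (q + 1) = Suc (nat q)" "nat (q + 2) = Suc (Suc (nat q))" by simp_all
    have "d (nat q) e \<in> d (nat q) ` carrier (E (nat q))" using e by (simp add: P_def)
    then show ?thesis using False unfolding d_image D_def P_def * by simp
  qed
qed

sublocale koszul_complex pr p1 p2 R P D x
  by unfold_locales (use complex gen in \<open>auto simp: ring_generators_def\<close>)

lemmas x_carrier = RD.part_carrier[OF x_part]
lemmas D_simps = linear_add[OF D_linear] linear_smult[OF D_linear] linear_neg[OF P.module P.module D_linear]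
  linear_zero[OF P.module P.module D_linear] linear_closed[OF D_linear]

lemma torsion_family_zero: "\<zero>\<^bsub>P q\<^esub> \<in> torsion_family j q u"
  using P.MD.part_zero x_carrier by (auto simp: torsion_family_def)

lemma torsion_family_subgroup: "additive_subgroup (torsion_family j q u) (P q)"
proof (cases "q < 0")
  case True
  have "additive_subgroup {\<zero>\<^bsub>P q\<^esub>} (P q)" by (rule P.M.additive_subgroupI') auto
  then show ?thesis using True by (simp add: torsion_family_def)
next
  case False
  then show ?thesis
    using power_torsion_subgroup[OF P.module[of q] P.MD.part_subgroup[of q u] x_carrier, of "{..<j}"]
    by (simp add: torsion_family_def)
qed

lemma torsion_family_smult:
  assumes a: "a \<in> rpart R i" and e: "e \<in> torsion_family j q u"
  shows "a \<odot>\<^bsub>P q\<^esub> e \<in> torsion_family j q (u + int i)"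
proof (cases "q < 0")
  case True
  then show ?thesis using e RD.part_carrier[OF a] by (simp add: torsion_family_def)
next
  case False
  have ac: "a \<in> carrier R" using a RD.part_carrier by blast
  have ep: "e \<in> part (P q) u" and t: "\<And>l. l < j \<Longrightarrow> \<exists>k. x l [^] (k::nat) \<odot>\<^bsub>P q\<^esub> e = \<zero>\<^bsub>P q\<^esub>"
    using e False by (auto simp: torsion_family_def)
  have ec: "e \<in> carrier (P q)" using ep P.MD.part_carrier by blast
  have "\<exists>k. x l [^] (k::nat) \<odot>\<^bsub>P q\<^esub> (a \<odot>\<^bsub>P q\<^esub> e) = \<zero>\<^bsub>P q\<^esub>" if l: "l < j" for l
  proof -
    obtain k :: nat where k: "x l [^] k \<odot>\<^bsub>P q\<^esub> e = \<zero>\<^bsub>P q\<^esub>" using t[OF l] by blast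
    have "x l [^] k \<odot>\<^bsub>P q\<^esub> (a \<odot>\<^bsub>P q\<^esub> e) = a \<odot>\<^bsub>P q\<^esub> (x l [^] k \<odot>\<^bsub>P q\<^esub> e)"
      using ac ec x_carrier by (simp add: P.smult_assoc1[symmetric] m_comm)
    then show ?thesis using k ac by auto
  qed
  then show ?thesis using False P.part_smult[OF a ep] by (simp add: torsion_family_def add.commute)
qed

lemma torsion_family_subcomplex: "subcomplex R P D (torsion_family j)"
  unfolding subcomplex_def
proof (intro conjI allI impI)
  fix q u e assume e: "e \<in> torsion_family j q u"
  show "D q e \<in> torsion_family j (q + 1) u"
  proof (cases "q < 0")
    case True
    then have "D q e = \<zero>\<^bsub>P (q + 1)\<^esub>" by (simp add: D_def P_def)
    then show ?thesis using torsion_family_zero by simp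
  next
    case False
    have ep: "e \<in> part (P q) u" and t: "\<And>l. l < j \<Longrightarrow> \<exists>k. x l [^] (k::nat) \<odot>\<^bsub>P q\<^esub> e = \<zero>\<^bsub>P q\<^esub>"
      using e False by (auto simp: torsion_family_def)
    have ec: "e \<in> carrier (P q)" using ep P.MD.part_carrier by blast
    have "\<exists>k. x l [^] (k::nat) \<odot>\<^bsub>P (q + 1)\<^esub> D q e = \<zero>\<^bsub>P (q + 1)\<^esub>" if l: "l < j" for l
    proof -
      obtain k :: nat where k: "x l [^] k \<odot>\<^bsub>P q\<^esub> e = \<zero>\<^bsub>P q\<^esub>" using t[OF l] by blast
      have "x l [^] k \<odot>\<^bsub>P (q + 1)\<^esub> D q e = D q (x l [^] k \<odot>\<^bsub>P q\<^esub> e)" using ec x_carrier by (simp add: D_simps)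
      then show ?thesis using k by (auto simp: D_simps)
    qed
    then show ?thesis using False D_part[OF ep] by (simp add: torsion_family_def)
  qed
qed (use torsion_family_subgroup torsion_family_smult in auto)

lemma cocycle_family_subcomplex: "subcomplex R P D cocycle_family"
  unfolding subcomplex_def
proof (intro conjI allI impI)
  fix q u
  have z: "additive_subgroup {\<zero>\<^bsub>P q\<^esub>} (P q)" by (rule P.M.additive_subgroupI') auto
  have "additive_subgroup {e \<in> part (P 0) u. D 0 e = \<zero>\<^bsub>P 1\<^esub>} (P 0)"
    by (rule P.M.additive_subgroupI')
      (use P.MD.part_carrier P.MD.part_zero P.MD.part_add P.M.additive_subgroup_neg[OF P.MD.part_subgroup]
         D_simps(1)[where q = 0, simplified] D_simps(3)[where q = 0, simplified] D_simps(4)[where q = 0, simplified] in auto)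
  then show "additive_subgroup (cocycle_family q u) (P q)" using z by (auto simp: cocycle_family_def)
next
  fix q u i a e assume a: "a \<in> rpart R i" and e: "e \<in> cocycle_family q u"
  have ac: "a \<in> carrier R" using a RD.part_carrier by blast
  show "a \<odot>\<^bsub>P q\<^esub> e \<in> cocycle_family q (u + int i)"
  proof (cases "q = 0")
    case True
    then have "e \<in> part (P 0) u" "D 0 e = \<zero>\<^bsub>P 1\<^esub>" using e by (auto simp: cocycle_family_def)
    moreover have "e \<in> carrier (P 0)" using calculation P.MD.part_carrier by blast
    moreover have "D 0 (a \<odot>\<^bsub>P 0\<^esub> e) = a \<odot>\<^bsub>P 1\<^esub> D 0 e" using D_simps(2)[of a e 0] ac calculation by simp
    ultimately show ?thesis using True ac P.part_smult[OF a, of e 0 u] by (simp add: cocycle_family_def add.commute)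
  next
    case False
    then show ?thesis using e ac by (simp add: cocycle_family_def)
  qed
next
  fix q u e assume e: "e \<in> cocycle_family q u"
  have z: "\<zero>\<^bsub>P (q + 1)\<^esub> \<in> cocycle_family (q + 1) u"
    using P.MD.part_zero D_simps(4)[of 0] by (auto simp: cocycle_family_def)
  have "D q e = \<zero>\<^bsub>P (q + 1)\<^esub>" using e D_simps(4)[of q] by (cases "q = 0") (auto simp: cocycle_family_def)
  then show "D q e \<in> cocycle_family (q + 1) u" using z by simp
qed

lemma P_minus_zero: "e \<in> carrier (P q) \<Longrightarrow> e \<ominus>\<^bsub>P q\<^esub> \<zero>\<^bsub>P q\<^esub> = e"
  by (simp add: a_minus_def)

lemma D_component: "e \<in> carrier (P q) \<Longrightarrow> q \<ge> 0 \<Longrightarrow> module_component (P (q + 1)) u (D q e) = D q (module_component (P q) u e)"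
  using graded_hom_component[OF E_graded E_graded d_hom, of e "nat q" u] by (simp add: D_def P_def nat_add_distrib)

text \<open>The inclusion of M into its resolution is a quasi-isomorphism, expressed as exactness of
  the quotient.\<close>

lemma resolution_exact: "relatively_exact P D cocycle_family (torsion_family 0) q u"
  unfolding relatively_exact_def
proof (intro ballI impI)
  fix e assume e: "e \<in> torsion_family 0 q u" and De: "D q e \<in> cocycle_family (q + 1) u"
  have ec: "e \<in> carrier (P q)" using additive_subgroup.a_Hcarr[OF torsion_family_subgroup e] .
  have zero: "D (q - 1) \<zero>\<^bsub>P (q - 1)\<^esub> = \<zero>\<^bsub>P q\<^esub>" using D_simps(4)[of "q - 1"] by simp
  consider "q < 0" | "q = 0" | "q > 0" by linarith
  then show "\<exists>c\<in>torsion_family 0 (q - 1) u. e \<ominus>\<^bsub>P q\<^esub> D (q - 1) c \<in> cocycle_family q u"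
  proof cases
    case 1
    then have "e \<in> cocycle_family q u" using e by (simp add: torsion_family_def cocycle_family_def)
    then show ?thesis using zero torsion_family_zero P_minus_zero[OF ec] by (intro bexI[of _ "\<zero>\<^bsub>P (q - 1)\<^esub>"]) auto
  next
    case 2
    then have "e \<in> cocycle_family q u" using e De by (simp add: torsion_family_def cocycle_family_def)
    then show ?thesis using zero torsion_family_zero P_minus_zero[OF ec] by (intro bexI[of _ "\<zero>\<^bsub>P (q - 1)\<^esub>"]) auto
  next
    case 3
    then obtain i where q: "q = int i + 1" by (metis zero_less_imp_eq_int of_nat_Suc Suc_pred add.commute of_nat_0_less_iff)
    have "D q e = \<zero>\<^bsub>P (q + 1)\<^esub>" using De 3 by (simp add: cocycle_family_def)
    moreover have n: "nat (int i + 1) = Suc i" "nat (int i + 1 + 1) = Suc (Suc i)" by simp_all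
    ultimately have "e \<in> d i ` carrier (E i)" using ec unfolding d_image by (simp add: q D_def P_def n)
    then obtain c where c: "c \<in> carrier (P (q - 1))" "e = D (q - 1) c" by (auto simp: q D_def P_def)
    \<comment> \<open>Exactness of the resolution yields a preimage that need not be homogeneous;
      its component of degree u maps to e as well.\<close>
    let ?c = "module_component (P (q - 1)) u c"
    have ep: "e \<in> part (P q) u" using e 3 by (simp add: torsion_family_def)
    have "D (q - 1) ?c = module_component (P q) u e" using D_component[OF c(1), of u] 3 c(2) by simp
    then have "D (q - 1) ?c = e" using P.MD.component_same[OF ep] by simp
    then have "e \<ominus>\<^bsub>P q\<^esub> D (q - 1) ?c \<in> cocycle_family q u" using ec 3 by (simp add: a_minus_def P.M.r_neg cocycle_family_def)
    moreover have "?c \<in> torsion_family 0 (q - 1) u" using P.MD.component_part[OF c(1)] 3 by (simp add: torsion_family_def)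
    ultimately show ?thesis by blast
  qed
qed

lemma torsion_family_Suc:
  "e \<in> torsion_family (Suc j) q u \<longleftrightarrow> e \<in> torsion_family j q u \<and> (\<exists>k. x j [^] (k::nat) \<odot>\<^bsub>P q\<^esub> e = \<zero>\<^bsub>P q\<^esub>)"
  using x_carrier by (auto simp: torsion_family_def lessThan_Suc)

text \<open>Together with \<open>torsion_family_injective\<close>, this makes x_j bijective on the
  j-th quotient of the filtration. Surjectivity is where injectivity of the module and the chain
  condition of the ring meet; injectivity is immediate, as torsion under x_j does not see one extra
  factor x_j.\<close>

lemma torsion_family_divisible:
  assumes b: "b \<in> torsion_family j q u"
  shows "\<exists>c\<in>torsion_family j q (u - 1). b \<ominus>\<^bsub>P q\<^esub> x j \<odot>\<^bsub>P q\<^esub> c \<in> torsion_family (Suc j) q u"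
proof (cases "q < 0")
  case True
  then have "b = \<zero>\<^bsub>P q\<^esub>" using b by (simp add: torsion_family_def)
  then show ?thesis using True torsion_family_zero x_carrier P_minus_zero
    by (intro bexI[of _ "\<zero>\<^bsub>P q\<^esub>"]) auto
next
  case False
  have bp: "b \<in> part (P q) u" and t: "\<And>l. l < j \<Longrightarrow> \<exists>k. x l [^] (k::nat) \<odot>\<^bsub>P q\<^esub> b = \<zero>\<^bsub>P q\<^esub>"
    using b False by (auto simp: torsion_family_def)
  have inj: "graded_injective R (P q)" by (simp add: P_def E_injective)
  from graded_injective_torsion_divide[where x = x, OF ring_acc P_graded inj x_part[of j] x_part bp t]
  obtain k :: nat and c where c: "c \<in> part (P q) (u - 1)" "x j [^] Suc k \<odot>\<^bsub>P q\<^esub> c = x j [^] k \<odot>\<^bsub>P q\<^esub> b"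
    "\<And>l. l < j \<Longrightarrow> \<exists>p. x l [^] (p::nat) \<odot>\<^bsub>P q\<^esub> c = \<zero>\<^bsub>P q\<^esub>" by blast
  have cT: "c \<in> torsion_family j q (u - 1)" using c False by (simp add: torsion_family_def)
  have cc: "c \<in> carrier (P q)" "b \<in> carrier (P q)" using c bp P.MD.part_carrier by blast+
  have "x j \<odot>\<^bsub>P q\<^esub> c \<in> torsion_family j q u" using torsion_family_smult[OF x_part cT, of j] by simp
  then have "b \<ominus>\<^bsub>P q\<^esub> x j \<odot>\<^bsub>P q\<^esub> c \<in> torsion_family j q u"
    using P.M.additive_subgroup_minus[OF torsion_family_subgroup b] by blast
  moreover have "x j [^] k \<odot>\<^bsub>P q\<^esub> (b \<ominus>\<^bsub>P q\<^esub> x j \<odot>\<^bsub>P q\<^esub> c) = \<zero>\<^bsub>P q\<^esub>"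
    using cc x_carrier c(2) by (simp add: a_minus_def P.smult_r_distr P.smult_r_minus P.smult_assoc1[symmetric] P.M.r_neg)
  ultimately show ?thesis unfolding torsion_family_Suc using cT by blast
qed

lemma torsion_family_injective:
  assumes b: "b \<in> torsion_family j q u" and xb: "x j \<odot>\<^bsub>P q\<^esub> b \<in> torsion_family (Suc j) q (u + 1)"
  shows "b \<in> torsion_family (Suc j) q u"
proof -
  have bc: "b \<in> carrier (P q)" using additive_subgroup.a_Hcarr[OF torsion_family_subgroup b] .
  from xb obtain k :: nat where "x j [^] k \<odot>\<^bsub>P q\<^esub> (x j \<odot>\<^bsub>P q\<^esub> b) = \<zero>\<^bsub>P q\<^esub>" unfolding torsion_family_Suc by blast
  then have "x j [^] Suc k \<odot>\<^bsub>P q\<^esub> b = \<zero>\<^bsub>P q\<^esub>" using bc x_carrier by (simp add: P.smult_assoc1)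
  then show ?thesis unfolding torsion_family_Suc using b by blast
qed

section \<open>Comparison of the Koszul complexes of M and of the torsion\<close>

abbreviation koszul_exact :: "(int \<Rightarrow> int \<Rightarrow> 'e set) \<Rightarrow> int \<Rightarrow> int \<Rightarrow> bool" where
  "koszul_exact S \<equiv> exact_at (KP n) (KD n) (KF S n)"

lemma koszul_exact_transfer:
  assumes A: "subcomplex R P D A" and B: "subcomplex R P D B" and AB: "\<And>q u. A q u \<subseteq> B q u"
    and rel: "\<And>q u. relatively_exact (KP n) (KD n) (KF A n) (KF B n) q u"
  shows "koszul_exact A q u \<longleftrightarrow> koszul_exact B q u"
proof
  assume "koszul_exact A q u"
  then show "koszul_exact B q u"
    by (rule exact_transfer_up[OF koszul_cochain_complex koszul_subcomplex[OF A] koszul_subcomplex[OF B] koszul_mono[of A B, OF AB] rel])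
next
  assume "koszul_exact B q u"
  then show "koszul_exact A q u"
    by (rule exact_transfer_down[OF koszul_cochain_complex koszul_subcomplex[OF A] koszul_subcomplex[OF B] koszul_mono[of A B, OF AB] rel])
qed

text \<open>The comparison is a zigzag through \<open>torsion_family 0\<close>, which contains both
  the cocycles and the torsion. The inclusion of the cocycles is handled by exactness of the
  resolution, each step of the filtration by the bijective action of one x_j.\<close>

theorem koszul_exact_torsion_iff: "koszul_exact (torsion_family n) q u \<longleftrightarrow> koszul_exact cocycle_family q u"
proof -
  have "koszul_exact (torsion_family j) q u \<longleftrightarrow> koszul_exact cocycle_family q u" if "j \<le> n" for j
    using that
  proof (induction j)
    case 0
    have sub: "cocycle_family q u \<subseteq> torsion_family 0 q u" for q u
      using P.MD.part_zero by (auto simp: cocycle_family_def torsion_family_def)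
    have "relatively_exact (KP n) (KD n) (KF cocycle_family n) (KF (torsion_family 0) n) q u" for q u
      by (rule koszul_relatively_exact[OF cocycle_family_subcomplex torsion_family_subcomplex sub, where i = 0])
        (use resolution_exact in auto)
    from koszul_exact_transfer[OF cocycle_family_subcomplex torsion_family_subcomplex sub this] show ?case by blast
  next
    case (Suc j)
    have sub: "torsion_family (Suc j) q u \<subseteq> torsion_family j q u" for q u using torsion_family_Suc by blast
    have "relatively_exact (KP n) (KD n) (KF (torsion_family (Suc j)) n) (KF (torsion_family j) n) q u" for q u
      by (rule koszul_relatively_exact_bij[OF torsion_family_subcomplex torsion_family_subcomplex sub, where i = j])
        (use torsion_family_injective torsion_family_divisible Suc.prems in auto)
    from koszul_exact_transfer[OF torsion_family_subcomplex torsion_family_subcomplex sub this] Suc show ?case by auto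
  qed
  then show ?thesis by blast
qed

interpretation E0: graded_module R "E 0" by (rule E_graded)

lemma \<epsilon>_simps:
  "a \<in> carrier M \<Longrightarrow> b \<in> carrier M \<Longrightarrow> \<epsilon> (a \<oplus>\<^bsub>M\<^esub> b) = \<epsilon> a \<oplus>\<^bsub>E 0\<^esub> \<epsilon> b"
  "r \<in> carrier R \<Longrightarrow> a \<in> carrier M \<Longrightarrow> \<epsilon> (r \<odot>\<^bsub>M\<^esub> a) = r \<odot>\<^bsub>E 0\<^esub> \<epsilon> a"
  "\<epsilon> \<zero>\<^bsub>M\<^esub> = \<zero>\<^bsub>E 0\<^esub>" "a \<in> carrier M \<Longrightarrow> \<epsilon> (\<ominus>\<^bsub>M\<^esub> a) = \<ominus>\<^bsub>E 0\<^esub> \<epsilon> a"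
  "a \<in> carrier M \<Longrightarrow> \<epsilon> a \<in> carrier (E 0)"
proof -
  have l: "linear R M (E 0) \<epsilon>" using \<epsilon>_hom by (simp add: graded_hom_def linear_def)
  show "a \<in> carrier M \<Longrightarrow> b \<in> carrier M \<Longrightarrow> \<epsilon> (a \<oplus>\<^bsub>M\<^esub> b) = \<epsilon> a \<oplus>\<^bsub>E 0\<^esub> \<epsilon> b" by (rule linear_add[OF l])
  show "r \<in> carrier R \<Longrightarrow> a \<in> carrier M \<Longrightarrow> \<epsilon> (r \<odot>\<^bsub>M\<^esub> a) = r \<odot>\<^bsub>E 0\<^esub> \<epsilon> a" by (rule linear_smult[OF l])
  show "\<epsilon> \<zero>\<^bsub>M\<^esub> = \<zero>\<^bsub>E 0\<^esub>" by (rule linear_zero[OF module E0.module l])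
  show "a \<in> carrier M \<Longrightarrow> \<epsilon> (\<ominus>\<^bsub>M\<^esub> a) = \<ominus>\<^bsub>E 0\<^esub> \<epsilon> a" by (rule linear_neg[OF module E0.module l])
  show "a \<in> carrier M \<Longrightarrow> \<epsilon> a \<in> carrier (E 0)" by (rule linear_closed[OF l])
qed

lemma cocycle_family_0: "cocycle_family 0 u = \<epsilon> ` part M u"
proof -
  have "e \<in> \<epsilon> ` part M u" if e: "e \<in> part (E 0) u" "d 0 e = \<zero>\<^bsub>E 1\<^esub>" for e
  proof -
    have "e \<in> \<epsilon> ` carrier M" unfolding \<epsilon>_image using e E0.MD.part_carrier by blast
    then obtain m where m: "m \<in> carrier M" "e = \<epsilon> m" by blast
    have "\<epsilon> (module_component M u m) = module_component (E 0) u e"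
      using graded_hom_component[OF graded_module E_graded \<epsilon>_hom m(1)] m(2) by simp
    then have "\<epsilon> (module_component M u m) = e" using E0.MD.component_same[OF e(1)] by simp
    then show ?thesis using MD.component_part[OF m(1)] by blast
  qed
  moreover have "\<epsilon> m \<in> part (E 0) u \<and> d 0 (\<epsilon> m) = \<zero>\<^bsub>E 1\<^esub>" if m: "m \<in> part M u" for m
    using \<epsilon>_part[OF m] \<epsilon>_image MD.part_carrier[OF m] by blast
  ultimately show ?thesis by (auto simp: cocycle_family_def P_def D_def)
qed

text \<open>Koszul cohomology in degree zero is M modulo the sum of the x_l M, which is M/R_+M; the
  injection \<open>\<epsilon>\<close> carries this over to the copy of M in the resolution.\<close>

lemma koszul_exact_zero_iff: "koszul_exact cocycle_family 0 u \<longleftrightarrow> part M u \<subseteq> irrelevant_smult R M"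
proof -
  have conc: "cocycle_family q u = {\<zero>\<^bsub>P q\<^esub>}" if "q \<noteq> 0" for q u using that by (simp add: cocycle_family_def)
  have P0: "P 0 = E 0" by (simp add: P_def)
  have span: "xspan (cocycle_family 0) j u = \<epsilon> ` generated_part x j u" for j
  proof (induction j)
    case 0
    then show ?case by (simp add: P0 \<epsilon>_simps)
  next
    case (Suc j)
    have *: "\<epsilon> (w \<oplus>\<^bsub>M\<^esub> x j \<odot>\<^bsub>M\<^esub> b) = \<epsilon> w \<oplus>\<^bsub>P 0\<^esub> x j \<odot>\<^bsub>P 0\<^esub> \<epsilon> b"
      if "w \<in> generated_part x j u" "b \<in> part M (u - 1)" for w b
      using generated_part_closed[OF gen that(1)] MD.part_carrier[OF that(2)] x_carrier by (simp add: P0 \<epsilon>_simps)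
    have "v \<in> xspan (cocycle_family 0) (Suc j) u \<longleftrightarrow> v \<in> \<epsilon> ` generated_part x (Suc j) u" for v
      unfolding xspan.simps generated_part.simps Suc cocycle_family_0 using * by (simp add: image_iff) metis
    then show ?case by blast
  qed
  have "koszul_exact cocycle_family 0 u \<longleftrightarrow> cocycle_family 0 u \<subseteq> xspan (cocycle_family 0) n u"
    by (rule koszul_exact_at_zero[OF cocycle_family_subcomplex conc])
  also have "\<dots> \<longleftrightarrow> \<epsilon> ` part M u \<subseteq> \<epsilon> ` generated_part x n u" by (subst span, subst cocycle_family_0) (rule refl)
  also have "\<dots> \<longleftrightarrow> part M u \<subseteq> generated_part x n u"
  proof
    assume sub: "\<epsilon> ` part M u \<subseteq> \<epsilon> ` generated_part x n u"
    show "part M u \<subseteq> generated_part x n u"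
    proof
      fix m assume m: "m \<in> part M u"
      then obtain w where w: "w \<in> generated_part x n u" "\<epsilon> m = \<epsilon> w" using sub by blast
      then have "m = w" using inj_onD[OF \<epsilon>_inj] MD.part_carrier[OF m] generated_part_closed[OF gen w(1)] by blast
      then show "m \<in> generated_part x n u" using w by simp
    qed
  qed blast
  also have "\<dots> \<longleftrightarrow> part M u \<subseteq> irrelevant_smult R M" using irrelevant_smult_part[OF gen, of u] by blast
  finally show ?thesis .
qed

text \<open>Chains in the copy of M are pulled back along \<open>\<epsilon>\<close> to chains in
  M.\<close>

lemma cocycle_family_noetherian: "noetherian_family R (P q) (cocycle_family q)"
proof (cases "q = 0")
  case False
  then have c: "cocycle_family q u = {\<zero>\<^bsub>P q\<^esub>}" for u by (simp add: cocycle_family_def)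
  show ?thesis
    unfolding noetherian_family_def
  proof (intro allI impI, elim conjE)
    fix N :: "nat \<Rightarrow> int \<Rightarrow> 'e set"
    assume g: "\<forall>k. graded_family R (P q) (N k)" and sub: "\<forall>k u. N k u \<subseteq> cocycle_family q u"
    have "\<zero>\<^bsub>P q\<^esub> \<in> N k u" for k u using g additive_subgroup.zero_closed by (fastforce simp: graded_family_def)
    then have "N k u = {\<zero>\<^bsub>P q\<^esub>}" for k u using sub c by blast
    then show "\<exists>k0. \<forall>k\<ge>k0. \<forall>u. N k u = N k0 u" by simp
  qed
next
  case True
  have P0: "P q = E 0" by (simp add: P_def True)
  show ?thesis
    unfolding noetherian_family_def
  proof (intro allI impI, elim conjE)
    fix N :: "nat \<Rightarrow> int \<Rightarrow> 'e set"
    assume g: "\<forall>k. graded_family R (P q) (N k)" and sub: "\<forall>k u. N k u \<subseteq> cocycle_family q u"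
      and up: "\<forall>k u. N k u \<subseteq> N (Suc k) u"
    have S: "additive_subgroup (N k u) (E 0)" for k u using g by (simp add: graded_family_def P0)
    have smult: "r \<odot>\<^bsub>E 0\<^esub> y \<in> N k (u + int i)" if "r \<in> rpart R i" "y \<in> N k u" for r i y k u
      using g that by (simp add: graded_family_def P0)
    define L where "L k u = {m \<in> part M u. \<epsilon> m \<in> N k u}" for k u
    have im: "N k u = \<epsilon> ` L k u" for k u using sub cocycle_family_0[of u] True by (fastforce simp: L_def)
    have "additive_subgroup (L k u) M" for k u
      by (rule M.additive_subgroupI')
        (use MD.part_carrier MD.part_zero MD.part_add M.additive_subgroup_neg[OF MD.part_subgroup]
          additive_subgroup.zero_closed[OF S] additive_subgroup.a_closed[OF S] E0.M.additive_subgroup_neg[OF S]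
          in \<open>auto simp: L_def \<epsilon>_simps\<close>)
    moreover have "r \<odot>\<^bsub>M\<^esub> y \<in> L k (u + int i)" if r: "r \<in> rpart R i" and y: "y \<in> L k u" for r i y k u
      using part_smult[OF r, of y u] smult[OF r, of "\<epsilon> y" k u] y MD.part_carrier[of y u] RD.part_carrier[OF r]
      by (simp add: L_def \<epsilon>_simps add.commute)
    ultimately have "graded_family R M (L k)" for k by (simp add: graded_family_def)
    moreover have "L k u \<subseteq> part M u" "L k u \<subseteq> L (Suc k) u" for k u using up by (auto simp: L_def)
    ultimately obtain k0 where "\<And>k u. k \<ge> k0 \<Longrightarrow> L k u = L k0 u"
      using noetherian_familyD[OF acc_noetherian_family[OF acc], of L] by metis
    then show "\<exists>k0. \<forall>k\<ge>k0. \<forall>u. N k u = N k0 u" unfolding im by metis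
  qed
qed

lemma koszul_exact_pos: "q > 0 \<Longrightarrow> koszul_exact cocycle_family q u"
  by (rule koszul_exact_at_pos[OF cocycle_family_subcomplex]) (simp_all add: cocycle_family_def)

text \<open>The bound from the chain condition depends on q. Only the degrees -n, ..., 0 can carry
  cohomology, so a maximum of finitely many bounds suffices.\<close>

lemma koszul_exact_large: "\<exists>B. \<forall>q. \<forall>u>B. koszul_exact cocycle_family q u"
proof -
  note S = cocycle_family_subcomplex
  have "\<exists>B. \<forall>u>B. koszul_exact cocycle_family q u" for q
    by (rule noetherian_exact_at_large[OF graded_ring koszul_cochain_complex koszul_subcomplex[OF S] gen
          koszul_null_homotopic[OF S] koszul_noetherian[OF S cocycle_family_noetherian]])
  then obtain B where B: "\<And>q u. u > B q \<Longrightarrow> koszul_exact cocycle_family q u" by metis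
  have low: "koszul_exact cocycle_family q u" if "q < - int n" for q u
    by (rule exact_at_trivial[OF S koszul_trivial_below]) (use that in \<open>auto simp: cocycle_family_def\<close>)
  define C where "C = Max (insert 0 (B ` {- int n..0}))"
  have "koszul_exact cocycle_family q u" if "u > C" for q u
  proof (cases "q \<in> {- int n..0}")
    case True
    then have "B q \<le> C" unfolding C_def by (intro Max_ge) auto
    then show ?thesis using B that by auto
  next
    case False
    then show ?thesis using low koszul_exact_pos by force
  qed
  then show ?thesis by blast
qed

section \<open>Vanishing of the cohomology of the torsion complex\<close>

abbreviation cohomology_vanishes :: "nat \<Rightarrow> int \<Rightarrow> bool" where
  "cohomology_vanishes i u \<equiv> exact_at P D (torsion_family n) (int i) u"

lemma torsion_exact_neg:
  assumes "q < 0" shows "exact_at P D (torsion_family j) q u"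
  unfolding exact_at_iff[OF complex torsion_family_subcomplex]
proof (intro ballI impI)
  fix b assume "b \<in> torsion_family j q u"
  then have "b = \<zero>\<^bsub>P q\<^esub>" using assms by (simp add: torsion_family_def)
  moreover have "D (q - 1) \<zero>\<^bsub>P (q - 1)\<^esub> = \<zero>\<^bsub>P q\<^esub>" using D_simps(4)[of "q - 1"] by simp
  ultimately show "\<exists>c\<in>torsion_family j (q - 1) u. D (q - 1) c = b" using torsion_family_zero by blast
qed

lemma torsion_exact_cases:
  assumes "\<And>i. q = int i \<Longrightarrow> cohomology_vanishes i u" shows "exact_at P D (torsion_family n) q u"
  using assms torsion_exact_neg[of q n u] by (cases "q < 0") (auto elim: nonneg_int_cases simp: not_less)

text \<open>Torsion transfers vanishing from Koszul degree i - n to degree i of the torsion complex.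
  For i > n the Koszul degree is positive and nothing is left; for i \<le> n, the condition u + i >
  B + n implies u > B.\<close>

lemma cohomology_vanishes_large: "\<exists>B. \<forall>i u. u + int i > B \<longrightarrow> cohomology_vanishes i u"
proof -
  obtain B where B: "\<And>q u. u > B \<Longrightarrow> koszul_exact cocycle_family q u" using koszul_exact_large by blast
  have tors: "\<exists>k. x l [^] (k::nat) \<odot>\<^bsub>P q\<^esub> a = \<zero>\<^bsub>P q\<^esub>" if "a \<in> torsion_family n q u" "l < n" for q u a l
    using that x_carrier by (auto simp: torsion_family_def split: if_splits)
  have key: "cohomology_vanishes i u" if "\<And>v. v > b \<Longrightarrow> koszul_exact cocycle_family (int i - int n) v" "u > b" for b i u
    using exact_from_koszul_torsion[OF torsion_family_subcomplex tors, where q = "int i" and j = 0 and D = b] that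
    by (simp add: koszul_exact_torsion_iff)
  have "cohomology_vanishes i u" if "u + int i > B + int n" for i u
  proof (cases "i \<le> n")
    case True
    then show ?thesis using key[of B i u] B that by auto
  next
    case False
    \<comment> \<open>Here the Koszul complex is exact in every internal degree, so any bound below
      u will do.\<close>
    then show ?thesis using key[of "u - 1" i u] koszul_exact_pos by auto
  qed
  then show ?thesis by blast
qed

text \<open>The Koszul complex at (0, u) is assembled from places of the torsion complex on the
  diagonal u, where the cohomology vanishes.\<close>

lemma generated_above:
  assumes "\<And>i u. u + int i \<ge> t \<Longrightarrow> cohomology_vanishes i u" and "u \<ge> t"
  shows "part M u \<subseteq> irrelevant_smult R M"
proof -
  have "exact_at P D (torsion_family n) q u" if "u \<ge> t - q" for q u
    by (rule torsion_exact_cases, rule assms(1)) (use that in simp)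
  from koszul_exact_above[OF torsion_family_subcomplex this, of t 0 u] assms(2)
  have "koszul_exact (torsion_family n) 0 u" by simp
  then show ?thesis by (simp add: koszul_exact_torsion_iff koszul_exact_zero_iff)
qed

text \<open>Nakayama's lemma in graded form: M is bounded below, and M = R_+M would make each part
  vanish together with its predecessor. It is needed to see that some local cohomology is nonzero,
  so that the regularity is not -\<infinity>.\<close>

lemma not_generated:
  assumes "carrier M \<noteq> {\<zero>\<^bsub>M\<^esub>}" shows "\<exists>u. \<not> part M u \<subseteq> irrelevant_smult R M"
proof (rule ccontr)
  assume "\<not> (\<exists>u. \<not> part M u \<subseteq> irrelevant_smult R M)"
  then have g: "part M u = generated_part x n u" for u using irrelevant_smult_part[OF gen, of u] by blast
  obtain u0 where u0: "\<And>u. u < u0 \<Longrightarrow> part M u = {\<zero>\<^bsub>M\<^esub>}"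
    using part_bounded_below[OF acc_noetherian_family[OF acc]] by blast
  have gz: "generated_part x j u = {\<zero>\<^bsub>M\<^esub>}" if "part M (u - 1) = {\<zero>\<^bsub>M\<^esub>}" for j u
    using that x_carrier by (induction j) auto
  have up: "part M (u0 - 1 + int k) = {\<zero>\<^bsub>M\<^esub>}" for k
  proof (induction k)
    case 0
    then show ?case using u0 by simp
  next
    case (Suc k)
    have "u0 - 1 + int (Suc k) - 1 = u0 - 1 + int k" by simp
    then show ?case using Suc g gz by metis
  qed
  have "part M u = {\<zero>\<^bsub>M\<^esub>}" for u
    using u0[of u] up[of "nat (u - u0 + 1)"] by (cases "u < u0") auto
  then have "m = \<zero>\<^bsub>M\<^esub>" if "m \<in> carrier M" for m
    using MD.component_eqI[OF that M.zero_closed] MD.component_part[OF that] by (simp add: MD.component_zero)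
  then show False using assms by blast
qed

text \<open>The Koszul complex is exact at (i, t - i + 2) for all i \<ge> 0: for i > 0 because it
  has no cohomology in positive degrees, for i = 0 because M_{t+2} lies in R_+M. The cones can then
  be removed, as the diagonal t + 1 is exact by hypothesis.\<close>

lemma weakly_regular_step:
  assumes ex: "\<And>i. cohomology_vanishes i (t - int i + 1)" and g: "\<And>u. u > t \<Longrightarrow> part M u \<subseteq> irrelevant_smult R M"
  shows "cohomology_vanishes i (t - int i + 2)"
proof -
  have "koszul_exact (torsion_family n) (int i) (t - int i + 2)"
    using koszul_exact_pos[of "int i"] g koszul_exact_zero_iff by (cases "i = 0") (auto simp: koszul_exact_torsion_iff)
  moreover have "exact_at P D (torsion_family n) q (t - q + 1)" for q
    by (rule torsion_exact_cases) (use ex in auto)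
  ultimately show ?thesis
    using exact_diagonal_from_koszul[OF torsion_family_subcomplex, where j = 0 and n = n and q = "int i" and t = t] by simp
qed

lemma weakly_regular_above:
  assumes ex: "\<And>i. cohomology_vanishes i (t - int i + 1)" and g: "\<And>u. u > t \<Longrightarrow> part M u \<subseteq> irrelevant_smult R M"
    and "u + int i > t"
  shows "cohomology_vanishes i u"
proof -
  have "\<forall>i. cohomology_vanishes i (t + int k - int i + 1)" for k
  proof (induction k)
    case (Suc k)
    then show ?case using weakly_regular_step[of "t + int k"] g by (simp add: algebra_simps)
  qed (use ex in simp)
  from this[of "nat (u + int i - t - 1)"] assms(3) show ?thesis by (auto dest: spec[of _ i])
qed

section \<open>Identification with the derived functor of torsion\<close>

lemma torsion_family_eq: "torsion_family n (int i) u = torsion_part R (E i) \<inter> part (E i) u"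
proof -
  interpret E: graded_module R "E i" by (rule E_graded)
  show ?thesis using torsion_part_eq[OF gen E.module] E.MD.part_carrier by (auto simp: torsion_family_def P_def)
qed

lemma torsion_part_subgroup: "additive_subgroup (torsion_part R (E i)) (E i)"
proof -
  interpret E: graded_module R "E i" by (rule E_graded)
  have "additive_subgroup (carrier (E i)) (E i)" by (rule E.M.additive_subgroupI') auto
  from power_torsion_subgroup[OF E.module this, of "{..<n}" x] x_carrier show ?thesis
    unfolding torsion_part_eq[OF gen E.module] by (simp add: Ball_def)
qed

lemma coboundaries_subgroup: "additive_subgroup (resolution_coboundaries R (\<epsilon>, E, d) i) (E i)"
proof (cases i)
  case 0
  have "additive_subgroup {\<zero>\<^bsub>E 0\<^esub>} (E 0)" by (rule E0.M.additive_subgroupI') auto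
  then show ?thesis by (simp add: resolution_coboundaries_def 0)
next
  case (Suc j)
  interpret A: graded_module R "E j" by (rule E_graded)
  interpret B: graded_module R "E (Suc j)" by (rule E_graded)
  have l: "linear R (E j) (E (Suc j)) (d j)" using d_hom[of j] by (simp add: graded_hom_def linear_def)
  note T = torsion_part_subgroup[of j]
  note Tc = additive_subgroup.a_Hcarr[OF T]
  have "additive_subgroup (d j ` torsion_part R (E j)) (E (Suc j))"
  proof (rule B.M.additive_subgroupI')
    show "d j ` torsion_part R (E j) \<subseteq> carrier (E (Suc j))" using Tc linear_closed[OF l] by blast
    show "\<zero>\<^bsub>E (Suc j)\<^esub> \<in> d j ` torsion_part R (E j)"
      using linear_zero[OF A.module B.module l] additive_subgroup.zero_closed[OF T] by (metis imageI)
  next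
    fix v w assume "v \<in> d j ` torsion_part R (E j)" "w \<in> d j ` torsion_part R (E j)"
    then obtain a b where h: "a \<in> torsion_part R (E j)" "v = d j a" "b \<in> torsion_part R (E j)" "w = d j b" by blast
    have "v \<oplus>\<^bsub>E (Suc j)\<^esub> w = d j (a \<oplus>\<^bsub>E j\<^esub> b)" using linear_add[OF l Tc[OF h(1)] Tc[OF h(3)]] h by simp
    then show "v \<oplus>\<^bsub>E (Suc j)\<^esub> w \<in> d j ` torsion_part R (E j)" using additive_subgroup.a_closed[OF T h(1,3)] by simp
  next
    fix v assume "v \<in> d j ` torsion_part R (E j)"
    then obtain a where h: "a \<in> torsion_part R (E j)" "v = d j a" by blast
    have "\<ominus>\<^bsub>E (Suc j)\<^esub> v = d j (\<ominus>\<^bsub>E j\<^esub> a)" using linear_neg[OF A.module B.module l Tc[OF h(1)]] h by simp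
    then show "\<ominus>\<^bsub>E (Suc j)\<^esub> v \<in> d j ` torsion_part R (E j)" using A.M.additive_subgroup_neg[OF T h(1)] by simp
  qed
  then show ?thesis by (simp add: resolution_coboundaries_def Suc)
qed

text \<open>A power of x_l is homogeneous, so when it kills an element it kills each
  component.\<close>

lemma torsion_part_component:
  assumes c: "c \<in> torsion_part R (E i)" shows "module_component (E i) u c \<in> torsion_part R (E i)"
proof -
  interpret E: graded_module R "E i" by (rule E_graded)
  have cc: "c \<in> carrier (E i)" and t: "\<And>l. l < n \<Longrightarrow> \<exists>k. x l [^] (k::nat) \<odot>\<^bsub>E i\<^esub> c = \<zero>\<^bsub>E i\<^esub>"
    using c unfolding torsion_part_eq[OF gen E.module] by auto
  have "\<exists>k. x l [^] (k::nat) \<odot>\<^bsub>E i\<^esub> module_component (E i) u c = \<zero>\<^bsub>E i\<^esub>" if l: "l < n" for l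
  proof -
    obtain k :: nat where k: "x l [^] k \<odot>\<^bsub>E i\<^esub> c = \<zero>\<^bsub>E i\<^esub>" using t[OF l] by blast
    have "x l [^] k \<in> rpart R k" using pow_part[OF x_part, of l k] by simp
    from E.module_component_smult[OF this cc, of "u + int k"] show ?thesis
      using k E.MD.component_zero by (intro exI[of _ k]) simp
  qed
  then show ?thesis unfolding torsion_part_eq[OF gen E.module] using E.MD.component_closed[OF cc] by simp
qed

text \<open>A part of the quotient is trivial when every homogeneous cocycle is a coboundary. Such a
  coboundary may come from an inhomogeneous torsion element, which is replaced by its component of
  degree u.\<close>

theorem derived_torsion_part_trivial:
  "part (derived_torsion R (\<epsilon>, E, d) i) u = {\<zero>\<^bsub>derived_torsion R (\<epsilon>, E, d) i\<^esub>} \<longleftrightarrow> cohomology_vanishes i u"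
proof -
  interpret E: graded_module R "E i" by (rule E_graded)
  let ?Z = "resolution_cocycles R (\<epsilon>, E, d) i" and ?B = "resolution_coboundaries R (\<epsilon>, E, d) i"
  have p: "part (graded_sub (E i) ?Z) u = {b \<in> torsion_family n (int i) u. D (int i) b = \<zero>\<^bsub>P (int i + 1)\<^esub>}"
    unfolding torsion_family_eq by (auto simp: graded_sub_def resolution_cocycles_def D_def P_def nat_add_distrib)
  have "\<zero>\<^bsub>P (int i)\<^esub> \<in> {b \<in> torsion_family n (int i) u. D (int i) b = \<zero>\<^bsub>P (int i + 1)\<^esub>}"
    using torsion_family_zero D_simps(4)[of "int i"] by simp
  then have ne: "part (graded_sub (E i) ?Z) u \<noteq> {}" unfolding p by blast
  have sub: "part (graded_sub (E i) ?Z) u \<subseteq> carrier (E i)"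
    using E.MD.part_carrier by (auto simp: graded_sub_def)
  have "add (graded_sub (E i) ?Z) = add (E i)" by (simp add: graded_sub_def)
  from graded_quot_part_trivial[OF E.M.abelian_group_axioms this coboundaries_subgroup sub ne]
  have "part (derived_torsion R (\<epsilon>, E, d) i) u = {\<zero>\<^bsub>derived_torsion R (\<epsilon>, E, d) i\<^esub>} \<longleftrightarrow>
      part (graded_sub (E i) ?Z) u \<subseteq> ?B" by (simp add: derived_torsion_def)
  also have "\<dots> \<longleftrightarrow> (\<forall>b\<in>torsion_family n (int i) u. D (int i) b = \<zero>\<^bsub>P (int i + 1)\<^esub> \<longrightarrow> b \<in> ?B)"
    unfolding p by blast
  also have "\<dots> \<longleftrightarrow> cohomology_vanishes i u"
  proof -
    have "b \<in> ?B \<longleftrightarrow> (\<exists>c\<in>torsion_family n (int i - 1) u. D (int i - 1) c = b)"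
      if b: "b \<in> torsion_family n (int i) u" for b
    proof (cases i)
      case 0
      then show ?thesis by (auto simp: resolution_coboundaries_def torsion_family_def D_def)
    next
      case (Suc j)
      interpret A: graded_module R "E j" by (rule E_graded)
      have q: "int i - 1 = int j" using Suc by simp
      have "b \<in> part (E i) u" using b by (simp add: torsion_family_eq)
      then have bu: "module_component (E (Suc j)) u b = b" using E.MD.component_same Suc by simp
      have "\<exists>c\<in>torsion_family n (int j) u. d j c = b" if c: "c \<in> torsion_part R (E j)" "d j c = b" for c
      proof
        have cc: "c \<in> carrier (E j)" using c(1) by (simp add: torsion_part_def)
        show "d j (module_component (E j) u c) = b"
          using graded_hom_component[OF E_graded E_graded d_hom cc] c(2) bu by simp
        show "module_component (E j) u c \<in> torsion_family n (int j) u"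
          unfolding torsion_family_eq using torsion_part_component[OF c(1)] A.MD.component_part[OF cc] by blast
      qed
      then have "b \<in> d j ` torsion_part R (E j) \<longleftrightarrow> (\<exists>c\<in>torsion_family n (int j) u. d j c = b)"
        by (auto simp: torsion_family_eq)
      then show ?thesis unfolding q by (simp add: resolution_coboundaries_def D_def Suc)
    qed
    then show ?thesis unfolding exact_at_iff[OF complex torsion_family_subcomplex] by blast
  qed
  finally show ?thesis .
qed

end

text \<open>Two functions are interleaved: one is stored at the even, the other at the odd
  numbers.\<close>

lemma universe_pairing:
  "pairing (\<lambda>f g l (k::nat). if even k then f l (k div 2) else g l (k div 2))
     (\<lambda>f l k. f l (2 * k)) (\<lambda>f l k. f l (2 * k + 1))"
  by unfold_locales auto

section \<open>Regularity as a maximum over nonvanishing cohomology\<close>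

context resolved_module
begin

lemma derived_torsion_nonzero_degrees:
  "nonzero_degrees (derived_torsion R (\<epsilon>, E, d) i) = {u. \<not> cohomology_vanishes i u}"
  unfolding nonzero_degrees_def derived_torsion_part_trivial ..

lemma quotient_nonzero_degrees:
  "nonzero_degrees (graded_quot M (irrelevant_smult R M)) = {u. \<not> part M u \<subseteq> irrelevant_smult R M}"
proof -
  have "additive_subgroup (irrelevant_smult R M) M"
  proof (rule M.additive_subgroupI')
    have H: "\<Inter>{H. submodule H R M \<and> S \<subseteq> H} \<subseteq> carrier M" if "S \<subseteq> carrier M" for S
    proof -
      have "submodule (carrier M) R M" by (rule submoduleI) auto
      then show ?thesis using that by blast
    qed
    show "irrelevant_smult R M \<subseteq> carrier M"
      unfolding irrelevant_smult_def submodule_generated_def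
      by (rule H) (use irrelevant_ideal_component in auto)
    have sz: "\<zero>\<^bsub>M\<^esub> \<in> H" if "submodule H R M" for H
      using additive_subgroup.zero_closed[OF additive_subgroup.intro[OF submodule.axioms(1)[OF that]]] .
    show "\<zero>\<^bsub>M\<^esub> \<in> irrelevant_smult R M"
      unfolding irrelevant_smult_def submodule_generated_def using sz by blast
    show "v \<oplus>\<^bsub>M\<^esub> w \<in> irrelevant_smult R M" if "v \<in> irrelevant_smult R M" "w \<in> irrelevant_smult R M" for v w
      using that submoduleE(5) unfolding irrelevant_smult_def submodule_generated_def by blast
    show "\<ominus>\<^bsub>M\<^esub> v \<in> irrelevant_smult R M" if "v \<in> irrelevant_smult R M" for v
      using that submoduleE(3) unfolding irrelevant_smult_def submodule_generated_def by blast
  qed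
  then have "part (graded_quot M (irrelevant_smult R M)) u = {\<zero>\<^bsub>graded_quot M (irrelevant_smult R M)\<^esub>} \<longleftrightarrow>
      part M u \<subseteq> irrelevant_smult R M" for u
    using MD.part_carrier MD.part_zero by (intro graded_quot_part_trivial[OF M.abelian_group_axioms refl]) blast+
  then show ?thesis by (simp add: nonzero_degrees_def)
qed

text \<open>The number r is the largest u + i for which cohomology in degrees i and u is nonzero.
  These numbers are bounded above, and by the graded Nakayama lemma there is at least one.
  Minimality holds because weak t-regularity and generation up to degree t kill everything beyond
  t.\<close>

theorem regularity_minimum:
  assumes nz: "carrier M \<noteq> {\<zero>\<^bsub>M\<^esub>}"
  obtains r where "\<And>i u. \<not> cohomology_vanishes i u \<Longrightarrow> u + int i \<le> r"
    "\<exists>i u. \<not> cohomology_vanishes i u \<and> u + int i = r" "\<And>u. u > r \<Longrightarrow> part M u \<subseteq> irrelevant_smult R M"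
    "\<And>t. (\<And>u. u > t \<Longrightarrow> part M u \<subseteq> irrelevant_smult R M) \<Longrightarrow>
       (\<And>i. cohomology_vanishes i (t - int i + 1)) \<Longrightarrow> r \<le> t"
proof -
  define S where "S = {u + int i | u i. \<not> cohomology_vanishes i u}"
  obtain B where B: "\<And>i u. u + int i > B \<Longrightarrow> cohomology_vanishes i u" using cohomology_vanishes_large by blast
  have SB: "s \<le> B" if "s \<in> S" for s
  proof (rule ccontr)
    assume "\<not> s \<le> B"
    then show False using that B unfolding S_def by force
  qed
  have "S \<noteq> {}"
  proof
    assume "S = {}"
    then have "cohomology_vanishes i u" for i u unfolding S_def by blast
    then show False using not_generated[OF nz] generated_above by blast
  qed
  then obtain s where s: "s \<in> S" by blast
  \<comment> \<open>\<open>S\<close> need not be bounded below; its portion above a given element s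
    is finite, so that the maximum exists.\<close>
  define T where "T = S \<inter> {s..B}"
  have T: "finite T" "T \<noteq> {}" unfolding T_def using s SB by auto
  define r where "r = Max T"
  have rT: "r \<in> T" unfolding r_def using T by (rule Max_in)
  have max: "v \<le> r" if "v \<in> S" for v
  proof (cases "v < s")
    case True
    then show ?thesis using rT by (simp add: T_def)
  next
    case False
    then have "v \<in> T" using that SB by (simp add: T_def)
    then show ?thesis unfolding r_def using T by simp
  qed
  have b: "u + int i \<le> r" if "\<not> cohomology_vanishes i u" for i u
    using max[of "u + int i"] that unfolding S_def by blast
  have att: "\<exists>i u. \<not> cohomology_vanishes i u \<and> u + int i = r" using rT unfolding T_def S_def by blast
  show thesis
  proof (rule that[OF b att])
    show "part M u \<subseteq> irrelevant_smult R M" if "u > r" for u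
      by (rule generated_above[of "r + 1"]) (use b that in force)+
    fix t assume t: "\<And>u. u > t \<Longrightarrow> part M u \<subseteq> irrelevant_smult R M"
      "\<And>i. cohomology_vanishes i (t - int i + 1)"
    obtain i u where iu: "\<not> cohomology_vanishes i u" "u + int i = r" using att by blast
    show "r \<le> t"
    proof (rule ccontr)
      assume "\<not> r \<le> t"
      then have "u + int i > t" using iu(2) by simp
      from weakly_regular_above[OF t(2) t(1) this] iu(1) show False by blast
    qed
  qed
qed

end

theorem corollary3p2:
  fixes R :: "'r graded_ring" and M :: "('r, 'm) graded_module"
  assumes "standard_graded_ring R"
    and "noetherian_ring (R\<lparr>carrier := rpart R 0\<rparr>)"
    and "finitely_generated_over_degree_zero R"
    and "graded_module R M"
    and "finitely_generated_module R M"
    and "carrier M \<noteq> {\<zero>\<^bsub>M\<^esub>}"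
  shows "\<exists>r :: int. reg R M = ereal (real_of_int r) \<and>
           r \<in> {t. ereal (real_of_int t) \<ge> gen_degree R M \<and> weakly_regular R M t} \<and>
           (\<forall>t \<in> {t. ereal (real_of_int t) \<ge> gen_degree R M \<and> weakly_regular R M t}. r \<le> t)"
proof -
  interpret graded_module R M by fact
  obtain n x where gen: "ring_generators R n x" using standard_ring_generators[OF assms(1,3)] by blast
  obtain A where A: "finite A" "A \<subseteq> carrier R" "carrier R = generate_ring R (rpart R 0 \<union> A)"
    using assms(3) unfolding finitely_generated_over_degree_zero_def by blast
  have K: "rpart R 0 \<subseteq> carrier R" using RD.part_carrier by blast
  obtain G where G: "finite G" "G \<subseteq> carrier M" "carrier M = submodule_generated R M G"
    using assms(5) unfolding finitely_generated_module_def by blast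
  have acc: "acc_below M (carrier R) (carrier M)"
  proof (rule finitely_generated_acc[OF assms(2) K A G(1,2)])
    fix H assume "submodule H R M" "G \<subseteq> H"
    then have "submodule_generated R M G \<subseteq> H" unfolding submodule_generated_def by blast
    then show "H = carrier M" using G(3) submoduleE(1)[OF \<open>submodule H R M\<close>] by blast
  qed
  interpret S: graded_module R "shifted_ring R 0" by (rule shifted_ring)
  \<comment> \<open>The ring is a module over itself, generated by 1, so the chain condition for its
    ideals is a case of the theorem on finitely generated modules.\<close>
  have racc: "acc_below (shifted_ring R 0) (carrier R) (carrier R)"
  proof -
    have "acc_below (shifted_ring R 0) (carrier R) (carrier (shifted_ring R 0))"
    proof (rule S.finitely_generated_acc[OF assms(2) K A])
      show "finite {\<one>\<^bsub>R\<^esub>}" "{\<one>\<^bsub>R\<^esub>} \<subseteq> carrier (shifted_ring R 0)" by simp_all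
      fix H assume H: "submodule H R (shifted_ring R 0)" "{\<one>\<^bsub>R\<^esub>} \<subseteq> H"
      have "r \<in> H" if r: "r \<in> carrier R" for r
        using S.submoduleE(4)[OF H(1) r, of "\<one>\<^bsub>R\<^esub>"] H(2) r by simp
      then show "H = carrier (shifted_ring R 0)" using S.submoduleE(1)[OF H(1)] by auto
    qed
    then show ?thesis by simp
  qed
  obtain \<epsilon> E d where ch: "chosen_resolution R M = (\<epsilon>, E, d)" by (metis prod_cases3)
  have res: "graded_injective_resolution R M (\<epsilon>, E, d)"
    using graded_injective_resolution_exists[OF assms(4)] unfolding ch .
  interpret resolved_module
    "\<lambda>f g l k. if even k then f l (k div 2) else g l (k div 2)" "\<lambda>f l k. f l (2 * k)" "\<lambda>f l k. f l (2 * k + 1)"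
    R M n x \<epsilon> E d
    by (intro resolved_module.intro universe_pairing resolved_module_axioms.intro gen res racc acc assms(4))
  obtain r where r: "\<And>i u. \<not> cohomology_vanishes i u \<Longrightarrow> u + int i \<le> r"
    "\<exists>i u. \<not> cohomology_vanishes i u \<and> u + int i = r" "\<And>u. u > r \<Longrightarrow> part M u \<subseteq> irrelevant_smult R M"
    "\<And>t. (\<And>u. u > t \<Longrightarrow> part M u \<subseteq> irrelevant_smult R M) \<Longrightarrow>
       (\<And>i. cohomology_vanishes i (t - int i + 1)) \<Longrightarrow> r \<le> t"
    using regularity_minimum[OF assms(6)] by blast
  have lc: "local_cohomology R M i = derived_torsion R (\<epsilon>, E, d) i" for i by (simp add: local_cohomology_def ch)
  have gen_degree: "gen_degree R M \<le> ereal (real_of_int t) \<longleftrightarrow> (\<forall>u>t. part M u \<subseteq> irrelevant_smult R M)" for t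
    unfolding gen_degree_def quotient_nonzero_degrees SUP_le_iff by (auto simp: not_le[symmetric])
  have regular: "weakly_regular R M t \<longleftrightarrow> (\<forall>i. cohomology_vanishes i (t - int i + 1))" for t
    unfolding weakly_regular_def lc derived_torsion_part_trivial ..
  have a: "a_invariant R M i = (SUP u\<in>{u. \<not> cohomology_vanishes i u}. ereal (real_of_int u))" for i
    unfolding a_invariant_def lc derived_torsion_nonzero_degrees ..
  have "reg R M = ereal (real_of_int r)"
  proof (rule antisym)
    show "reg R M \<le> ereal (real_of_int r)"
      unfolding reg_def
    proof (rule SUP_least)
      fix i
      \<comment> \<open>Bounding the invariant by the finite number r - i lets i be added back by
        monotonicity, also when the supremum is -\<infinity>.\<close>
      have "a_invariant R M i \<le> ereal (real_of_int r - real i)"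
        unfolding a
      proof (rule SUP_least)
        fix u assume "u \<in> {u. \<not> cohomology_vanishes i u}"
        then have "u + int i \<le> r" using r(1) by blast
        then show "ereal (real_of_int u) \<le> ereal (real_of_int r - real i)" by simp
      qed
      then have "a_invariant R M i + ereal (real i) \<le> ereal (real_of_int r - real i) + ereal (real i)"
        by (rule add_right_mono)
      then show "a_invariant R M i + ereal (real i) \<le> ereal (real_of_int r)" by simp
    qed
    obtain i u where iu: "\<not> cohomology_vanishes i u" "u + int i = r" using r(2) by blast
    have "ereal (real_of_int r) = ereal (real_of_int u) + ereal (real i)" using iu(2) by auto
    also have "\<dots> \<le> a_invariant R M i + ereal (real i)"
      by (rule add_right_mono) (use iu(1) in \<open>auto simp: a intro: SUP_upper\<close>)
    also have "\<dots> \<le> reg R M" unfolding reg_def by (rule SUP_upper) simp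
    finally show "ereal (real_of_int r) \<le> reg R M" .
  qed
  \<comment> \<open>The diagonal r + 1 lies beyond all nonzero cohomology, so M is weakly
    r-regular.\<close>
  moreover have "cohomology_vanishes i (r - int i + 1)" for i using r(1)[of i "r - int i + 1"] by force
  ultimately show ?thesis
    using r(3,4) by (intro exI[of _ r]) (simp add: gen_degree regular)
qed

end
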